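(* For every finite connected metric graph $K$ with at least one edge, $$\inf_{S\in\mathscr U(K)}\mathbf M(\partial S)=\#\operatorname{Odd}(K).$$ The infimum is attained by a current whose orientation is balanced at every vertex: its boundary coefficient is $0$ at every even-degree vertex and has absolute value $1$ at every odd-degree vertex.
   Context: Currents are metric currents in the sense of Ambrosio–Kirchheim; $\mathbf I_1(K)$ is the group of integral $1$-currents in $K$ (integer rectifiable of finite mass, with boundary integer rectifiable of finite mass), $\mathbf M$ is mass, $\partial$ is the boundary, and $\theta_S$ denotes the intrinsic nonnegative integer multiplicity of $S$ in the rectifiable representation (absolute value of the signed coefficient). A finite metric graph $K$ is a space obtained by gluing finitely many compact intervals of positive length (the edges) along endpoints, with pairwise disjoint edge interiors, equipped with the path metric. $V(K)$ and $E(K)$ are its vertex and edge sets; multiple edges and loops are allowed, and a loop is counted twice in the degree. Set $$\operatorname{Odd}(K)=\{v\in V(K):\deg_K(v)\text{ is odd}\}.$$ $\mathscr U(K)$ is the class of currents $S\in\mathbf I_1(K)$ whose multiplicity has absolute value one (i.e. $\theta_S=1$) $\mathcal H^1$-almost everywhere on every edge. The boundary $\partial S\in\mathbf I_0(K)$ is a finite sum $\sum_j m_j[\![x_j]\!]$ of integer point masses at distinct points; the boundary coefficient at a vertex $v$ is the integer multiplying $[\![v]\!]$ (zero if $v$ is not an atom), and $\mathbf M(\partial S)=\sum_j|m_j|$. *)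

theory Defs
  imports "HOL-Analysis.Analysis"
begin

section \<open>Finite connected metric graphs\<close>

text \<open>
  A graph is given inside an ambient metric space by its vertices, an index set of edges, and for
  each edge \<open>e\<close> the quotient map \<open>param G e\<close> restricted to the glued interval \<open>[0, len G e]\<close>.
  The type of the ambient metric space is arbitrary.
\<close>

record ('a, 'e) metric_graph =
  verts :: "'a set"
  edges :: "'e set"
  len :: "'e \<Rightarrow> real"
  param :: "'e \<Rightarrow> real \<Rightarrow> 'a"

definition edge_set :: "('a, 'e) metric_graph \<Rightarrow> 'e \<Rightarrow> 'a set" where
  "edge_set G e = param G e ` {0..len G e}"

definition edge_interior :: "('a, 'e) metric_graph \<Rightarrow> 'e \<Rightarrow> 'a set" where
  "edge_interior G e = param G e ` {0<..<len G e}"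

definition points :: "('a, 'e) metric_graph \<Rightarrow> 'a set" where
  "points G = verts G \<union> (\<Union>e\<in>edges G. edge_set G e)"

text \<open>
  A triple \<open>(e, s, t)\<close> is the segment of the edge \<open>e\<close> from parameter \<open>s\<close> to parameter \<open>t\<close>.
  A chain from \<open>x\<close> to \<open>y\<close> is a finite concatenation of such segments; the path metric of the
  glued space is the infimum of the lengths of the chains.
\<close>

fun chain :: "('a, 'e) metric_graph \<Rightarrow> 'a \<Rightarrow> ('e \<times> real \<times> real) list \<Rightarrow> 'a \<Rightarrow> bool" where
  "chain G x [] y \<longleftrightarrow> x = y"
| "chain G x ((e, s, t) # c) y \<longleftrightarrow>
     e \<in> edges G \<and> s \<in> {0..len G e} \<and> t \<in> {0..len G e} \<and>
     param G e s = x \<and> chain G (param G e t) c y"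

definition chain_length :: "('e \<times> real \<times> real) list \<Rightarrow> real" where
  "chain_length c = (\<Sum>(e, s, t)\<leftarrow>c. \<bar>t - s\<bar>)"

definition finite_connected_metric_graph :: "('a::metric_space, 'e) metric_graph \<Rightarrow> bool" where
  "finite_connected_metric_graph G \<longleftrightarrow>
     finite (verts G) \<and> finite (edges G) \<and>
     (\<forall>e\<in>edges G. 0 < len G e \<and>
        param G e 0 \<in> verts G \<and> param G e (len G e) \<in> verts G \<and>
        inj_on (param G e) {0<..<len G e} \<and>
        edge_interior G e \<inter> verts G = {}) \<and>
     (\<forall>e\<in>edges G. \<forall>e'\<in>edges G. e \<noteq> e' \<longrightarrow> edge_interior G e \<inter> edge_interior G e' = {}) \<and>
     (\<forall>x\<in>points G. \<forall>y\<in>points G. (\<exists>c. chain G x c y) \<and>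
        dist x y = Inf {chain_length c | c. chain G x c y})"

definition degree :: "('a, 'e) metric_graph \<Rightarrow> 'a \<Rightarrow> nat" where
  "degree G v = card {e\<in>edges G. param G e 0 = v} + card {e\<in>edges G. param G e (len G e) = v}"

definition Odd :: "('a, 'e) metric_graph \<Rightarrow> 'a set" where
  "Odd G = {v\<in>verts G. odd (degree G v)}"


section \<open>Metric currents (Ambrosio--Kirchheim)\<close>

text \<open>
  All notions are relative to a subset \<open>X\<close> of a metric space, regarded as a metric space itself.
  A \<open>k\<close>-dimensional functional maps \<open>(f, [\<pi>\<^sub>1, \<dots>, \<pi>\<^sub>k])\<close>, with all functions Lipschitz on \<open>X\<close> and \<open>f\<close>
  bounded, to a real number. Its values on other arguments are irrelevant: two functionals which
  agree on these tuples represent the same current. Likewise only the values of \<open>f\<close> and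
  \<open>\<pi>\<^sub>i\<close> on \<open>X\<close> matter, which for currents follows from linearity and finite mass.
\<close>

type_synonym 'a functional = "('a \<Rightarrow> real) \<Rightarrow> ('a \<Rightarrow> real) list \<Rightarrow> real"

definition Lip :: "'a::metric_space set \<Rightarrow> ('a \<Rightarrow> real) set" where
  "Lip X = {f. \<exists>C. C-lipschitz_on X f}"

definition Lip_bdd :: "'a::metric_space set \<Rightarrow> ('a \<Rightarrow> real) set" where
  "Lip_bdd X = {f\<in>Lip X. bounded (f ` X)}"

definition lip_const :: "'a::metric_space set \<Rightarrow> ('a \<Rightarrow> real) \<Rightarrow> real" where
  "lip_const X f = Inf {C. C-lipschitz_on X f}"

definition forms :: "nat \<Rightarrow> 'a::metric_space set \<Rightarrow> (('a \<Rightarrow> real) \<times> ('a \<Rightarrow> real) list) set" where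
  "forms k X = {(f, ps). f \<in> Lip_bdd X \<and> length ps = k \<and> set ps \<subseteq> Lip X}"

definition boundary :: "'a functional \<Rightarrow> 'a functional" where
  "boundary T f ps = T (\<lambda>_. 1) (f # ps)"

definition push_forward :: "('a \<Rightarrow> 'b) \<Rightarrow> 'a functional \<Rightarrow> 'b functional" where
  "push_forward \<phi> T f ps = T (f \<circ> \<phi>) (map (\<lambda>p. p \<circ> \<phi>) ps)"

definition mass_dominated ::
    "nat \<Rightarrow> 'a::metric_space set \<Rightarrow> 'a functional \<Rightarrow> 'a measure \<Rightarrow> bool" where
  "mass_dominated k X T \<mu> \<longleftrightarrow>
     sets \<mu> = sets (restrict_space borel X) \<and> finite_measure \<mu> \<and>
     (\<forall>(f, ps)\<in>forms k X. \<bar>T f ps\<bar> \<le> (\<Prod>p\<leftarrow>ps. lip_const X p) * (\<integral>x. \<bar>f x\<bar> \<partial>\<mu>))"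

text \<open>
  Below, \<open>X\<close> is a compact graph or the real line, so finite Borel measures are automatically tight and
  no such condition is imposed on the dominating measures.
\<close>

definition mass_measure ::
    "nat \<Rightarrow> 'a::metric_space set \<Rightarrow> 'a functional \<Rightarrow> 'a measure" where
  "mass_measure k X T = (THE \<mu>. mass_dominated k X T \<mu> \<and>
     (\<forall>\<nu>. mass_dominated k X T \<nu> \<longrightarrow>
        (\<forall>A\<in>sets (restrict_space borel X). emeasure \<mu> A \<le> emeasure \<nu> A)))"

definition mass :: "nat \<Rightarrow> 'a::metric_space set \<Rightarrow> 'a functional \<Rightarrow> real" where
  "mass k X T = measure (mass_measure k X T) X"

definition multilinear :: "nat \<Rightarrow> 'a::metric_space set \<Rightarrow> 'a functional \<Rightarrow> bool" where
  "multilinear k X T \<longleftrightarrow>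
     (\<forall>f g ps a b. (f, ps) \<in> forms k X \<longrightarrow> (g, ps) \<in> forms k X \<longrightarrow>
        T (\<lambda>x. a * f x + b * g x) ps = a * T f ps + b * T g ps) \<and>
     (\<forall>f ps i p q a b. (f, ps) \<in> forms k X \<longrightarrow> i < k \<longrightarrow> p \<in> Lip X \<longrightarrow> q \<in> Lip X \<longrightarrow>
        T f (ps[i := \<lambda>x. a * p x + b * q x]) = a * T f (ps[i := p]) + b * T f (ps[i := q]))"

definition continuity_axiom :: "nat \<Rightarrow> 'a::metric_space set \<Rightarrow> 'a functional \<Rightarrow> bool" where
  "continuity_axiom k X T \<longleftrightarrow>
     (\<forall>f ps P C. (f, ps) \<in> forms k X \<longrightarrow>
        (\<forall>n. length (P n) = k \<and> (\<forall>i<k. C-lipschitz_on X (P n ! i))) \<longrightarrow>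
        (\<forall>i<k. \<forall>x\<in>X. (\<lambda>n. (P n ! i) x) \<longlonglongrightarrow> (ps ! i) x) \<longrightarrow>
        (\<lambda>n. T f (P n)) \<longlonglongrightarrow> T f ps)"

definition locality_axiom :: "nat \<Rightarrow> 'a::metric_space set \<Rightarrow> 'a functional \<Rightarrow> bool" where
  "locality_axiom k X T \<longleftrightarrow>
     (\<forall>(f, ps)\<in>forms k X.
        (\<exists>i<k. \<exists>U c. open U \<and> {x\<in>X. f x \<noteq> 0} \<subseteq> U \<and> (\<forall>x\<in>X \<inter> U. (ps ! i) x = c)) \<longrightarrow>
        T f ps = 0)"

definition metric_currents :: "nat \<Rightarrow> 'a::metric_space set \<Rightarrow> 'a functional set" where
  "metric_currents k X =
     {T. (\<exists>\<mu>. mass_dominated k X T \<mu>) \<and>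
         multilinear k X T \<and> continuity_axiom k X T \<and> locality_axiom k X T}"

text \<open>
  The extension of \<open>T\<close> to bounded Borel first arguments \<open>g\<close>, by density of the bounded Lipschitz
  functions in \<open>L\<^sup>1(\<parallel>T\<parallel>)\<close>, and the restriction of \<open>T\<close> to a Borel set \<open>A\<close>.
\<close>

definition borel_extension ::
    "nat \<Rightarrow> 'a::metric_space set \<Rightarrow> 'a functional \<Rightarrow> 'a functional" where
  "borel_extension k X T g ps = (THE c. \<forall>F. (\<forall>n. F n \<in> Lip_bdd X) \<longrightarrow>
     (\<lambda>n. \<integral>x. \<bar>F n x - g x\<bar> \<partial>mass_measure k X T) \<longlonglongrightarrow> 0 \<longrightarrow>
     (\<lambda>n. T (F n) ps) \<longlonglongrightarrow> c)"

definition restriction ::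
    "nat \<Rightarrow> 'a::metric_space set \<Rightarrow> 'a functional \<Rightarrow> 'a set \<Rightarrow> 'a functional" where
  "restriction k X T A f ps = borel_extension k X T (\<lambda>x. indicator A x * f x) ps"


section \<open>Rectifiable and integral currents in dimensions 0 and 1\<close>

definition hausdorff1_delta :: "real \<Rightarrow> 'a::metric_space set \<Rightarrow> ennreal" where
  "hausdorff1_delta \<delta> A =
     (INF C\<in>{C :: nat \<Rightarrow> 'a set. A \<subseteq> (\<Union>i. C i) \<and> (\<forall>i. bounded (C i) \<and> diameter (C i) < \<delta>)}.
        \<Sum>i. ennreal (diameter (C i)))"

definition hausdorff1 :: "'a::metric_space set \<Rightarrow> ennreal" where
  "hausdorff1 A = (SUP \<delta>\<in>{0<..}. hausdorff1_delta \<delta> A)"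

definition countably_H1_rectifiable :: "'a::metric_space set \<Rightarrow> bool" where
  "countably_H1_rectifiable S \<longleftrightarrow>
     (\<exists>(A :: nat \<Rightarrow> real set) g. (\<forall>i. \<exists>C. C-lipschitz_on (A i) (g i)) \<and>
        hausdorff1 (S - (\<Union>i. g i ` A i)) = 0)"

text \<open>
  The current \<open>\<phi>\<^sub>#\<lbrakk>\<theta>\<rbrakk>\<close> for \<open>\<theta> \<in> L\<^sup>1(C)\<close>, \<open>C \<subseteq> \<real>\<close>, and a Lipschitz map \<open>\<phi>\<close> on \<open>C\<close>.
  As \<open>\<pi> \<circ> \<phi>\<close> is Lipschitz on \<open>C\<close>, its derivative within \<open>C\<close> exists and is unique almost everywhere on \<open>C\<close>,
  and agrees there with that of any Lipschitz extension to \<open>\<real>\<close>; \<open>lebesgue\<close> being complete, the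
  arbitrary value at the remaining points does not matter. Only the one-element list of the
  dimension one is meaningful.
\<close>

definition line_current :: "real set \<Rightarrow> (real \<Rightarrow> 'a) \<Rightarrow> (real \<Rightarrow> int) \<Rightarrow> 'a functional" where
  "line_current C \<phi> \<theta> f ps =
     (LINT t:C|lebesgue. real_of_int (\<theta> t) * f (\<phi> t) *
        vector_derivative (\<lambda>s. hd ps (\<phi> s)) (at t within C))"

definition integer_rectifiable_1 :: "'a::metric_space set \<Rightarrow> 'a functional set" where
  "integer_rectifiable_1 X =
     {T\<in>metric_currents 1 X.
        (\<exists>S\<in>sets (restrict_space borel X). countably_H1_rectifiable S \<and>
           emeasure (mass_measure 1 X T) (X - S) = 0) \<and>
        (\<forall>N\<in>sets (restrict_space borel X). hausdorff1 N = 0 \<longrightarrow>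
           emeasure (mass_measure 1 X T) N = 0) \<and>
        (\<forall>\<phi>\<in>Lip X. \<forall>U. open U \<longrightarrow>
           (\<exists>\<theta> :: real \<Rightarrow> int. integrable lebesgue (\<lambda>t. real_of_int (\<theta> t)) \<and>
              (\<forall>(f, ps)\<in>forms 1 (UNIV :: real set).
                 push_forward \<phi> (restriction 1 X T U) f ps =
                 line_current UNIV id \<theta> f ps)))}"

text \<open>\<open>T = \<Sum>\<^sub>x m(x) \<lbrakk>x\<rbrakk>\<close> as a \<open>0\<close>-current, the sum being finite.\<close>

definition point_mass_sum ::
    "'a::metric_space set \<Rightarrow> 'a functional \<Rightarrow> ('a \<Rightarrow> int) \<Rightarrow> bool" where
  "point_mass_sum X T m \<longleftrightarrow>
     finite {x. m x \<noteq> 0} \<and> {x. m x \<noteq> 0} \<subseteq> X \<and>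
     (\<forall>f\<in>Lip_bdd X. T f [] = (\<Sum>x | m x \<noteq> 0. real_of_int (m x) * f x))"

definition integer_rectifiable_0 :: "'a::metric_space set \<Rightarrow> 'a functional set" where
  "integer_rectifiable_0 X = {T\<in>metric_currents 0 X. \<exists>m. point_mass_sum X T m}"

definition point_coeff :: "'a::metric_space set \<Rightarrow> 'a functional \<Rightarrow> 'a \<Rightarrow> int" where
  "point_coeff X T = (THE m. point_mass_sum X T m)"

definition integral_currents_1 :: "'a::metric_space set \<Rightarrow> 'a functional set" where
  "integral_currents_1 X =
     {T\<in>integer_rectifiable_1 X. boundary T \<in> integer_rectifiable_0 X}"


section \<open>Multiplicity\<close>

definition bilipschitz_on :: "real set \<Rightarrow> (real \<Rightarrow> 'a::metric_space) \<Rightarrow> bool" where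
  "bilipschitz_on C \<phi> \<longleftrightarrow>
     (\<exists>L>0. \<forall>s\<in>C. \<forall>t\<in>C.
        dist s t / L \<le> dist (\<phi> s) (\<phi> t) \<and> dist (\<phi> s) (\<phi> t) \<le> L * dist s t)"

text \<open>
  Parametric representation \<open>T = \<Sum>\<^sub>i \<phi>\<^sub>i\<^sub>#\<lbrakk>\<theta>\<^sub>i\<rbrakk>\<close> without cancellation of mass, where the
  \<open>\<phi>\<^sub>i\<close> are bi-Lipschitz charts with disjoint images and the integers \<open>\<theta>\<^sub>i\<close> are the signed
  coefficients. The chart domains are Borel sets rather than compact sets, so that touching pieces,
  such as the two halves of an edge, can be made disjoint.
\<close>

definition rectifiable_representation ::
    "'a::metric_space set \<Rightarrow> 'a functional \<Rightarrow>
     (nat \<Rightarrow> real set) \<Rightarrow> (nat \<Rightarrow> real \<Rightarrow> 'a) \<Rightarrow> (nat \<Rightarrow> real \<Rightarrow> int) \<Rightarrow> bool" where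
  "rectifiable_representation X T C \<phi> \<theta> \<longleftrightarrow>
     (\<forall>i. C i \<in> sets borel \<and> \<phi> i ` C i \<subseteq> X \<and> bilipschitz_on (C i) (\<phi> i) \<and>
          set_integrable lebesgue (C i) (\<lambda>t. real_of_int (\<theta> i t))) \<and>
     (\<forall>i j. i \<noteq> j \<longrightarrow> \<phi> i ` C i \<inter> \<phi> j ` C j = {}) \<and>
     (\<forall>(f, ps)\<in>forms 1 X. (\<lambda>i. line_current (C i) (\<phi> i) (\<theta> i) f ps) sums T f ps) \<and>
     (\<lambda>i. mass 1 X (line_current (C i) (\<phi> i) (\<theta> i))) sums mass 1 X T"

text \<open>
  A representative of the multiplicity \<open>\<theta>\<^sub>T\<close>, which is determined up to \<open>H\<^sup>1\<close>-null sets.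
\<close>

definition is_multiplicity :: "'a::metric_space set \<Rightarrow> 'a functional \<Rightarrow> ('a \<Rightarrow> nat) \<Rightarrow> bool" where
  "is_multiplicity X T m \<longleftrightarrow>
     (\<exists>C \<phi> \<theta>. rectifiable_representation X T C \<phi> \<theta> \<and>
        (\<forall>i. \<forall>t\<in>C i. m (\<phi> i t) = nat \<bar>\<theta> i t\<bar>) \<and>
        (\<forall>x. x \<notin> (\<Union>i. \<phi> i ` C i) \<longrightarrow> m x = 0))"

definition unit_currents :: "('a::metric_space, 'e) metric_graph \<Rightarrow> 'a functional set" where
  "unit_currents G =
     {S\<in>integral_currents_1 (points G).
        \<exists>m. is_multiplicity (points G) S m \<and>
          (\<forall>e\<in>edges G. hausdorff1 {x\<in>edge_set G e. m x \<noteq> 1} = 0)}"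

end

theory Submission
  imports Defs
begin

text \<open>A current of multiplicity one is, up to null sets, a measurable choice of sign on every edge:
  composing its charts with the edge parametrizations, the area formula for bi-Lipschitz functions
  of one variable (with Rademacher's theorem, proved from Vitali's covering theorem) turns the
  integral over the charts into integrals over the edges. If the boundary is a finite sum of point
  masses, testing it against hat functions shows that the sign is constant between consecutive
  atoms, in particular near both ends of every edge. Testing it against a tent around a vertex
  \<open>v\<close> expresses the boundary coefficient at \<open>v\<close> as a sum of \<open>deg v\<close> signs. It is therefore odd,
  hence nonzero, at every odd vertex, and the mass of the boundary is at least the number of odd vertices.

  Conversely, every finite multigraph has an orientation whose balance is \<open>0\<close> at even and \<open>\<plusminus>1\<close> at odd
  vertices: splice two edges at a common vertex into one and induct on the number of edges. The
  currents of integration over the edges so oriented add up to a current attaining the bound.\<close>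

section \<open>Lipschitz functions on the line\<close>

text \<open>One obstacle shapes both halves of the proof: mass, restriction to a set and boundary
  coefficients are definite descriptions, so nothing can be computed before a candidate has been
  exhibited and shown to be the only one. For sums over edges, minimality of the weighted length
  measure comes from a single test function, the distance to the nearer end of an edge, whose slope
  is \<plusminus>1 on every half edge. Integer rectifiability asks for more: after restriction to
  any open set and push-forward to the line, one integer density has to serve all forms. An open
  part of an edge is a countable union of intervals; each is pushed to the signed interval between
  its end values, and these add up in L^1.

  For the lower bound a competitor is evaluated on forms with first argument 1 only. Constancy of
  its sign is reached without functions of bounded variation: hat functions force the positively
  oriented set to fill the same proportion of every initial interval, which leaves the proportions 0
  and 1. A vertex coefficient then enters through its parity alone, so the individual signs never
  have to be determined.\<close>

lemma countable_imp_negligible: "countable A \<Longrightarrow> negligible A" for A :: "real set"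
  using countable_imp_null_set_lborel[of A]
  by (simp add: negligible_iff_null_sets null_sets_completionI)

text \<open>Vitali's theorem for balls, with centre and radius traded for two end points. Keeping
  the intervals inside the open set \<open>U\<close> is what allows one covering to be nested in
  another; it is achieved by shrinking the admissible lengths.\<close>

lemma vitali_intervals:
  fixes E U :: "real set"
  assumes "open U" "E \<subseteq> U"
    and Q: "\<And>x d. x \<in> E \<Longrightarrow> 0 < d \<Longrightarrow> \<exists>a b. a < b \<and> x \<in> {a..b} \<and> b - a < d \<and> Q a b"
  obtains C where "countable C"
    "\<forall>p\<in>C. fst p < snd p \<and> Q (fst p) (snd p) \<and> {fst p..snd p} \<subseteq> U"
    "disjoint_family_on (\<lambda>p. {fst p..snd p}) C"
    "negligible (E - (\<Union>p\<in>C. {fst p..snd p}))"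
proof -
  define K where "K = {p. fst p < snd p \<and> Q (fst p) (snd p) \<and> {fst p..snd p} \<subseteq> U}"
  define c where "c = (\<lambda>p::real\<times>real. (fst p + snd p) / 2)"
  define r where "r = (\<lambda>p::real\<times>real. (snd p - fst p) / 2)"
  have cb: "cball (c p) (r p) = {fst p..snd p}" for p
    by (auto simp: c_def r_def cball_def dist_real_def abs_if field_simps)
  have r0: "0 < r p" if "p \<in> K" for p
    using that by (auto simp: K_def r_def)
  have ex: "\<exists>p. p \<in> K \<and> x \<in> cball (c p) (r p) \<and> r p < d" if "x \<in> E" "0 < d" for x d
  proof -
    from \<open>x \<in> E\<close> assms(1,2) obtain e where e: "e > 0" "cball x e \<subseteq> U"
      using open_contains_cball by blast
    with that obtain a b where ab: "a < b" "x \<in> {a..b}" "b - a < min d e" "Q a b"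
      using Q[of x "min d e"] by auto
    have "{a..b} \<subseteq> cball x e"
      using ab by (auto simp: cball_def dist_real_def)
    with ab e show ?thesis
      by (intro exI[of _ "(a, b)"]) (auto simp: K_def cb, auto simp: r_def)
  qed
  obtain C where C: "countable C" "C \<subseteq> K"
     "pairwise (\<lambda>i j. disjnt (cball (c i) (r i)) (cball (c j) (r j))) C"
     "negligible(E - (\<Union>i \<in> C. cball (c i) (r i)))"
    by (rule Vitali_covering_theorem_cballs[of K r E c, OF r0 ex])
  show ?thesis
  proof (rule that[of C])
    show "disjoint_family_on (\<lambda>p. {fst p..snd p}) C"
      using C(3) by (simp add: cb disjoint_family_on_def pairwise_def disjnt_def)
    show "negligible (E - (\<Union>p\<in>C. {fst p..snd p}))"
      using C(4) unfolding cb .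
  qed (use C in \<open>auto simp: K_def\<close>)
qed

text \<open>The classical argument for monotone functions. If E had outer measure s > 0, cover it
  inside an almost optimal open U by intervals on which f grows slower than u, and again, inside the
  interiors of those, by intervals on which f grows faster than v. Comparing the lengths of the
  images under f gives v s \<le> u \<bar>U\<bar>, which fails once \<bar>U\<bar> is close to s,
  because u < v.\<close>

lemma slopes_gap_negligible:
  fixes f :: "real \<Rightarrow> real"
  assumes inc: "strict_mono f" and cont: "continuous_on UNIV f"
    and uv: "0 < u" "u < v" and bdd: "bounded E"
    and low: "\<And>x d. x \<in> E \<Longrightarrow> 0 < d \<Longrightarrow>
      \<exists>a b. a < b \<and> x \<in> {a..b} \<and> b - a < d \<and> f b - f a < u * (b - a)"
    and high: "\<And>x d. x \<in> E \<Longrightarrow> 0 < d \<Longrightarrow>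
      \<exists>a b. a < b \<and> x \<in> {a..b} \<and> b - a < d \<and> f b - f a > v * (b - a)"
  shows "negligible E"
proof -
  have im: "f ` {a..b} = {f a..f b}" if "a < b" for a b
  proof
    show "f ` {a..b} \<subseteq> {f a..f b}"
      using inc by (auto simp: strict_mono_less_eq)
    show "{f a..f b} \<subseteq> f ` {a..b}"
    proof
      fix y assume "y \<in> {f a..f b}"
      have "continuous_on {a..b} f" using cont by (rule continuous_on_subset) simp
      then obtain x where "a \<le> x" "x \<le> b" "f x = y"
        using IVT'[of f a y b] \<open>a < b\<close> \<open>y \<in> {f a..f b}\<close> by auto
      then show "y \<in> f ` {a..b}" by auto
    qed
  qed
  have injf: "inj f" using inc by (rule strict_mono_imp_inj_on)
  \<comment> \<open>An increasing continuous function maps disjoint closed intervals to disjoint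
    closed intervals, so both unions are measured by adding lengths.\<close>
  have meas: "emeasure lborel (\<Union>p\<in>C. {fst p..snd p}) = (\<integral>\<^sup>+p. ennreal (snd p - fst p) \<partial>count_space C)"
    "emeasure lborel (f ` (\<Union>p\<in>C. {fst p..snd p})) = (\<integral>\<^sup>+p. ennreal (f (snd p) - f (fst p)) \<partial>count_space C)"
    "(\<Union>p\<in>C. {fst p..snd p}) \<in> sets borel" "f ` (\<Union>p\<in>C. {fst p..snd p}) \<in> sets borel"
    if C: "countable C" "\<And>p. p \<in> C \<Longrightarrow> fst p < snd p" "disjoint_family_on (\<lambda>p. {fst p..snd p}) C"
    for C :: "(real \<times> real) set"
  proof -
    have fim: "f ` (\<Union>p\<in>C. {fst p..snd p}) = (\<Union>p\<in>C. {f (fst p)..f (snd p)})"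
      unfolding image_UN using C(2) im by auto
    have dj: "disjoint_family_on (\<lambda>p. {f (fst p)..f (snd p)}) C"
      unfolding disjoint_family_on_def
    proof (intro ballI impI)
      fix p q assume pq: "p \<in> C" "q \<in> C" "p \<noteq> q"
      then have "{f (fst p)..f (snd p)} \<inter> {f (fst q)..f (snd q)} = f ` ({fst p..snd p} \<inter> {fst q..snd q})"
        using im C(2) by (simp add: image_Int[OF injf] del: Int_atLeastAtMost)
      also have "{fst p..snd p} \<inter> {fst q..snd q} = {}"
        using C(3) pq unfolding disjoint_family_on_def by metis
      finally show "{f (fst p)..f (snd p)} \<inter> {f (fst q)..f (snd q)} = {}" by simp
    qed
    show "emeasure lborel (\<Union>p\<in>C. {fst p..snd p}) = (\<integral>\<^sup>+p. ennreal (snd p - fst p) \<partial>count_space C)"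
      using C by (subst emeasure_UN_countable) (auto intro!: nn_integral_cong simp: less_imp_le)
    show "emeasure lborel (f ` (\<Union>p\<in>C. {fst p..snd p})) = (\<integral>\<^sup>+p. ennreal (f (snd p) - f (fst p)) \<partial>count_space C)"
      unfolding fim using C dj
      by (subst emeasure_UN_countable)
        (auto intro!: nn_integral_cong simp: less_imp_le strict_mono_less_eq[OF inc])
    show "(\<Union>p\<in>C. {fst p..snd p}) \<in> sets borel" "f ` (\<Union>p\<in>C. {fst p..snd p}) \<in> sets borel"
      unfolding fim using C(1) by auto
  qed
  \<comment> \<open>The outer measure of \<open>E\<close>, whose measurability is not known. The
    next step carries the lower bound from open supersets to all Lebesgue measurable ones.\<close>
  define s where "s = (INF U\<in>{U. open U \<and> E \<subseteq> U}. emeasure lborel U)"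
  have s_le: "s \<le> emeasure lebesgue W" if W: "W \<in> sets lebesgue" "E \<subseteq> W" for W
  proof (rule ennreal_le_epsilon)
    fix e :: real assume "e > 0"
    from sets_lebesgue_outer_open[OF W(1) this] obtain T where
      T: "open T" "W \<subseteq> T" "(T - W) \<in> lmeasurable" "emeasure lebesgue (T - W) < ennreal e" by metis
    have "s \<le> emeasure lborel T"
      unfolding s_def using T W by (intro INF_lower) auto
    also have "\<dots> = emeasure lebesgue (W \<union> (T - W))"
      using T by (simp add: Un_absorb1)
    also have "\<dots> \<le> emeasure lebesgue W + emeasure lebesgue (T - W)"
      using T W by (intro emeasure_subadditive) (auto simp: fmeasurableD)
    also have "\<dots> \<le> emeasure lebesgue W + ennreal e"
      using T by (intro add_left_mono) auto
    finally show "s \<le> emeasure lebesgue W + ennreal e" .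
  qed
  have key: "v * s \<le> u * emeasure lborel U" if U: "open U" "E \<subseteq> U" for U
  proof -
    obtain C where C: "countable C"
      "\<forall>p\<in>C. fst p < snd p \<and> f (snd p) - f (fst p) < u * (snd p - fst p) \<and> {fst p..snd p} \<subseteq> U"
      "disjoint_family_on (\<lambda>p. {fst p..snd p}) C"
      "negligible (E - (\<Union>p\<in>C. {fst p..snd p}))"
      by (rule vitali_intervals[where Q="\<lambda>a b. f b - f a < u * (b - a)", OF U low])
    \<comment> \<open>The second covering has to live in an open set, so the intervals of the first
      are replaced by their interiors; this loses only countably many end points.\<close>
    define U' where "U' = (\<Union>p\<in>C. {fst p<..<snd p})"
    have "open U'" by (auto simp: U'_def)
    have U'sub: "U' \<subseteq> (\<Union>p\<in>C. {fst p..snd p})" unfolding U'_def by fastforce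
    have N1: "negligible (E - U')"
    proof (rule negligible_subset)
      show "negligible ((E - (\<Union>p\<in>C. {fst p..snd p})) \<union> (fst ` C \<union> snd ` C))"
        using C by (intro negligible_Un) (auto intro: countable_imp_negligible)
      show "E - U' \<subseteq> (E - (\<Union>p\<in>C. {fst p..snd p})) \<union> (fst ` C \<union> snd ` C)"
      proof
        fix x assume x: "x \<in> E - U'"
        show "x \<in> (E - (\<Union>p\<in>C. {fst p..snd p})) \<union> (fst ` C \<union> snd ` C)"
        proof (cases "\<exists>p\<in>C. x \<in> {fst p..snd p}")
          case True
          then obtain p where p: "p \<in> C" "x \<in> {fst p..snd p}" by auto
          moreover have "x \<notin> {fst p<..<snd p}" using x p by (auto simp: U'_def)
          ultimately have "x = fst p \<or> x = snd p" by auto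
          then show ?thesis using p by auto
        qed (use x in auto)
      qed
    qed
    have low': "emeasure lborel (f ` (\<Union>p\<in>C. {fst p..snd p})) \<le> u * emeasure lborel U"
    proof -
      have "emeasure lborel (f ` (\<Union>p\<in>C. {fst p..snd p})) \<le> (\<integral>\<^sup>+p. ennreal u * ennreal (snd p - fst p) \<partial>count_space C)"
        using C uv by (subst meas(2)) (auto intro!: nn_integral_mono ennreal_leI simp flip: ennreal_mult' intro: less_imp_le)
      also have "\<dots> = u * emeasure lborel (\<Union>p\<in>C. {fst p..snd p})"
        using C by (subst meas(1)) (auto simp: nn_integral_cmult)
      also have "\<dots> \<le> u * emeasure lborel U"
        using C U(1) by (intro mult_left_mono emeasure_mono) auto
      finally show ?thesis .
    qed
    obtain D where D: "countable D"
      "\<forall>p\<in>D. fst p < snd p \<and> f (snd p) - f (fst p) > v * (snd p - fst p) \<and> {fst p..snd p} \<subseteq> U'"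
      "disjoint_family_on (\<lambda>p. {fst p..snd p}) D"
      "negligible (E \<inter> U' - (\<Union>p\<in>D. {fst p..snd p}))"
      by (rule vitali_intervals[where Q="\<lambda>a b. f b - f a > v * (b - a)", OF \<open>open U'\<close> Int_lower2 high[OF IntD1]])
    define M where "M = (\<Union>p\<in>D. {fst p..snd p})"
    define N where "N = (E - U') \<union> (E \<inter> U' - M)"
    have "negligible N" using N1 D by (auto simp: N_def M_def)
    have Mb: "M \<in> sets borel" unfolding M_def using D(1) by auto
    have "s \<le> emeasure lebesgue (M \<union> N)"
      using Mb \<open>negligible N\<close> by (intro s_le) (auto simp: N_def negligible_iff_null_sets)
    also have "\<dots> = emeasure lebesgue M"
      using Mb \<open>negligible N\<close> by (intro emeasure_Un_null_set) (auto simp: negligible_iff_null_sets)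
    also have "\<dots> = emeasure lborel M" using Mb by simp
    finally have "v * s \<le> v * emeasure lborel M" by (rule mult_left_mono) auto
    also have "\<dots> = (\<integral>\<^sup>+p. ennreal v * ennreal (snd p - fst p) \<partial>count_space D)"
      using D unfolding M_def by (subst meas(1)) (auto simp: nn_integral_cmult)
    also have "\<dots> \<le> emeasure lborel (f ` M)"
      using D uv unfolding M_def
      by (subst meas(2)) (auto intro!: nn_integral_mono ennreal_leI simp flip: ennreal_mult' intro: less_imp_le)
    also have "\<dots> \<le> emeasure lborel (f ` (\<Union>p\<in>C. {fst p..snd p}))"
    proof (intro emeasure_mono image_mono)
      have "M \<subseteq> U'" unfolding M_def using D(2) by (intro UN_least) auto
      then show "M \<subseteq> (\<Union>p\<in>C. {fst p..snd p})" using U'sub by simp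
    qed (use meas(4)[of C] C in auto)
    also note low'
    finally show ?thesis .
  qed
  from bdd obtain B where B: "E \<subseteq> ball 0 B" using bounded_subset_ballD by blast
  have sfin: "s < top"
  proof -
    have "s \<le> emeasure lborel (ball (0::real) B)" unfolding s_def using B by (intro INF_lower) blast
    also have "\<dots> < top" using emeasure_bounded_finite[of "ball (0::real) B"] by (simp add: less_top)
    finally show ?thesis .
  qed
  have "s = 0"
  proof (rule ccontr)
    assume "s \<noteq> 0"
    obtain r where r: "s = ennreal r" "r > 0"
      using sfin \<open>s \<noteq> 0\<close> by (cases s) (auto simp: ennreal_eq_0_iff not_le)
    \<comment> \<open>The factor v / u > 1 leaves room for an open superset U of measure below
      \<open>v / u * r\<close>, and for this U the estimate \<open>key\<close> reads v s < v
      s.\<close>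
    have "s < ennreal (v / u * r)"
      unfolding r(1) using r uv by (subst ennreal_less_iff) (auto simp: field_simps)
    then obtain U where U: "open U" "E \<subseteq> U" "emeasure lborel U < ennreal (v / u * r)"
      unfolding s_def by (auto simp: INF_less_iff)
    have "v * s \<le> u * emeasure lborel U" using key U by auto
    also have "\<dots> < u * ennreal (v / u * r)"
      using U(3) uv by (intro ennreal_mult_strict_left_mono) auto
    also have "\<dots> = v * s"
      unfolding r(1) using uv r by (simp flip: ennreal_mult')
    finally show False by simp
  qed
  show "negligible E"
    unfolding negligible_outer_le
  proof safe
    fix e :: real assume "e > 0"
    then have "s < ennreal e" using \<open>s = 0\<close> by simp
    then obtain U where U: "open U" "E \<subseteq> U" "emeasure lborel U < ennreal e"
      unfolding s_def by (auto simp: INF_less_iff)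
    moreover have "U \<in> lmeasurable"
      using U by (intro fmeasurableI) (auto intro: order.strict_trans)
    moreover have "measure lebesgue U \<le> e"
      using U \<open>e > 0\<close> by (simp add: measure_def) (metis enn2real_leI less_imp_le)
    ultimately show "\<exists>T. E \<subseteq> T \<and> T \<in> lmeasurable \<and> measure lebesgue T \<le> e" by blast
  qed
qed

text \<open>Rademacher's theorem in dimension one. Adding a linear term makes all slopes positive;
  where the derivative fails to exist, two rationals separate the lower from the upper limit of the
  slopes, and each pair of rationals accounts for a null set.\<close>

lemma lipschitz_differentiable_ae:
  fixes g :: "real \<Rightarrow> real"
  assumes "L-lipschitz_on UNIV g"
  shows "negligible {x. \<not> g differentiable (at x)}"
proof -
  \<comment> \<open>With \<open>L + 1\<close> in place of L all slopes are at least 1, which gives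
    strict monotonicity and lets the separating rationals be positive.\<close>
  define f where "f x = g x + (L + 1) * x" for x
  have g_bd: "\<bar>g y - g x\<bar> \<le> L * (y - x)" if "x \<le> y" for x y
    using lipschitz_onD[OF assms, of y x] that by (simp add: dist_real_def)
  have f_lo: "y - x \<le> f y - f x" if "x \<le> y" for x y
    using g_bd[OF that] by (simp add: f_def algebra_simps abs_le_iff)
  have f_hi: "f y - f x \<le> (2 * L + 1) * (y - x)" if "x \<le> y" for x y
    using g_bd[OF that] by (simp add: f_def algebra_simps abs_le_iff)
  have inc: "strict_mono f"
    unfolding strict_mono_def using f_lo by (metis diff_gt_0_iff_gt less_imp_le less_le_trans)
  have cont: "continuous_on UNIV f"
    unfolding f_def using lipschitz_on_continuous_on[OF assms] by (intro continuous_intros)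
  \<comment> \<open>Arbitrarily short intervals around x whose increment and length satisfy P: the
    shape in which \<open>slopes_gap_negligible\<close> receives its small and its large
    slopes.\<close>
  define freq where "freq P x \<longleftrightarrow> (\<forall>d>0. \<exists>a b. a < b \<and> x \<in> {a..b} \<and> b - a < d \<and> P (f b - f a) (b - a))"
    for P :: "real \<Rightarrow> real \<Rightarrow> bool" and x
  define I :: "(real \<times> real \<times> real) set"
    where "I = {(u, v, n). u \<in> \<rat> \<and> v \<in> \<rat> \<and> 0 < u \<and> u < v \<and> n \<in> \<nat>}"
  \<comment> \<open>Rational u and v keep the union countable, and the windows [-n, n] supply
    boundedness.\<close>
  define Z where "Z = (\<Union>(u, v, n)\<in>I. {x\<in>{-n..n}. freq (\<lambda>a b. a < u * b) x \<and> freq (\<lambda>a b. a > v * b) x})"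
  have cnt: "countable I"
  proof (rule countable_subset)
    show "I \<subseteq> \<rat> \<times> \<rat> \<times> \<nat>" by (auto simp: I_def)
    show "countable (\<rat> \<times> \<rat> \<times> \<nat> :: (real \<times> real \<times> real) set)"
      by (intro countable_SIGMA countable_rat) (auto simp: Nats_def)
  qed
  have neg: "negligible {x\<in>{-n..n}. freq (\<lambda>a b. a < u * b) x \<and> freq (\<lambda>a b. a > v * b) x}"
    if uv: "0 < u" "u < v" for u v n
  proof (rule slopes_gap_negligible[OF inc cont uv])
    show "bounded {x\<in>{-n..n}. freq (\<lambda>a b. a < u * b) x \<and> freq (\<lambda>a b. v * b < a) x}"
      by (rule bounded_subset[of "{-n..n}"]) auto
  qed (auto simp: freq_def)
  have "negligible Z"
    unfolding Z_def
    by (rule negligible_countable_Union[OF countable_image[OF cnt]]) (use neg in \<open>auto simp: I_def\<close>)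
  moreover have "g differentiable (at x)" if "x \<notin> Z" for x
  proof -
    have nofreq: "\<not> (freq (\<lambda>a b. a < u * b) x \<and> freq (\<lambda>a b. a > v * b) x)"
      if "u \<in> \<rat>" "v \<in> \<rat>" "0 < u" "u < v" for u v
    proof -
      obtain n where n: "\<bar>x\<bar> \<le> real n" using real_arch_simple by blast
      then have "x \<in> {- real n..real n}" by auto
      with that \<open>x \<notin> Z\<close> show ?thesis unfolding Z_def I_def by fastforce
    qed
    define q where "q y = (f y - f x) / (y - x)" for y
    have q_eq: "q y = (f (max x y) - f (min x y)) / (max x y - min x y)" if "y \<noteq> x" for y
      using that by (auto simp: q_def max_def min_def field_simps)
    have q1: "1 \<le> q y" "q y \<le> 2 * L + 1" if "y \<noteq> x" for y
      using that f_lo[of "min x y" "max x y"] f_hi[of "min x y" "max x y"]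
      by (auto simp: q_eq divide_simps max_def min_def)
    have ev_iff: "freq (\<lambda>a b. P (a / b)) x" if "\<exists>\<^sub>F y in at x. P (q y)" for P
      unfolding freq_def
    proof safe
      fix d :: real assume "d > 0"
      then have "\<forall>\<^sub>F y in at x. y \<noteq> x \<and> dist y x < d"
        by (auto simp: eventually_at)
      with that have "\<exists>\<^sub>F y in at x. P (q y) \<and> (y \<noteq> x \<and> dist y x < d)"
        using frequently_eventually_frequently by fast
      then obtain y where y: "P (q y)" "y \<noteq> x" "dist y x < d"
        using frequently_ex by blast
      then show "\<exists>a b. a < b \<and> x \<in> {a..b} \<and> b - a < d \<and> P ((f b - f a) / (b - a))"
        by (intro exI[of _ "min x y"] exI[of _ "max x y"])
          (auto simp: q_eq dist_real_def max_def min_def split: if_splits)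
    qed
    \<comment> \<open>\<open>Sup S\<close> is the lower limit of the slopes at x. If the slopes did
      not converge to it, rationals u < v between it and a value exceeded or reached frequently
      would put x into \<open>Z\<close>.\<close>
    define S where "S = {u. \<forall>\<^sub>F y in at x. u \<le> q y}"
    have ev_ne: "\<forall>\<^sub>F y in at x. y \<noteq> x" by (rule eventually_neq_at_within)
    have "1 \<in> S" unfolding S_def using q1 ev_ne by (auto elim: eventually_mono)
    have bdd: "bdd_above S"
    proof (rule bdd_aboveI)
      fix u assume "u \<in> S"
      then have "\<forall>\<^sub>F y in at x. u \<le> q y \<and> y \<noteq> x" unfolding S_def using ev_ne by (auto intro: eventually_conj)
      then obtain y where "u \<le> q y" "y \<noteq> x"
        using eventually_happens' trivial_limit_at by (metis (mono_tags, lifting) at_neq_bot)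
      then show "u \<le> 2 * L + 1" using q1 by fastforce
    qed
    define c where "c = Sup S"
    have "(q \<longlongrightarrow> c) (at x)"
    proof (rule order_tendstoI)
      fix a assume "a < c"
      then obtain s where "s \<in> S" "a < s"
        using less_cSupD[of S a] \<open>1 \<in> S\<close> unfolding c_def by blast
      then show "\<forall>\<^sub>F y in at x. a < q y"
        unfolding S_def by (auto elim: eventually_mono)
    next
      fix b assume "c < b"
      have "1 \<le> c" unfolding c_def using \<open>1 \<in> S\<close> bdd by (rule cSup_upper)
      obtain v where v: "v \<in> \<rat>" "c < v" "v < b" using Rats_dense_in_real[OF \<open>c < b\<close>] by blast
      obtain u where u: "u \<in> \<rat>" "c < u" "u < v" using Rats_dense_in_real[OF \<open>c < v\<close>] by blast
      show "\<forall>\<^sub>F y in at x. q y < b"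
      proof (rule ccontr)
        assume "\<not> (\<forall>\<^sub>F y in at x. q y < b)"
        then have "\<exists>\<^sub>F y in at x. q y > v"
          using v by (auto simp: not_eventually elim!: frequently_mono[rotated])
        then have "freq (\<lambda>a b. a / b > v) x" by (rule ev_iff)
        then have "freq (\<lambda>a b. a > v * b) x"
          unfolding freq_def by (simp add: pos_less_divide_eq cong: conj_cong)
        with nofreq[of u v] u v \<open>1 \<le> c\<close> have nu: "\<not> freq (\<lambda>a b. a < u * b) x" by auto
        have "\<forall>\<^sub>F y in at x. u \<le> q y"
        proof (rule ccontr)
          assume "\<not> (\<forall>\<^sub>F y in at x. u \<le> q y)"
          then have "\<exists>\<^sub>F y in at x. q y < u" by (simp add: not_eventually not_le)
          then have "freq (\<lambda>a b. a / b < u) x" by (rule ev_iff)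
          then have "freq (\<lambda>a b. a < u * b) x"
            unfolding freq_def by (simp add: pos_divide_less_eq cong: conj_cong)
          with nu show False by simp
        qed
        then have "u \<le> c" unfolding c_def using bdd by (intro cSup_upper) (auto simp: S_def)
        with u show False by simp
      qed
    qed
    then have "(f has_field_derivative c) (at x)"
      by (simp add: has_field_derivative_iff q_def[abs_def])
    then have "((\<lambda>y. f y - (L + 1) * y) has_field_derivative (c - (L + 1) * 1)) (at x)"
      by (auto intro!: derivative_eq_intros)
    then show ?thesis
      unfolding f_def by (auto simp: real_differentiable_def)
  qed
  ultimately show ?thesis
    by (elim negligible_subset) blast
qed

section \<open>The fundamental theorem of calculus for Lipschitz functions\<close>

text \<open>Prolonging by the end values keeps the constant, so results for the whole line apply to
  functions on an interval.\<close>

lemma lipschitz_clamp: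
  fixes u :: "real \<Rightarrow> real"
  assumes "L-lipschitz_on {a..b} u" "a \<le> b"
  shows "L-lipschitz_on UNIV (\<lambda>t. u (max a (min b t)))"
proof (rule lipschitz_onI)
  show "0 \<le> L" using assms lipschitz_on_nonneg by blast
  fix x y :: real
  have "dist (u (max a (min b x))) (u (max a (min b y))) \<le> L * dist (max a (min b x)) (max a (min b y))"
    using assms by (intro lipschitz_onD) auto
  also have "\<dots> \<le> L * dist x y"
    using \<open>0 \<le> L\<close> by (intro mult_left_mono) (auto simp: dist_real_def max_def min_def)
  finally show "dist (u (max a (min b x))) (u (max a (min b y))) \<le> L * dist x y" .
qed

lemma clamp_has_vector_derivative_iff:
  fixes u :: "real \<Rightarrow> real"
  assumes "t \<in> {a<..<b}"
  shows "((\<lambda>t. u (max a (min b t))) has_vector_derivative d) (at t) \<longleftrightarrow> (u has_vector_derivative d) (at t)"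
proof -
  have ev: "\<forall>\<^sub>F s in nhds t. u (max a (min b s)) = u s"
    using assms by (intro eventually_nhds[THEN iffD2] exI[of _ "{a<..<b}"]) auto
  then show ?thesis
    by (intro has_vector_derivative_cong_ev) (auto dest: eventually_nhds_x_imp_x)
qed

lemma lipschitz_vector_derivative_bound:
  fixes u :: "real \<Rightarrow> real"
  assumes "L-lipschitz_on S u" "(u has_vector_derivative d) (at t within S)" "t \<in> S" "at t within S \<noteq> bot"
  shows "\<bar>d\<bar> \<le> L"
proof -
  have "((\<lambda>y. (u y - u t) / (y - t)) \<longlongrightarrow> d) (at t within S)"
    using assms(2) by (simp add: has_real_derivative_iff_has_vector_derivative[symmetric] has_field_derivative_iff)
  then have "((\<lambda>y. \<bar>(u y - u t) / (y - t)\<bar>) \<longlongrightarrow> \<bar>d\<bar>) (at t within S)"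
    by (rule tendsto_rabs)
  moreover have "\<forall>\<^sub>F y in at t within S. \<bar>(u y - u t) / (y - t)\<bar> \<le> L"
    unfolding eventually_at_filter
  proof (rule always_eventually, intro allI impI)
    fix y assume "y \<noteq> t" "y \<in> S"
    then show "\<bar>(u y - u t) / (y - t)\<bar> \<le> L"
      using lipschitz_onD[OF assms(1), of y t] assms(3) by (simp add: dist_real_def divide_simps)
  qed
  ultimately show ?thesis using assms(4) by (intro tendsto_upperbound)
qed

text \<open>The difference quotients of the prolonged function are bounded by L and converge to the
  derivative off a null set. Their integral is the mean of the function over a short interval to the
  right of b minus the mean over one to the right of a, and tends to u b - u a.\<close>

lemma
  fixes u :: "real \<Rightarrow> real"
  assumes u: "L-lipschitz_on {a..b} u"
  shows lipschitz_interval_differentiable_ae: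
      "negligible {t\<in>{a<..<b}. \<not> u differentiable (at t)}"
    and lipschitz_interval_derivative_integrable:
      "set_integrable lebesgue {a<..<b} (\<lambda>t. vector_derivative u (at t))"
    and lipschitz_interval_FTC:
      "a \<le> b \<Longrightarrow> (LINT t:{a<..<b}|lebesgue. vector_derivative u (at t)) = u b - u a"
proof -
  define U where "U = (\<lambda>t. u (max a (min b t)))"
  have "negligible {t\<in>{a<..<b}. \<not> u differentiable (at t)} \<and>
    set_integrable lebesgue {a<..<b} (\<lambda>t. vector_derivative u (at t)) \<and>
    (LINT t:{a<..<b}|lebesgue. vector_derivative u (at t)) = u b - u a" if "a \<le> b"
  proof -
    have L0: "L \<ge> 0" using u lipschitz_on_nonneg by blast
    have U: "L-lipschitz_on UNIV U" unfolding U_def using u that by (rule lipschitz_clamp)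
    define N where "N = {x. \<not> U differentiable (at x)}"
    have N: "negligible N" unfolding N_def using U by (rule lipschitz_differentiable_ae)
    have diff_iff: "U differentiable (at t) \<longleftrightarrow> u differentiable (at t)" if "t \<in> {a<..<b}" for t
      unfolding real_differentiable_def has_real_derivative_iff_has_vector_derivative U_def
      using clamp_has_vector_derivative_iff[OF that] by simp
    have vd_eq: "vector_derivative U (at t) = vector_derivative u (at t)" if "t \<in> {a<..<b}" for t
      unfolding vector_derivative_def U_def using clamp_has_vector_derivative_iff[OF that] by simp
    have neg: "negligible {t\<in>{a<..<b}. \<not> u differentiable (at t)}"
      by (rule negligible_subset[OF N]) (use diff_iff in \<open>auto simp: N_def\<close>)
    have contU: "continuous_on A U" for A
      using lipschitz_on_continuous_on[OF U] continuous_on_subset by blast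
    \<comment> \<open>An antiderivative turns these means into difference quotients of W. The
      margins 1 and 2 leave room for shifts by \<open>h n\<close> \<le> 1 to the right of b and make
      all derivatives of W in use two-sided.\<close>
    obtain W where W: "\<And>x. x \<in> {a - 1..b + 2} \<Longrightarrow> (W has_vector_derivative U x) (at x within {a - 1..b + 2})"
      using antiderivative_continuous[of "a - 1" "b + 2" U] contU by blast
    have W': "(W has_vector_derivative U x) (at x)" if "x \<in> {a - 1<..<b + 2}" for x
      using W[of x] that at_within_interior[of x "{a - 1..b + 2}"] by auto
    define h where "h n = inverse (real (Suc n))" for n
    have h: "0 < h n" "h n \<le> 1" for n
      unfolding h_def by (auto simp: inverse_le_1_iff)
    have h_lim: "filterlim h (at 0) sequentially"
      unfolding filterlim_at using LIMSEQ_inverse_real_of_nat by (auto simp: h_def[abs_def])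
    define q where "q n t = (U (t + h n) - U t) / h n" for n t
    have q_int: "(q n has_integral ((W (b + h n) - W b) / h n - (W (a + h n) - W a) / h n)) {a..b}" for n
    proof -
      have "((\<lambda>t. (W (t + h n) - W t) / h n) has_vector_derivative q n t) (at t within {a..b})"
        if t: "t \<in> {a..b}" for t
      proof -
        have "(W has_vector_derivative U (t + h n)) (at (t + h n))" "(W has_vector_derivative U t) (at t)"
          using t h[of n] by (auto intro!: W')
        then have "(W has_real_derivative U (t + h n)) (at (t + h n))" "(W has_real_derivative U t) (at t)"
          by (simp_all add: has_real_derivative_iff_has_vector_derivative)
        then have "((\<lambda>t. (W (t + h n) - W t) / h n) has_real_derivative q n t) (at t)"
          unfolding q_def by (intro DERIV_cdivide DERIV_diff) (auto simp: DERIV_shift)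
        then show ?thesis
          by (simp add: has_real_derivative_iff_has_vector_derivative has_vector_derivative_at_within)
      qed
      from fundamental_theorem_of_calculus[OF that this] show ?thesis
        by (simp add: diff_divide_distrib)
    qed
    have lim: "(\<lambda>n. (W (c + h n) - W c) / h n) \<longlonglongrightarrow> U c" if "c \<in> {a..b}" for c
    proof -
      have "(W has_real_derivative U c) (at c)"
        using that by (auto intro!: W' simp: has_real_derivative_iff_has_vector_derivative)
      then have *: "((\<lambda>s. (W (c + s) - W c) / s) \<longlongrightarrow> U c) (at 0)" by (simp add: DERIV_def)
      from filterlim_compose[OF * h_lim] show ?thesis .
    qed
    \<comment> \<open>The dominated convergence theorem applied below asks for convergence at every
      point, so the quotients and their limit are set to 0 on the exceptional set.\<close>
    define g where "g t = (if t \<in> N then 0 else vector_derivative U (at t))" for t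
    define r where "r n t = (if t \<in> N then 0 else q n t)" for n t
    have r_int: "(r n has_integral ((W (b + h n) - W b) / h n - (W (a + h n) - W a) / h n)) {a..b}" for n
      by (rule has_integral_spike[OF N _ q_int]) (auto simp: r_def)
    have r_bd: "norm (r n t) \<le> L" for n t
      using lipschitz_onD[OF U, of "t + h n" t] h[of n] L0
      by (auto simp: r_def q_def dist_real_def divide_simps)
    have r_lim: "(\<lambda>n. r n t) \<longlonglongrightarrow> g t" for t
    proof (cases "t \<in> N")
      case False
      then obtain d where d: "(U has_real_derivative d) (at t)"
        by (auto simp: N_def real_differentiable_def)
      then have vd: "vector_derivative U (at t) = d"
        by (simp add: has_real_derivative_iff_has_vector_derivative vector_derivative_at)
      from d have *: "((\<lambda>s. (U (t + s) - U t) / s) \<longlongrightarrow> d) (at 0)" by (simp add: DERIV_def)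
      from filterlim_compose[OF * h_lim] show ?thesis
        using False vd by (simp add: r_def g_def q_def)
    qed (simp add: r_def g_def)
    have dc: "g integrable_on {a..b}" "(\<lambda>n. integral {a..b} (r n)) \<longlonglongrightarrow> integral {a..b} g"
      using dominated_convergence[of r "{a..b}" "\<lambda>_. L" g] r_int r_bd r_lim
      by (auto simp: has_integral_integrable)
    have "(\<lambda>n. integral {a..b} (r n)) \<longlonglongrightarrow> U b - U a"
      using tendsto_diff[OF lim[of b] lim[of a]] that r_int
      by (simp add: integral_unique[OF r_int])
    with dc(2) have ig: "integral {a..b} g = u b - u a"
      using LIMSEQ_unique that by (fastforce simp: U_def)
    have g_bd: "norm (g t) \<le> L" for t
      using tendsto_upperbound[OF tendsto_norm[OF r_lim[of t]]] r_bd by simp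
    have "g absolutely_integrable_on {a..b}"
      by (rule absolutely_integrable_integrable_bound[OF _ dc(1), of "\<lambda>_. L"]) (use g_bd in auto)
    then have g_ai: "g absolutely_integrable_on {a<..<b}"
      by (rule set_integrable_subset) auto
    have ai: "(\<lambda>t. vector_derivative u (at t)) absolutely_integrable_on {a<..<b}"
      by (rule absolutely_integrable_spike[OF g_ai N]) (auto simp: g_def vd_eq)
    moreover have "integral {a<..<b} (\<lambda>t. vector_derivative u (at t)) = integral {a<..<b} g"
      by (rule integral_spike[OF N]) (auto simp: g_def vd_eq)
    ultimately show ?thesis
      using neg ig by (simp add: set_lebesgue_integral_eq_integral integral_open_interval_real)
  qed
  note main = this
  show "negligible {t\<in>{a<..<b}. \<not> u differentiable (at t)}"
    using main by (cases "a \<le> b") auto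
  show "set_integrable lebesgue {a<..<b} (\<lambda>t. vector_derivative u (at t))"
    using main by (cases "a \<le> b") (simp_all add: set_integrable_def)
  show "a \<le> b \<Longrightarrow> (LINT t:{a<..<b}|lebesgue. vector_derivative u (at t)) = u b - u a"
    using main by simp
qed

section \<open>Integration by parts and weak convergence of derivatives\<close>

lemma lipschitz_on_mult_bounded:
  fixes f g :: "'a::metric_space \<Rightarrow> real"
  assumes "K-lipschitz_on X f" "L-lipschitz_on X g"
    and "\<And>x. x \<in> X \<Longrightarrow> \<bar>f x\<bar> \<le> A" "\<And>x. x \<in> X \<Longrightarrow> \<bar>g x\<bar> \<le> B" and "0 \<le> A" "0 \<le> B"
  shows "(A * L + B * K)-lipschitz_on X (\<lambda>x. f x * g x)"
proof (rule lipschitz_onI)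
  have KL: "0 \<le> K" "0 \<le> L" using assms lipschitz_on_nonneg by auto
  show "0 \<le> A * L + B * K" using assms KL by auto
  fix x y assume xy: "x \<in> X" "y \<in> X"
  have "\<bar>f x * g x - f y * g y\<bar> = \<bar>f x * (g x - g y) + g y * (f x - f y)\<bar>"
    by (simp add: algebra_simps)
  also have "\<dots> \<le> \<bar>f x\<bar> * \<bar>g x - g y\<bar> + \<bar>g y\<bar> * \<bar>f x - f y\<bar>"
    by (metis abs_mult abs_triangle_ineq)
  also have "\<dots> \<le> A * (L * dist x y) + B * (K * dist x y)"
    using lipschitz_onD[OF assms(1) xy] lipschitz_onD[OF assms(2) xy] assms(3-6) xy KL
    by (intro add_mono mult_mono) (auto simp: dist_real_def)
  finally show "dist (f x * g x) (f y * g y) \<le> (A * L + B * K) * dist x y"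
    by (simp add: dist_real_def algebra_simps)
qed

lemma lipschitz_interval_bounded:
  fixes f :: "real \<Rightarrow> real"
  assumes "K-lipschitz_on {a..b} f"
  obtains B where "0 \<le> B" "\<And>x. x \<in> {a..b} \<Longrightarrow> \<bar>f x\<bar> \<le> B"
proof
  have K: "0 \<le> K" using assms lipschitz_on_nonneg by blast
  show "0 \<le> \<bar>f a\<bar> + K * \<bar>b - a\<bar>" using K by auto
  fix x assume x: "x \<in> {a..b}"
  then have "\<bar>f x - f a\<bar> \<le> K * \<bar>x - a\<bar>"
    using lipschitz_onD[OF assms, of x a] by (auto simp: dist_real_def)
  also have "\<dots> \<le> K * \<bar>b - a\<bar>" using x K by (intro mult_left_mono) auto
  finally show "\<bar>f x\<bar> \<le> \<bar>f a\<bar> + K * \<bar>b - a\<bar>" by linarith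
qed

lemma lipschitz_interval_measurable:
  fixes h :: "real \<Rightarrow> real"
  assumes "M-lipschitz_on {a..b} h"
  shows "set_borel_measurable lebesgue {a<..<b} h"
proof -
  have "continuous_on {a<..<b} h"
    using assms by (intro lipschitz_on_continuous_on[OF lipschitz_on_subset]) auto
  then have "(\<lambda>t. indicator {a<..<b} t *\<^sub>R h t) \<in> borel_measurable borel"
    by (intro borel_measurable_continuous_on_indicator) auto
  then show ?thesis
    unfolding set_borel_measurable_def by (intro measurable_completion) simp
qed

lemma lipschitz_interval_derivative_AE:
  fixes u :: "real \<Rightarrow> real"
  assumes "L-lipschitz_on {a..b} u"
  shows "AE t in lebesgue. t \<in> {a<..<b} \<longrightarrow>
    (u has_vector_derivative vector_derivative u (at t)) (at t) \<and> \<bar>vector_derivative u (at t)\<bar> \<le> L"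
proof -
  have "{t\<in>{a<..<b}. \<not> u differentiable (at t)} \<in> null_sets lebesgue"
    using lipschitz_interval_differentiable_ae[OF assms] by (simp add: negligible_iff_null_sets)
  then have "AE t in lebesgue. t \<notin> {t\<in>{a<..<b}. \<not> u differentiable (at t)}"
    by (rule AE_not_in)
  then show ?thesis
  proof (rule AE_mp, intro AE_I2 impI)
    fix t assume t: "t \<notin> {t\<in>{a<..<b}. \<not> u differentiable (at t)}" "t \<in> {a<..<b}"
    then have d: "(u has_vector_derivative vector_derivative u (at t)) (at t)"
      by (simp add: vector_derivative_works)
    moreover have "\<bar>vector_derivative u (at t)\<bar> \<le> L"
    proof (rule lipschitz_vector_derivative_bound)
      show "L-lipschitz_on {a<..<b} u"
        using assms by (rule lipschitz_on_subset) auto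
      show "(u has_vector_derivative vector_derivative u (at t)) (at t within {a<..<b})"
        using d by (rule has_vector_derivative_at_within)
      show "t \<in> {a<..<b}" by fact
      show "at t within {a<..<b} \<noteq> bot"
        using t by (simp add: at_within_open[of t "{a<..<b}"])
    qed
    ultimately show "(u has_vector_derivative vector_derivative u (at t)) (at t) \<and> \<bar>vector_derivative u (at t)\<bar> \<le> L" ..
  qed
qed

lemma lipschitz_derivative_mult_integrable:
  fixes u g :: "real \<Rightarrow> real"
  assumes "L-lipschitz_on {a..b} u" and g: "set_borel_measurable lebesgue {a<..<b} g"
    and B: "\<And>t. t \<in> {a<..<b} \<Longrightarrow> \<bar>g t\<bar> \<le> B"
  shows "set_integrable lebesgue {a<..<b} (\<lambda>t. g t * vector_derivative u (at t))"
proof -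
  have i: "integrable lebesgue (\<lambda>t. B * (indicator {a<..<b} t * vector_derivative u (at t)))"
    using lipschitz_interval_derivative_integrable[OF assms(1)] by (simp add: set_integrable_def)
  have "(\<lambda>t. (indicator {a<..<b} t * g t) * (indicator {a<..<b} t * vector_derivative u (at t))) \<in> borel_measurable lebesgue"
    using borel_measurable_times[of "\<lambda>t. indicator {a<..<b} t * g t" lebesgue "\<lambda>t. indicator {a<..<b} t * vector_derivative u (at t)"]
      g lipschitz_interval_derivative_integrable[OF assms(1)]
    by (simp add: set_integrable_def set_borel_measurable_def borel_measurable_integrable)
  moreover have "(\<lambda>t. (indicator {a<..<b} t * g t) * (indicator {a<..<b} t * vector_derivative u (at t))) =
    (\<lambda>t. indicator {a<..<b} t * (g t * vector_derivative u (at t)))"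
    by (auto simp: fun_eq_iff indicator_def)
  ultimately show ?thesis
    unfolding set_integrable_def
    by (intro Bochner_Integration.integrable_bound[OF i])
      (auto simp: abs_mult indicator_def intro!: AE_I2 mult_right_mono order_trans[OF B])
qed

lemma lipschitz_derivative_mult_bound:
  fixes u g :: "real \<Rightarrow> real"
  assumes u: "L-lipschitz_on {a..b} u" and "a \<le> b" and g: "set_borel_measurable lebesgue {a<..<b} g"
    and B: "\<And>t. t \<in> {a<..<b} \<Longrightarrow> \<bar>g t\<bar> \<le> B"
  shows "\<bar>LINT t:{a<..<b}|lebesgue. g t * vector_derivative u (at t)\<bar> \<le> B * L * (b - a)"
proof -
  have L: "0 \<le> L" using u lipschitz_on_nonneg by blast
  have "\<bar>LINT t:{a<..<b}|lebesgue. g t * vector_derivative u (at t)\<bar>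
     \<le> (LINT t|lebesgue. \<bar>indicator {a<..<b} t *\<^sub>R (g t * vector_derivative u (at t))\<bar>)"
    unfolding set_lebesgue_integral_def by (rule integral_abs_bound)
  also have "\<dots> \<le> (LINT t|lebesgue. B * L * indicator {a<..<b} t)"
  proof (rule integral_mono_AE)
    show "integrable lebesgue (\<lambda>t. \<bar>indicator {a<..<b} t *\<^sub>R (g t * vector_derivative u (at t))\<bar>)"
      using lipschitz_derivative_mult_integrable[OF u g B] unfolding set_integrable_def by (rule integrable_abs)
    show "integrable lebesgue (\<lambda>t. B * L * indicator {a<..<b} t)"
      by (intro integrable_mult_right integrable_real_indicator) (use \<open>a \<le> b\<close> in auto)
    show "AE t in lebesgue. \<bar>indicator {a<..<b} t *\<^sub>R (g t * vector_derivative u (at t))\<bar> \<le> B * L * indicator {a<..<b} t"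
      using lipschitz_interval_derivative_AE[OF u]
    proof eventually_elim
      case (elim t)
      then show ?case using B[of t] L by (auto simp: indicator_def abs_mult intro!: mult_mono)
    qed
  qed
  also have "\<dots> = B * L * (b - a)" using \<open>a \<le> b\<close> by simp
  finally show ?thesis .
qed

text \<open>On a bounded interval the product of two Lipschitz functions is Lipschitz, so the
  fundamental theorem applies to it, and the product rule holds almost everywhere.\<close>

lemma lipschitz_IBP:
  fixes f p :: "real \<Rightarrow> real"
  assumes f: "K-lipschitz_on {a..b} f" and p: "L-lipschitz_on {a..b} p" and "a \<le> b"
  shows "(LINT t:{a<..<b}|lebesgue. f t * vector_derivative p (at t)) =
    f b * p b - f a * p a - (LINT t:{a<..<b}|lebesgue. p t * vector_derivative f (at t))"
proof -
  obtain A where A: "0 \<le> A" "\<And>x. x \<in> {a..b} \<Longrightarrow> \<bar>f x\<bar> \<le> A" using lipschitz_interval_bounded[OF f] by blast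
  obtain B where B: "0 \<le> B" "\<And>x. x \<in> {a..b} \<Longrightarrow> \<bar>p x\<bar> \<le> B" using lipschitz_interval_bounded[OF p] by blast
  have fp: "(A * L + B * K)-lipschitz_on {a..b} (\<lambda>x. f x * p x)"
    using lipschitz_on_mult_bounded[OF f p A(2) B(2) A(1) B(1)] .
  note meas = lipschitz_interval_measurable
  have i1: "set_integrable lebesgue {a<..<b} (\<lambda>t. f t * vector_derivative p (at t))"
    using A by (intro lipschitz_derivative_mult_integrable[OF p meas[OF f], of A]) auto
  have i2: "set_integrable lebesgue {a<..<b} (\<lambda>t. p t * vector_derivative f (at t))"
    using B by (intro lipschitz_derivative_mult_integrable[OF f meas[OF p], of B]) auto
  have "f b * p b - f a * p a = (LINT t:{a<..<b}|lebesgue. vector_derivative (\<lambda>x. f x * p x) (at t))"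
    using lipschitz_interval_FTC[OF fp \<open>a \<le> b\<close>] by simp
  also have "\<dots> = (LINT t:{a<..<b}|lebesgue. f t * vector_derivative p (at t) + p t * vector_derivative f (at t))"
    unfolding set_lebesgue_integral_def
  proof (rule integral_cong_AE)
    show "(\<lambda>t. indicator {a<..<b} t *\<^sub>R vector_derivative (\<lambda>x. f x * p x) (at t)) \<in> borel_measurable lebesgue"
      using lipschitz_interval_derivative_integrable[OF fp] by (simp add: set_integrable_def)
    show "(\<lambda>t. indicator {a<..<b} t *\<^sub>R (f t * vector_derivative p (at t) + p t * vector_derivative f (at t))) \<in> borel_measurable lebesgue"
      using set_integral_add(1)[OF i1 i2] by (simp add: set_integrable_def)
    show "AE t in lebesgue. indicator {a<..<b} t *\<^sub>R vector_derivative (\<lambda>x. f x * p x) (at t) =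
      indicator {a<..<b} t *\<^sub>R (f t * vector_derivative p (at t) + p t * vector_derivative f (at t))"
      using lipschitz_interval_derivative_AE[OF f] lipschitz_interval_derivative_AE[OF p]
    proof eventually_elim
      case (elim t)
      show ?case
      proof (cases "t \<in> {a<..<b}")
        case True
        with elim have "((\<lambda>x. f x * p x) has_vector_derivative (f t * vector_derivative p (at t) + vector_derivative f (at t) * p t)) (at t)"
          by (intro has_vector_derivative_mult) auto
        from vector_derivative_at[OF this] True show ?thesis by (simp add: mult.commute)
      qed auto
    qed
  qed
  also have "\<dots> = (LINT t:{a<..<b}|lebesgue. f t * vector_derivative p (at t)) + (LINT t:{a<..<b}|lebesgue. p t * vector_derivative f (at t))"
    using set_integral_add(2)[OF i1 i2] .
  finally show ?thesis by simp
qed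

text \<open>The derivatives of the \<open>P n\<close> need not converge pointwise. Integration by
  parts moves the derivative to the fixed function f, and then the uniformly bounded
  \<open>P n\<close> themselves converge. On a single edge this is the continuity axiom of
  currents.\<close>

lemma lipschitz_derivative_weak_limit:
  fixes f p :: "real \<Rightarrow> real" and P :: "nat \<Rightarrow> real \<Rightarrow> real"
  assumes f: "K-lipschitz_on {a..b} f" and P: "\<And>n. L-lipschitz_on {a..b} (P n)" and p: "L-lipschitz_on {a..b} p"
    and "a \<le> b" and lim: "\<And>t. t \<in> {a..b} \<Longrightarrow> (\<lambda>n. P n t) \<longlonglongrightarrow> p t"
  shows "(\<lambda>n. LINT t:{a<..<b}|lebesgue. f t * vector_derivative (P n) (at t)) \<longlonglongrightarrow>
    (LINT t:{a<..<b}|lebesgue. f t * vector_derivative p (at t))"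
proof -
  have L: "0 \<le> L" using p lipschitz_on_nonneg by blast
  \<comment> \<open>Convergence bounds the values at a, and the common Lipschitz constant spreads
    the bound over the interval.\<close>
  have "Bseq (\<lambda>n. P n a)" using lim[of a] \<open>a \<le> b\<close> by (intro convergent_imp_Bseq convergentI) auto
  then obtain C where C: "\<And>n. \<bar>P n a\<bar> \<le> C" unfolding Bseq_def by auto
  have Pb: "\<bar>P n t\<bar> \<le> C + L * (b - a)" if "t \<in> {a..b}" for n t
  proof -
    have "\<bar>P n t - P n a\<bar> \<le> L * \<bar>t - a\<bar>"
      using lipschitz_onD[OF P, of t a n] that by (auto simp: dist_real_def)
    also have "\<dots> \<le> L * (b - a)" using that L by (intro mult_left_mono) auto
    finally show ?thesis using C[of n] by linarith
  qed
  note meas = lipschitz_interval_measurable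
  have mf: "set_borel_measurable lebesgue {a<..<b} (\<lambda>t. h t * vector_derivative f (at t))" if h: "M-lipschitz_on {a..b} h" for h M
  proof -
    obtain B where B: "0 \<le> B" "\<And>x. x \<in> {a..b} \<Longrightarrow> \<bar>h x\<bar> \<le> B" using lipschitz_interval_bounded[OF h] by blast
    then have "set_integrable lebesgue {a<..<b} (\<lambda>t. h t * vector_derivative f (at t))"
      by (intro lipschitz_derivative_mult_integrable[OF f meas[OF h], of B]) auto
    then show ?thesis by (simp add: set_integrable_def set_borel_measurable_def)
  qed
  have "(\<lambda>n. LINT t:{a<..<b}|lebesgue. P n t * vector_derivative f (at t)) \<longlonglongrightarrow>
    (LINT t:{a<..<b}|lebesgue. p t * vector_derivative f (at t))"
    unfolding set_lebesgue_integral_def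
  proof (rule integral_dominated_convergence)
    show "integrable lebesgue (\<lambda>t. (C + L * (b - a)) * \<bar>indicator {a<..<b} t * vector_derivative f (at t)\<bar>)"
      using lipschitz_interval_derivative_integrable[OF f] by (simp add: set_integrable_def)
    show "(\<lambda>t. indicator {a<..<b} t *\<^sub>R (p t * vector_derivative f (at t))) \<in> borel_measurable lebesgue"
      "\<And>n. (\<lambda>t. indicator {a<..<b} t *\<^sub>R (P n t * vector_derivative f (at t))) \<in> borel_measurable lebesgue"
      using mf[OF p] mf[OF P] by (simp_all add: set_borel_measurable_def)
    show "AE t in lebesgue. (\<lambda>n. indicator {a<..<b} t *\<^sub>R (P n t * vector_derivative f (at t))) \<longlonglongrightarrow> indicator {a<..<b} t *\<^sub>R (p t * vector_derivative f (at t))"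
      using lim by (intro AE_I2) (auto simp: indicator_def intro!: tendsto_intros)
    show "AE t in lebesgue. norm (indicator {a<..<b} t *\<^sub>R (P n t * vector_derivative f (at t))) \<le> (C + L * (b - a)) * \<bar>indicator {a<..<b} t * vector_derivative f (at t)\<bar>" for n
      using Pb by (intro AE_I2) (auto simp: indicator_def abs_mult intro!: mult_right_mono)
  qed
  then have "(\<lambda>n. f b * P n b - f a * P n a - (LINT t:{a<..<b}|lebesgue. P n t * vector_derivative f (at t))) \<longlonglongrightarrow>
    f b * p b - f a * p a - (LINT t:{a<..<b}|lebesgue. p t * vector_derivative f (at t))"
    using lim \<open>a \<le> b\<close> by (intro tendsto_intros) auto
  then show ?thesis
    using lipschitz_IBP[OF f P \<open>a \<le> b\<close>] lipschitz_IBP[OF f p \<open>a \<le> b\<close>] by simp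
qed

section \<open>Push-forward along Lipschitz functions of one variable\<close>

lemma open_bounded_disjoint_intervals:
  fixes V :: "real set"
  assumes "open V" "V \<subseteq> {a<..<b}"
  obtains l r :: "nat \<Rightarrow> real" where "\<And>n. l n \<le> r n" "\<And>n. l n < r n \<Longrightarrow> {l n..r n} \<subseteq> {a..b}"
    "disjoint_family (\<lambda>n. {l n<..<r n})" "V = (\<Union>n. {l n<..<r n})"
proof -
  have comp: "C = {Inf C<..<Sup C} \<and> Inf C < Sup C \<and> {Inf C..Sup C} \<subseteq> {a..b}" if C: "C \<in> components V" for C
  proof -
    have op: "open C" using open_components[OF assms(1) C] .
    have cn: "connected C" and ne: "C \<noteq> {}" using C by (auto simp: in_components_connected in_components_nonempty)
    have sub: "C \<subseteq> {a<..<b}" using C assms(2) in_components_subset by blast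
    have bd: "bdd_below C" "bdd_above C" using sub by (auto intro!: bdd_belowI[of _ a] bdd_aboveI[of _ b])
    have bds: "a \<le> Inf C" "Sup C \<le> b"
    proof -
      show "a \<le> Inf C" by (rule cInf_greatest[OF ne]) (use sub in force)
      show "Sup C \<le> b" by (rule cSup_least[OF ne]) (use sub in force)
    qed
    have "C \<subseteq> {Inf C<..<Sup C}"
    proof
      fix x assume "x \<in> C"
      then obtain e where e: "e > 0" "ball x e \<subseteq> C" using op open_contains_ball by blast
      then have "x - e / 2 \<in> C" "x + e / 2 \<in> C" by (auto intro!: subsetD[OF e(2)] simp: dist_real_def)
      then have "Inf C \<le> x - e / 2" "x + e / 2 \<le> Sup C" using bd by (auto intro: cInf_lower cSup_upper)
      with e show "x \<in> {Inf C<..<Sup C}" by auto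
    qed
    moreover have "{Inf C<..<Sup C} \<subseteq> C"
    proof
      fix x assume x: "x \<in> {Inf C<..<Sup C}"
      then obtain y where y: "y \<in> C" "y < x" using cInf_lessD[OF ne, of x] by auto
      obtain z where z: "z \<in> C" "x < z" using less_cSupD[OF ne, of x] x by auto
      show "x \<in> C" using connectedD_interval[OF cn y(1) z(1), of x] y z by auto
    qed
    ultimately have eq: "C = {Inf C<..<Sup C}" by auto
    moreover have "Inf C < Sup C" using eq ne by (metis greaterThanLessThan_empty_iff not_le)
    moreover have "{Inf C..Sup C} \<subseteq> {a..b}" using bds by auto
    ultimately show ?thesis by blast
  qed
  have "countable (components V)"
  proof (rule countable_disjoint_open_subsets)
    show "pairwise disjnt (components V)"
      using pairwise_disjoint_components[of V] by (auto simp: pairwise_def disjnt_def)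
  qed (use open_components[OF assms(1)] in auto)
  then obtain k :: "real set \<Rightarrow> nat" where k: "inj_on k (components V)" by (rule countableE)
  define c where "c n = (if n \<in> k ` components V then inv_into (components V) k n else {})" for n
  define l where "l n = (if n \<in> k ` components V then Inf (c n) else 0)" for n
  define r where "r n = (if n \<in> k ` components V then Sup (c n) else 0)" for n
  have cin: "c n \<in> components V" if "n \<in> k ` components V" for n
    using that by (simp add: c_def inv_into_into)
  have ck: "c (k C) = C" if "C \<in> components V" for C
    using that k by (simp add: c_def)
  have ceq: "{l n<..<r n} = c n" for n
    using comp[OF cin, of n] by (cases "n \<in> k ` components V") (auto simp: l_def r_def c_def)
  have dj: "c m \<inter> c n = {}" if "m \<noteq> n" for m n
  proof (cases "m \<in> k ` components V \<and> n \<in> k ` components V")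
    case True
    then have "c m \<noteq> c n" using that by (metis ck imageE)
    then show ?thesis using True cin pairwise_disjoint_components[of V] by (auto simp: pairwise_def)
  qed (auto simp: c_def)
  show ?thesis
  proof (rule that[of l r])
    show "l n \<le> r n" for n
      using comp[OF cin, of n] by (cases "n \<in> k ` components V") (auto simp: l_def r_def)
    show "{l n..r n} \<subseteq> {a..b}" if "l n < r n" for n
      using comp[OF cin, of n] that by (cases "n \<in> k ` components V") (auto simp: l_def r_def)
    show "disjoint_family (\<lambda>n. {l n<..<r n})"
      unfolding ceq disjoint_family_on_def using dj by blast
    show "V = (\<Union>n. {l n<..<r n})"
    proof
      show "V \<subseteq> (\<Union>n. {l n<..<r n})"
        unfolding ceq using ck Union_components[of V] by blast
      show "(\<Union>n. {l n<..<r n}) \<subseteq> V"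
      proof
        fix x assume "x \<in> (\<Union>n. {l n<..<r n})"
        then obtain n where n: "x \<in> c n" unfolding ceq by auto
        then have "n \<in> k ` components V" by (auto simp: c_def split: if_splits)
        from cin[OF this] n show "x \<in> V" using Union_components[of V] by blast
      qed
    qed
  qed
qed

text \<open>The oriented interval from y to y' as an integer density: what remains of a path from y
  to y' on the line after cancellation, however often it turns back.\<close>

definition signed_interval :: "real \<Rightarrow> real \<Rightarrow> real \<Rightarrow> int" where
  "signed_interval y y' z = (if y < z \<and> z < y' then 1 else if y' < z \<and> z < y then -1 else 0)"

lemma signed_interval_measurable [measurable]:
  "(\<lambda>z. real_of_int (signed_interval y y' z)) \<in> borel_measurable borel"
  unfolding signed_interval_def by measurable

lemma has_bochner_integral_signed_interval:
  assumes "integrable lebesgue (\<lambda>z. indicator {min y y'<..<max y y'} z *\<^sub>R w z)"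
  shows "integrable lebesgue (\<lambda>z. real_of_int (signed_interval y y' z) * w z)"
    "(LINT z|lebesgue. real_of_int (signed_interval y y' z) * w z) = sgn (y' - y) * (LINT z:{min y y'<..<max y y'}|lebesgue. w z)"
proof -
  have eq: "real_of_int (signed_interval y y' z) * w z = sgn (y' - y) * (indicator {min y y'<..<max y y'} z *\<^sub>R w z)" for z
    by (auto simp: signed_interval_def indicator_def min_def max_def)
  show "integrable lebesgue (\<lambda>z. real_of_int (signed_interval y y' z) * w z)"
    unfolding eq using assms by simp
  show "(LINT z|lebesgue. real_of_int (signed_interval y y' z) * w z) = sgn (y' - y) * (LINT z:{min y y'<..<max y y'}|lebesgue. w z)"
    unfolding eq set_lebesgue_integral_def by simp
qed

context
  fixes f p :: "real \<Rightarrow> real" and K M B :: real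
  assumes f: "K-lipschitz_on UNIV f" and p: "M-lipschitz_on UNIV p" and B: "\<And>x. \<bar>f x\<bar> \<le> B"
begin

lemma lipschitz_pair_interval_integrable: "integrable lebesgue (\<lambda>z. indicator {a<..<b} z *\<^sub>R (f z * vector_derivative p (at z)))"
  using lipschitz_derivative_mult_integrable[of M a b p f B] B lipschitz_on_subset[OF p] lipschitz_interval_measurable[of K a b f]
    lipschitz_on_subset[OF f]
  by (simp add: set_integrable_def)

lemma signed_interval_integral_bound:
  "\<bar>LINT z|lebesgue. real_of_int (signed_interval y y' z) * (f z * vector_derivative p (at z))\<bar> \<le> B * M * \<bar>y' - y\<bar>"
proof -
  have "\<bar>LINT z:{min y y'<..<max y y'}|lebesgue. f z * vector_derivative p (at z)\<bar> \<le> B * M * (max y y' - min y y')"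
    using lipschitz_derivative_mult_bound[of M "min y y'" "max y y'" p f B] B lipschitz_on_subset[OF p]
      lipschitz_interval_measurable[of K "min y y'" "max y y'" f] lipschitz_on_subset[OF f]
    by simp
  moreover have "max y y' - min y y' = \<bar>y' - y\<bar>" by auto
  ultimately show ?thesis
    unfolding has_bochner_integral_signed_interval(2)[OF lipschitz_pair_interval_integrable]
    by (auto simp: abs_mult sgn_if)
qed

text \<open>Oriented intervals add up off their three end points. This makes the integral with base
  point \<open>y0\<close> a primitive of f dp.\<close>

lemma signed_interval_integral_diff:
  "(LINT z|lebesgue. real_of_int (signed_interval y0 y' z) * (f z * vector_derivative p (at z))) -
   (LINT z|lebesgue. real_of_int (signed_interval y0 y z) * (f z * vector_derivative p (at z))) =
   (LINT z|lebesgue. real_of_int (signed_interval y y' z) * (f z * vector_derivative p (at z)))"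
proof -
  have i: "integrable lebesgue (\<lambda>z. real_of_int (signed_interval y y' z) * (f z * vector_derivative p (at z)))" for y y'
    by (rule has_bochner_integral_signed_interval(1)[OF lipschitz_pair_interval_integrable])
  have "negligible {y0, y, y'}" by simp
  then have "AE z in lebesgue. z \<notin> {y0, y, y'}"
    by (intro AE_not_in) (simp add: negligible_iff_null_sets)
  then have "AE z in lebesgue. real_of_int (signed_interval y0 y' z) * (f z * vector_derivative p (at z)) -
     real_of_int (signed_interval y0 y z) * (f z * vector_derivative p (at z)) =
     real_of_int (signed_interval y y' z) * (f z * vector_derivative p (at z))"
    by eventually_elim (auto simp: signed_interval_def)
  then have "(LINT z|lebesgue. real_of_int (signed_interval y0 y' z) * (f z * vector_derivative p (at z)) -
     real_of_int (signed_interval y0 y z) * (f z * vector_derivative p (at z))) =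
     (LINT z|lebesgue. real_of_int (signed_interval y y' z) * (f z * vector_derivative p (at z)))"
    using i by (intro integral_cong_AE borel_measurable_diff borel_measurable_integrable) auto
  then show ?thesis using i by simp
qed

text \<open>Freezing f at y changes it by at most \<open>K * \<bar>y' - y\<bar>\<close> on an
  interval of length \<open>\<bar>y' - y\<bar>\<close>. The error is quadratic and disappears when a
  derivative is taken.\<close>

lemma signed_interval_integral_approx:
  "\<bar>(LINT z|lebesgue. real_of_int (signed_interval y y' z) * (f z * vector_derivative p (at z))) - f y * (p y' - p y)\<bar>
    \<le> K * M * \<bar>y' - y\<bar>\<^sup>2"
proof -
  let ?I = "{min y y'<..<max y y'}"
  have pI: "M-lipschitz_on {min y y'..max y y'} p" using p by (rule lipschitz_on_subset) auto
  have K: "0 \<le> K" using f lipschitz_on_nonneg by blast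
  have fy: "K-lipschitz_on UNIV (\<lambda>z. f z - f y)"
    using lipschitz_on_diff[OF f lipschitz_on_constant[of UNIV "f y"]] by simp
  have ft: "(LINT z:?I|lebesgue. vector_derivative p (at z)) = p (max y y') - p (min y y')"
    by (rule lipschitz_interval_FTC[OF pI]) simp
  have bd: "\<bar>LINT z:?I|lebesgue. (f z - f y) * vector_derivative p (at z)\<bar> \<le> (K * \<bar>y' - y\<bar>) * M * (max y y' - min y y')"
  proof (rule lipschitz_derivative_mult_bound[OF pI])
    show "set_borel_measurable lebesgue ?I (\<lambda>z. f z - f y)"
      by (rule lipschitz_interval_measurable[OF lipschitz_on_subset[OF fy]]) simp
    fix t assume "t \<in> ?I"
    then have "\<bar>t - y\<bar> \<le> \<bar>y' - y\<bar>" by (auto simp: min_def max_def split: if_splits)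
    then have "K * \<bar>t - y\<bar> \<le> K * \<bar>y' - y\<bar>" using K by (rule mult_left_mono)
    moreover have "\<bar>f t - f y\<bar> \<le> K * \<bar>t - y\<bar>" using lipschitz_onD[OF f, of t y] by (simp add: dist_real_def)
    ultimately show "\<bar>f t - f y\<bar> \<le> K * \<bar>y' - y\<bar>" by simp
  qed simp
  have i1: "set_integrable lebesgue ?I (\<lambda>z. f z * vector_derivative p (at z))"
    using lipschitz_pair_interval_integrable by (simp add: set_integrable_def)
  have i2: "set_integrable lebesgue ?I (\<lambda>z. f y * vector_derivative p (at z))"
    using lipschitz_interval_derivative_integrable[OF pI] by simp
  have "(LINT z:?I|lebesgue. (f z - f y) * vector_derivative p (at z)) =
    (LINT z:?I|lebesgue. f z * vector_derivative p (at z)) - f y * (p (max y y') - p (min y y'))"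
    using set_integral_diff(2)[OF i1 i2] ft by (simp add: left_diff_distrib)
  moreover have "max y y' - min y y' = \<bar>y' - y\<bar>" by auto
  ultimately have "\<bar>(LINT z:?I|lebesgue. f z * vector_derivative p (at z)) - f y * (p (max y y') - p (min y y'))\<bar> \<le> K * M * \<bar>y' - y\<bar>\<^sup>2"
    using bd by (simp add: power2_eq_square mult_ac)
  moreover have "(LINT z|lebesgue. real_of_int (signed_interval y y' z) * (f z * vector_derivative p (at z))) - f y * (p y' - p y)
     = sgn (y' - y) * ((LINT z:?I|lebesgue. f z * vector_derivative p (at z)) - f y * (p (max y y') - p (min y y')))"
    unfolding has_bochner_integral_signed_interval(2)[OF lipschitz_pair_interval_integrable]
    by (auto simp: sgn_if algebra_simps max_def min_def)
  ultimately show ?thesis by (auto simp: abs_mult sgn_if)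
qed

text \<open>Let H be the primitive of f dp that vanishes at u a. Wherever p \<circ> u has a
  derivative d, the quadratic estimate gives H \<circ> u the derivative f (u t) d, and the
  fundamental theorem does the rest. This bypasses the chain rule, which could fail on a set of t of
  positive measure, since p may have no derivative at u t.\<close>

lemma pushforward_interval:
  fixes u :: "real \<Rightarrow> real"
  assumes u: "L-lipschitz_on {a..b} u" and "a \<le> b"
  shows "(LINT t:{a<..<b}|lebesgue. f (u t) * vector_derivative (\<lambda>s. p (u s)) (at t)) =
    (LINT y|lebesgue. real_of_int (signed_interval (u a) (u b) y) * (f y * vector_derivative p (at y)))"
proof -
  define H where "H y = (LINT z|lebesgue. real_of_int (signed_interval (u a) y z) * (f z * vector_derivative p (at z)))" for y
  have nonneg: "0 \<le> L" "0 \<le> M" "0 \<le> K" "0 \<le> B"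
    using u p f lipschitz_on_nonneg B[of 0] by (auto intro: order_trans[OF abs_ge_zero])
  have H0: "H (u a) = 0" using signed_interval_integral_bound[of "u a" "u a"] unfolding H_def by simp
  have Hlip: "(B * M)-lipschitz_on UNIV H"
  proof (rule lipschitz_onI)
    show "dist (H x) (H y) \<le> B * M * dist x y" for x y
      using signed_interval_integral_bound[of y x] by (simp add: H_def signed_interval_integral_diff dist_real_def)
  qed (use nonneg in simp)
  have Hu: "(B * M * L)-lipschitz_on {a..b} (\<lambda>t. H (u t))"
    using lipschitz_on_compose2[OF u lipschitz_on_subset[OF Hlip]] by simp
  have pu: "(M * L)-lipschitz_on {a..b} (\<lambda>t. p (u t))"
    using lipschitz_on_compose2[OF u lipschitz_on_subset[OF p]] by simp
  have der: "((\<lambda>t. H (u t)) has_vector_derivative f (u t) * d) (at t)"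
    if t: "t \<in> {a<..<b}" and d: "((\<lambda>t. p (u t)) has_vector_derivative d) (at t)" for t d
  proof -
    have "((\<lambda>s. (p (u s) - p (u t)) / (s - t)) \<longlongrightarrow> d) (at t)"
      using d by (simp add: has_real_derivative_iff_has_vector_derivative[symmetric] has_field_derivative_iff)
    then have 1: "((\<lambda>s. f (u t) * ((p (u s) - p (u t)) / (s - t))) \<longlongrightarrow> f (u t) * d) (at t)"
      by (intro tendsto_intros)
    have ev: "\<forall>\<^sub>F s in at t. s \<in> {a<..<b} \<and> s \<noteq> t"
      using t by (intro eventually_conj eventually_at_in_open' eventually_neq_at_within) auto
    \<comment> \<open>As u is Lipschitz, the quadratic error is a multiple of \<bar>s - t\<bar>^2
      and leaves a multiple of \<bar>s - t\<bar> in the quotient.\<close>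
    have 2: "((\<lambda>s. (H (u s) - H (u t)) / (s - t) - f (u t) * ((p (u s) - p (u t)) / (s - t))) \<longlongrightarrow> 0) (at t)"
    proof (rule Lim_null_comparison)
      show "\<forall>\<^sub>F s in at t. norm ((H (u s) - H (u t)) / (s - t) - f (u t) * ((p (u s) - p (u t)) / (s - t))) \<le> K * M * L\<^sup>2 * \<bar>s - t\<bar>"
        using ev
      proof eventually_elim
        case (elim s)
        have "\<bar>u s - u t\<bar> \<le> L * \<bar>s - t\<bar>"
          using lipschitz_onD[OF u, of s t] elim t by (simp add: dist_real_def)
        then have "\<bar>u s - u t\<bar>\<^sup>2 \<le> (L * \<bar>s - t\<bar>)\<^sup>2" by (intro power_mono) auto
        then have "K * M * \<bar>u s - u t\<bar>\<^sup>2 \<le> K * M * (L * \<bar>s - t\<bar>)\<^sup>2" using nonneg by (intro mult_left_mono) auto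
        then have "\<bar>H (u s) - H (u t) - f (u t) * (p (u s) - p (u t))\<bar> \<le> K * M * (L * \<bar>s - t\<bar>)\<^sup>2"
          using signed_interval_integral_approx[of "u t" "u s"] by (simp add: H_def signed_interval_integral_diff)
        moreover have "(H (u s) - H (u t)) / (s - t) - f (u t) * ((p (u s) - p (u t)) / (s - t)) =
          (H (u s) - H (u t) - f (u t) * (p (u s) - p (u t))) / (s - t)"
          by (simp add: diff_divide_distrib right_diff_distrib)
        ultimately show ?case
          using elim by (simp add: abs_divide divide_simps power2_eq_square mult_ac)
      qed
      have "((\<lambda>s. K * M * L\<^sup>2 * \<bar>s - t\<bar>) \<longlongrightarrow> K * M * L\<^sup>2 * \<bar>t - t\<bar>) (at t)"
        by (intro tendsto_intros)
      then show "((\<lambda>s. K * M * L\<^sup>2 * \<bar>s - t\<bar>) \<longlongrightarrow> 0) (at t)" by simp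
    qed
    from tendsto_add[OF 1 2] show ?thesis
      by (simp add: has_real_derivative_iff_has_vector_derivative[symmetric] has_field_derivative_iff)
  qed
  have fu: "(K * L)-lipschitz_on {a..b} (\<lambda>t. f (u t))"
    using lipschitz_on_compose2[OF u lipschitz_on_subset[OF f]] by simp
  have "(LINT t:{a<..<b}|lebesgue. f (u t) * vector_derivative (\<lambda>s. p (u s)) (at t)) =
    (LINT t:{a<..<b}|lebesgue. vector_derivative (\<lambda>s. H (u s)) (at t))"
    unfolding set_lebesgue_integral_def
  proof (rule integral_cong_AE)
    have "set_integrable lebesgue {a<..<b} (\<lambda>t. f (u t) * vector_derivative (\<lambda>s. p (u s)) (at t))"
      using lipschitz_derivative_mult_integrable[OF pu lipschitz_interval_measurable[OF fu], of B] B by simp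
    then show "(\<lambda>t. indicator {a<..<b} t *\<^sub>R (f (u t) * vector_derivative (\<lambda>s. p (u s)) (at t))) \<in> borel_measurable lebesgue"
      by (simp add: set_integrable_def borel_measurable_integrable)
    show "(\<lambda>t. indicator {a<..<b} t *\<^sub>R vector_derivative (\<lambda>s. H (u s)) (at t)) \<in> borel_measurable lebesgue"
      using lipschitz_interval_derivative_integrable[OF Hu] by (simp add: set_integrable_def borel_measurable_integrable)
    show "AE t in lebesgue. indicator {a<..<b} t *\<^sub>R (f (u t) * vector_derivative (\<lambda>s. p (u s)) (at t)) =
      indicator {a<..<b} t *\<^sub>R vector_derivative (\<lambda>s. H (u s)) (at t)"
      using lipschitz_interval_derivative_AE[OF pu]
      by eventually_elim (auto simp: indicator_def vector_derivative_at[OF der])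
  qed
  also have "\<dots> = H (u b) - H (u a)" using lipschitz_interval_FTC[OF Hu \<open>a \<le> b\<close>] .
  finally show ?thesis by (simp add: H0) (simp add: H_def)
qed

end

text \<open>The terms tend to 0, and an integer of absolute value below 1 is 0, so the series is a
  finite sum.\<close>

lemma of_int_summable_suminf_Ints:
  fixes k :: "nat \<Rightarrow> int"
  assumes "summable (\<lambda>n. real_of_int (k n))"
  shows "(\<Sum>n. real_of_int (k n)) \<in> \<int>"
proof -
  have "(\<lambda>n. real_of_int (k n)) \<longlonglongrightarrow> 0" using assms by (rule summable_LIMSEQ_zero)
  then have "\<forall>\<^sub>F n in sequentially. \<bar>real_of_int (k n)\<bar> < 1"
    by (auto simp: tendsto_iff dist_real_def)
  then obtain N where N: "\<And>n. n \<ge> N \<Longrightarrow> k n = 0"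
    unfolding eventually_sequentially by (metis of_int_abs of_int_less_1_iff zabs_less_one_iff)
  have "(\<Sum>n. real_of_int (k n)) = (\<Sum>n<N. real_of_int (k n))"
    using N by (intro suminf_finite) (auto simp: not_less)
  then show ?thesis by (metis Ints_of_int of_int_sum)
qed

text \<open>Each component of V is pushed to a signed interval at most L times as long. The lengths
  of the components have a finite sum, so the signed intervals add up in L^1 and, almost everywhere,
  absolutely to an integer. The density is fixed before f and p are given, as integer rectifiability
  demands.\<close>

lemma pushforward_density:
  fixes u :: "real \<Rightarrow> real"
  assumes u: "L-lipschitz_on {a..b} u" and V: "open V" "V \<subseteq> {a<..<b}"
  obtains \<theta> :: "real \<Rightarrow> int" where "integrable lebesgue (\<lambda>y. real_of_int (\<theta> y))"
    "\<And>(f :: real \<Rightarrow> real) p K M B. K-lipschitz_on UNIV f \<Longrightarrow> M-lipschitz_on UNIV p \<Longrightarrow> (\<And>x. \<bar>f x\<bar> \<le> B) \<Longrightarrow>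
       integrable lebesgue (\<lambda>y. real_of_int (\<theta> y) * (f y * vector_derivative p (at y))) \<and>
       (LINT t:V|lebesgue. f (u t) * vector_derivative (\<lambda>s. p (u s)) (at t)) =
       (LINT y|lebesgue. real_of_int (\<theta> y) * (f y * vector_derivative p (at y)))"
proof -
  obtain l r :: "nat \<Rightarrow> real" where lr: "\<forall>n. l n \<le> r n" "\<forall>n. l n < r n \<longrightarrow> {l n..r n} \<subseteq> {a..b}"
    and dj: "disjoint_family (\<lambda>n. {l n<..<r n})" and Veq: "V = (\<Union>n. {l n<..<r n})"
    by (rule open_bounded_disjoint_intervals[OF V]) blast
  note lr = lr(1)[rule_format] lr(2)[rule_format]
  have L: "0 \<le> L" using u lipschitz_on_nonneg by blast
  define s where "s n y = real_of_int (if l n < r n then signed_interval (u (l n)) (u (r n)) y else 0)" for n y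
  have lenb: "\<bar>u (r n) - u (l n)\<bar> \<le> L * (r n - l n)" if "l n < r n" for n
  proof -
    have "r n \<in> {a..b}" "l n \<in> {a..b}" using lr(2)[OF that] that by auto
    then show ?thesis using lipschitz_onD[OF u, of "r n" "l n"] that by (simp add: dist_real_def)
  qed
  have sm: "s n \<in> borel_measurable borel" for n
    unfolding s_def by (cases "l n < r n") simp_all
  have s_abs: "(\<integral>\<^sup>+y. ennreal \<bar>s n y\<bar> \<partial>lebesgue) \<le> ennreal (L * (r n - l n))" for n
  proof (cases "l n < r n")
    case True
    have "(\<integral>\<^sup>+y. ennreal \<bar>s n y\<bar> \<partial>lebesgue) \<le> (\<integral>\<^sup>+y. indicator {min (u (l n)) (u (r n))<..<max (u (l n)) (u (r n))} y \<partial>lebesgue)"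
      using True by (intro nn_integral_mono) (auto simp: s_def signed_interval_def indicator_def)
    also have "\<dots> = ennreal \<bar>u (r n) - u (l n)\<bar>"
      by (auto simp: max_def min_def)
    also have "\<dots> \<le> ennreal (L * (r n - l n))" using lenb[OF True] by (rule ennreal_leI)
    finally show ?thesis .
  qed (simp add: s_def)
  have "(\<Sum>n. emeasure lborel {l n<..<r n}) = emeasure lborel (\<Union>n. {l n<..<r n})"
    by (rule suminf_emeasure) (use dj in auto)
  then have "(\<Sum>n. ennreal (r n - l n)) = emeasure lborel (\<Union>n. {l n<..<r n})"
    using lr(1) by simp
  also have "\<dots> \<le> emeasure lborel {a<..<b}"
    using V unfolding Veq by (intro emeasure_mono) auto
  also have "\<dots> < top" by (cases "a \<le> b") auto
  finally have sum_len: "(\<Sum>n. ennreal (r n - l n)) < top" .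
  then have sbl: "summable (\<lambda>n. r n - l n)"
  proof (intro summable_suminf_not_top)
    show "0 \<le> r n - l n" for n using lr(1)[of n] by simp
    show "(\<Sum>n. ennreal (r n - l n)) \<noteq> top" using sum_len by (rule less_imp_neq)
  qed
  have s_int: "integrable lebesgue (s n)" for n
  proof (rule integrableI_bounded)
    show "s n \<in> borel_measurable lebesgue" using sm by (intro measurable_completion) simp
    show "(\<integral>\<^sup>+y. ennreal (norm (s n y)) \<partial>lebesgue) < \<infinity>"
      using s_abs[of n] by (auto intro: le_less_trans)
  qed
  have s_absint: "(LINT y|lebesgue. \<bar>s n y\<bar>) \<le> L * (r n - l n)" for n
  proof -
    have "ennreal (LINT y|lebesgue. \<bar>s n y\<bar>) = (\<integral>\<^sup>+y. ennreal \<bar>s n y\<bar> \<partial>lebesgue)"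
      using s_int[of n] by (intro nn_integral_eq_integral[symmetric]) auto
    then have "ennreal (LINT y|lebesgue. \<bar>s n y\<bar>) \<le> ennreal (L * (r n - l n))"
      using s_abs[of n] by simp
    then show ?thesis using L lr(1)[of n] by (subst (asm) ennreal_le_iff) auto
  qed
  have sum_s: "summable (\<lambda>n. LINT y|lebesgue. norm (s n y))"
    by (rule summable_comparison_test'[OF summable_mult[OF sbl, of L]]) (use s_absint in \<open>auto intro: order_trans\<close>)
  have ae: "AE y in lebesgue. summable (\<lambda>n. norm (s n y))"
  proof -
    have "(\<integral>\<^sup>+y. (\<Sum>n. ennreal (norm (s n y))) \<partial>lebesgue) = (\<Sum>n. \<integral>\<^sup>+y. ennreal (norm (s n y)) \<partial>lebesgue)"
      using s_int by (intro nn_integral_suminf) (auto dest: borel_measurable_integrable)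
    also have "\<dots> \<le> (\<Sum>n. ennreal (L * (r n - l n)))"
      using s_abs by (intro suminf_le) auto
    also have "\<dots> = ennreal (\<Sum>n. L * (r n - l n))"
      using lr(1) L sbl by (intro suminf_ennreal2 summable_mult) auto
    finally have "(\<integral>\<^sup>+y. (\<Sum>n. ennreal (norm (s n y))) \<partial>lebesgue) \<noteq> \<infinity>" by (auto simp: top_unique)
    then have "AE y in lebesgue. (\<Sum>n. ennreal (norm (s n y))) \<noteq> \<infinity>"
    proof (rule nn_integral_PInf_AE[rotated])
      have "s n \<in> borel_measurable lebesgue" for n using s_int by (rule borel_measurable_integrable)
      then show "(\<lambda>y. \<Sum>n. ennreal (norm (s n y))) \<in> borel_measurable lebesgue" by measurable
    qed
    then show ?thesis
      by eventually_elim (auto intro!: summable_suminf_not_top)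
  qed
  \<comment> \<open>The floor does nothing where the series converges absolutely, and makes \<theta>
    integer valued on the remaining null set too.\<close>
  define \<theta> where "\<theta> y = \<lfloor>\<Sum>n. s n y\<rfloor>" for y
  have th: "AE y in lebesgue. real_of_int (\<theta> y) = (\<Sum>n. s n y)"
    using ae
  proof eventually_elim
    case (elim y)
    then have "summable (\<lambda>n. s n y)" by (rule summable_norm_cancel)
    then have "(\<Sum>n. s n y) \<in> \<int>" unfolding s_def by (rule of_int_summable_suminf_Ints)
    then show ?case unfolding \<theta>_def by (auto elim: Ints_cases)
  qed
  have S_int: "integrable lebesgue (\<lambda>y. \<Sum>n. s n y)"
    using s_int ae sum_s by (rule integrable_suminf)
  have th_m: "(\<lambda>y. real_of_int (\<theta> y)) \<in> borel_measurable lebesgue"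
    using borel_measurable_integrable[OF S_int] unfolding \<theta>_def by measurable
  show ?thesis
  proof (rule that[of \<theta>])
    show "integrable lebesgue (\<lambda>y. real_of_int (\<theta> y))"
      using S_int th th_m by (subst integrable_cong_AE[of _ _ "\<lambda>y. \<Sum>n. s n y"]) (auto dest: borel_measurable_integrable)
    fix f p :: "real \<Rightarrow> real" and K M B :: real
    assume f: "K-lipschitz_on UNIV f" and p: "M-lipschitz_on UNIV p" and B: "\<And>x. \<bar>f x\<bar> \<le> B"
    define w where "w y = f y * vector_derivative p (at y)" for y
    have nonneg: "0 \<le> M" "0 \<le> B" using p lipschitz_on_nonneg B[of 0] by (auto intro: order_trans[OF abs_ge_zero])
    have sw_int: "integrable lebesgue (\<lambda>y. s n y * w y)" for n
      unfolding s_def w_def using has_bochner_integral_signed_interval(1)[OF lipschitz_pair_interval_integrable[OF f p B]]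
      by (cases "l n < r n") simp_all
    \<comment> \<open>The derivative bound is available on bounded intervals; countably many of them
      exhaust the line.\<close>
    have w_bd: "AE y in lebesgue. \<bar>w y\<bar> \<le> B * M"
    proof -
      have "AE y in lebesgue. \<forall>n::nat. y \<in> {-real n<..<real n} \<longrightarrow> \<bar>vector_derivative p (at y)\<bar> \<le> M"
        unfolding AE_all_countable
      proof
        fix n :: nat
        show "AE y in lebesgue. y \<in> {-real n<..<real n} \<longrightarrow> \<bar>vector_derivative p (at y)\<bar> \<le> M"
          using lipschitz_interval_derivative_AE[OF lipschitz_on_subset[OF p], of "-real n" "real n"] by auto
      qed
      then show ?thesis
      proof eventually_elim
        case (elim y)
        obtain n where "\<bar>y\<bar> < real n" using reals_Archimedean2 by blast
        then have "y \<in> {-real n<..<real n}" by (simp add: abs_less_iff)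
        then have "\<bar>vector_derivative p (at y)\<bar> \<le> M" by (rule elim[rule_format])
        then show ?case using B[of y] nonneg by (auto simp: w_def abs_mult intro!: mult_mono)
      qed
    qed
    have ae_w: "AE y in lebesgue. summable (\<lambda>n. norm (s n y * w y))"
      using ae by eventually_elim (simp add: abs_mult summable_mult2)
    have sum_w: "summable (\<lambda>n. LINT y|lebesgue. norm (s n y * w y))"
    proof (rule summable_comparison_test'[OF summable_mult2[OF sum_s, of "B * M"]])
      fix n
      have "(LINT y|lebesgue. norm (s n y * w y)) \<le> (LINT y|lebesgue. norm (s n y) * (B * M))"
      proof (rule integral_mono_AE)
        show "integrable lebesgue (\<lambda>y. norm (s n y * w y))" using sw_int by (rule integrable_norm)
        show "integrable lebesgue (\<lambda>y. norm (s n y) * (B * M))" using s_int by simp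
        show "AE y in lebesgue. norm (s n y * w y) \<le> norm (s n y) * (B * M)"
          using w_bd by eventually_elim (auto simp: abs_mult intro: mult_left_mono)
      qed
      then show "norm (LINT y|lebesgue. norm (s n y * w y)) \<le> (LINT y|lebesgue. norm (s n y)) * (B * M)"
        by simp
    qed
    have wm: "w \<in> borel_measurable lebesgue"
    proof (rule borel_measurable_LIMSEQ_real)
      show "(\<lambda>y. indicator {-real n<..<real n} y * w y) \<in> borel_measurable lebesgue" for n
        using lipschitz_pair_interval_integrable[OF f p B, of "-real n" "real n"] by (simp add: w_def borel_measurable_integrable)
      fix y
      obtain N where N: "\<bar>y\<bar> < real N" using reals_Archimedean2 by blast
      have "\<forall>\<^sub>F n in sequentially. indicator {-real n<..<real n} y * w y = w y"
        using N by (intro eventually_sequentiallyI[of N]) (auto simp: indicator_def)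
      then show "(\<lambda>n. indicator {-real n<..<real n} y * w y) \<longlonglongrightarrow> w y" by (rule tendsto_eventually)
    qed
    have th_w: "AE y in lebesgue. (\<Sum>n. s n y * w y) = real_of_int (\<theta> y) * w y"
      using th ae by eventually_elim (simp add: suminf_mult2[OF summable_norm_cancel])
    have sum_m: "(\<lambda>y. \<Sum>n. s n y * w y) \<in> borel_measurable lebesgue"
      using integrable_suminf[OF sw_int ae_w sum_w] by (rule borel_measurable_integrable)
    have thw_int: "integrable lebesgue (\<lambda>y. real_of_int (\<theta> y) * w y)"
      using integrable_suminf[OF sw_int ae_w sum_w] th_w th_m wm sum_m
      by (subst integrable_cong_AE[of _ _ "\<lambda>y. \<Sum>n. s n y * w y"]) auto
    have step: "(LINT t:{l n<..<r n}|lebesgue. f (u t) * vector_derivative (\<lambda>s. p (u s)) (at t)) = (LINT y|lebesgue. s n y * w y)" for n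
    proof (cases "l n < r n")
      case True
      then show ?thesis
        using pushforward_interval[OF f p B lipschitz_on_subset[OF u lr(2)[OF True]]] by (simp add: s_def w_def)
    qed (use lr(1)[of n] in \<open>simp add: s_def set_lebesgue_integral_def\<close>)
    have fu: "(K * L)-lipschitz_on {a..b} (\<lambda>t. f (u t))"
      using lipschitz_on_compose2[OF u lipschitz_on_subset[OF f]] by simp
    have pu: "(M * L)-lipschitz_on {a..b} (\<lambda>t. p (u t))"
      using lipschitz_on_compose2[OF u lipschitz_on_subset[OF p]] by simp
    have int: "set_integrable lebesgue {a<..<b} (\<lambda>t. f (u t) * vector_derivative (\<lambda>s. p (u s)) (at t))"
      using lipschitz_derivative_mult_integrable[OF pu lipschitz_interval_measurable[OF fu], of B] B by simp
    have "(LINT t:V|lebesgue. f (u t) * vector_derivative (\<lambda>s. p (u s)) (at t)) =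
      (\<Sum>n. LINT t:{l n<..<r n}|lebesgue. f (u t) * vector_derivative (\<lambda>s. p (u s)) (at t))"
      unfolding Veq
    proof (rule lebesgue_integral_countable_add)
      show "{l i<..<r i} \<inter> {l j<..<r j} = {}" if "i \<noteq> j" for i j
        using dj that unfolding disjoint_family_on_def by blast
      show "set_integrable lebesgue (\<Union>n. {l n<..<r n}) (\<lambda>t. f (u t) * vector_derivative (\<lambda>s. p (u s)) (at t))"
        by (rule set_integrable_subset[OF int]) (use V(2) Veq in auto)
    qed auto
    also have "\<dots> = (\<Sum>n. LINT y|lebesgue. s n y * w y)" unfolding step ..
    also have "\<dots> = (LINT y|lebesgue. (\<Sum>n. s n y * w y))"
      by (rule integral_suminf[OF sw_int ae_w sum_w, symmetric])
    also have "\<dots> = (LINT y|lebesgue. real_of_int (\<theta> y) * w y)"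
      using th_w th_m wm sum_m by (intro integral_cong_AE) auto
    finally show "integrable lebesgue (\<lambda>y. real_of_int (\<theta> y) * (f y * vector_derivative p (at y))) \<and>
       (LINT t:V|lebesgue. f (u t) * vector_derivative (\<lambda>s. p (u s)) (at t)) =
       (LINT y|lebesgue. real_of_int (\<theta> y) * (f y * vector_derivative p (at y)))"
      using thw_int by (simp add: w_def)
  qed
qed

section \<open>The area formula for bi-Lipschitz functions of one variable\<close>

text \<open>Every isolated point is singled out by a member of a countable base. Derivatives within
  a set are unique at its limit points, and this is the price of discarding all other
  points.\<close>

lemma countable_isolated_points:
  fixes A :: "'a::second_countable_topology set"
  shows "countable {t\<in>A. \<not> t islimpt A}"
proof -
  obtain \<B> :: "'a set set" where \<B>: "countable \<B>" "\<forall>S. open S \<longrightarrow> (\<exists>U. U \<subseteq> \<B> \<and> S = \<Union>U)"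
    by (rule univ_second_countable) blast
  have "\<exists>B\<in>\<B>. B \<inter> A = {t}" if t: "t \<in> A" "\<not> t islimpt A" for t
  proof -
    obtain T where T: "open T" "t \<in> T" "\<And>y. y \<in> A \<Longrightarrow> y \<in> T \<Longrightarrow> y = t"
      using t unfolding islimpt_def by auto
    then obtain U where "U \<subseteq> \<B>" "T = \<Union>U" using \<B>(2) by blast
    then obtain B where "B \<in> \<B>" "t \<in> B" "B \<subseteq> T" using T(2) by blast
    then show ?thesis using T(3) t(1) by blast
  qed
  then obtain b where b: "\<And>t. t \<in> A \<Longrightarrow> \<not> t islimpt A \<Longrightarrow> b t \<in> \<B> \<and> b t \<inter> A = {t}"
    by metis
  show ?thesis
  proof (rule countable_image_inj_on)
    show "countable (b ` {t\<in>A. \<not> t islimpt A})"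
      by (rule countable_subset[OF _ \<B>(1)]) (use b in auto)
    show "inj_on b {t\<in>A. \<not> t islimpt A}"
    proof (rule inj_onI)
      fix x y assume x: "x \<in> {t\<in>A. \<not> t islimpt A}" and y: "y \<in> {t\<in>A. \<not> t islimpt A}" and "b x = b y"
      moreover have "b x \<inter> A = {x}" "b y \<inter> A = {y}" using b x y by simp_all
      ultimately have "{x} = {y}" by metis
      then show "x = y" by simp
    qed
  qed
qed

text \<open>McShane's formula: the infimum of the cones of slope L erected over the graph of
  g.\<close>

lemma lipschitz_extension_real:
  fixes g :: "'a::metric_space \<Rightarrow> real"
  assumes g: "L-lipschitz_on A g"
  obtains G where "L-lipschitz_on UNIV G" "\<And>x. x \<in> A \<Longrightarrow> G x = g x"
proof (cases "A = {}")
  case True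
  have "L-lipschitz_on UNIV (\<lambda>_::'a. 0::real)"
    using lipschitz_on_nonneg[OF g] by (intro lipschitz_onI) auto
  then show ?thesis using True that by blast
next
  case False
  have L: "0 \<le> L" using g lipschitz_on_nonneg by blast
  define G where "G t = (INF s\<in>A. g s + L * dist s t)" for t
  obtain a where a: "a \<in> A" using False by auto
  have bdd: "bdd_below ((\<lambda>s. g s + L * dist s t) ` A)" for t
  proof (rule bdd_belowI2[of _ "g a - L * dist a t"])
    fix s assume s: "s \<in> A"
    have "g a - g s \<le> L * dist a s" using lipschitz_onD[OF g a s] by (simp add: dist_real_def)
    also have "\<dots> \<le> L * (dist a t + dist s t)" using L by (intro mult_left_mono dist_triangle2) auto
    finally show "g a - L * dist a t \<le> g s + L * dist s t" by (simp add: algebra_simps)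
  qed
  have G_le: "G t \<le> G t' + L * dist t t'" for t t'
  proof -
    have "G t - L * dist t t' \<le> G t'"
      unfolding G_def[of t']
    proof (rule cINF_greatest[OF False])
      fix s assume "s \<in> A"
      have "G t \<le> g s + L * dist s t" unfolding G_def using bdd \<open>s \<in> A\<close> by (rule cINF_lower)
      also have "\<dots> \<le> g s + L * (dist s t' + dist t t')"
        using L by (intro add_left_mono mult_left_mono dist_triangle2) auto
      finally show "G t - L * dist t t' \<le> g s + L * dist s t'" by (simp add: algebra_simps)
    qed
    then show ?thesis by simp
  qed
  show ?thesis
  proof (rule that[of G])
    show "L-lipschitz_on UNIV G"
    proof (rule lipschitz_onI[OF _ L])
      fix x y
      show "dist (G x) (G y) \<le> L * dist x y"
        using G_le[of x y] G_le[of y x] by (simp add: dist_real_def abs_le_iff dist_commute)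
    qed
    fix x assume x: "x \<in> A"
    show "G x = g x"
    proof (rule antisym)
      have "G x \<le> g x + L * dist x x" unfolding G_def using bdd x by (rule cINF_lower)
      then show "G x \<le> g x" by simp
      show "g x \<le> G x" unfolding G_def
      proof (rule cINF_greatest[OF False])
        fix s assume "s \<in> A"
        then show "g x \<le> g s + L * dist s x"
          using lipschitz_onD[OF g x, of s] by (simp add: dist_real_def dist_commute abs_le_iff)
      qed
    qed
  qed
qed

lemma lipschitz_derivative_measurable:
  fixes G :: "real \<Rightarrow> real"
  assumes "L-lipschitz_on UNIV G"
  shows "(\<lambda>t. vector_derivative G (at t)) \<in> borel_measurable lebesgue"
proof (rule borel_measurable_LIMSEQ_real)
  show "(\<lambda>y. indicator {-real n<..<real n} y * vector_derivative G (at y)) \<in> borel_measurable lebesgue" for n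
    using lipschitz_interval_derivative_integrable[OF lipschitz_on_subset[OF assms], of "-real n" "real n"]
    by (simp add: set_integrable_def borel_measurable_integrable)
  fix y
  obtain N where N: "\<bar>y\<bar> < real N" using reals_Archimedean2 by blast
  have "\<forall>\<^sub>F n in sequentially. indicator {-real n<..<real n} y * vector_derivative G (at y) = vector_derivative G (at y)"
    using N by (intro eventually_sequentiallyI[of N]) (auto simp: indicator_def)
  then show "(\<lambda>n. indicator {-real n<..<real n} y * vector_derivative G (at y)) \<longlonglongrightarrow> vector_derivative G (at y)"
    by (rule tendsto_eventually)
qed

text \<open>Lebesgue measure is complete, so measurability passes from one function to the
  other.\<close>

lemma lebesgue_integral_eq_AE:
  fixes f g :: "real \<Rightarrow> real"
  assumes "g \<in> borel_measurable lebesgue" "AE x in lebesgue. f x = g x"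
  shows "(LINT x|lebesgue. f x) = (LINT x|lebesgue. g x)"
proof (rule integral_cong_AE)
  have "AE x in lebesgue. g x = f x" using assms(2) by eventually_elim simp
  with assms(1) show "f \<in> borel_measurable lebesgue" by (rule borel_measurable_AE)
qed (use assms in auto)

lemma negligible_lipschitz_image:
  fixes f :: "real \<Rightarrow> real"
  assumes "negligible S" "\<And>x y. x \<in> S \<Longrightarrow> y \<in> S \<Longrightarrow> \<bar>f x - f y\<bar> \<le> L * \<bar>x - y\<bar>"
  shows "negligible (f ` S)"
proof (rule negligible_locally_Lipschitz_image[OF _ assms(1)])
  fix x assume "x \<in> S"
  then show "\<exists>T B. open T \<and> x \<in> T \<and> (\<forall>y\<in>S \<inter> T. norm (f y - f x) \<le> B * norm (y - x))"
    using assms(2) by (intro exI[of _ UNIV] exI[of _ L]) auto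
qed simp

lemma vector_derivative_within_unique:
  fixes f :: "real \<Rightarrow> real"
  assumes "(f has_vector_derivative d) (at t within A)" "t islimpt A"
  shows "vector_derivative f (at t within A) = d"
  using assms by (intro vector_derivative_within) (auto simp: trivial_limit_within)

text \<open>Almost everywhere \<theta> = \<plusminus>1 and g has a derivative d \<noteq> 0; the sign
  of \<theta> d tells whether the chart runs with or against the coordinate of the target. P and N
  are the images of the points with positive and with negative sign. There \<theta> d equals
  \<bar>d\<bar> and -\<bar>d\<bar> respectively, which is the factor in the change of variables
  formula for injective functions.\<close>

lemma bilipschitz_chart_signed_area:
  fixes g :: "real \<Rightarrow> real" and \<theta> :: "real \<Rightarrow> int"
  assumes A: "A \<in> sets lebesgue" and "L > 0"
    and up: "\<And>s t. s \<in> A \<Longrightarrow> t \<in> A \<Longrightarrow> \<bar>g s - g t\<bar> \<le> L * \<bar>s - t\<bar>"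
    and lo: "\<And>s t. s \<in> A \<Longrightarrow> t \<in> A \<Longrightarrow> \<bar>s - t\<bar> \<le> L * \<bar>g s - g t\<bar>"
    and im: "g ` A \<subseteq> {\<alpha><..<\<beta>}"
    and \<theta>m: "set_borel_measurable lebesgue A (\<lambda>t. real_of_int (\<theta> t))"
    and \<theta>1: "negligible {t\<in>A. \<bar>\<theta> t\<bar> \<noteq> 1}"
  obtains P N where "P \<in> sets lebesgue" "N \<in> sets lebesgue" "P \<inter> N = {}" "P \<union> N \<subseteq> g ` A"
    "negligible (g ` A - (P \<union> N))"
    "\<And>(u :: real \<Rightarrow> real) K. K-lipschitz_on {\<alpha>..\<beta>} u \<Longrightarrow>
      set_integrable lebesgue A (\<lambda>t. real_of_int (\<theta> t) * vector_derivative (\<lambda>s. u (g s)) (at t within A)) \<and>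
      (LINT t:A|lebesgue. real_of_int (\<theta> t) * vector_derivative (\<lambda>s. u (g s)) (at t within A)) =
      (LINT s:P|lebesgue. vector_derivative u (at s)) - (LINT s:N|lebesgue. vector_derivative u (at s))"
proof -
  have "L-lipschitz_on A g" using up \<open>L > 0\<close> by (intro lipschitz_onI) (auto simp: dist_real_def)
  then obtain G where G: "L-lipschitz_on UNIV G" "\<And>x. x \<in> A \<Longrightarrow> G x = g x"
    using lipschitz_extension_real by blast
  define d where "d t = vector_derivative G (at t)" for t
  have dm: "d \<in> borel_measurable lebesgue"
    using lipschitz_derivative_measurable[OF G(1)] unfolding d_def[abs_def] .
  \<comment> \<open>A null set to be discarded: wrong multiplicity, no derivative of the extension,
    or isolated in A, where derivatives within A are not unique.\<close>
  define Z where "Z = {t\<in>A. \<bar>\<theta> t\<bar> \<noteq> 1} \<union> {t. \<not> G differentiable (at t)} \<union> {t\<in>A. \<not> t islimpt A}"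
  have Z: "negligible Z"
    unfolding Z_def
    by (intro negligible_Un \<theta>1 lipschitz_differentiable_ae[OF G(1)] countable_imp_negligible countable_isolated_points)
  define A0 where "A0 = A - Z"
  have A0: "A0 \<in> sets lebesgue" "A0 \<subseteq> A"
    unfolding A0_def using A Z by (auto intro: negligible_imp_sets)
  have A0D: "\<bar>\<theta> t\<bar> = 1" "t islimpt A" "(G has_vector_derivative d t) (at t)" if "t \<in> A0" for t
    using that unfolding A0_def Z_def d_def by (auto simp: vector_derivative_works)
  have gder: "(g has_vector_derivative d t) (at t within A)" if "t \<in> A0" for t
    by (rule has_vector_derivative_transform[OF _ _ has_vector_derivative_at_within[OF A0D(3)[OF that]]])
      (use that A0(2) G(2) in auto)
  \<comment> \<open>The lower Lipschitz bound keeps the difference quotients along A above 1 / L in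
    absolute value, and points of A accumulate at t.\<close>
  have d0: "d t \<noteq> 0" if t: "t \<in> A0" for t
  proof
    assume "d t = 0"
    with gder[OF t] have "((\<lambda>s. (g s - g t) / (s - t)) \<longlongrightarrow> 0) (at t within A)"
      by (simp add: has_real_derivative_iff_has_vector_derivative[symmetric] has_field_derivative_iff)
    then have lim: "((\<lambda>s. \<bar>(g s - g t) / (s - t)\<bar>) \<longlongrightarrow> 0) (at t within A)"
      using tendsto_rabs_zero by blast
    moreover have "\<forall>\<^sub>F s in at t within A. 1 / L \<le> \<bar>(g s - g t) / (s - t)\<bar>"
      unfolding eventually_at_filter
    proof (rule always_eventually, intro allI impI)
      fix s assume "s \<noteq> t" "s \<in> A"
      then show "1 / L \<le> \<bar>(g s - g t) / (s - t)\<bar>"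
        using lo[of s t] t A0(2) \<open>L > 0\<close> by (auto simp: abs_divide divide_simps mult_ac)
    qed
    moreover have "at t within A \<noteq> bot" using A0D(2)[OF t] by (simp add: trivial_limit_within)
    ultimately have "1 / L \<le> 0" using tendsto_lowerbound by blast
    with \<open>L > 0\<close> show False by simp
  qed
  \<comment> \<open>Measurability of \<theta> is known on A only, so it is cut off before its sign
    is combined with that of d.\<close>
  define sg where "sg t = (indicator A t * real_of_int (\<theta> t)) * d t" for t
  have sgm: "sg \<in> borel_measurable lebesgue"
    unfolding sg_def using \<theta>m dm by (auto simp: set_borel_measurable_def)
  define Ap where "Ap = {t\<in>A0. 0 < sg t}"
  define An where "An = {t\<in>A0. sg t < 0}"
  have Am: "Ap \<in> sets lebesgue" "An \<in> sets lebesgue"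
  proof -
    have "Ap = A0 \<inter> sg -` {0<..}" "An = A0 \<inter> sg -` {..<0}" unfolding Ap_def An_def by auto
    then show "Ap \<in> sets lebesgue" "An \<in> sets lebesgue"
      using A0(1) measurable_sets[OF sgm, of "{0<..}"] measurable_sets[OF sgm, of "{..<0}"] by auto
  qed
  have sub: "Ap \<subseteq> A0" "An \<subseteq> A0" "Ap \<inter> An = {}" unfolding Ap_def An_def by auto
  have un: "Ap \<union> An = A0"
  proof -
    have "sg t \<noteq> 0" if "t \<in> A0" for t
      using d0[OF that] A0D(1)[OF that] A0(2) that by (auto simp: sg_def)
    then show ?thesis unfolding Ap_def An_def by (auto simp: neq_iff)
  qed
  have inj: "inj_on g A"
  proof (rule inj_onI)
    fix x y assume "x \<in> A" "y \<in> A" "g x = g y"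
    then show "x = y" using lo[of x y] by simp
  qed
  have gder': "(g has_real_derivative d t) (at t within B)" if "t \<in> B" "B \<subseteq> A0" for t B
    using has_vector_derivative_within_subset[OF gder, of t B] that A0(2)
    by (auto simp: has_real_derivative_iff_has_vector_derivative)
  have imm: "g ` B \<in> sets lebesgue" if "B \<in> sets lebesgue" "B \<subseteq> A0" for B
  proof (rule differentiable_image_in_sets_lebesgue[OF that(1)])
    show "g differentiable_on B"
      unfolding differentiable_on_def using gder'[OF _ that(2)]
      by (auto simp: has_field_derivative_def differentiable_def)
  qed simp
  show ?thesis
  proof (rule that[of "g ` Ap" "g ` An"])
    show "g ` Ap \<in> sets lebesgue" "g ` An \<in> sets lebesgue" using imm Am sub by auto
    show "g ` Ap \<inter> g ` An = {}"
    proof -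
      have "g ` Ap \<inter> g ` An = g ` (Ap \<inter> An)"
        using inj_on_image_Int[OF inj, of Ap An] sub A0(2) by auto
      then show ?thesis using sub by simp
    qed
    show "g ` Ap \<union> g ` An \<subseteq> g ` A" using sub A0(2) by auto
    show "negligible (g ` A - (g ` Ap \<union> g ` An))"
    proof (rule negligible_subset)
      show "negligible (g ` (A \<inter> Z))"
        using Z up by (intro negligible_lipschitz_image[of _ _ L] negligible_Int) auto
      show "g ` A - (g ` Ap \<union> g ` An) \<subseteq> g ` (A \<inter> Z)" using un unfolding A0_def by blast
    qed
    fix u :: "real \<Rightarrow> real" and K assume u: "K-lipschitz_on {\<alpha>..\<beta>} u"
    define u' where "u' s = vector_derivative u (at s)" for s
    have u'ai: "u' absolutely_integrable_on {\<alpha><..<\<beta>}"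
      using lipschitz_interval_derivative_integrable[OF u] unfolding u'_def .
    have cov: "(\<lambda>t. \<bar>d t\<bar> * u' (g t)) absolutely_integrable_on B \<and> integral B (\<lambda>t. \<bar>d t\<bar> * u' (g t)) = integral (g ` B) u'"
      "u' absolutely_integrable_on (g ` B)"
      if B: "B \<in> sets lebesgue" "B \<subseteq> A0" for B
    proof -
      show "u' absolutely_integrable_on (g ` B)"
        by (rule set_integrable_subset[OF u'ai imm[OF B]]) (use im B A0(2) in auto)
      then show "(\<lambda>t. \<bar>d t\<bar> * u' (g t)) absolutely_integrable_on B \<and> integral B (\<lambda>t. \<bar>d t\<bar> * u' (g t)) = integral (g ` B) u'"
        using has_absolute_integral_change_of_variables_1'[of B g d u' "integral (g ` B) u'"] B(1) gder'[OF _ B(2)]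
          inj_on_subset[OF inj, of B] B(2) A0(2) by auto
    qed
    define Y where "Y t = indicator Ap t *\<^sub>R (\<bar>d t\<bar> * u' (g t)) - indicator An t *\<^sub>R (\<bar>d t\<bar> * u' (g t))" for t
    have i: "integrable lebesgue (\<lambda>t. indicator Ap t *\<^sub>R (\<bar>d t\<bar> * u' (g t)))"
      "integrable lebesgue (\<lambda>t. indicator An t *\<^sub>R (\<bar>d t\<bar> * u' (g t)))"
      using cov(1)[OF Am(1) sub(1)] cov(1)[OF Am(2) sub(2)] by (auto simp: set_integrable_def)
    define E where "E = {s\<in>{\<alpha><..<\<beta>}. \<not> u differentiable (at s)}"
    \<comment> \<open>The points sent by g to where u has no derivative. They form a null set
      because the inverse of g on its image is L-Lipschitz.\<close>
    define F where "F = {t\<in>A. g t \<in> E}"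
    have "negligible F"
    proof -
      have "negligible (inv_into A g ` (g ` F))"
      proof (rule negligible_lipschitz_image[of _ _ L])
        show "negligible (g ` F)"
          by (rule negligible_subset[OF lipschitz_interval_differentiable_ae[OF u]]) (auto simp: F_def E_def)
        fix x y assume "x \<in> g ` F" "y \<in> g ` F"
        then obtain s t where "x = g s" "y = g t" "s \<in> A" "t \<in> A" by (auto simp: F_def)
        then show "\<bar>inv_into A g x - inv_into A g y\<bar> \<le> L * \<bar>x - y\<bar>"
          using lo inj by simp
      qed
      moreover have "inv_into A g ` (g ` F) = F"
        using inj by (intro inv_into_image_cancel) (auto simp: F_def)
      ultimately show ?thesis by simp
    qed
    then have "negligible (Z \<union> F)" using Z by simp
    then have "AE t in lebesgue. t \<notin> Z \<union> F"
      by (intro AE_not_in) (simp add: negligible_iff_null_sets)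
    then have ae: "AE t in lebesgue. indicator A t *\<^sub>R (real_of_int (\<theta> t) * vector_derivative (\<lambda>s. u (g s)) (at t within A)) = Y t"
    proof eventually_elim
      case (elim t)
      show ?case
      proof (cases "t \<in> A")
        case True
        with elim have t: "t \<in> A0" "g t \<notin> E" by (auto simp: A0_def F_def)
        then have "(u has_vector_derivative u' (g t)) (at (g t))"
          using im True by (auto simp: E_def u'_def vector_derivative_works)
        then have "((u \<circ> g) has_vector_derivative d t *\<^sub>R u' (g t)) (at t within A)"
          using gder[OF t(1)] by (intro vector_diff_chain_within) (auto intro: has_vector_derivative_at_within)
        then have vd: "vector_derivative (\<lambda>s. u (g s)) (at t within A) = d t * u' (g t)"
          using A0D(2)[OF t(1)] by (intro vector_derivative_within_unique) (auto simp: o_def)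
        have sgt: "sg t = real_of_int (\<theta> t) * d t" using True by (simp add: sg_def)
        have tpn: "t \<in> Ap \<longleftrightarrow> 0 < real_of_int (\<theta> t) * d t" "t \<in> An \<longleftrightarrow> real_of_int (\<theta> t) * d t < 0"
          using t(1) by (simp_all add: Ap_def An_def sgt)
        have th: "\<theta> t = 1 \<or> \<theta> t = -1" using A0D(1)[OF t(1)] by linarith
        show ?thesis
          using th d0[OF t(1)] True tpn unfolding vd Y_def
          by (auto simp: indicator_def abs_if)
      next
        case False
        then have "t \<notin> Ap" "t \<notin> An" using sub A0(2) by auto
        then show ?thesis using False by (simp add: Y_def)
      qed
    qed
    have Yi: "integrable lebesgue Y"
      unfolding Y_def[abs_def] using i by (rule Bochner_Integration.integrable_diff)
    have si: "set_integrable lebesgue A (\<lambda>t. real_of_int (\<theta> t) * vector_derivative (\<lambda>s. u (g s)) (at t within A))"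
      unfolding set_integrable_def
    proof (rule integrable_cong_AE_imp[OF Yi])
      show aeY: "AE t in lebesgue. Y t = indicator A t *\<^sub>R (real_of_int (\<theta> t) * vector_derivative (\<lambda>s. u (g s)) (at t within A))"
        using ae by eventually_elim simp
      show "(\<lambda>t. indicator A t *\<^sub>R (real_of_int (\<theta> t) * vector_derivative (\<lambda>s. u (g s)) (at t within A))) \<in> borel_measurable lebesgue"
        by (rule borel_measurable_AE[OF borel_measurable_integrable[OF Yi] aeY])
    qed
    have "(LINT t:A|lebesgue. real_of_int (\<theta> t) * vector_derivative (\<lambda>s. u (g s)) (at t within A)) = (LINT t|lebesgue. Y t)"
      unfolding set_lebesgue_integral_def
      by (rule lebesgue_integral_eq_AE[OF borel_measurable_integrable[OF Yi] ae])
    also have "\<dots> = (LINT t:Ap|lebesgue. \<bar>d t\<bar> * u' (g t)) - (LINT t:An|lebesgue. \<bar>d t\<bar> * u' (g t))"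
      unfolding Y_def set_lebesgue_integral_def using i by (rule Bochner_Integration.integral_diff)
    also have "\<dots> = (LINT s:g ` Ap|lebesgue. u' s) - (LINT s:g ` An|lebesgue. u' s)"
      using cov[OF Am(1) sub(1)] cov[OF Am(2) sub(2)] by (simp add: set_lebesgue_integral_eq_integral)
    finally show "set_integrable lebesgue A (\<lambda>t. real_of_int (\<theta> t) * vector_derivative (\<lambda>s. u (g s)) (at t within A)) \<and>
      (LINT t:A|lebesgue. real_of_int (\<theta> t) * vector_derivative (\<lambda>s. u (g s)) (at t within A)) =
      (LINT s:g ` Ap|lebesgue. vector_derivative u (at s)) - (LINT s:g ` An|lebesgue. vector_derivative u (at s))"
      using si unfolding u'_def by simp
  qed
qed

section \<open>Bounded Lipschitz functions and mass measures\<close>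

lemma Lip_bddI:
  fixes f :: "'a::metric_space \<Rightarrow> real"
  assumes "C-lipschitz_on X f" "\<And>x. x \<in> X \<Longrightarrow> \<bar>f x\<bar> \<le> B"
  shows "f \<in> Lip_bdd X"
  using assms by (auto simp: Lip_bdd_def Lip_def bounded_iff)

lemma Lip_bddE:
  fixes f :: "'a::metric_space \<Rightarrow> real"
  assumes "f \<in> Lip_bdd X"
  obtains C B where "C-lipschitz_on X f" "0 \<le> B" "\<And>x. x \<in> X \<Longrightarrow> \<bar>f x\<bar> \<le> B"
proof -
  from assms obtain C B where C: "C-lipschitz_on X f" and B: "\<forall>y\<in>f ` X. norm y \<le> B"
    unfolding Lip_bdd_def Lip_def bounded_iff by blast
  show ?thesis by (rule that[OF C, of "max 0 B"]) (use B in auto)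
qed

lemma Lip_bdd_const: "(\<lambda>_. c) \<in> Lip_bdd X"
  by (rule Lip_bddI[OF lipschitz_on_constant, where B="\<bar>c\<bar>"]) auto

lemma Lip_bdd_lincomb:
  fixes f g :: "'a::metric_space \<Rightarrow> real"
  assumes "f \<in> Lip_bdd X" "g \<in> Lip_bdd X"
  shows "(\<lambda>x. a * f x + b * g x) \<in> Lip_bdd X"
proof -
  obtain C B where f: "C-lipschitz_on X f" "\<And>x. x \<in> X \<Longrightarrow> \<bar>f x\<bar> \<le> B" using Lip_bddE[OF assms(1)] by metis
  obtain C' B' where g: "C'-lipschitz_on X g" "\<And>x. x \<in> X \<Longrightarrow> \<bar>g x\<bar> \<le> B'" using Lip_bddE[OF assms(2)] by metis
  show ?thesis
  proof (rule Lip_bddI)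
    show "(\<bar>a\<bar> * C + \<bar>b\<bar> * C')-lipschitz_on X (\<lambda>x. a * f x + b * g x)"
      using f(1) g(1) by (intro lipschitz_on_add lipschitz_on_cmult_real)
    fix x assume "x \<in> X"
    then have "\<bar>a * f x + b * g x\<bar> \<le> \<bar>a\<bar> * \<bar>f x\<bar> + \<bar>b\<bar> * \<bar>g x\<bar>" by (metis abs_mult abs_triangle_ineq)
    also have "\<dots> \<le> \<bar>a\<bar> * B + \<bar>b\<bar> * B'" using f(2) g(2) \<open>x \<in> X\<close> by (intro add_mono mult_left_mono) auto
    finally show "\<bar>a * f x + b * g x\<bar> \<le> \<bar>a\<bar> * B + \<bar>b\<bar> * B'" .
  qed
qed

lemma Lip_bdd_mult:
  fixes f g :: "'a::metric_space \<Rightarrow> real"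
  assumes "f \<in> Lip_bdd X" "g \<in> Lip_bdd X"
  shows "(\<lambda>x. f x * g x) \<in> Lip_bdd X"
proof -
  obtain C B where f: "C-lipschitz_on X f" "0 \<le> B" "\<And>x. x \<in> X \<Longrightarrow> \<bar>f x\<bar> \<le> B" using Lip_bddE[OF assms(1)] by metis
  obtain C' B' where g: "C'-lipschitz_on X g" "0 \<le> B'" "\<And>x. x \<in> X \<Longrightarrow> \<bar>g x\<bar> \<le> B'" using Lip_bddE[OF assms(2)] by metis
  show ?thesis
  proof (rule Lip_bddI[OF lipschitz_on_mult_bounded[OF f(1) g(1) f(3) g(3) f(2) g(2)]])
    fix x assume "x \<in> X"
    then show "\<bar>f x * g x\<bar> \<le> B * B'" using f g by (auto simp: abs_mult intro!: mult_mono)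
  qed
qed

lemma Lip_bdd_sum:
  fixes f :: "'i \<Rightarrow> 'a::metric_space \<Rightarrow> real"
  assumes "\<And>i. i \<in> I \<Longrightarrow> f i \<in> Lip_bdd X"
  shows "(\<lambda>x. \<Sum>i\<in>I. f i x) \<in> Lip_bdd X"
  using assms
proof (induction I rule: infinite_finite_induct)
  case (insert i I)
  then show ?case using Lip_bdd_lincomb[of "f i" X "\<lambda>x. \<Sum>i\<in>I. f i x" 1 1] by simp
qed (simp_all add: Lip_bdd_const)

lemma Lip_bdd_imp_Lip: "f \<in> Lip_bdd X \<Longrightarrow> f \<in> Lip X"
  by (simp add: Lip_bdd_def)

lemma lip_const_nonneg:
  assumes "f \<in> Lip X"
  shows "0 \<le> lip_const X f"
  unfolding lip_const_def using assms by (intro cInf_greatest) (auto simp: Lip_def lipschitz_on_nonneg)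

lemma lip_const_le: "C-lipschitz_on X f \<Longrightarrow> lip_const X f \<le> C"
  unfolding lip_const_def by (intro cInf_lower bdd_belowI[of _ 0]) (auto simp: lipschitz_on_nonneg)

lemma lipschitz_on_lip_const:
  assumes "f \<in> Lip X"
  shows "(lip_const X f)-lipschitz_on X f"
proof (rule lipschitz_onI[OF _ lip_const_nonneg[OF assms]])
  fix x y assume xy: "x \<in> X" "y \<in> X"
  show "dist (f x) (f y) \<le> lip_const X f * dist x y"
  proof (cases "x = y")
    case False
    then have d: "0 < dist x y" by simp
    have "dist (f x) (f y) / dist x y \<le> lip_const X f"
      unfolding lip_const_def
    proof (rule cInf_greatest)
      show "{C. C-lipschitz_on X f} \<noteq> {}" using assms by (auto simp: Lip_def)
      fix C assume "C \<in> {C. C-lipschitz_on X f}"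
      then show "dist (f x) (f y) / dist x y \<le> C"
        using lipschitz_onD[OF _ xy, of C f] d by (simp add: divide_le_eq)
    qed
    with d show ?thesis by (simp add: divide_le_eq)
  qed simp
qed

lemma Lip_borel_measurable:
  fixes f :: "'a::metric_space \<Rightarrow> real"
  assumes "f \<in> Lip X" "sets M = sets (restrict_space borel X)"
  shows "f \<in> borel_measurable M"
proof -
  have "continuous_on X f" using assms(1) by (auto simp: Lip_def intro: lipschitz_on_continuous_on)
  then have "f \<in> borel_measurable (restrict_space borel X)"
    by (rule borel_measurable_continuous_on_restrict)
  then show ?thesis using measurable_cong_sets[OF assms(2) refl] by blast
qed

lemma space_restrict_borel: "sets M = sets (restrict_space borel X) \<Longrightarrow> space M = X"
  using sets_eq_imp_space_eq[of M "restrict_space borel X"] by (simp add: space_restrict_space)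

lemma Lip_bdd_integrable:
  fixes f :: "'a::metric_space \<Rightarrow> real"
  assumes "f \<in> Lip_bdd X" "sets M = sets (restrict_space borel X)" "finite_measure M"
  shows "integrable M f"
proof -
  interpret finite_measure M by fact
  obtain C B where f: "C-lipschitz_on X f" "0 \<le> B" "\<And>x. x \<in> X \<Longrightarrow> \<bar>f x\<bar> \<le> B" using Lip_bddE[OF assms(1)] by metis
  show ?thesis
    by (rule integrable_const_bound[where B=B])
      (use f space_restrict_borel[OF assms(2)] Lip_borel_measurable[OF Lip_bdd_imp_Lip[OF assms(1)] assms(2)] in auto)
qed

section \<open>Density of bounded Lipschitz functions in L^1\<close>

text \<open>Induction over the Borel sets, from open sets through complements and disjoint countable
  unions. The measure is any finite one on X, so that sums of measures are covered as well.\<close>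

lemma Lip_bdd_approx_indicator_borel:
  fixes X :: "'a::metric_space set"
  assumes M: "sets M = sets (restrict_space borel X)" "finite_measure M" and B: "B \<in> sets borel"
  shows "\<exists>F. (\<forall>n::nat. F n \<in> Lip_bdd X) \<and> (\<lambda>n. \<integral>x. \<bar>F n x - indicator B x\<bar> \<partial>M) \<longlonglongrightarrow> 0"
proof -
  interpret finite_measure M by fact
  note sp = space_restrict_borel[OF M(1)]
  have ind: "indicat_real B \<in> borel_measurable M" if "B \<in> sets borel" for B
  proof -
    have "indicat_real B \<in> borel_measurable (restrict_space borel X)"
      using that by (intro measurable_restrict_space1) auto
    then show ?thesis using measurable_cong_sets[OF M(1) refl] by blast
  qed
  have indi: "integrable M (indicat_real B)" if "B \<in> sets borel" for B
    by (rule integrable_const_bound[where B=1]) (use ind[OF that] in \<open>auto simp: indicator_def\<close>)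
  define P where "P B \<longleftrightarrow> (\<forall>e>0. \<exists>F\<in>Lip_bdd X. (\<integral>x. \<bar>F x - indicator B x\<bar> \<partial>M) < e)" for B
  have gen: "B \<in> sigma_sets UNIV {S :: 'a set. open S}" using B by (simp add: borel_def)
  have "Int_stable {S :: 'a set. open S}" "{S :: 'a set. open S} \<subseteq> Pow UNIV"
    by (auto simp: Int_stable_def)
  from this gen have "P B"
  proof (induction rule: sigma_sets_induct_disjoint)
    case (basic U)
    then have U: "open U" by simp
    show ?case
    proof (cases "U = UNIV")
      case True
      then show ?thesis unfolding P_def by (intro allI impI bexI[of _ "\<lambda>_. 1"] Lip_bdd_const) auto
    next
      case False
      \<comment> \<open>These functions increase to the indicator of U, since the distance to the
        closed complement is positive on U. The whole space has been treated apart because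
        \<open>infdist\<close> to the empty set is 0.\<close>
      define F where "F n x = min 1 (real n * infdist x (- U))" for n x
      have F: "F n \<in> Lip_bdd X" for n
      proof (rule Lip_bddI)
        show "(real n)-lipschitz_on X (F n)"
        proof (rule lipschitz_onI)
          fix x y
          have "\<bar>F n x - F n y\<bar> \<le> \<bar>real n * infdist x (- U) - real n * infdist y (- U)\<bar>"
            unfolding F_def by (auto simp: min_def)
          also have "\<dots> = real n * \<bar>infdist x (- U) - infdist y (- U)\<bar>"
            by (simp add: abs_mult flip: right_diff_distrib)
          also have "\<dots> \<le> real n * dist x y"
            by (intro mult_left_mono infdist_triangle_abs) auto
          finally show "dist (F n x) (F n y) \<le> real n * dist x y" by (simp add: dist_real_def)
        qed simp
        show "\<bar>F n x\<bar> \<le> 1" for x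
          unfolding F_def using infdist_nonneg[of x "- U"] by (auto simp: min_def)
      qed
      have lim: "(\<lambda>n. F n x) \<longlonglongrightarrow> indicator U x" for x
      proof (cases "x \<in> U")
        case True
        then have "infdist x (- U) > 0"
          using U False in_closed_iff_infdist_zero[of "- U" x] infdist_nonneg[of x "- U"] by (auto simp: closed_Compl less_le)
        then obtain N where N: "1 < real N * infdist x (- U)" using ex_less_of_nat_mult by blast
        have "F n x = 1" if "n \<ge> N" for n
        proof -
          have "real N * infdist x (- U) \<le> real n * infdist x (- U)"
            using that infdist_nonneg[of x "- U"] by (intro mult_right_mono) auto
          with N show ?thesis by (simp add: F_def)
        qed
        then have "\<forall>\<^sub>F n in sequentially. F n x = indicator U x"
          using True by (auto simp: eventually_sequentially)
        then show ?thesis by (rule tendsto_eventually)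
      next
        case False
        then have "infdist x (- U) = 0" by simp
        then show ?thesis using False by (simp add: F_def)
      qed
      have "(\<lambda>n. \<integral>x. \<bar>F n x - indicator U x\<bar> \<partial>M) \<longlonglongrightarrow> (\<integral>x. \<bar>indicator U x - indicator U x\<bar> \<partial>M)"
      proof (rule integral_dominated_convergence[where w="\<lambda>_. 1"])
        show "AE x in M. (\<lambda>n. \<bar>F n x - indicator U x\<bar>) \<longlonglongrightarrow> \<bar>indicator U x - indicator U x\<bar>"
          by (intro AE_I2 tendsto_intros lim)
        show "AE x in M. norm \<bar>F n x - indicator U x\<bar> \<le> 1" for n
          by (intro AE_I2) (auto simp: F_def infdist_nonneg min_def indicator_def)
        show "(\<lambda>x. \<bar>F n x - indicator U x\<bar>) \<in> borel_measurable M" for n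
          using ind[of U] U Lip_borel_measurable[OF Lip_bdd_imp_Lip[OF F] M(1)] by (intro borel_measurable_abs borel_measurable_diff) auto
      qed auto
      then have "(\<lambda>n. \<integral>x. \<bar>F n x - indicator U x\<bar> \<partial>M) \<longlonglongrightarrow> 0" by simp
      then have "\<exists>n. (\<integral>x. \<bar>F n x - indicator U x\<bar> \<partial>M) < e" if "e > 0" for e
        using order_tendstoD(2)[OF _ that] eventually_sequentially by (metis (no_types, lifting) order_refl)
      with F show ?thesis unfolding P_def by blast
    qed
  next
    case empty
    show ?case unfolding P_def by (intro allI impI bexI[of _ "\<lambda>_. 0"] Lip_bdd_const) auto
  next
    case (compl A)
    show ?case unfolding P_def
    proof (intro allI impI)
      fix e :: real assume "e > 0"
      with compl.IH obtain F where F: "F \<in> Lip_bdd X" "(\<integral>x. \<bar>F x - indicator A x\<bar> \<partial>M) < e" unfolding P_def by blast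
      have "\<bar>(1 * 1 + (-1) * F x) - indicator (UNIV - A) x\<bar> = \<bar>F x - indicator A x\<bar>" for x
        by (auto simp: indicator_def)
      then show "\<exists>F\<in>Lip_bdd X. (\<integral>x. \<bar>F x - indicator (UNIV - A) x\<bar> \<partial>M) < e"
        using F by (intro bexI[OF _ Lip_bdd_lincomb[OF Lip_bdd_const[of 1] F(1), of 1 "-1"]]) simp
    qed
  next
    case (union A)
    have A: "A i \<in> sets borel" for i using union(2) by (auto simp: borel_def)
    show ?case unfolding P_def
    proof (intro allI impI)
      fix e :: real assume "e > 0"
      have "(\<lambda>n. \<integral>x. \<bar>indicat_real (\<Union>i<n. A i) x - indicat_real (\<Union>i. A i) x\<bar> \<partial>M) \<longlonglongrightarrow> (\<integral>x. \<bar>indicat_real (\<Union>i. A i) x - indicat_real (\<Union>i. A i) x\<bar> \<partial>M)"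
      proof (rule integral_dominated_convergence[where w="\<lambda>_. 1"])
        show "AE x in M. (\<lambda>n. \<bar>indicat_real (\<Union>i<n. A i) x - indicat_real (\<Union>i. A i) x\<bar>) \<longlonglongrightarrow> \<bar>indicat_real (\<Union>i. A i) x - indicat_real (\<Union>i. A i) x :: real\<bar>"
          by (intro AE_I2 tendsto_intros LIMSEQ_indicator_UN)
        show "AE x in M. norm \<bar>indicat_real (\<Union>i<n. A i) x - indicat_real (\<Union>i. A i) x :: real\<bar> \<le> 1" for n
          by (intro AE_I2) (auto simp: indicator_def)
        show "(\<lambda>x. \<bar>indicat_real (\<Union>i<n. A i) x - indicat_real (\<Union>i. A i) x :: real\<bar>) \<in> borel_measurable M" for n
          using ind A by (intro borel_measurable_abs borel_measurable_diff) auto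
      qed auto
      then have "(\<lambda>n. \<integral>x. \<bar>indicat_real (\<Union>i<n. A i) x - indicat_real (\<Union>i. A i) x\<bar> \<partial>M) \<longlonglongrightarrow> 0" by simp
      then have "\<forall>\<^sub>F n in sequentially. (\<integral>x. \<bar>indicat_real (\<Union>i<n. A i) x - indicat_real (\<Union>i. A i) x\<bar> \<partial>M) < e / 2"
        using \<open>e > 0\<close> by (intro order_tendstoD(2)) auto
      then obtain N where N: "(\<integral>x. \<bar>indicat_real (\<Union>i<N. A i) x - indicat_real (\<Union>i. A i) x\<bar> \<partial>M) < e / 2"
        unfolding eventually_sequentially by blast
      \<comment> \<open>Half of e is spent on the tail of the union and the other half is shared by
        N sets; \<open>Suc N\<close> covers the case N = 0.\<close>
      have "\<forall>i. \<exists>F\<in>Lip_bdd X. (\<integral>x. \<bar>F x - indicator (A i) x\<bar> \<partial>M) < e / (2 * real (Suc N))"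
        using union(3) \<open>e > 0\<close> unfolding P_def by auto
      then obtain F where F: "\<And>i. F i \<in> Lip_bdd X" "\<And>i. (\<integral>x. \<bar>F i x - indicator (A i) x\<bar> \<partial>M) < e / (2 * real (Suc N))"
        by metis
      define H where "H x = (\<Sum>i<N. F i x)" for x
      have H: "H \<in> Lip_bdd X" unfolding H_def[abs_def] using F(1) by (intro Lip_bdd_sum)
      have Fi: "integrable M (\<lambda>x. \<bar>F i x - indicator (A i) x\<bar>)" for i
        using Lip_bdd_integrable[OF F(1) M] indi[OF A] by (intro integrable_abs Bochner_Integration.integrable_diff)
      have "(\<integral>x. \<bar>H x - indicat_real (\<Union>i. A i) x\<bar> \<partial>M) \<le>
        (\<integral>x. (\<Sum>i<N. \<bar>F i x - indicator (A i) x\<bar>) + \<bar>indicat_real (\<Union>i<N. A i) x - indicat_real (\<Union>i. A i) x\<bar> \<partial>M)"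
      proof (rule integral_mono)
        show "integrable M (\<lambda>x. \<bar>H x - indicat_real (\<Union>i. A i) x\<bar>)"
          using Lip_bdd_integrable[OF H M] indi A by (intro integrable_abs Bochner_Integration.integrable_diff) auto
        show "integrable M (\<lambda>x. (\<Sum>i<N. \<bar>F i x - indicator (A i) x\<bar>) + \<bar>indicat_real (\<Union>i<N. A i) x - indicat_real (\<Union>i. A i) x\<bar>)"
        proof (rule Bochner_Integration.integrable_add)
          show "integrable M (\<lambda>x. \<Sum>i<N. \<bar>F i x - indicator (A i) x\<bar>)"
            by (rule Bochner_Integration.integrable_sum) (rule Fi)
          show "integrable M (\<lambda>x. \<bar>indicat_real (\<Union>i<N. A i) x - indicat_real (\<Union>i. A i) x\<bar>)"
            using indi A by (intro integrable_abs Bochner_Integration.integrable_diff) auto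
        qed
        fix x
        have "disjoint_family_on A {..<N}" using union(1) by (auto simp: disjoint_family_on_def)
        then have "indicat_real (\<Union>i<N. A i) x = (\<Sum>i<N. indicator (A i) x :: real)"
          by (intro indicator_UN_disjoint) auto
        then have "H x - indicat_real (\<Union>i. A i) x = (\<Sum>i<N. F i x - indicator (A i) x) + (indicat_real (\<Union>i<N. A i) x - indicat_real (\<Union>i. A i) x)"
          by (simp add: H_def sum_subtractf)
        then show "\<bar>H x - indicat_real (\<Union>i. A i) x\<bar> \<le> (\<Sum>i<N. \<bar>F i x - indicator (A i) x\<bar>) + \<bar>indicat_real (\<Union>i<N. A i) x - indicat_real (\<Union>i. A i) x\<bar>"
          using sum_abs[of "\<lambda>i. F i x - indicator (A i) x" "{..<N}"] by linarith
      qed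
      also have "\<dots> = (\<Sum>i<N. \<integral>x. \<bar>F i x - indicator (A i) x\<bar> \<partial>M) + (\<integral>x. \<bar>indicat_real (\<Union>i<N. A i) x - indicat_real (\<Union>i. A i) x\<bar> \<partial>M)"
      proof (subst Bochner_Integration.integral_add)
        show "integrable M (\<lambda>x. \<bar>indicat_real (\<Union>i<N. A i) x - indicat_real (\<Union>i. A i) x :: real\<bar>)"
          using indi A by (intro integrable_abs Bochner_Integration.integrable_diff) auto
      qed (use Fi in \<open>auto intro: Bochner_Integration.integrable_sum\<close>)
      also have "\<dots> < (\<Sum>i<N. e / (2 * real (Suc N))) + e / 2"
        using N F(2) by (intro add_le_less_mono sum_mono less_imp_le) auto
      also have "\<dots> \<le> e" using \<open>e > 0\<close> by (simp add: field_simps)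
      finally show "\<exists>F\<in>Lip_bdd X. (\<integral>x. \<bar>F x - indicat_real (\<Union>i. A i) x\<bar> \<partial>M) < e" using H by blast
    qed
  qed
  then have "\<forall>n::nat. \<exists>F\<in>Lip_bdd X. (\<integral>x. \<bar>F x - indicator B x\<bar> \<partial>M) < inverse (real (Suc n))"
    unfolding P_def by auto
  then obtain F where F: "\<And>n. F n \<in> Lip_bdd X" "\<And>n. (\<integral>x. \<bar>F n x - indicator B x\<bar> \<partial>M) < inverse (real (Suc n))"
    by metis
  have "(\<lambda>n. \<integral>x. \<bar>F n x - indicator B x\<bar> \<partial>M) \<longlonglongrightarrow> 0"
    by (rule tendsto_sandwich[OF _ _ tendsto_const LIMSEQ_inverse_real_of_nat])
      (use F(2) in \<open>auto intro!: always_eventually less_imp_le\<close>)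
  with F(1) show ?thesis by blast
qed

section \<open>Identification of mass measures, and Hausdorff null sets\<close>

text \<open>Two minimal dominating measures bound each other on every set and so coincide;
  exhibiting one therefore evaluates the description.\<close>

lemma mass_measure_eqI:
  assumes "mass_dominated k X T \<mu>"
    and "\<And>\<nu> A. mass_dominated k X T \<nu> \<Longrightarrow> A \<in> sets (restrict_space borel X) \<Longrightarrow> emeasure \<mu> A \<le> emeasure \<nu> A"
  shows "mass_measure k X T = \<mu>"
  unfolding mass_measure_def
proof (rule the_equality)
  fix \<mu>' assume \<mu>': "mass_dominated k X T \<mu>' \<and> (\<forall>\<nu>. mass_dominated k X T \<nu> \<longrightarrow>
    (\<forall>A\<in>sets (restrict_space borel X). emeasure \<mu>' A \<le> emeasure \<nu> A))"
  show "\<mu>' = \<mu>"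
  proof (rule measure_eqI)
    show s: "sets \<mu>' = sets \<mu>" using \<mu>' assms(1) by (simp add: mass_dominated_def)
    fix A assume "A \<in> sets \<mu>'"
    then have "A \<in> sets (restrict_space borel X)" using \<mu>' by (simp add: mass_dominated_def)
    then show "emeasure \<mu>' A = emeasure \<mu> A" using \<mu>' assms by (intro antisym) auto
  qed
qed (use assms in auto)

text \<open>A covering by sets of small total diameter becomes a covering by intervals whose total
  length is at most 2 L times as large. Coverings at scale 1 suffice, since the total diameter is
  all that enters.\<close>

lemma hausdorff1_null_lipschitz_image:
  fixes \<psi> :: "'a::metric_space \<Rightarrow> real"
  assumes "hausdorff1 N = 0" and \<psi>: "\<And>x y. x \<in> N \<Longrightarrow> y \<in> N \<Longrightarrow> \<bar>\<psi> x - \<psi> y\<bar> \<le> L * dist x y" and "0 \<le> L"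
  shows "negligible (\<psi> ` N)"
  unfolding negligible_outer_le
proof (intro allI impI)
  fix e :: real assume "e > 0"
  \<comment> \<open>The summand 1 takes care of L = 0, and still \<open>2 * L * \<epsilon>\<close>
    \<le> e.\<close>
  define \<epsilon> where "\<epsilon> = e / (2 * L + 1)"
  have "\<epsilon> > 0" using \<open>e > 0\<close> \<open>0 \<le> L\<close> by (simp add: \<epsilon>_def)
  have "hausdorff1_delta 1 N \<le> 0"
    using SUP_upper[of "1::real" "{0<..}" "\<lambda>\<delta>. hausdorff1_delta \<delta> N"] assms(1) by (simp add: hausdorff1_def)
  then have "hausdorff1_delta 1 N < ennreal \<epsilon>" using \<open>\<epsilon> > 0\<close> by simp
  then obtain C :: "nat \<Rightarrow> 'a set" where C: "N \<subseteq> (\<Union>i. C i)" "\<And>i. bounded (C i)" "(\<Sum>i. ennreal (diameter (C i))) < ennreal \<epsilon>"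
    unfolding hausdorff1_delta_def by (auto simp: INF_less_iff)
  define y where "y i = (SOME y. y \<in> N \<inter> C i)" for i
  define D where "D i = (if N \<inter> C i = {} then {} else cball (\<psi> (y i)) (L * diameter (C i)))" for i
  have y: "y i \<in> N \<inter> C i" if "N \<inter> C i \<noteq> {}" for i
    unfolding y_def using that by (metis someI_ex ex_in_conv)
  have diam: "0 \<le> diameter (C i)" for i using C(2) by (rule diameter_ge_0)
  have eD: "emeasure lborel (D i) \<le> ennreal (2 * L) * ennreal (diameter (C i))" for i
  proof (cases "N \<inter> C i = {}")
    case False
    then have "D i = {\<psi> (y i) - L * diameter (C i)..\<psi> (y i) + L * diameter (C i)}"
      by (auto simp: D_def cball_def dist_real_def)
    then show ?thesis using diam[of i] \<open>0 \<le> L\<close> by (simp flip: ennreal_mult')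
  qed (simp add: D_def)
  have Db: "D i \<in> sets borel" for i by (auto simp: D_def)
  have "emeasure lborel (\<Union>i. D i) \<le> (\<Sum>i. emeasure lborel (D i))"
    by (rule emeasure_subadditive_countably) (use Db in auto)
  also have "\<dots> \<le> (\<Sum>i. ennreal (2 * L) * ennreal (diameter (C i)))"
    using eD by (intro suminf_le) auto
  also have "\<dots> = ennreal (2 * L) * (\<Sum>i. ennreal (diameter (C i)))" by simp
  also have "\<dots> \<le> ennreal (2 * L) * ennreal \<epsilon>" using C(3) by (intro mult_left_mono) auto
  also have "\<dots> = ennreal (2 * L * \<epsilon>)" using \<open>0 \<le> L\<close> by (simp flip: ennreal_mult')
  also have "\<dots> \<le> ennreal e"
    using \<open>e > 0\<close> \<open>0 \<le> L\<close> by (intro ennreal_leI) (simp add: \<epsilon>_def field_simps)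
  finally have em: "emeasure lborel (\<Union>i. D i) \<le> ennreal e" .
  have "\<psi> ` N \<subseteq> (\<Union>i. D i)"
  proof
    fix z assume "z \<in> \<psi> ` N"
    then obtain x where x: "x \<in> N" "z = \<psi> x" by auto
    then obtain i where i: "x \<in> C i" using C(1) by auto
    then have ne: "N \<inter> C i \<noteq> {}" using x by auto
    have "\<bar>\<psi> (y i) - \<psi> x\<bar> \<le> L * dist (y i) x" using \<psi> y[OF ne] x by auto
    also have "\<dots> \<le> L * diameter (C i)"
      using diameter_bounded_bound[OF C(2)] y[OF ne] i \<open>0 \<le> L\<close> by (intro mult_left_mono) auto
    finally have "z \<in> D i" using ne x by (simp add: D_def dist_real_def)
    then show "z \<in> (\<Union>i. D i)" by auto
  qed
  moreover have "(\<Union>i. D i) \<in> lmeasurable"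
  proof (rule fmeasurableI)
    have "(\<Union>i. D i) \<in> sets borel" using Db by auto
    then show "(\<Union>i. D i) \<in> sets lebesgue" "emeasure lebesgue (\<Union>i. D i) < \<infinity>"
      using em by (auto intro: le_less_trans)
  qed
  moreover have "measure lebesgue (\<Union>i. D i) \<le> e"
  proof -
    have "(\<Union>i. D i) \<in> sets borel" using Db by auto
    then show ?thesis using em \<open>e > 0\<close> unfolding measure_def by (intro enn2real_leI) auto
  qed
  ultimately show "\<exists>T. \<psi> ` N \<subseteq> T \<and> T \<in> lmeasurable \<and> measure lebesgue T \<le> e" by blast
qed

lemma hausdorff1_finite:
  fixes A :: "'a::metric_space set"
  assumes "finite A"
  shows "hausdorff1 A = 0"
proof -
  have "hausdorff1_delta \<delta> A \<le> 0" if "\<delta> > 0" for \<delta>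
  proof -
    define C where "C i = (if A = {} then {} else {from_nat_into A i})" for i
    have "hausdorff1_delta \<delta> A \<le> (\<Sum>i. ennreal (diameter (C i)))"
      unfolding hausdorff1_delta_def
    proof (rule INF_lower, safe)
      fix x assume "x \<in> A"
      then show "x \<in> (\<Union>i. C i)"
        using from_nat_into_surj[OF countable_finite[OF assms], of x] by (auto simp: C_def)
    qed (use that in \<open>auto simp: C_def\<close>)
    also have "\<dots> = 0" by (cases "A = {}") (simp_all add: C_def)
    finally show ?thesis .
  qed
  then show ?thesis unfolding hausdorff1_def by (auto intro!: antisym SUP_least)
qed

section \<open>Currents of dimension zero\<close>

text \<open>Cones of height one over x with slope n: Lipschitz functions that shrink to the
  indicator of a point and thereby read off the atom there.\<close>

definition bump :: "nat \<Rightarrow> 'a::metric_space \<Rightarrow> 'a \<Rightarrow> real" where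
  "bump n x y = max 0 (1 - real n * dist x y)"

lemma bump_bounds: "0 \<le> bump n x y" "bump n x y \<le> 1" "bump n x x = 1"
  by (auto simp: bump_def)

lemma bump_Lip_bdd: "bump n x \<in> Lip_bdd X"
proof (rule Lip_bddI)
  show "(real n)-lipschitz_on X (bump n x)"
  proof (rule lipschitz_onI)
    fix y z
    have "\<bar>bump n x y - bump n x z\<bar> \<le> \<bar>real n * dist x y - real n * dist x z\<bar>"
      by (auto simp: bump_def max_def)
    also have "\<dots> = real n * \<bar>dist x y - dist x z\<bar>"
      by (simp add: abs_mult flip: right_diff_distrib)
    also have "\<dots> \<le> real n * dist y z"
      using dist_triangle[of x y z] dist_triangle[of x z y]
      by (intro mult_left_mono) (auto simp: abs_le_iff dist_commute)
    finally show "dist (bump n x y) (bump n x z) \<le> real n * dist y z" by (simp add: dist_real_def)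
  qed simp
  show "\<bar>bump n x y\<bar> \<le> 1" for y using bump_bounds(1,2)[of n x y] by simp
qed

lemma bump_tendsto: "(\<lambda>n. bump n x y) \<longlonglongrightarrow> indicator {x} y"
proof (cases "x = y")
  case False
  then obtain N where N: "1 < real N * dist x y" using ex_less_of_nat_mult[of "dist x y" 1] by auto
  have "bump n x y = 0" if "n \<ge> N" for n
  proof -
    have "real N * dist x y \<le> real n * dist x y" using that by (intro mult_right_mono) auto
    with N show ?thesis by (simp add: bump_def)
  qed
  then have "\<forall>\<^sub>F n in sequentially. bump n x y = indicator {x} y"
    using False by (auto simp: eventually_sequentially)
  then show ?thesis by (rule tendsto_eventually)
qed (simp add: bump_bounds)

text \<open>In the limit the shrinking bumps see just one of the finitely many atoms. This recovers
  the coefficients from the values of T and makes them unique.\<close>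

lemma point_mass_sum_bump_limit:
  assumes "point_mass_sum X T m"
  shows "(\<lambda>n. T (bump n x) []) \<longlonglongrightarrow> real_of_int (m x)"
proof -
  have "(\<lambda>n. \<Sum>y | m y \<noteq> 0. real_of_int (m y) * bump n x y) \<longlonglongrightarrow> (\<Sum>y | m y \<noteq> 0. real_of_int (m y) * indicator {x} y)"
    by (intro tendsto_intros bump_tendsto)
  also have "(\<Sum>y | m y \<noteq> 0. real_of_int (m y) * indicator {x} y) = (\<Sum>y | m y \<noteq> 0. if y = x then real_of_int (m y) else 0)"
    by (intro sum.cong) (auto simp: indicator_def)
  also have "\<dots> = real_of_int (m x)"
    using assms by (simp add: point_mass_sum_def)
  finally have lim: "(\<lambda>n. \<Sum>y | m y \<noteq> 0. real_of_int (m y) * bump n x y) \<longlonglongrightarrow> real_of_int (m x)" .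
  have "T (bump n x) [] = (\<Sum>y | m y \<noteq> 0. real_of_int (m y) * bump n x y)" for n
    using assms bump_Lip_bdd[of n x X] by (simp add: point_mass_sum_def)
  then show ?thesis using lim by (simp only:)
qed

lemma point_mass_sum_unique:
  assumes "point_mass_sum X T m" "point_mass_sum X T m'"
  shows "m = m'"
proof
  fix x
  show "m x = m' x"
    using LIMSEQ_unique[OF assms[THEN point_mass_sum_bump_limit]] by simp
qed

lemma point_coeff_eq: "point_mass_sum X T m \<Longrightarrow> point_coeff X T = m"
  unfolding point_coeff_def by (rule the_equality) (auto dest: point_mass_sum_unique)

text \<open>The variation of the sum of point masses, transported to the Borel sets of X, on which
  dominating measures are compared.\<close>

definition atomic_measure :: "'a::metric_space set \<Rightarrow> ('a \<Rightarrow> int) \<Rightarrow> 'a measure" where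
  "atomic_measure X m = distr (point_measure {x. m x \<noteq> 0} (\<lambda>x. ennreal \<bar>real_of_int (m x)\<bar>)) (restrict_space borel X) (\<lambda>x. x)"

context
  fixes X :: "'a::metric_space set" and T :: "'a functional" and m :: "'a \<Rightarrow> int"
  assumes T: "point_mass_sum X T m"
begin

lemma atomic_fin: "finite {x. m x \<noteq> 0}" and atomic_sub: "{x. m x \<noteq> 0} \<subseteq> X"
  using T by (auto simp: point_mass_sum_def)

lemma atomic_measurable: "(\<lambda>x. x) \<in> measurable (point_measure {x. m x \<noteq> 0} w) (restrict_space borel X)"
  using atomic_sub by (auto simp: measurable_def point_measure_def space_restrict_space)

lemma emeasure_atomic_measure:
  assumes "A \<in> sets (restrict_space borel X)"
  shows "emeasure (atomic_measure X m) A = (\<Sum>x\<in>{x. m x \<noteq> 0} \<inter> A. ennreal \<bar>real_of_int (m x)\<bar>)"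
proof -
  have "emeasure (atomic_measure X m) A = emeasure (point_measure {x. m x \<noteq> 0} (\<lambda>x. ennreal \<bar>real_of_int (m x)\<bar>)) ({x. m x \<noteq> 0} \<inter> A)"
    unfolding atomic_measure_def using assms
    by (subst emeasure_distr[OF atomic_measurable]) (auto simp: space_point_measure Int_commute)
  also have "\<dots> = (\<Sum>x\<in>{x. m x \<noteq> 0} \<inter> A. ennreal \<bar>real_of_int (m x)\<bar>)"
    using atomic_fin by (intro emeasure_point_measure_finite2) auto
  finally show ?thesis .
qed

lemma finite_atomic_measure: "finite_measure (atomic_measure X m)"
proof (rule finite_measureI)
  have "space (atomic_measure X m) = X" by (simp add: atomic_measure_def space_restrict_space)
  moreover have "X \<in> sets (restrict_space borel X)"
    using sets.top[of "restrict_space borel X"] by (simp add: space_restrict_space)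
  ultimately show "emeasure (atomic_measure X m) (space (atomic_measure X m)) \<noteq> \<infinity>"
    using atomic_fin by (simp add: emeasure_atomic_measure sum_ennreal)
qed

lemma integral_atomic_measure:
  assumes "f \<in> borel_measurable (restrict_space borel X)"
  shows "(\<integral>x. f x \<partial>atomic_measure X m) = (\<Sum>x | m x \<noteq> 0. \<bar>real_of_int (m x)\<bar> * f x)"
  unfolding atomic_measure_def using atomic_fin
  by (subst integral_distr[OF atomic_measurable assms]) (simp add: lebesgue_integral_point_measure_finite)

lemma mass_dominated_atomic: "mass_dominated 0 X T (atomic_measure X m)"
  unfolding mass_dominated_def
proof (intro conjI)
  show "sets (atomic_measure X m) = sets (restrict_space borel X)" by (simp add: atomic_measure_def)
  show "finite_measure (atomic_measure X m)" by (rule finite_atomic_measure)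
  show "\<forall>(f, ps)\<in>forms 0 X. \<bar>T f ps\<bar> \<le> (\<Prod>p\<leftarrow>ps. lip_const X p) * (\<integral>x. \<bar>f x\<bar> \<partial>atomic_measure X m)"
  proof clarify
    fix f ps assume "(f, ps) \<in> forms 0 X"
    then have f: "f \<in> Lip_bdd X" and ps: "ps = []" by (auto simp: forms_def)
    have fm: "(\<lambda>x. \<bar>f x\<bar>) \<in> borel_measurable (restrict_space borel X)"
      using Lip_borel_measurable[OF Lip_bdd_imp_Lip[OF f] refl] by simp
    have "\<bar>T f ps\<bar> = \<bar>\<Sum>x | m x \<noteq> 0. real_of_int (m x) * f x\<bar>"
      using T f ps by (simp add: point_mass_sum_def)
    also have "\<dots> \<le> (\<Sum>x | m x \<noteq> 0. \<bar>real_of_int (m x)\<bar> * \<bar>f x\<bar>)"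
      using sum_abs[of "\<lambda>x. real_of_int (m x) * f x"] by (simp add: abs_mult)
    finally show "\<bar>T f ps\<bar> \<le> (\<Prod>p\<leftarrow>ps. lip_const X p) * (\<integral>x. \<bar>f x\<bar> \<partial>atomic_measure X m)"
      using ps by (simp add: integral_atomic_measure[OF fm])
  qed
qed

lemma singleton_sets: "x \<in> X \<Longrightarrow> {x} \<in> sets (restrict_space borel X)"
  by (auto simp: sets_restrict_space intro!: image_eqI[of _ _ "{x}"])

text \<open>Bumps at x show that every dominating measure gives {x} at least the absolute value of
  the coefficient at x; summing over the finitely many atoms in A gives the bound.\<close>

lemma atomic_measure_minimal:
  assumes \<nu>: "mass_dominated 0 X T \<nu>" and A: "A \<in> sets (restrict_space borel X)"
  shows "emeasure (atomic_measure X m) A \<le> emeasure \<nu> A"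
proof -
  have s: "sets \<nu> = sets (restrict_space borel X)" using \<nu> by (simp add: mass_dominated_def)
  interpret \<nu>: finite_measure \<nu> using \<nu> by (simp add: mass_dominated_def)
  have pt: "\<bar>real_of_int (m x)\<bar> \<le> measure \<nu> {x}" if "x \<in> X" for x
  proof -
    have bm: "bump n x \<in> borel_measurable \<nu>" for n
      using Lip_borel_measurable[OF Lip_bdd_imp_Lip[OF bump_Lip_bdd] s] .
    have "(\<lambda>n. \<integral>y. \<bar>bump n x y\<bar> \<partial>\<nu>) \<longlonglongrightarrow> (\<integral>y. indicator {x} y \<partial>\<nu>)"
    proof (rule integral_dominated_convergence[where w="\<lambda>_. 1"])
      show "indicat_real {x} \<in> borel_measurable \<nu>" using singleton_sets[OF that] s by simp
      show "AE y in \<nu>. (\<lambda>n. \<bar>bump n x y\<bar>) \<longlonglongrightarrow> indicat_real {x} y"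
        using bump_tendsto by (auto simp: abs_of_nonneg[OF bump_bounds(1)])
      show "AE y in \<nu>. norm \<bar>bump n x y\<bar> \<le> 1" for n using bump_bounds(2) by (intro AE_I2) (simp add: abs_of_nonneg[OF bump_bounds(1)])
      show "(\<lambda>y. \<bar>bump n x y\<bar>) \<in> borel_measurable \<nu>" for n using bm by simp
    qed auto
    then have lim1: "(\<lambda>n. \<integral>y. \<bar>bump n x y\<bar> \<partial>\<nu>) \<longlonglongrightarrow> measure \<nu> {x}"
      using singleton_sets[OF that] s by simp
    have lim2: "(\<lambda>n. \<bar>T (bump n x) []\<bar>) \<longlonglongrightarrow> \<bar>real_of_int (m x)\<bar>"
      using point_mass_sum_bump_limit[OF T] by (rule tendsto_rabs)
    have "\<bar>T (bump n x) []\<bar> \<le> (\<integral>y. \<bar>bump n x y\<bar> \<partial>\<nu>)" for n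
      using \<nu> bump_Lip_bdd[of n x X] unfolding mass_dominated_def forms_def by fastforce
    then show ?thesis by (intro LIMSEQ_le[OF lim2 lim1]) auto
  qed
  let ?F = "{x. m x \<noteq> 0} \<inter> A"
  have FX: "?F \<subseteq> X" using atomic_sub by auto
  have "emeasure (atomic_measure X m) A = (\<Sum>x\<in>?F. ennreal \<bar>real_of_int (m x)\<bar>)"
    by (rule emeasure_atomic_measure[OF A])
  also have "\<dots> \<le> (\<Sum>x\<in>?F. emeasure \<nu> {x})"
    using pt FX by (intro sum_mono) (auto simp: \<nu>.emeasure_eq_measure)
  also have "\<dots> = emeasure \<nu> ?F"
    using atomic_fin FX singleton_sets s by (intro emeasure_eq_sum_singleton[symmetric]) auto
  also have "\<dots> \<le> emeasure \<nu> A" using A s by (intro emeasure_mono) auto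
  finally show ?thesis .
qed

lemma mass_point_mass_sum: "mass 0 X T = (\<Sum>x | m x \<noteq> 0. \<bar>real_of_int (m x)\<bar>)"
proof -
  have "mass_measure 0 X T = atomic_measure X m"
    using mass_dominated_atomic atomic_measure_minimal by (rule mass_measure_eqI)
  moreover have "X \<in> sets (restrict_space borel X)"
    using sets.top[of "restrict_space borel X"] by (simp add: space_restrict_space)
  ultimately have "mass 0 X T = enn2real (\<Sum>x\<in>{x. m x \<noteq> 0} \<inter> X. ennreal \<bar>real_of_int (m x)\<bar>)"
    by (simp add: mass_def measure_def emeasure_atomic_measure)
  moreover have "{x. m x \<noteq> 0} \<inter> X = {x. m x \<noteq> 0}" using atomic_sub by auto
  ultimately show ?thesis by (simp add: sum_ennreal sum_nonneg)
qed

lemma point_mass_sum_integer_rectifiable_0: "T \<in> integer_rectifiable_0 X"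
proof -
  have val: "T f [] = (\<Sum>x | m x \<noteq> 0. real_of_int (m x) * f x)" if "f \<in> Lip_bdd X" for f
    using T that by (simp add: point_mass_sum_def)
  have "multilinear 0 X T"
    unfolding multilinear_def forms_def
    by (auto simp: val Lip_bdd_lincomb sum.distrib sum_distrib_left algebra_simps)
  moreover have "continuity_axiom 0 X T"
    unfolding continuity_axiom_def forms_def by auto
  moreover have "locality_axiom 0 X T" by (simp add: locality_axiom_def)
  ultimately show ?thesis
    unfolding integer_rectifiable_0_def metric_currents_def using mass_dominated_atomic T by auto
qed

end

section \<open>Half edges\<close>

text \<open>Edges are cut at their midpoints: unlike a whole edge, which may be a loop or have a shortcut, a
  half edge is isometrically embedded.\<close>

definition half_lo :: "('a, 'e) metric_graph \<Rightarrow> 'e \<times> bool \<Rightarrow> real" where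
  "half_lo G h = (if snd h then 0 else len G (fst h) / 2)"

definition half_hi :: "('a, 'e) metric_graph \<Rightarrow> 'e \<times> bool \<Rightarrow> real" where
  "half_hi G h = (if snd h then len G (fst h) / 2 else len G (fst h))"

abbreviation half_dom :: "('a, 'e) metric_graph \<Rightarrow> 'e \<times> bool \<Rightarrow> real set" where
  "half_dom G h \<equiv> {half_lo G h<..<half_hi G h}"

abbreviation half_set :: "('a, 'e) metric_graph \<Rightarrow> 'e \<times> bool \<Rightarrow> 'a set" where
  "half_set G h \<equiv> param G (fst h) ` half_dom G h"

definition halves :: "('a, 'e) metric_graph \<Rightarrow> ('e \<times> bool) set" where
  "halves G = edges G \<times> UNIV"

section \<open>Lipschitz functions on the graph and the geometry of half edges\<close>

text \<open>A function prescribed by vertex values and edge profiles. An interior point of an edge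
  comes from one pair (e, t) only, so the choice is unambiguous; at the two ends the profile has to
  agree with the vertex values for the formula to hold on the closed edge.\<close>

definition glue :: "('a, 'e) metric_graph \<Rightarrow> ('a \<Rightarrow> real) \<Rightarrow> ('e \<Rightarrow> real \<Rightarrow> real) \<Rightarrow> 'a \<Rightarrow> real" where
  "glue G val k x = (if x \<in> verts G then val x
     else case (SOME p. fst p \<in> edges G \<and> snd p \<in> {0<..<len G (fst p)} \<and> param G (fst p) (snd p) = x) of (e, t) \<Rightarrow> k e t)"

text \<open>The distance along an edge to its nearer end, with slope 1 on the first and -1 on the
  second half. It bounds distances in the graph from below and is the form against which mass is
  detected.\<close>

definition tent :: "('a, 'e) metric_graph \<Rightarrow> 'a \<Rightarrow> real" where
  "tent G = glue G (\<lambda>_. 0) (\<lambda>e t. min t (len G e - t))"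

lemma chain_length_nonneg: "0 \<le> chain_length c"
  unfolding chain_length_def by (induction c) auto

locale fin_metric_graph =
  fixes G :: "('a::metric_space, 'e) metric_graph"
  assumes graph: "finite_connected_metric_graph G"
begin

lemma fin_verts: "finite (verts G)" and fin_edges: "finite (edges G)"
  using graph by (auto simp: finite_connected_metric_graph_def)

lemma fin_halves: "finite (halves G)"
  using fin_edges by (simp add: halves_def)

context
  fixes e assumes e: "e \<in> edges G"
begin

lemma len_pos: "0 < len G e"
  and param_0: "param G e 0 \<in> verts G" and param_len: "param G e (len G e) \<in> verts G"
  and param_inj: "inj_on (param G e) {0<..<len G e}"
  using e graph by (auto simp: finite_connected_metric_graph_def)

lemma interior_not_vertex: "t \<in> {0<..<len G e} \<Longrightarrow> param G e t \<notin> verts G"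
  using e graph unfolding finite_connected_metric_graph_def edge_interior_def by blast

lemma param_in_points: "t \<in> {0..len G e} \<Longrightarrow> param G e t \<in> points G"
  unfolding points_def edge_set_def using e by blast

end

lemma interiors_disjoint:
  assumes "e \<in> edges G" "e' \<in> edges G" "t \<in> {0<..<len G e}" "t' \<in> {0<..<len G e'}"
    and "param G e t = param G e' t'"
  shows "e = e' \<and> t = t'"
proof -
  have "param G e t \<in> edge_interior G e" "param G e t \<in> edge_interior G e'"
    using imageI[OF assms(3), of "param G e"] imageI[OF assms(4), of "param G e'"] assms(5)
    by (simp_all add: edge_interior_def)
  then have "edge_interior G e \<inter> edge_interior G e' \<noteq> {}" by blast
  then have "e = e'" using assms(1,2) graph unfolding finite_connected_metric_graph_def by blast
  then show ?thesis using inj_onD[OF param_inj[OF assms(1)]] assms by auto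
qed

lemma dist_points: "x \<in> points G \<Longrightarrow> y \<in> points G \<Longrightarrow> dist x y = Inf {chain_length c | c. chain G x c y}"
  and chain_ex: "x \<in> points G \<Longrightarrow> y \<in> points G \<Longrightarrow> \<exists>c. chain G x c y"
  using graph by (auto simp: finite_connected_metric_graph_def)

lemma param_lipschitz:
  assumes "e \<in> edges G"
  shows "1-lipschitz_on {0..len G e} (param G e)"
proof (rule lipschitz_onI)
  fix s t assume st: "s \<in> {0..len G e}" "t \<in> {0..len G e}"
  have c: "chain G (param G e s) [(e, s, t)] (param G e t)" using st assms by simp
  have "dist (param G e s) (param G e t) = Inf {chain_length c | c. chain G (param G e s) c (param G e t)}"
    using st assms by (intro dist_points param_in_points)
  also have "\<dots> \<le> chain_length [(e, s, t)]"
    using c by (intro cInf_lower bdd_belowI[of _ 0]) (auto simp: chain_length_nonneg)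
  finally show "dist (param G e s) (param G e t) \<le> 1 * dist s t"
    by (simp add: chain_length_def dist_real_def abs_minus_commute)
qed simp

text \<open>Distances are infima of chain lengths, and along a chain the increments of F telescope,
  each being controlled within one edge. The case L = 0 is separate because the other case divides
  by L.\<close>

lemma edgewise_lipschitz:
  fixes F :: "'a \<Rightarrow> real"
  assumes F: "\<And>e. e \<in> edges G \<Longrightarrow> L-lipschitz_on {0..len G e} (\<lambda>t. F (param G e t))" and "0 \<le> L"
  shows "L-lipschitz_on (points G) F"
proof (rule lipschitz_onI[OF _ \<open>0 \<le> L\<close>])
  fix x y assume xy: "x \<in> points G" "y \<in> points G"
  have ch: "\<bar>F x - F y\<bar> \<le> L * chain_length c" if "chain G x c y" for x y c
    using that
  proof (induction c arbitrary: x)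
    case Nil
    then show ?case by (simp add: chain_length_def)
  next
    case (Cons a c)
    obtain e s t where a: "a = (e, s, t)" by (cases a) auto
    have h: "e \<in> edges G" "s \<in> {0..len G e}" "t \<in> {0..len G e}" "param G e s = x" "chain G (param G e t) c y"
      using Cons.prems a by auto
    have "\<bar>F (param G e s) - F (param G e t)\<bar> \<le> L * \<bar>s - t\<bar>"
      using lipschitz_onD[OF F[OF h(1)] h(2,3)] by (simp add: dist_real_def)
    moreover have "\<bar>F (param G e t) - F y\<bar> \<le> L * chain_length c" using Cons.IH h by auto
    moreover have "chain_length (a # c) = \<bar>s - t\<bar> + chain_length c"
      by (simp add: a chain_length_def abs_minus_commute)
    ultimately show ?case using h(4) by (simp add: distrib_left)
  qed
  show "dist (F x) (F y) \<le> L * dist x y"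
  proof (cases "L = 0")
    case True
    then show ?thesis using ch chain_ex[OF xy] by (auto simp: dist_real_def)
  next
    case False
    then have L: "0 < L" using \<open>0 \<le> L\<close> by simp
    have "\<bar>F x - F y\<bar> / L \<le> dist x y"
      unfolding dist_points[OF xy]
    proof (rule cInf_greatest)
      show "{chain_length c |c. chain G x c y} \<noteq> {}" using chain_ex[OF xy] by auto
      fix z assume "z \<in> {chain_length c |c. chain G x c y}"
      then show "\<bar>F x - F y\<bar> / L \<le> z" using ch L by (auto simp: divide_le_eq mult.commute)
    qed
    then show ?thesis using L by (simp add: dist_real_def divide_le_eq mult.commute)
  qed
qed

lemma glue_param:
  assumes e: "e \<in> edges G" and t: "t \<in> {0..len G e}"
    and "k e 0 = val (param G e 0)" "k e (len G e) = val (param G e (len G e))"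
  shows "glue G val k (param G e t) = k e t"
proof (cases "t = 0 \<or> t = len G e")
  case True
  then show ?thesis using param_0[OF e] param_len[OF e] assms(3,4) by (auto simp: glue_def)
next
  case False
  then have t': "t \<in> {0<..<len G e}" using t by auto
  have "(SOME p. fst p \<in> edges G \<and> snd p \<in> {0<..<len G (fst p)} \<and> param G (fst p) (snd p) = param G e t) = (e, t)"
  proof (rule some_equality)
    fix p assume "fst p \<in> edges G \<and> snd p \<in> {0<..<len G (fst p)} \<and> param G (fst p) (snd p) = param G e t"
    then show "p = (e, t)" using interiors_disjoint[of "fst p" e "snd p" t] e t' by (metis prod.collapse)
  qed (use e t' in auto)
  then show ?thesis using interior_not_vertex[OF e t'] by (simp add: glue_def)
qed

lemma glue_lipschitz:
  assumes "\<And>e. e \<in> edges G \<Longrightarrow> k e 0 = val (param G e 0)" "\<And>e. e \<in> edges G \<Longrightarrow> k e (len G e) = val (param G e (len G e))"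
    and lip: "\<And>e. e \<in> edges G \<Longrightarrow> L-lipschitz_on {0..len G e} (k e)" and "0 \<le> L"
  shows "L-lipschitz_on (points G) (glue G val k)"
proof (rule edgewise_lipschitz[OF _ \<open>0 \<le> L\<close>])
  fix e assume e: "e \<in> edges G"
  show "L-lipschitz_on {0..len G e} (\<lambda>t. glue G val k (param G e t))"
    using lip[OF e] by (rule lipschitz_on_transform) (simp add: glue_param[where k=k and val=val and e=e, OF e _ assms(1)[OF e] assms(2)[OF e]])
qed

lemma tent_param: "e \<in> edges G \<Longrightarrow> t \<in> {0..len G e} \<Longrightarrow> tent G (param G e t) = min t (len G e - t)"
  unfolding tent_def by (subst glue_param) (auto dest: len_pos)

lemma tent_lipschitz: "1-lipschitz_on (points G) (tent G)"
  unfolding tent_def by (rule glue_lipschitz) (auto dest: len_pos intro!: lipschitz_onI simp: dist_real_def)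

lemma half_lo_less_hi: "h \<in> halves G \<Longrightarrow> half_lo G h < half_hi G h"
  using len_pos by (auto simp: halves_def half_lo_def half_hi_def)

lemma half_closed_subset: "h \<in> halves G \<Longrightarrow> {half_lo G h..half_hi G h} \<subseteq> {0..len G (fst h)}"
  using len_pos[of "fst h"] by (auto simp: halves_def half_lo_def half_hi_def split: if_splits)

lemma half_open_subset: "h \<in> halves G \<Longrightarrow> half_dom G h \<subseteq> {0<..<len G (fst h)}"
  using len_pos[of "fst h"] by (auto simp: halves_def half_lo_def half_hi_def split: if_splits)

lemma half_fst: "h \<in> halves G \<Longrightarrow> fst h \<in> edges G"
  by (auto simp: halves_def)

text \<open>The segment is itself a chain, whence the upper bound. For the lower one, the tent
  function is 1-Lipschitz on the graph and on a half edge equals the parameter up to sign and an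
  additive constant.\<close>

lemma half_isometry:
  assumes h: "h \<in> halves G" and st: "s \<in> {half_lo G h..half_hi G h}" "t \<in> {half_lo G h..half_hi G h}"
  shows "dist (param G (fst h) s) (param G (fst h) t) = \<bar>s - t\<bar>"
proof (rule antisym)
  have e: "fst h \<in> edges G" using h by (rule half_fst)
  have st': "s \<in> {0..len G (fst h)}" "t \<in> {0..len G (fst h)}" using st half_closed_subset[OF h] by auto
  show "dist (param G (fst h) s) (param G (fst h) t) \<le> \<bar>s - t\<bar>"
    using lipschitz_onD[OF param_lipschitz[OF e] st'] by (simp add: dist_real_def)
  have "\<bar>tent G (param G (fst h) s) - tent G (param G (fst h) t)\<bar> \<le> dist (param G (fst h) s) (param G (fst h) t)"
    using lipschitz_onD[OF tent_lipschitz param_in_points[OF e st'(1)] param_in_points[OF e st'(2)]] by (simp add: dist_real_def)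
  then show "\<bar>s - t\<bar> \<le> dist (param G (fst h) s) (param G (fst h) t)"
    using st unfolding tent_param[OF e st'(1)] tent_param[OF e st'(2)]
    by (auto simp: half_lo_def half_hi_def min_def split: if_splits)
qed

lemma half_inj: "h \<in> halves G \<Longrightarrow> inj_on (param G (fst h)) (half_dom G h)"
proof (rule inj_onI)
  fix s t assume "h \<in> halves G" "s \<in> half_dom G h" "t \<in> half_dom G h" "param G (fst h) s = param G (fst h) t"
  then show "s = t" using half_isometry[of h s t] by simp
qed

lemma half_sets_disjoint:
  assumes "h \<in> halves G" "h' \<in> halves G" "h \<noteq> h'"
  shows "half_set G h \<inter> half_set G h' = {}"
proof (rule ccontr)
  assume "half_set G h \<inter> half_set G h' \<noteq> {}"
  then obtain x where "x \<in> half_set G h" "x \<in> half_set G h'" by blast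
  moreover from this(1) obtain s where "s \<in> half_dom G h" "x = param G (fst h) s" by (rule imageE)
  moreover from calculation(2) obtain t where "t \<in> half_dom G h'" "x = param G (fst h') t" by (rule imageE)
  ultimately have st: "s \<in> half_dom G h" "t \<in> half_dom G h'" "param G (fst h) s = param G (fst h') t" by simp_all
  then have "fst h = fst h' \<and> s = t"
    using half_open_subset[OF assms(1)] half_open_subset[OF assms(2)] assms(1,2)
    by (intro interiors_disjoint) (auto intro: half_fst)
  with st assms(3) show False
    by (cases h; cases h') (auto simp: half_lo_def half_hi_def split: if_splits)
qed

lemma half_set_subset: "h \<in> halves G \<Longrightarrow> half_set G h \<subseteq> points G"
  using half_open_subset half_fst param_in_points by (fastforce simp: subset_iff)

text \<open>Vertices and midpoints are all that is left, so cutting into open halves loses nothing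
  that Hausdorff or Lebesgue measure could see.\<close>

lemma finite_points_minus_halves: "finite (points G - (\<Union>h\<in>halves G. half_set G h))"
proof (rule finite_subset)
  show "finite (verts G \<union> (\<lambda>e. param G e (len G e / 2)) ` edges G)" using fin_verts fin_edges by simp
  show "points G - (\<Union>h\<in>halves G. half_set G h) \<subseteq> verts G \<union> (\<lambda>e. param G e (len G e / 2)) ` edges G"
  proof
    fix x assume x: "x \<in> points G - (\<Union>h\<in>halves G. half_set G h)"
    show "x \<in> verts G \<union> (\<lambda>e. param G e (len G e / 2)) ` edges G"
    proof (cases "x \<in> verts G")
      case False
      then obtain e t where et: "e \<in> edges G" "t \<in> {0..len G e}" "x = param G e t"
        using x by (auto simp: points_def edge_set_def)
      have "t \<noteq> 0" "t \<noteq> len G e" using False et param_0 param_len by auto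
      moreover have "t \<notin> half_dom G (e, b)" for b
      proof
        assume "t \<in> half_dom G (e, b)"
        then have "x \<in> half_set G (e, b)" using et(3) by auto
        moreover have "(e, b) \<in> halves G" using et(1) by (simp add: halves_def)
        ultimately show False using x by blast
      qed
      from this[of True] this[of False] have "t \<le> 0 \<or> len G e / 2 \<le> t" "t \<le> len G e / 2 \<or> len G e \<le> t"
        by (auto simp: half_lo_def half_hi_def)
      ultimately have "t = len G e / 2" using et(2) by auto
      then have "x = (\<lambda>e. param G e (len G e / 2)) e" using et(3) by (simp only:)
      then show ?thesis using et(1) by blast
    qed auto
  qed
qed

text \<open>The half is the positivity set of a glued Lipschitz function that vanishes elsewhere.
  Being relatively open makes it Borel, and allows a chart to be cut down to one half without
  affecting derivatives within its domain.\<close>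

lemma half_set_openin:
  assumes h: "h \<in> halves G"
  obtains U where "open U" "half_set G h = points G \<inter> U"
proof -
  define q where "q = glue G (\<lambda>_. 0) (\<lambda>e t. if e = fst h then max 0 (min (t - half_lo G h) (half_hi G h - t)) else 0)"
  have b: "half_lo G h \<ge> 0" "half_hi G h \<le> len G (fst h)" "half_lo G h < half_hi G h"
    using half_closed_subset[OF h] half_lo_less_hi[OF h] by auto
  have q: "q (param G e t) = (if e = fst h then max 0 (min (t - half_lo G h) (half_hi G h - t)) else 0)"
    if "e \<in> edges G" "t \<in> {0..len G e}" for e t
    unfolding q_def using that b by (subst glue_param) auto
  have "1-lipschitz_on (points G) q"
    unfolding q_def using b by (intro glue_lipschitz) (auto intro!: lipschitz_onI simp: dist_real_def)
  then have "continuous_on (points G) q" by (rule lipschitz_on_continuous_on)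
  then have "openin (top_of_set (points G)) (points G \<inter> q -` {0<..})"
    by (rule continuous_openin_preimage_gen) simp
  then obtain U where U: "open U" "points G \<inter> q -` {0<..} = points G \<inter> U"
    by (auto simp: openin_open)
  have "points G \<inter> q -` {0<..} = half_set G h"
  proof
    show "half_set G h \<subseteq> points G \<inter> q -` {0<..}"
    proof
      fix x assume "x \<in> half_set G h"
      then obtain t where t: "t \<in> half_dom G h" "x = param G (fst h) t" by auto
      then have "t \<in> {0..len G (fst h)}" using half_open_subset[OF h] by auto
      then show "x \<in> points G \<inter> q -` {0<..}"
        using t q[OF half_fst[OF h]] param_in_points[OF half_fst[OF h]] by auto
    qed
    show "points G \<inter> q -` {0<..} \<subseteq> half_set G h"
    proof
      fix x assume x: "x \<in> points G \<inter> q -` {0<..}"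
      then have "x \<notin> verts G" by (auto simp: q_def glue_def)
      then obtain e t where et: "e \<in> edges G" "t \<in> {0..len G e}" "x = param G e t"
        using x by (auto simp: points_def edge_set_def)
      have "q x > 0" using x by auto
      with q[OF et(1,2)] have "e = fst h" "t \<in> half_dom G h"
        unfolding et(3) by (auto split: if_splits simp: max_def min_def)
      then show "x \<in> half_set G h" using et(3) by blast
    qed
  qed
  then show ?thesis using U that by auto
qed

lemma half_set_measurable: "h \<in> halves G \<Longrightarrow> half_set G h \<in> sets (restrict_space borel (points G))"
  by (metis half_set_openin borel_open sets_restrict_space image_eqI)

end

section \<open>Currents carried by the edges\<close>

definition add_measure :: "'a measure \<Rightarrow> 'a measure \<Rightarrow> 'a measure" where
  "add_measure M N = measure_of (space M) (sets M) (\<lambda>A. emeasure M A + emeasure N A)"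

context
  fixes M N :: "'a measure"
  assumes sets_MN: "sets N = sets M"
begin

lemma sets_add_measure: "sets (add_measure M N) = sets M"
  by (simp add: add_measure_def)

lemma emeasure_add_measure: "A \<in> sets M \<Longrightarrow> emeasure (add_measure M N) A = emeasure M A + emeasure N A"
  unfolding add_measure_def
proof (rule emeasure_measure_of_sigma)
  show "sigma_algebra (space M) (sets M)" by (rule sets.sigma_algebra_axioms)
  show "positive (sets M) (\<lambda>A. emeasure M A + emeasure N A)" by (simp add: positive_def)
  show "countably_additive (sets M) (\<lambda>A. emeasure M A + emeasure N A)"
    unfolding countably_additive_def
  proof (intro allI impI)
    fix A :: "nat \<Rightarrow> 'a set" assume A: "range A \<subseteq> sets M" "disjoint_family A" "(\<Union>i. A i) \<in> sets M"
    have "(\<Sum>i. emeasure M (A i) + emeasure N (A i)) = (\<Sum>i. emeasure M (A i)) + (\<Sum>i. emeasure N (A i))"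
      by (rule suminf_add[symmetric]) auto
    also have "(\<Sum>i. emeasure M (A i)) = emeasure M (\<Union>i. A i)" using A by (intro suminf_emeasure)
    also have "(\<Sum>i. emeasure N (A i)) = emeasure N (\<Union>i. A i)" using A by (intro suminf_emeasure) (simp_all add: sets_MN)
    finally show "(\<Sum>i. emeasure M (A i) + emeasure N (A i)) = emeasure M (\<Union>i. A i) + emeasure N (\<Union>i. A i)" .
  qed
qed

lemma borel_N: "f \<in> borel_measurable M \<Longrightarrow> f \<in> borel_measurable N"
  using measurable_cong_sets[OF sets_MN refl] by blast

lemma borel_add_measure: "f \<in> borel_measurable M \<Longrightarrow> f \<in> borel_measurable (add_measure M N)"
  using measurable_cong_sets[OF sets_add_measure refl] by blast

lemma nn_integral_add_measure:
  assumes "f \<in> borel_measurable M"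
  shows "(\<integral>\<^sup>+x. f x \<partial>add_measure M N) = (\<integral>\<^sup>+x. f x \<partial>M) + (\<integral>\<^sup>+x. f x \<partial>N)"
  using assms
proof (induction rule: borel_measurable_induct)
  case (cong f g)
  have sp: "space N = space M" "space (add_measure M N) = space M"
    using sets_eq_imp_space_eq[OF sets_MN] sets_eq_imp_space_eq[OF sets_add_measure] by auto
  have "(\<integral>\<^sup>+x. f x \<partial>add_measure M N) = (\<integral>\<^sup>+x. g x \<partial>add_measure M N)" "(\<integral>\<^sup>+x. f x \<partial>M) = (\<integral>\<^sup>+x. g x \<partial>M)"
    "(\<integral>\<^sup>+x. f x \<partial>N) = (\<integral>\<^sup>+x. g x \<partial>N)"
    using cong(3) sp by (auto intro!: nn_integral_cong)
  then show ?case using cong by simp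
next
  case (set A)
  then show ?case by (simp add: sets_add_measure emeasure_add_measure sets_MN)
next
  case (mult u c)
  then show ?case by (simp add: nn_integral_cmult distrib_left borel_N borel_add_measure)
next
  case (add u v)
  then show ?case by (simp add: nn_integral_add add_ac borel_N borel_add_measure)
next
  case (seq U)
  have inc: "incseq (\<lambda>i. integral\<^sup>N K (U i))" for K :: "'a measure"
    using seq(3) by (auto simp: mono_def le_fun_def intro!: nn_integral_mono)
  have sup: "(\<integral>\<^sup>+x. (SUP i. U i) x \<partial>K) = (SUP i. integral\<^sup>N K (U i))" if "\<And>i. U i \<in> borel_measurable K" for K
    using nn_integral_monotone_convergence_SUP[OF seq(3), of K] that by (simp add: image_comp)
  have "(\<integral>\<^sup>+x. (SUP i. U i) x \<partial>add_measure M N) = (SUP i. integral\<^sup>N M (U i) + integral\<^sup>N N (U i))"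
    using seq by (subst sup) (simp_all add: borel_add_measure)
  also have "\<dots> = (SUP i. integral\<^sup>N M (U i)) + (SUP i. integral\<^sup>N N (U i))"
    using inc by (intro ennreal_SUP_add)
  also have "(SUP i. integral\<^sup>N M (U i)) = (\<integral>\<^sup>+x. (SUP i. U i) x \<partial>M)"
    using seq by (subst sup) simp_all
  also have "(SUP i. integral\<^sup>N N (U i)) = (\<integral>\<^sup>+x. (SUP i. U i) x \<partial>N)"
    using seq by (subst sup) (simp_all add: borel_N)
  finally show ?case .
qed

lemma finite_measure_add_measure:
  assumes "finite_measure M" "finite_measure N"
  shows "finite_measure (add_measure M N)"
proof (rule finite_measureI)
  have "emeasure (add_measure M N) (space M) = emeasure M (space M) + emeasure N (space M)"
    by (rule emeasure_add_measure) simp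
  then show "emeasure (add_measure M N) (space (add_measure M N)) \<noteq> \<infinity>"
    using finite_measure.emeasure_finite[OF assms(1), of "space M"] finite_measure.emeasure_finite[OF assms(2), of "space M"]
      sets_eq_imp_space_eq[OF sets_add_measure]
    by simp
qed

lemma integral_le_add_measure:
  fixes f :: "'a \<Rightarrow> real"
  assumes "integrable (add_measure M N) f"
  shows "(\<integral>x. \<bar>f x\<bar> \<partial>M) \<le> (\<integral>x. \<bar>f x\<bar> \<partial>add_measure M N)" "(\<integral>x. \<bar>f x\<bar> \<partial>N) \<le> (\<integral>x. \<bar>f x\<bar> \<partial>add_measure M N)"
proof -
  have fm: "f \<in> borel_measurable M" using assms borel_measurable_integrable measurable_cong_sets[OF sets_add_measure refl] by blast
  then have fn: "f \<in> borel_measurable N" using measurable_cong_sets[OF sets_MN refl] by blast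
  have fin: "(\<integral>\<^sup>+x. ennreal \<bar>f x\<bar> \<partial>add_measure M N) < top"
    using assms by (simp add: integrable_iff_bounded)
  have eq: "(\<integral>\<^sup>+x. ennreal \<bar>f x\<bar> \<partial>add_measure M N) = (\<integral>\<^sup>+x. ennreal \<bar>f x\<bar> \<partial>M) + (\<integral>\<^sup>+x. ennreal \<bar>f x\<bar> \<partial>N)"
    using fm by (intro nn_integral_add_measure) simp
  have i: "(\<integral>x. \<bar>f x\<bar> \<partial>K) = enn2real (\<integral>\<^sup>+x. ennreal \<bar>f x\<bar> \<partial>K)" if "f \<in> borel_measurable K" for K
    using that by (intro integral_eq_nn_integral) auto
  show "(\<integral>x. \<bar>f x\<bar> \<partial>M) \<le> (\<integral>x. \<bar>f x\<bar> \<partial>add_measure M N)" "(\<integral>x. \<bar>f x\<bar> \<partial>N) \<le> (\<integral>x. \<bar>f x\<bar> \<partial>add_measure M N)"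
    unfolding i[OF fm] i[OF fn] i[OF borel_measurable_integrable[OF assms]]
    using fin unfolding eq by (auto intro!: enn2real_mono)
qed

end

text \<open>One sequence has to serve both measures. Approximation in L^1 of their sum provides it,
  since either integral is bounded by the integral for the sum.\<close>

lemma Lip_bdd_approx_indicator_two_measures:
  fixes X :: "'a::metric_space set"
  assumes M: "sets M = sets (restrict_space borel X)" "finite_measure M"
    and N: "sets N = sets (restrict_space borel X)" "finite_measure N" and A: "A \<in> sets (restrict_space borel X)"
  obtains F where "\<And>n::nat. F n \<in> Lip_bdd X" "(\<lambda>n. \<integral>x. \<bar>F n x - indicator A x\<bar> \<partial>M) \<longlonglongrightarrow> 0"
    "(\<lambda>n. \<integral>x. \<bar>F n x - indicator A x\<bar> \<partial>N) \<longlonglongrightarrow> 0"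
proof -
  obtain B where B: "B \<in> sets borel" "A = X \<inter> B" using A by (auto simp: sets_restrict_space)
  have s: "sets N = sets M" using M N by simp
  have sS: "sets (add_measure M N) = sets (restrict_space borel X)" using sets_add_measure[OF s] M by simp
  have fS: "finite_measure (add_measure M N)" using finite_measure_add_measure[OF s] M N by simp
  obtain F where F: "\<And>n::nat. F n \<in> Lip_bdd X" "(\<lambda>n. \<integral>x. \<bar>F n x - indicator B x\<bar> \<partial>add_measure M N) \<longlonglongrightarrow> 0"
    using Lip_bdd_approx_indicator_borel[OF sS fS B(1)] by blast
  have eq: "(\<integral>x. \<bar>F n x - indicator B x\<bar> \<partial>add_measure M N) = (\<integral>x. \<bar>F n x - indicator A x\<bar> \<partial>add_measure M N)" for n
    using space_restrict_borel[OF sS] B(2) by (intro Bochner_Integration.integral_cong) (auto simp: indicator_def)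
  have int: "integrable (add_measure M N) (\<lambda>x. F n x - indicator A x)" for n
  proof (rule Bochner_Integration.integrable_diff[OF Lip_bdd_integrable[OF F(1) sS fS]])
    show "integrable (add_measure M N) (indicat_real A)"
      using A sS finite_measure.emeasure_finite[OF fS, of A]
      by (intro integrable_real_indicator) (auto simp: less_top)
  qed
  show ?thesis
  proof (rule that[of F])
    show "(\<lambda>n. \<integral>x. \<bar>F n x - indicator A x\<bar> \<partial>M) \<longlonglongrightarrow> 0"
      by (rule tendsto_sandwich[OF _ _ tendsto_const F(2)[unfolded eq]])
        (use integral_le_add_measure(1)[OF s int] in auto)
    show "(\<lambda>n. \<integral>x. \<bar>F n x - indicator A x\<bar> \<partial>N) \<longlonglongrightarrow> 0"
      by (rule tendsto_sandwich[OF _ _ tendsto_const F(2)[unfolded eq]])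
        (use integral_le_add_measure(2)[OF s int] in auto)
  qed (rule F(1))
qed

section \<open>Weighted edge currents and their mass\<close>

text \<open>Weights sit on half edges rather than edges, so that the current carried by one chart is
  again of this form, and a single computation of mass covers the whole current and its
  pieces.\<close>

definition edge_current :: "('a::metric_space, 'e) metric_graph \<Rightarrow> ('e \<times> bool \<Rightarrow> real) \<Rightarrow> 'a functional" where
  "edge_current G w f ps = (\<Sum>h\<in>halves G. w h *
     (LINT t:half_dom G h|lebesgue. f (param G (fst h) t) * vector_derivative (\<lambda>s. hd ps (param G (fst h) s)) (at t)))"

text \<open>Length on the halves weighted with the absolute values of w, written as the image of a
  measure on a disjoint union of lines. Outside a half the value \<open>param G (fst h) 0\<close>
  merely keeps the map inside the graph, as the density vanishes there.\<close>

definition edge_measure :: "('a::metric_space, 'e) metric_graph \<Rightarrow> ('e \<times> bool \<Rightarrow> real) \<Rightarrow> 'a measure" where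
  "edge_measure G w = distr
     (density (count_space (halves G) \<Otimes>\<^sub>M lborel) (\<lambda>(h, t). ennreal \<bar>w h\<bar> * indicator (half_dom G h) t))
     (restrict_space borel (points G))
     (\<lambda>(h, t). if t \<in> half_dom G h then param G (fst h) t else param G (fst h) 0)"

context fin_metric_graph
begin

lemma half_param_points: "h \<in> halves G \<Longrightarrow> t \<in> half_dom G h \<Longrightarrow> param G (fst h) t \<in> points G"
  using half_set_subset by blast

lemma param_half_measurable:
  assumes h: "h \<in> halves G"
  shows "(\<lambda>t. if t \<in> half_dom G h then param G (fst h) t else param G (fst h) 0) \<in> measurable lborel (restrict_space borel (points G))"
proof -
  have "param G (fst h) \<in> measurable (restrict_space borel (half_dom G h)) (restrict_space borel (points G))"
  proof (rule measurable_restrict_space2)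
    show "param G (fst h) \<in> space (restrict_space borel (half_dom G h)) \<rightarrow> points G"
      using half_set_subset[OF h] by (auto simp: space_restrict_space)
    have "continuous_on (half_dom G h) (param G (fst h))"
      by (rule continuous_on_subset[OF lipschitz_on_continuous_on[OF param_lipschitz[OF half_fst[OF h]]]])
        (use half_open_subset[OF h] in auto)
    then show "param G (fst h) \<in> borel_measurable (restrict_space borel (half_dom G h))"
      by (rule borel_measurable_continuous_on_restrict)
  qed
  moreover have "param G (fst h) 0 \<in> points G"
    using param_in_points[OF half_fst[OF h], of 0] len_pos[OF half_fst[OF h]] by simp
  ultimately have "(\<lambda>t. if t \<in> half_dom G h then param G (fst h) t else param G (fst h) 0) \<in> measurable borel (restrict_space borel (points G))"
    by (subst measurable_restrict_space_iff[symmetric]) (auto simp: space_restrict_space)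
  then show ?thesis by simp
qed

lemma nn_integral_edge_measure:
  assumes f: "f \<in> borel_measurable (restrict_space borel (points G))"
  shows "(\<integral>\<^sup>+x. f x \<partial>edge_measure G w) =
    (\<Sum>h\<in>halves G. ennreal \<bar>w h\<bar> * (\<integral>\<^sup>+t. f (param G (fst h) t) * indicator (half_dom G h) t \<partial>lborel))"
proof -
  let ?P = "count_space (halves G) \<Otimes>\<^sub>M lborel :: (('e \<times> bool) \<times> real) measure"
  let ?g = "\<lambda>(h, t). if t \<in> half_dom G h then param G (fst h) t else param G (fst h) 0"
  let ?d = "\<lambda>(h, t). ennreal \<bar>w h\<bar> * indicator (half_dom G h) t"
  have cnt: "countable (halves G)" using fin_halves by (rule countable_finite)
  have g: "?g \<in> measurable ?P (restrict_space borel (points G))"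
    using param_half_measurable by (intro measurable_pair_measure_countable1[OF cnt]) simp
  have d: "?d \<in> borel_measurable ?P"
    by (intro measurable_pair_measure_countable1[OF cnt]) simp
  have fg: "(\<lambda>x. f (?g x)) \<in> borel_measurable ?P"
    using measurable_compose[OF g f] .
  have "(\<integral>\<^sup>+x. f x \<partial>edge_measure G w) = (\<integral>\<^sup>+x. f (?g x) \<partial>density ?P ?d)"
    unfolding edge_measure_def using g f by (intro nn_integral_distr) simp_all
  also have "\<dots> = (\<integral>\<^sup>+x. ?d x * f (?g x) \<partial>?P)"
    using d fg by (intro nn_integral_density)
  also have "\<dots> = (\<integral>\<^sup>+h. \<integral>\<^sup>+t. ?d (h, t) * f (?g (h, t)) \<partial>lborel \<partial>count_space (halves G))"
    by (rule lborel.nn_integral_fst[symmetric]) (rule borel_measurable_times_ennreal[OF d fg])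
  also have "\<dots> = (\<Sum>h\<in>halves G. \<integral>\<^sup>+t. ?d (h, t) * f (?g (h, t)) \<partial>lborel)"
    using fin_halves by (rule nn_integral_count_space_finite)
  also have "\<dots> = (\<Sum>h\<in>halves G. ennreal \<bar>w h\<bar> * (\<integral>\<^sup>+t. f (param G (fst h) t) * indicator (half_dom G h) t \<partial>lborel))"
  proof (rule sum.cong[OF refl])
    fix h assume h: "h \<in> halves G"
    have m: "(\<lambda>t. f (if t \<in> half_dom G h then param G (fst h) t else param G (fst h) 0) * indicator (half_dom G h) t) \<in> borel_measurable lborel"
      by (rule borel_measurable_times_ennreal[OF measurable_compose[OF param_half_measurable[OF h] f]]) simp
    have "(\<integral>\<^sup>+t. ?d (h, t) * f (?g (h, t)) \<partial>lborel) = (\<integral>\<^sup>+t. ennreal \<bar>w h\<bar> * (f (if t \<in> half_dom G h then param G (fst h) t else param G (fst h) 0) * indicator (half_dom G h) t) \<partial>lborel)"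
      by (intro nn_integral_cong) (auto simp: mult_ac)
    also have "\<dots> = ennreal \<bar>w h\<bar> * (\<integral>\<^sup>+t. f (if t \<in> half_dom G h then param G (fst h) t else param G (fst h) 0) * indicator (half_dom G h) t \<partial>lborel)"
      using m by (rule nn_integral_cmult)
    also have "(\<integral>\<^sup>+t. f (if t \<in> half_dom G h then param G (fst h) t else param G (fst h) 0) * indicator (half_dom G h) t \<partial>lborel) =
      (\<integral>\<^sup>+t. f (param G (fst h) t) * indicator (half_dom G h) t \<partial>lborel)"
      by (intro nn_integral_cong) (auto simp: indicator_def)
    finally show "(\<integral>\<^sup>+t. ?d (h, t) * f (?g (h, t)) \<partial>lborel) = ennreal \<bar>w h\<bar> * (\<integral>\<^sup>+t. f (param G (fst h) t) * indicator (half_dom G h) t \<partial>lborel)" .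
  qed
  finally show ?thesis .
qed

lemma sets_edge_measure: "sets (edge_measure G w) = sets (restrict_space borel (points G))"
  by (simp add: edge_measure_def)

lemma emeasure_edge_measure:
  assumes "A \<in> sets (restrict_space borel (points G))"
  shows "emeasure (edge_measure G w) A = (\<Sum>h\<in>halves G. ennreal \<bar>w h\<bar> * (\<integral>\<^sup>+t. indicator A (param G (fst h) t) * indicator (half_dom G h) t \<partial>lborel))"
  using nn_integral_edge_measure[of "indicator A" w] assms sets_edge_measure[of w] by simp

lemma measure_edge_measure_points:
  "emeasure (edge_measure G w) (points G) = ennreal (\<Sum>h\<in>halves G. \<bar>w h\<bar> * (half_hi G h - half_lo G h))"
proof -
  have "points G \<in> sets (restrict_space borel (points G))"
    using sets.top[of "restrict_space borel (points G)"] by (simp add: space_restrict_space)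
  then have "emeasure (edge_measure G w) (points G) = (\<Sum>h\<in>halves G. ennreal \<bar>w h\<bar> * (\<integral>\<^sup>+t. indicator (points G) (param G (fst h) t) * indicator (half_dom G h) t \<partial>lborel))"
    by (rule emeasure_edge_measure)
  also have "\<dots> = (\<Sum>h\<in>halves G. ennreal (\<bar>w h\<bar> * (half_hi G h - half_lo G h)))"
  proof (rule sum.cong[OF refl])
    fix h assume h: "h \<in> halves G"
    have "(\<integral>\<^sup>+t. indicator (points G) (param G (fst h) t) * indicator (half_dom G h) t \<partial>lborel) = (\<integral>\<^sup>+t. indicator (half_dom G h) t \<partial>lborel)"
      using half_set_subset[OF h] by (intro nn_integral_cong) (auto simp: indicator_def)
    also have "\<dots> = ennreal (half_hi G h - half_lo G h)"
      using half_lo_less_hi[OF h] by simp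
    finally show "ennreal \<bar>w h\<bar> * (\<integral>\<^sup>+t. indicator (points G) (param G (fst h) t) * indicator (half_dom G h) t \<partial>lborel) = ennreal (\<bar>w h\<bar> * (half_hi G h - half_lo G h))"
      using half_lo_less_hi[OF h] by (simp add: ennreal_mult)
  qed
  also have "\<dots> = ennreal (\<Sum>h\<in>halves G. \<bar>w h\<bar> * (half_hi G h - half_lo G h))"
    using half_lo_less_hi by (intro sum_ennreal) (auto intro!: mult_nonneg_nonneg simp: less_imp_le)
  finally show ?thesis .
qed

lemma finite_edge_measure: "finite_measure (edge_measure G w)"
  using measure_edge_measure_points[of w] space_restrict_borel[OF sets_edge_measure[of w]]
  by (intro finite_measureI) simp

lemma half_comp_measurable:
  fixes g :: "'a \<Rightarrow> real"
  assumes "g \<in> borel_measurable (restrict_space borel (points G))" "h \<in> halves G"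
  shows "(\<lambda>t. indicator (half_dom G h) t *\<^sub>R g (param G (fst h) t)) \<in> borel_measurable borel"
proof -
  have "(\<lambda>t. indicator (half_dom G h) t *\<^sub>R g (if t \<in> half_dom G h then param G (fst h) t else param G (fst h) 0)) \<in> borel_measurable lborel"
    using measurable_compose[OF param_half_measurable[OF assms(2)] assms(1)] by (intro borel_measurable_scaleR) auto
  also have "(\<lambda>t. indicator (half_dom G h) t *\<^sub>R g (if t \<in> half_dom G h then param G (fst h) t else param G (fst h) 0)) =
    (\<lambda>t. indicator (half_dom G h) t *\<^sub>R g (param G (fst h) t))"
    by (auto simp: indicator_def)
  finally show ?thesis by simp
qed

lemma half_comp_set_measurable:
  fixes g :: "'a \<Rightarrow> real"
  assumes "g \<in> borel_measurable (restrict_space borel (points G))" "h \<in> halves G"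
  shows "set_borel_measurable lebesgue (half_dom G h) (\<lambda>t. g (param G (fst h) t))"
  unfolding set_borel_measurable_def using half_comp_measurable[OF assms] by (intro measurable_completion) simp

lemma half_comp_integrable:
  fixes g :: "'a \<Rightarrow> real"
  assumes g: "g \<in> borel_measurable (restrict_space borel (points G))" and B: "\<And>x. x \<in> points G \<Longrightarrow> \<bar>g x\<bar> \<le> B"
    and h: "h \<in> halves G"
  shows "integrable lborel (\<lambda>t. indicator (half_dom G h) t *\<^sub>R g (param G (fst h) t))"
proof (rule Bochner_Integration.integrable_bound)
  show "integrable lborel (\<lambda>t. B * indicator (half_dom G h) t)"
    using half_lo_less_hi[OF h] by (intro integrable_mult_right integrable_real_indicator) auto
  show "(\<lambda>t. indicator (half_dom G h) t *\<^sub>R g (param G (fst h) t)) \<in> borel_measurable lborel"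
    using half_comp_measurable[OF g h] by simp
  show "AE t in lborel. norm (indicator (half_dom G h) t *\<^sub>R g (param G (fst h) t)) \<le> norm (B * indicator (half_dom G h) t)"
    using B[OF half_param_points[OF h]] by (intro AE_I2) (auto simp: indicator_def intro: order_trans[OF _ abs_ge_self])
qed

lemma integral_edge_measure:
  fixes g :: "'a \<Rightarrow> real"
  assumes g: "g \<in> borel_measurable (restrict_space borel (points G))" and B: "\<And>x. x \<in> points G \<Longrightarrow> \<bar>g x\<bar> \<le> B"
  shows "(\<integral>x. \<bar>g x\<bar> \<partial>edge_measure G w) = (\<Sum>h\<in>halves G. \<bar>w h\<bar> * (LINT t:half_dom G h|lebesgue. \<bar>g (param G (fst h) t)\<bar>))"
proof -
  have ga: "(\<lambda>x. \<bar>g x\<bar>) \<in> borel_measurable (restrict_space borel (points G))" using g by simp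
  have "(\<integral>x. \<bar>g x\<bar> \<partial>edge_measure G w) = enn2real (\<integral>\<^sup>+x. ennreal \<bar>g x\<bar> \<partial>edge_measure G w)"
    using ga measurable_cong_sets[OF sets_edge_measure[of w] refl] by (intro integral_eq_nn_integral) auto
  also have "(\<integral>\<^sup>+x. ennreal \<bar>g x\<bar> \<partial>edge_measure G w) =
    (\<Sum>h\<in>halves G. ennreal \<bar>w h\<bar> * (\<integral>\<^sup>+t. ennreal \<bar>g (param G (fst h) t)\<bar> * indicator (half_dom G h) t \<partial>lborel))"
    using ga by (intro nn_integral_edge_measure) simp
  also have "\<dots> = (\<Sum>h\<in>halves G. ennreal (\<bar>w h\<bar> * (LINT t:half_dom G h|lebesgue. \<bar>g (param G (fst h) t)\<bar>)))"
  proof (rule sum.cong[OF refl])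
    fix h assume h: "h \<in> halves G"
    have i: "integrable lborel (\<lambda>t. indicator (half_dom G h) t *\<^sub>R \<bar>g (param G (fst h) t)\<bar>)"
      using half_comp_integrable[OF ga _ h, of B] B by simp
    have "(\<integral>\<^sup>+t. ennreal \<bar>g (param G (fst h) t)\<bar> * indicator (half_dom G h) t \<partial>lborel) =
      (\<integral>\<^sup>+t. ennreal (indicator (half_dom G h) t *\<^sub>R \<bar>g (param G (fst h) t)\<bar>) \<partial>lborel)"
      by (intro nn_integral_cong) (auto simp: indicator_def)
    also have "\<dots> = ennreal (LINT t|lborel. indicator (half_dom G h) t *\<^sub>R \<bar>g (param G (fst h) t)\<bar>)"
      by (rule nn_integral_eq_integral[OF i]) (auto simp: indicator_def)
    also have "(LINT t|lborel. indicator (half_dom G h) t *\<^sub>R \<bar>g (param G (fst h) t)\<bar>) = (LINT t:half_dom G h|lebesgue. \<bar>g (param G (fst h) t)\<bar>)"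
      unfolding set_lebesgue_integral_def using i by (intro integral_completion[symmetric]) (rule borel_measurable_integrable)
    finally show "ennreal \<bar>w h\<bar> * (\<integral>\<^sup>+t. ennreal \<bar>g (param G (fst h) t)\<bar> * indicator (half_dom G h) t \<partial>lborel) =
      ennreal (\<bar>w h\<bar> * (LINT t:half_dom G h|lebesgue. \<bar>g (param G (fst h) t)\<bar>))"
      by (simp add: ennreal_mult')
  qed
  also have "\<dots> = ennreal (\<Sum>h\<in>halves G. \<bar>w h\<bar> * (LINT t:half_dom G h|lebesgue. \<bar>g (param G (fst h) t)\<bar>))"
    by (intro sum_ennreal mult_nonneg_nonneg) (auto simp: set_lebesgue_integral_def intro!: Bochner_Integration.integral_nonneg)
  finally show ?thesis
    by (simp add: sum_nonneg set_lebesgue_integral_def Bochner_Integration.integral_nonneg)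
qed

lemma half_lipschitz:
  assumes "C-lipschitz_on (points G) p" "h \<in> halves G"
  shows "C-lipschitz_on {half_lo G h..half_hi G h} (\<lambda>t. p (param G (fst h) t))"
proof -
  have "(C * 1)-lipschitz_on {0..len G (fst h)} (\<lambda>t. p (param G (fst h) t))"
    by (rule lipschitz_on_compose2[OF param_lipschitz[OF half_fst[OF assms(2)]] lipschitz_on_subset[OF assms(1)]])
      (use param_in_points[OF half_fst[OF assms(2)]] in auto)
  then show ?thesis using half_closed_subset[OF assms(2)] by (auto intro: lipschitz_on_subset)
qed

lemma edge_current_integrable:
  fixes g :: "'a \<Rightarrow> real"
  assumes g: "g \<in> borel_measurable (restrict_space borel (points G))" and B: "\<And>x. x \<in> points G \<Longrightarrow> \<bar>g x\<bar> \<le> B"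
    and p: "C-lipschitz_on (points G) p" and h: "h \<in> halves G"
  shows "set_integrable lebesgue (half_dom G h) (\<lambda>t. g (param G (fst h) t) * vector_derivative (\<lambda>s. p (param G (fst h) s)) (at t))"
  using B[OF half_param_points[OF h]]
  by (intro lipschitz_derivative_mult_integrable[OF half_lipschitz[OF p h] half_comp_set_measurable[OF g h], of B]) auto

lemma edge_current_bound:
  fixes g :: "'a \<Rightarrow> real"
  assumes g: "g \<in> borel_measurable (restrict_space borel (points G))" and B: "\<And>x. x \<in> points G \<Longrightarrow> \<bar>g x\<bar> \<le> B"
    and p: "C-lipschitz_on (points G) p"
  shows "\<bar>edge_current G w g [p]\<bar> \<le> C * (\<integral>x. \<bar>g x\<bar> \<partial>edge_measure G w)"
proof -
  have C: "0 \<le> C" using p lipschitz_on_nonneg by blast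
  have "\<bar>edge_current G w g [p]\<bar> \<le> (\<Sum>h\<in>halves G. \<bar>w h\<bar> * (C * (LINT t:half_dom G h|lebesgue. \<bar>g (param G (fst h) t)\<bar>)))"
    unfolding edge_current_def list.sel
  proof (rule order_trans[OF sum_abs], rule sum_mono)
    fix h assume h: "h \<in> halves G"
    note i = edge_current_integrable[OF g B p h, unfolded set_integrable_def]
    have ga: "(\<lambda>x. \<bar>g x\<bar>) \<in> borel_measurable (restrict_space borel (points G))" using g by simp
    have j: "integrable lebesgue (\<lambda>t. indicator (half_dom G h) t *\<^sub>R \<bar>g (param G (fst h) t)\<bar>)"
      using half_comp_integrable[OF ga _ h, of B] B by (intro integrable_completion[THEN iffD2] borel_measurable_integrable) auto
    have "\<bar>LINT t:half_dom G h|lebesgue. g (param G (fst h) t) * vector_derivative (\<lambda>s. p (param G (fst h) s)) (at t)\<bar>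
      \<le> (LINT t|lebesgue. \<bar>indicator (half_dom G h) t *\<^sub>R (g (param G (fst h) t) * vector_derivative (\<lambda>s. p (param G (fst h) s)) (at t))\<bar>)"
      unfolding set_lebesgue_integral_def by (rule integral_abs_bound)
    also have "\<dots> \<le> (LINT t|lebesgue. C * (indicator (half_dom G h) t *\<^sub>R \<bar>g (param G (fst h) t)\<bar>))"
    proof (rule integral_mono_AE)
      show "AE t in lebesgue. \<bar>indicator (half_dom G h) t *\<^sub>R (g (param G (fst h) t) * vector_derivative (\<lambda>s. p (param G (fst h) s)) (at t))\<bar>
        \<le> C * (indicator (half_dom G h) t *\<^sub>R \<bar>g (param G (fst h) t)\<bar>)"
        using lipschitz_interval_derivative_AE[OF half_lipschitz[OF p h]]
        by eventually_elim (auto simp: indicator_def abs_mult mult.commute[of C] intro!: mult_left_mono)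
    qed (use i j in auto)
    also have "\<dots> = C * (LINT t:half_dom G h|lebesgue. \<bar>g (param G (fst h) t)\<bar>)"
      unfolding set_lebesgue_integral_def by simp
    finally show "\<bar>w h * (LINT t:half_dom G h|lebesgue. g (param G (fst h) t) * vector_derivative (\<lambda>s. p (param G (fst h) s)) (at t))\<bar>
      \<le> \<bar>w h\<bar> * (C * (LINT t:half_dom G h|lebesgue. \<bar>g (param G (fst h) t)\<bar>))"
      by (simp add: abs_mult mult_left_mono)
  qed
  also have "\<dots> = C * (\<integral>x. \<bar>g x\<bar> \<partial>edge_measure G w)"
    by (subst integral_edge_measure[OF g B]) (simp_all add: sum_distrib_left mult_ac)
  finally show ?thesis .
qed

lemma edge_current_lincomb:
  fixes f g :: "'a \<Rightarrow> real"
  assumes f: "f \<in> borel_measurable (restrict_space borel (points G))" "\<And>x. x \<in> points G \<Longrightarrow> \<bar>f x\<bar> \<le> A"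
    and g: "g \<in> borel_measurable (restrict_space borel (points G))" "\<And>x. x \<in> points G \<Longrightarrow> \<bar>g x\<bar> \<le> B"
    and p: "C-lipschitz_on (points G) p"
  shows "edge_current G w (\<lambda>x. a * f x + b * g x) [p] = a * edge_current G w f [p] + b * edge_current G w g [p]"
proof -
  have "(LINT t:half_dom G h|lebesgue. (a * f (param G (fst h) t) + b * g (param G (fst h) t)) * vector_derivative (\<lambda>s. p (param G (fst h) s)) (at t)) =
     a * (LINT t:half_dom G h|lebesgue. f (param G (fst h) t) * vector_derivative (\<lambda>s. p (param G (fst h) s)) (at t)) +
     b * (LINT t:half_dom G h|lebesgue. g (param G (fst h) t) * vector_derivative (\<lambda>s. p (param G (fst h) s)) (at t))"
    if h: "h \<in> halves G" for h
  proof -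
    note i = edge_current_integrable[OF f p h] edge_current_integrable[OF g p h]
    have "(LINT t:half_dom G h|lebesgue. (a * f (param G (fst h) t) + b * g (param G (fst h) t)) * vector_derivative (\<lambda>s. p (param G (fst h) s)) (at t)) =
      (LINT t:half_dom G h|lebesgue. a * (f (param G (fst h) t) * vector_derivative (\<lambda>s. p (param G (fst h) s)) (at t)) +
        b * (g (param G (fst h) t) * vector_derivative (\<lambda>s. p (param G (fst h) s)) (at t)))"
      by (simp add: algebra_simps)
    also have "\<dots> = a * (LINT t:half_dom G h|lebesgue. f (param G (fst h) t) * vector_derivative (\<lambda>s. p (param G (fst h) s)) (at t)) +
      b * (LINT t:half_dom G h|lebesgue. g (param G (fst h) t) * vector_derivative (\<lambda>s. p (param G (fst h) s)) (at t))"
      using i by (subst set_integral_add) (auto intro: set_integrable_mult_right)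
    finally show ?thesis .
  qed
  then show ?thesis
    unfolding edge_current_def list.sel by (simp add: sum.distrib sum_distrib_left algebra_simps)
qed

lemma points_sets: "points G \<in> sets (restrict_space borel (points G))"
  using sets.top[of "restrict_space borel (points G)"] by (simp add: space_restrict_space)

lemma tent_derivative:
  assumes h: "h \<in> halves G" and t: "t \<in> half_dom G h"
  shows "vector_derivative (\<lambda>s. tent G (param G (fst h) s)) (at t) = (if snd h then 1 else -1)"
proof (rule vector_derivative_at)
  have eq: "tent G (param G (fst h) s) = (if snd h then s else len G (fst h) - s)" if "s \<in> half_dom G h" for s
    using that half_open_subset[OF h] tent_param[OF half_fst[OF h], of s]
    by (auto simp: half_lo_def half_hi_def min_def subset_iff split: if_splits)
  have "((\<lambda>s. if snd h then s else len G (fst h) - s) has_vector_derivative (if snd h then 1 else -1)) (at t)"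
    by (cases "snd h") (auto intro!: derivative_eq_intros)
  then show "((\<lambda>s. tent G (param G (fst h) s)) has_vector_derivative (if snd h then 1 else -1)) (at t)"
    by (rule has_vector_derivative_transform_within_open[OF _ open_greaterThanLessThan t]) (simp add: eq)
qed

lemma mass_dominated_edge_current: "mass_dominated 1 (points G) (edge_current G w) (edge_measure G w)"
  unfolding mass_dominated_def
proof (intro conjI sets_edge_measure finite_edge_measure)
  show "\<forall>(f, ps)\<in>forms 1 (points G). \<bar>edge_current G w f ps\<bar> \<le> (\<Prod>p\<leftarrow>ps. lip_const (points G) p) * (\<integral>x. \<bar>f x\<bar> \<partial>edge_measure G w)"
  proof clarify
    fix f ps assume "(f, ps) \<in> forms 1 (points G)"
    then obtain p where f: "f \<in> Lip_bdd (points G)" and p: "p \<in> Lip (points G)" and ps: "ps = [p]"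
      by (auto simp: forms_def length_Suc_conv)
    obtain C B where B: "\<And>x. x \<in> points G \<Longrightarrow> \<bar>f x\<bar> \<le> B" using Lip_bddE[OF f] by metis
    show "\<bar>edge_current G w f ps\<bar> \<le> (\<Prod>p\<leftarrow>ps. lip_const (points G) p) * (\<integral>x. \<bar>f x\<bar> \<partial>edge_measure G w)"
      using edge_current_bound[OF Lip_borel_measurable[OF Lip_bdd_imp_Lip[OF f] refl] B lipschitz_on_lip_const[OF p], of w] ps
      by simp
  qed
qed

text \<open>The other halves do not meet the support, and on this one the slope of the tent is
  constantly 1 or -1. Up to sign, the test returns the weighted length of the part of A in the
  half.\<close>

lemma edge_current_indicator_half:
  assumes h: "h \<in> halves G"
  shows "edge_current G w (indicator (A \<inter> half_set G h)) [tent G] =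
    w h * (if snd h then 1 else -1) * (LINT t:half_dom G h|lebesgue. indicator A (param G (fst h) t))"
proof -
  have "w h' * (LINT t:half_dom G h'|lebesgue. indicator (A \<inter> half_set G h) (param G (fst h') t) * vector_derivative (\<lambda>s. tent G (param G (fst h') s)) (at t))
    = (if h' = h then w h * (if snd h then 1 else -1) * (LINT t:half_dom G h|lebesgue. indicator A (param G (fst h) t)) else 0)"
    if h': "h' \<in> halves G" for h'
  proof (cases "h' = h")
    case True
    have "(LINT t:half_dom G h|lebesgue. indicator (A \<inter> half_set G h) (param G (fst h) t) * vector_derivative (\<lambda>s. tent G (param G (fst h) s)) (at t))
      = (LINT t:half_dom G h|lebesgue. (if snd h then 1 else -1) * indicator A (param G (fst h) t))"
      unfolding set_lebesgue_integral_def
      by (intro Bochner_Integration.integral_cong refl) (auto simp: indicator_def tent_derivative[OF h])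
    then show ?thesis using True by simp
  next
    case False
    have "indicator (A \<inter> half_set G h) (param G (fst h') t) = (0::real)" if "t \<in> half_dom G h'" for t
    proof -
      have "param G (fst h') t \<notin> half_set G h" using half_sets_disjoint[OF h' h False] that by blast
      then show ?thesis by simp
    qed
    then have "(LINT t:half_dom G h'|lebesgue. indicator (A \<inter> half_set G h) (param G (fst h') t) * vector_derivative (\<lambda>s. tent G (param G (fst h') s)) (at t)) = (LINT t:half_dom G h'|lebesgue. 0)"
      unfolding set_lebesgue_integral_def
      by (intro Bochner_Integration.integral_cong refl) (auto simp: indicator_def)
    then show ?thesis using False by (simp add: set_lebesgue_integral_def)
  qed
  then have "edge_current G w (indicator (A \<inter> half_set G h)) [tent G] =
    (\<Sum>h'\<in>halves G. if h' = h then w h * (if snd h then 1 else -1) * (LINT t:half_dom G h|lebesgue. indicator A (param G (fst h) t)) else 0)"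
    unfolding edge_current_def list.sel by (intro sum.cong) auto
  then show ?thesis using h fin_halves by simp
qed

text \<open>Domination speaks about Lipschitz first arguments, so the indicator is approximated:
  convergence in L^1 of the edge measure takes the current to its limit, and convergence in L^1 of
  \<nu> does so for the bound.\<close>

lemma edge_measure_half_le:
  assumes \<nu>: "mass_dominated 1 (points G) (edge_current G w) \<nu>" and A: "A \<in> sets (restrict_space borel (points G))"
    and h: "h \<in> halves G"
  shows "\<bar>w h\<bar> * (LINT t:half_dom G h|lebesgue. indicator A (param G (fst h) t)) \<le> measure \<nu> (A \<inter> half_set G h)"
proof -
  let ?X = "points G" and ?T = "edge_current G w" and ?P = "tent G"
  define B where "B = A \<inter> half_set G h"
  have s: "sets \<nu> = sets (restrict_space borel ?X)" and fin: "finite_measure \<nu>" using \<nu> by (simp_all add: mass_dominated_def)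
  have Bs: "B \<in> sets (restrict_space borel ?X)" unfolding B_def using A half_set_measurable[OF h] by (rule sets.Int)
  obtain F where F: "\<And>n::nat. F n \<in> Lip_bdd ?X" "(\<lambda>n. \<integral>x. \<bar>F n x - indicator B x\<bar> \<partial>edge_measure G w) \<longlonglongrightarrow> 0"
    "(\<lambda>n. \<integral>x. \<bar>F n x - indicator B x\<bar> \<partial>\<nu>) \<longlonglongrightarrow> 0"
    by (rule Lip_bdd_approx_indicator_two_measures[OF sets_edge_measure finite_edge_measure s fin Bs]) blast
  have Fm: "F n \<in> borel_measurable (restrict_space borel ?X)" for n
    using Lip_borel_measurable[OF Lip_bdd_imp_Lip[OF F(1)] refl] .
  have Bm: "indicat_real B \<in> borel_measurable (restrict_space borel ?X)" using Bs by simp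
  have lim1: "(\<lambda>n. ?T (F n) [?P]) \<longlonglongrightarrow> ?T (indicator B) [?P]"
  proof (rule LIM_zero_cancel, rule Lim_null_comparison[OF _ F(2)], rule always_eventually, rule allI)
    fix n
    obtain C M where M: "0 \<le> M" "\<And>x. x \<in> ?X \<Longrightarrow> \<bar>F n x\<bar> \<le> M" using Lip_bddE[OF F(1)] by metis
    have b1: "\<bar>indicat_real B x\<bar> \<le> 1" for x by (simp add: indicator_def)
    have b2: "\<bar>F n x - indicator B x\<bar> \<le> M + 1" if "x \<in> ?X" for x using M(2)[OF that] b1[of x] by linarith
    have "?T (F n) [?P] - ?T (indicator B) [?P] = ?T (\<lambda>x. 1 * F n x + (-1) * indicator B x) [?P]"
      by (subst edge_current_lincomb[OF Fm M(2) Bm b1 tent_lipschitz]) simp_all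
    also have "\<dots> = ?T (\<lambda>x. F n x - indicator B x) [?P]" by simp
    finally show "norm (?T (F n) [?P] - ?T (indicator B) [?P]) \<le> (\<integral>x. \<bar>F n x - indicator B x\<bar> \<partial>edge_measure G w)"
      using edge_current_bound[OF borel_measurable_diff[OF Fm Bm] b2 tent_lipschitz, of w] by simp
  qed
  have Fi: "integrable \<nu> (F n)" for n using Lip_bdd_integrable[OF F(1) s fin] .
  have Bi: "integrable \<nu> (indicat_real B)"
    using Bs s finite_measure.emeasure_finite[OF fin, of B] by (intro integrable_real_indicator) (auto simp: less_top)
  have lim2: "(\<lambda>n. \<integral>x. \<bar>F n x\<bar> \<partial>\<nu>) \<longlonglongrightarrow> measure \<nu> B"
  proof (rule LIM_zero_cancel, rule Lim_null_comparison[OF _ F(3)], rule always_eventually, rule allI)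
    fix n
    have "measure \<nu> B = (\<integral>x. \<bar>indicat_real B x\<bar> \<partial>\<nu>)" using Bs s by simp
    then have "norm ((\<integral>x. \<bar>F n x\<bar> \<partial>\<nu>) - measure \<nu> B) = \<bar>\<integral>x. \<bar>F n x\<bar> - \<bar>indicat_real B x\<bar> \<partial>\<nu>\<bar>"
      using Fi[of n] Bi by (subst Bochner_Integration.integral_diff) auto
    also have "\<dots> \<le> (\<integral>x. \<bar>\<bar>F n x\<bar> - \<bar>indicat_real B x\<bar>\<bar> \<partial>\<nu>)" by (rule integral_abs_bound)
    also have "\<dots> \<le> (\<integral>x. \<bar>F n x - indicator B x\<bar> \<partial>\<nu>)"
    proof (rule integral_mono)
      show "integrable \<nu> (\<lambda>x. \<bar>\<bar>F n x\<bar> - \<bar>indicat_real B x\<bar>\<bar>)"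
        by (intro integrable_abs Bochner_Integration.integrable_diff Fi Bi)
      show "integrable \<nu> (\<lambda>x. \<bar>F n x - indicator B x\<bar>)"
        by (intro integrable_abs Bochner_Integration.integrable_diff Fi Bi)
    qed (rule abs_triangle_ineq3)
    finally show "norm ((\<integral>x. \<bar>F n x\<bar> \<partial>\<nu>) - measure \<nu> B) \<le> (\<integral>x. \<bar>F n x - indicator B x\<bar> \<partial>\<nu>)" .
  qed
  have le: "\<bar>?T (F n) [?P]\<bar> \<le> (\<integral>x. \<bar>F n x\<bar> \<partial>\<nu>)" for n
  proof -
    have PL: "?P \<in> Lip ?X" using tent_lipschitz by (auto simp: Lip_def)
    then have "(F n, [?P]) \<in> forms 1 ?X" using F(1) by (auto simp: forms_def)
    then have "\<bar>?T (F n) [?P]\<bar> \<le> lip_const ?X ?P * (\<integral>x. \<bar>F n x\<bar> \<partial>\<nu>)"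
      using \<nu> unfolding mass_dominated_def by fastforce
    also have "\<dots> \<le> 1 * (\<integral>x. \<bar>F n x\<bar> \<partial>\<nu>)"
      using lip_const_le[OF tent_lipschitz] by (intro mult_right_mono) auto
    finally show ?thesis by simp
  qed
  have "\<bar>?T (indicator B) [?P]\<bar> \<le> measure \<nu> B"
    by (rule LIMSEQ_le[OF tendsto_rabs[OF lim1] lim2]) (use le in auto)
  moreover have "0 \<le> (LINT t:half_dom G h|lebesgue. indicat_real A (param G (fst h) t))"
    unfolding set_lebesgue_integral_def by (intro Bochner_Integration.integral_nonneg) auto
  ultimately show ?thesis
    unfolding B_def edge_current_indicator_half[OF h] by (auto simp: abs_mult split: if_splits)
qed

lemma measure_edge_measure:
  assumes "A \<in> sets (restrict_space borel (points G))"
  shows "measure (edge_measure G w) A = (\<Sum>h\<in>halves G. \<bar>w h\<bar> * (LINT t:half_dom G h|lebesgue. indicator A (param G (fst h) t)))"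
proof -
  have "measure (edge_measure G w) A = (\<integral>x. \<bar>indicat_real A x\<bar> \<partial>edge_measure G w)"
    using assms sets_edge_measure[of w] by simp
  also have "\<dots> = (\<Sum>h\<in>halves G. \<bar>w h\<bar> * (LINT t:half_dom G h|lebesgue. \<bar>indicat_real A (param G (fst h) t)\<bar>))"
    by (rule integral_edge_measure[where B=1]) (use assms in \<open>auto simp: indicator_def\<close>)
  finally show ?thesis by simp
qed

text \<open>The halves are disjoint, so their estimates add up; whatever \<nu> carries elsewhere
  only increases its side.\<close>

lemma edge_measure_minimal:
  assumes \<nu>: "mass_dominated 1 (points G) (edge_current G w) \<nu>" and A: "A \<in> sets (restrict_space borel (points G))"
  shows "emeasure (edge_measure G w) A \<le> emeasure \<nu> A"
proof -
  interpret \<mu>: finite_measure "edge_measure G w" by (rule finite_edge_measure)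
  interpret \<nu>: finite_measure \<nu> using \<nu> by (simp add: mass_dominated_def)
  have s: "sets \<nu> = sets (restrict_space borel (points G))" using \<nu> by (simp add: mass_dominated_def)
  have B: "A \<inter> half_set G h \<in> sets \<nu>" if "h \<in> halves G" for h
    unfolding s using A half_set_measurable[OF that] by (rule sets.Int)
  have dj: "disjoint_family_on (\<lambda>h. A \<inter> half_set G h) (halves G)"
    unfolding disjoint_family_on_def
  proof (intro ballI impI)
    fix h h' assume "h \<in> halves G" "h' \<in> halves G" "h \<noteq> h'"
    then show "A \<inter> half_set G h \<inter> (A \<inter> half_set G h') = {}" using half_sets_disjoint[of h h'] by blast
  qed
  have "measure (edge_measure G w) A \<le> (\<Sum>h\<in>halves G. measure \<nu> (A \<inter> half_set G h))"
    unfolding measure_edge_measure[OF A] using edge_measure_half_le[OF \<nu> A] by (rule sum_mono)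
  also have "\<dots> = measure \<nu> (\<Union>h\<in>halves G. A \<inter> half_set G h)"
    using fin_halves dj B by (intro \<nu>.finite_measure_finite_Union[symmetric]) auto
  also have "\<dots> \<le> measure \<nu> A"
    using A s by (intro \<nu>.finite_measure_mono) auto
  finally show ?thesis
    using A s sets_edge_measure[of w] by (simp add: \<mu>.emeasure_eq_measure \<nu>.emeasure_eq_measure)
qed

lemma mass_measure_edge_current: "mass_measure 1 (points G) (edge_current G w) = edge_measure G w"
  using mass_dominated_edge_current edge_measure_minimal by (rule mass_measure_eqI)

lemma mass_edge_current: "mass 1 (points G) (edge_current G w) = (\<Sum>h\<in>halves G. \<bar>w h\<bar> * (half_hi G h - half_lo G h))"
  unfolding mass_def mass_measure_edge_current measure_def measure_edge_measure_points
  using half_lo_less_hi by (intro enn2real_ennreal sum_nonneg mult_nonneg_nonneg) (auto simp: less_imp_le)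

end

section \<open>Axioms of metric currents for edge currents, and the boundary\<close>

lemma mass_dominated_cong:
  assumes "\<And>f ps. (f, ps) \<in> forms k X \<Longrightarrow> T f ps = T' f ps"
  shows "mass_dominated k X T = mass_dominated k X T'"
  using assms unfolding mass_dominated_def by (intro ext) (auto simp: Ball_def)

lemma mass_cong:
  assumes "\<And>f ps. (f, ps) \<in> forms k X \<Longrightarrow> T f ps = T' f ps"
  shows "mass k X T = mass k X T'"
proof -
  have "mass_dominated k X T = mass_dominated k X T'" by (rule mass_dominated_cong) (rule assms)
  then show ?thesis by (simp only: mass_def mass_measure_def)
qed

lemma set_integral_split_interval:
  fixes f :: "real \<Rightarrow> real"
  assumes "a < c" "c < b" and 1: "set_integrable lebesgue {a<..<c} f" and 2: "set_integrable lebesgue {c<..<b} f"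
  shows "(LINT t:{a<..<b}|lebesgue. f t) = (LINT t:{a<..<c}|lebesgue. f t) + (LINT t:{c<..<b}|lebesgue. f t)"
proof -
  have "AE t in lebesgue. t \<notin> {c}" by (intro AE_not_in) (simp flip: negligible_iff_null_sets)
  then have "AE t in lebesgue. indicator {a<..<b} t *\<^sub>R f t = indicator {a<..<c} t *\<^sub>R f t + indicator {c<..<b} t *\<^sub>R f t"
    by eventually_elim (use assms(1,2) in \<open>auto simp: indicator_def\<close>)
  then have "(LINT t:{a<..<b}|lebesgue. f t) = (LINT t|lebesgue. indicator {a<..<c} t *\<^sub>R f t + indicator {c<..<b} t *\<^sub>R f t)"
    unfolding set_lebesgue_integral_def
    using 1 2 by (intro lebesgue_integral_eq_AE borel_measurable_integrable Bochner_Integration.integrable_add) (auto simp: set_integrable_def)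
  then show ?thesis
    using 1 2 by (simp add: set_lebesgue_integral_def set_integrable_def)
qed

context fin_metric_graph
begin

lemma Lip_points_const_measurable: "(\<lambda>_. c :: real) \<in> borel_measurable (restrict_space borel (points G))"
  by simp

lemma edge_lipschitz:
  assumes "C-lipschitz_on (points G) p" "e \<in> edges G"
  shows "C-lipschitz_on {0..len G e} (\<lambda>t. p (param G e t))"
proof -
  have "(C * 1)-lipschitz_on {0..len G e} (\<lambda>t. p (param G e t))"
    by (rule lipschitz_on_compose2[OF param_lipschitz[OF assms(2)] lipschitz_on_subset[OF assms(1)]])
      (use param_in_points[OF assms(2)] in auto)
  then show ?thesis by simp
qed

text \<open>With equal weights on both halves the integrals join at the midpoint, a null set.
  Continuity, boundary and push-forward are all computed on whole edges.\<close>

lemma edge_current_full: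
  fixes g :: "'a \<Rightarrow> real"
  assumes g: "g \<in> borel_measurable (restrict_space borel (points G))" "\<And>x. x \<in> points G \<Longrightarrow> \<bar>g x\<bar> \<le> B"
    and p: "C-lipschitz_on (points G) p"
  shows "edge_current G (\<lambda>h. \<sigma> (fst h)) g [p] =
    (\<Sum>e\<in>edges G. \<sigma> e * (LINT t:{0<..<len G e}|lebesgue. g (param G e t) * vector_derivative (\<lambda>s. p (param G e s)) (at t)))"
proof -
  let ?f = "\<lambda>e t. g (param G e t) * vector_derivative (\<lambda>s. p (param G e s)) (at t)"
  have "edge_current G (\<lambda>h. \<sigma> (fst h)) g [p] = (\<Sum>e\<in>edges G. \<Sum>b\<in>UNIV. \<sigma> e * (LINT t:half_dom G (e, b)|lebesgue. ?f e t))"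
    unfolding edge_current_def halves_def list.sel by (simp add: sum.cartesian_product case_prod_beta)
  also have "\<dots> = (\<Sum>e\<in>edges G. \<sigma> e * (LINT t:{0<..<len G e}|lebesgue. ?f e t))"
  proof (rule sum.cong[OF refl])
    fix e assume e: "e \<in> edges G"
    have h: "(e, b) \<in> halves G" for b using e by (simp add: halves_def)
    have i: "set_integrable lebesgue {0<..<len G e / 2} (?f e)" "set_integrable lebesgue {len G e / 2<..<len G e} (?f e)"
      using edge_current_integrable[OF g p h[of True]] edge_current_integrable[OF g p h[of False]]
      by (simp_all add: half_lo_def half_hi_def)
    have "(LINT t:{0<..<len G e}|lebesgue. ?f e t) = (LINT t:{0<..<len G e / 2}|lebesgue. ?f e t) + (LINT t:{len G e / 2<..<len G e}|lebesgue. ?f e t)"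
      using len_pos[OF e] i by (intro set_integral_split_interval) auto
    then show "(\<Sum>b\<in>UNIV. \<sigma> e * (LINT t:half_dom G (e, b)|lebesgue. ?f e t)) = \<sigma> e * (LINT t:{0<..<len G e}|lebesgue. ?f e t)"
      by (simp add: UNIV_bool half_lo_def half_hi_def distrib_left)
  qed
  finally show ?thesis .
qed

lemma edge_current_lincomb_form:
  fixes f :: "'a \<Rightarrow> real"
  assumes f: "f \<in> borel_measurable (restrict_space borel (points G))" "\<And>x. x \<in> points G \<Longrightarrow> \<bar>f x\<bar> \<le> A"
    and p: "C-lipschitz_on (points G) p" and q: "D-lipschitz_on (points G) q"
  shows "edge_current G w f [\<lambda>x. a * p x + b * q x] = a * edge_current G w f [p] + b * edge_current G w f [q]"
proof -
  have "(LINT t:half_dom G h|lebesgue. f (param G (fst h) t) * vector_derivative (\<lambda>s. a * p (param G (fst h) s) + b * q (param G (fst h) s)) (at t)) =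
     a * (LINT t:half_dom G h|lebesgue. f (param G (fst h) t) * vector_derivative (\<lambda>s. p (param G (fst h) s)) (at t)) +
     b * (LINT t:half_dom G h|lebesgue. f (param G (fst h) t) * vector_derivative (\<lambda>s. q (param G (fst h) s)) (at t))"
    (is "?L = a * ?P + b * ?Q") if h: "h \<in> halves G" for h
  proof -
    let ?fp = "\<lambda>t. f (param G (fst h) t) * vector_derivative (\<lambda>s. p (param G (fst h) s)) (at t)"
    let ?fq = "\<lambda>t. f (param G (fst h) t) * vector_derivative (\<lambda>s. q (param G (fst h) s)) (at t)"
    have i: "set_integrable lebesgue (half_dom G h) (\<lambda>t. a * ?fp t)" "set_integrable lebesgue (half_dom G h) (\<lambda>t. b * ?fq t)"
      using edge_current_integrable[OF f p h] edge_current_integrable[OF f q h] by auto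
    have "?L = (LINT t:half_dom G h|lebesgue. a * ?fp t + b * ?fq t)"
      unfolding set_lebesgue_integral_def
    proof (rule lebesgue_integral_eq_AE)
      show "(\<lambda>t. indicator (half_dom G h) t *\<^sub>R (a * ?fp t + b * ?fq t)) \<in> borel_measurable lebesgue"
        using set_integral_add(1)[OF i] by (simp add: set_integrable_def borel_measurable_integrable)
      show "AE t in lebesgue. indicator (half_dom G h) t *\<^sub>R (f (param G (fst h) t) * vector_derivative (\<lambda>s. a * p (param G (fst h) s) + b * q (param G (fst h) s)) (at t)) =
        indicator (half_dom G h) t *\<^sub>R (a * ?fp t + b * ?fq t)"
        using lipschitz_interval_derivative_AE[OF half_lipschitz[OF p h]] lipschitz_interval_derivative_AE[OF half_lipschitz[OF q h]]
      proof eventually_elim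
        case (elim t)
        show ?case
        proof (cases "t \<in> half_dom G h")
          case True
          let ?dp = "vector_derivative (\<lambda>s. p (param G (fst h) s)) (at t)" and ?dq = "vector_derivative (\<lambda>s. q (param G (fst h) s)) (at t)"
          have "((\<lambda>s. p (param G (fst h) s)) has_real_derivative ?dp) (at t)" "((\<lambda>s. q (param G (fst h) s)) has_real_derivative ?dq) (at t)"
            using elim True by (simp_all add: has_real_derivative_iff_has_vector_derivative)
          then have "((\<lambda>s. a * p (param G (fst h) s) + b * q (param G (fst h) s)) has_real_derivative (a * ?dp + b * ?dq)) (at t)"
            by (intro DERIV_add DERIV_cmult)
          then have "vector_derivative (\<lambda>s. a * p (param G (fst h) s) + b * q (param G (fst h) s)) (at t) = a * ?dp + b * ?dq"
            by (intro vector_derivative_at) (simp add: has_real_derivative_iff_has_vector_derivative)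
          then show ?thesis by (simp add: algebra_simps)
        qed simp
      qed
    qed
    also have "\<dots> = a * ?P + b * ?Q" using set_integral_add(2)[OF i] by simp
    finally show ?thesis .
  qed
  then show ?thesis
    unfolding edge_current_def list.sel by (simp add: sum.distrib sum_distrib_left algebra_simps)
qed

lemma forms_1E:
  assumes "(f, ps) \<in> forms 1 (X :: 'b::metric_space set)"
  obtains p C A where "ps = [p]" "f \<in> Lip_bdd X" "p \<in> Lip X" "C-lipschitz_on X p"
    "f \<in> borel_measurable (restrict_space borel X)" "\<And>x. x \<in> X \<Longrightarrow> \<bar>f x\<bar> \<le> A" "0 \<le> A"
proof -
  from assms obtain p where p: "ps = [p]" "f \<in> Lip_bdd X" "p \<in> Lip X"
    by (auto simp: forms_def length_Suc_conv)
  obtain A where A: "0 \<le> A" "\<And>x. x \<in> X \<Longrightarrow> \<bar>f x\<bar> \<le> A" using Lip_bddE[OF p(2)] by metis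
  show ?thesis
    using that[OF p lipschitz_on_lip_const[OF p(3)] Lip_borel_measurable[OF Lip_bdd_imp_Lip[OF p(2)] refl] A(2) A(1)] .
qed

lemma multilinear_edge_current: "multilinear 1 (points G) (edge_current G w)"
  unfolding multilinear_def
proof (intro conjI allI impI)
  fix f g :: "'a \<Rightarrow> real" and ps a b assume f: "(f, ps) \<in> forms 1 (points G)" and g: "(g, ps) \<in> forms 1 (points G)"
  obtain p C A where 1: "ps = [p]" "C-lipschitz_on (points G) p"
    "f \<in> borel_measurable (restrict_space borel (points G))" "\<And>x. x \<in> points G \<Longrightarrow> \<bar>f x\<bar> \<le> A"
    using forms_1E[OF f] by metis
  obtain B where 2: "g \<in> borel_measurable (restrict_space borel (points G))" "\<And>x. x \<in> points G \<Longrightarrow> \<bar>g x\<bar> \<le> B"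
    using forms_1E[OF g] by metis
  show "edge_current G w (\<lambda>x. a * f x + b * g x) ps = a * edge_current G w f ps + b * edge_current G w g ps"
    unfolding 1(1) by (rule edge_current_lincomb[OF 1(3,4) 2 1(2)])
next
  fix f :: "'a \<Rightarrow> real" and ps i p q a b
  assume f: "(f, ps) \<in> forms 1 (points G)" and i: "i < (1::nat)" and p: "p \<in> Lip (points G)" and q: "q \<in> Lip (points G)"
  obtain r A where 1: "ps = [r]"
    "f \<in> borel_measurable (restrict_space borel (points G))" "\<And>x. x \<in> points G \<Longrightarrow> \<bar>f x\<bar> \<le> A"
    using forms_1E[OF f] by metis
  show "edge_current G w f (ps[i := \<lambda>x. a * p x + b * q x]) = a * edge_current G w f (ps[i := p]) + b * edge_current G w f (ps[i := q])"
    using i edge_current_lincomb_form[OF 1(2,3) lipschitz_on_lip_const[OF p] lipschitz_on_lip_const[OF q], of w a b]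
    by (simp add: 1(1))
qed

text \<open>By continuity of the parametrization, a parameter with f \<noteq> 0 has a neighbourhood
  that is mapped into U, where the form is constant; so its derivative vanishes there.\<close>

lemma locality_edge_current: "locality_axiom 1 (points G) (edge_current G w)"
proof -
  have "edge_current G w f ps = 0"
    if f: "(f, ps) \<in> forms 1 (points G)" and i: "i < (1::nat)" and U: "open U" "{x \<in> points G. f x \<noteq> 0} \<subseteq> U"
      and c: "\<forall>x\<in>points G \<inter> U. (ps ! i) x = c" for f ps i U c
  proof -
  obtain p where p: "ps = [p]" using forms_1E[OF f] by metis
  have pc: "p x = c" if "x \<in> points G" "x \<in> U" for x using c i p that by simp
  have "f (param G (fst h) t) * vector_derivative (\<lambda>s. p (param G (fst h) s)) (at t) = 0"
    if h: "h \<in> halves G" and t: "t \<in> half_dom G h" for h t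
  proof (cases "f (param G (fst h) t) = 0")
    case False
    then have "param G (fst h) t \<in> U" using U half_param_points[OF h t] by auto
    define W where "W = half_dom G h \<inter> param G (fst h) -` U"
    have "continuous_on (half_dom G h) (param G (fst h))"
      by (rule continuous_on_subset[OF lipschitz_on_continuous_on[OF param_lipschitz[OF half_fst[OF h]]]])
        (use half_open_subset[OF h] in auto)
    then have "open W" unfolding W_def using U(1) by (intro continuous_open_preimage) auto
    moreover have "t \<in> W" using t \<open>param G (fst h) t \<in> U\<close> by (simp add: W_def)
    ultimately have "((\<lambda>s. p (param G (fst h) s)) has_vector_derivative 0) (at t)"
      by (rule has_vector_derivative_transform_within_open[OF has_vector_derivative_const[of c]])
        (use pc half_param_points[OF h] in \<open>auto simp: W_def\<close>)
    then show ?thesis by (simp add: vector_derivative_at)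
  qed simp
  then have "(LINT t:half_dom G h|lebesgue. f (param G (fst h) t) * vector_derivative (\<lambda>s. p (param G (fst h) s)) (at t)) = (LINT t:half_dom G h|lebesgue. 0)"
    if "h \<in> halves G" for h
    using that unfolding set_lebesgue_integral_def by (intro Bochner_Integration.integral_cong refl) (auto simp: indicator_def)
  then show "edge_current G w f ps = 0"
    unfolding edge_current_def p list.sel by (simp add: set_lebesgue_integral_def)
  qed
  then show ?thesis unfolding locality_axiom_def by blast
qed

lemma continuity_edge_current: "continuity_axiom 1 (points G) (edge_current G (\<lambda>h. \<sigma> (fst h)))"
  unfolding continuity_axiom_def
proof (intro allI impI)
  fix f :: "'a \<Rightarrow> real" and ps and P :: "nat \<Rightarrow> ('a \<Rightarrow> real) list" and C
  assume f: "(f, ps) \<in> forms 1 (points G)"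
    and P: "\<forall>n. length (P n) = 1 \<and> (\<forall>i<1. C-lipschitz_on (points G) (P n ! i))"
    and lim: "\<forall>i<1. \<forall>x\<in>points G. (\<lambda>n. (P n ! i) x) \<longlonglongrightarrow> (ps ! i) x"
  obtain p D A where p: "ps = [p]" "D-lipschitz_on (points G) p" and fm: "f \<in> borel_measurable (restrict_space borel (points G))"
    and A: "\<And>x. x \<in> points G \<Longrightarrow> \<bar>f x\<bar> \<le> A" and fL: "f \<in> Lip_bdd (points G)"
    using forms_1E[OF f] by metis
  define q where "q n = hd (P n)" for n
  have Pq: "P n = [q n]" for n using P by (metis One_nat_def Suc_length_conv length_0_conv list.sel(1) q_def)
  have q: "C-lipschitz_on (points G) (q n)" for n using P Pq by (metis less_one nth_Cons_0)
  have limq: "(\<lambda>n. q n x) \<longlonglongrightarrow> p x" if "x \<in> points G" for x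
    using lim that by (simp add: Pq p(1))
  \<comment> \<open>One constant for the sequence and its limit, as the weak limit lemma
    expects.\<close>
  define L where "L = max C D"
  have qL: "L-lipschitz_on (points G) (q n)" for n
    using q by (rule lipschitz_on_mono) (auto simp: L_def)
  have pL: "L-lipschitz_on (points G) p"
    using p(2) by (rule lipschitz_on_mono) (auto simp: L_def)
  obtain K where K: "K-lipschitz_on (points G) f" using fL by (auto simp: Lip_bdd_def Lip_def)
  have "(\<lambda>n. \<Sum>e\<in>edges G. \<sigma> e * (LINT t:{0<..<len G e}|lebesgue. f (param G e t) * vector_derivative (\<lambda>s. q n (param G e s)) (at t)))
    \<longlonglongrightarrow> (\<Sum>e\<in>edges G. \<sigma> e * (LINT t:{0<..<len G e}|lebesgue. f (param G e t) * vector_derivative (\<lambda>s. p (param G e s)) (at t)))"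
  proof (intro tendsto_sum tendsto_mult_left)
    fix e assume e: "e \<in> edges G"
    show "(\<lambda>n. LINT t:{0<..<len G e}|lebesgue. f (param G e t) * vector_derivative (\<lambda>s. q n (param G e s)) (at t))
      \<longlonglongrightarrow> (LINT t:{0<..<len G e}|lebesgue. f (param G e t) * vector_derivative (\<lambda>s. p (param G e s)) (at t))"
      using len_pos[OF e] limq param_in_points[OF e]
      by (intro lipschitz_derivative_weak_limit[OF edge_lipschitz[OF K e] edge_lipschitz[OF qL e] edge_lipschitz[OF pL e]]) auto
  qed
  then show "(\<lambda>n. edge_current G (\<lambda>h. \<sigma> (fst h)) f (P n)) \<longlonglongrightarrow> edge_current G (\<lambda>h. \<sigma> (fst h)) f ps"
    unfolding Pq p(1) by (simp only: edge_current_full[OF fm _ qL, of A] edge_current_full[OF fm _ pL, of A] A)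
qed

lemma edge_current_metric_current: "edge_current G (\<lambda>h. \<sigma> (fst h)) \<in> metric_currents 1 (points G)"
  unfolding metric_currents_def
  using mass_dominated_edge_current multilinear_edge_current continuity_edge_current locality_edge_current by blast

text \<open>Net inflow at v when e is traversed with sign \<open>\<sigma> e\<close>; the two ends of
  a loop cancel.\<close>

definition vertex_balance :: "('e \<Rightarrow> int) \<Rightarrow> 'a \<Rightarrow> int" where
  "vertex_balance \<sigma> v = (\<Sum>e\<in>edges G. \<sigma> e * (of_bool (param G e (len G e) = v) - of_bool (param G e 0 = v)))"

lemma vertex_balance_support: "{v. vertex_balance \<sigma> v \<noteq> 0} \<subseteq> verts G"
proof
  fix v assume "v \<in> {v. vertex_balance \<sigma> v \<noteq> 0}"
  then obtain e where "e \<in> edges G" "\<sigma> e * (of_bool (param G e (len G e) = v) - of_bool (param G e 0 = v)) \<noteq> 0"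
    unfolding vertex_balance_def by (auto elim: sum.not_neutral_contains_not_neutral)
  then show "v \<in> verts G" using param_0 param_len by (auto split: if_splits simp: of_bool_def)
qed

text \<open>On each edge the fundamental theorem leaves the difference of the end values; regrouping
  these by vertices produces the coefficients.\<close>

lemma boundary_edge_current:
  "point_mass_sum (points G) (boundary (edge_current G (\<lambda>h. real_of_int (\<sigma> (fst h))))) (vertex_balance \<sigma>)"
  unfolding point_mass_sum_def
proof (intro conjI ballI)
  show "finite {v. vertex_balance \<sigma> v \<noteq> 0}" using finite_subset[OF vertex_balance_support fin_verts] .
  show "{v. vertex_balance \<sigma> v \<noteq> 0} \<subseteq> points G" using vertex_balance_support by (auto simp: points_def)
  fix f assume "f \<in> Lip_bdd (points G)"
  then obtain C where C: "C-lipschitz_on (points G) f" by (auto simp: Lip_bdd_def Lip_def)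
  have "boundary (edge_current G (\<lambda>h. real_of_int (\<sigma> (fst h)))) f [] =
    (\<Sum>e\<in>edges G. \<sigma> e * (LINT t:{0<..<len G e}|lebesgue. 1 * vector_derivative (\<lambda>s. f (param G e s)) (at t)))"
    unfolding boundary_def by (rule edge_current_full[OF Lip_points_const_measurable _ C, where B=1]) simp
  also have "\<dots> = (\<Sum>e\<in>edges G. \<sigma> e * (f (param G e (len G e)) - f (param G e 0)))"
    using lipschitz_interval_FTC[OF edge_lipschitz[OF C]] len_pos by (intro sum.cong refl) (simp add: less_imp_le)
  also have "\<dots> = (\<Sum>e\<in>edges G. \<Sum>v\<in>verts G. \<sigma> e * (of_bool (param G e (len G e) = v) - of_bool (param G e 0 = v)) * f v)"
  proof (rule sum.cong[OF refl])
    fix e assume e: "e \<in> edges G"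
    have "(\<Sum>v\<in>verts G. of_bool (param G e t = v) * f v) = f (param G e t)" if "param G e t \<in> verts G" for t
    proof -
      have "(\<Sum>v\<in>verts G. of_bool (param G e t = v) * f v) = (\<Sum>v\<in>verts G. if v = param G e t then f v else 0)"
        by (intro sum.cong) auto
      then show ?thesis using that fin_verts by simp
    qed
    then show "\<sigma> e * (f (param G e (len G e)) - f (param G e 0)) = (\<Sum>v\<in>verts G. \<sigma> e * (of_bool (param G e (len G e) = v) - of_bool (param G e 0 = v)) * f v)"
      using param_0[OF e] param_len[OF e]
      by (simp add: left_diff_distrib right_diff_distrib sum_subtractf mult.assoc flip: sum_distrib_left)
  qed
  also have "\<dots> = (\<Sum>v\<in>verts G. \<Sum>e\<in>edges G. \<sigma> e * (of_bool (param G e (len G e) = v) - of_bool (param G e 0 = v)) * f v)"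
    by (rule sum.swap)
  also have "\<dots> = (\<Sum>v\<in>verts G. real_of_int (vertex_balance \<sigma> v) * f v)"
    unfolding vertex_balance_def by (simp add: sum_distrib_right)
  also have "\<dots> = (\<Sum>v | vertex_balance \<sigma> v \<noteq> 0. real_of_int (vertex_balance \<sigma> v) * f v)"
    using vertex_balance_support[of \<sigma>] fin_verts by (intro sum.mono_neutral_right) auto
  finally show "boundary (edge_current G (\<lambda>h. real_of_int (\<sigma> (fst h)))) f [] = (\<Sum>v | vertex_balance \<sigma> v \<noteq> 0. real_of_int (vertex_balance \<sigma> v) * f v)" .
qed

end

section \<open>Restriction, push-forward and integrality of edge currents\<close>

text \<open>The conclusion of \<open>pushforward_density\<close> turned into a predicate of the
  density, so that one density per edge can be chosen.\<close>

definition pushes_forward_to :: "(real \<Rightarrow> real) \<Rightarrow> real set \<Rightarrow> (real \<Rightarrow> int) \<Rightarrow> bool" where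
  "pushes_forward_to u V \<theta> \<longleftrightarrow> integrable lebesgue (\<lambda>y. real_of_int (\<theta> y)) \<and>
    (\<forall>(f :: real \<Rightarrow> real) p K M B. K-lipschitz_on UNIV f \<longrightarrow> M-lipschitz_on UNIV p \<longrightarrow> (\<forall>x. \<bar>f x\<bar> \<le> B) \<longrightarrow>
       integrable lebesgue (\<lambda>y. real_of_int (\<theta> y) * (f y * vector_derivative p (at y))) \<and>
       (LINT t:V|lebesgue. f (u t) * vector_derivative (\<lambda>s. p (u s)) (at t)) =
       (LINT y|lebesgue. real_of_int (\<theta> y) * (f y * vector_derivative p (at y))))"

lemma ex_pushes_forward_to:
  fixes u :: "real \<Rightarrow> real"
  assumes u: "L-lipschitz_on {a..b} u" and V: "open V" "V \<subseteq> {a<..<b}"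
  shows "\<exists>\<theta>. pushes_forward_to u V \<theta>"
proof (rule pushforward_density[OF u V])
  fix \<theta> :: "real \<Rightarrow> int"
  assume 1: "integrable lebesgue (\<lambda>y. real_of_int (\<theta> y))"
    and 2: "\<And>(f :: real \<Rightarrow> real) p K M B. K-lipschitz_on UNIV f \<Longrightarrow> M-lipschitz_on UNIV p \<Longrightarrow> (\<And>x. \<bar>f x\<bar> \<le> B) \<Longrightarrow>
       integrable lebesgue (\<lambda>y. real_of_int (\<theta> y) * (f y * vector_derivative p (at y))) \<and>
       (LINT t:V|lebesgue. f (u t) * vector_derivative (\<lambda>s. p (u s)) (at t)) =
       (LINT y|lebesgue. real_of_int (\<theta> y) * (f y * vector_derivative p (at y)))"
  show ?thesis
    unfolding pushes_forward_to_def
  proof (intro exI[of _ \<theta>] conjI[OF 1] allI impI)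
    fix f p :: "real \<Rightarrow> real" and K M B :: real
    assume "K-lipschitz_on UNIV f" "M-lipschitz_on UNIV p" "\<forall>x. \<bar>f x\<bar> \<le> B"
    then show "integrable lebesgue (\<lambda>y. real_of_int (\<theta> y) * (f y * vector_derivative p (at y))) \<and>
       (LINT t:V|lebesgue. f (u t) * vector_derivative (\<lambda>s. p (u s)) (at t)) =
       (LINT y|lebesgue. real_of_int (\<theta> y) * (f y * vector_derivative p (at y)))"
      by (intro 2) auto
  qed
qed

lemma pushes_forward_toD:
  assumes pf: "pushes_forward_to u V \<theta>"
  shows "integrable lebesgue (\<lambda>y. real_of_int (\<theta> y))"
    and "K-lipschitz_on UNIV f \<Longrightarrow> M-lipschitz_on UNIV p \<Longrightarrow> (\<And>x. \<bar>f x\<bar> \<le> B) \<Longrightarrow>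
       integrable lebesgue (\<lambda>y. real_of_int (\<theta> y) * (f y * vector_derivative p (at y)))"
    and "K-lipschitz_on UNIV f \<Longrightarrow> M-lipschitz_on UNIV p \<Longrightarrow> (\<And>x. \<bar>f x\<bar> \<le> B) \<Longrightarrow>
       (LINT t:V|lebesgue. f (u t) * vector_derivative (\<lambda>s. p (u s)) (at t)) =
       (LINT y|lebesgue. real_of_int (\<theta> y) * (f y * vector_derivative p (at y)))"
proof -
  show "integrable lebesgue (\<lambda>y. real_of_int (\<theta> y))"
    using pf unfolding pushes_forward_to_def by blast
  assume "K-lipschitz_on UNIV f" "M-lipschitz_on UNIV p" "\<And>x. \<bar>f x\<bar> \<le> B"
  then have "integrable lebesgue (\<lambda>y. real_of_int (\<theta> y) * (f y * vector_derivative p (at y))) \<and>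
       (LINT t:V|lebesgue. f (u t) * vector_derivative (\<lambda>s. p (u s)) (at t)) =
       (LINT y|lebesgue. real_of_int (\<theta> y) * (f y * vector_derivative p (at y)))"
    using pf unfolding pushes_forward_to_def by blast
  then show "integrable lebesgue (\<lambda>y. real_of_int (\<theta> y) * (f y * vector_derivative p (at y)))"
    "(LINT t:V|lebesgue. f (u t) * vector_derivative (\<lambda>s. p (u s)) (at t)) =
       (LINT y|lebesgue. real_of_int (\<theta> y) * (f y * vector_derivative p (at y)))" by simp_all
qed

lemma hausdorff1_null_subset:
  assumes "A \<subseteq> B" "hausdorff1 B = 0"
  shows "hausdorff1 A = 0"
proof -
  have "hausdorff1_delta \<delta> A \<le> hausdorff1_delta \<delta> B" for \<delta>
    unfolding hausdorff1_delta_def using assms(1) by (intro INF_superset_mono) auto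
  then have "hausdorff1 A \<le> hausdorff1 B"
    unfolding hausdorff1_def by (intro SUP_mono) auto
  with assms(2) show ?thesis by simp
qed

text \<open>The finitely many edges are enumerated by all naturals with repetition, which takes at
  least one edge. Any point they miss is a vertex, and finite sets are null.\<close>

lemma countably_H1_rectifiable_param:
  assumes "fin_metric_graph G" "edges G \<noteq> {}"
  shows "countably_H1_rectifiable (points G)"
proof -
  interpret fin_metric_graph G by fact
  have rng: "range (from_nat_into (edges G)) = edges G"
    using assms(2) countable_finite[OF fin_edges] by (rule range_from_nat_into)
  have sub: "points G - (\<Union>i. param G (from_nat_into (edges G) i) ` {0..len G (from_nat_into (edges G) i)}) \<subseteq> verts G"
  proof
    fix x assume x: "x \<in> points G - (\<Union>i. param G (from_nat_into (edges G) i) ` {0..len G (from_nat_into (edges G) i)})"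
    show "x \<in> verts G"
    proof (rule ccontr)
      assume "x \<notin> verts G"
      then obtain e where e: "e \<in> edges G" "x \<in> edge_set G e" using x by (auto simp: points_def)
      obtain i where "from_nat_into (edges G) i = e" using e(1) rng by (metis imageE)
      with e(2) have "x \<in> (\<Union>i. param G (from_nat_into (edges G) i) ` {0..len G (from_nat_into (edges G) i)})"
        unfolding edge_set_def by blast
      with x show False by blast
    qed
  qed
  have "hausdorff1 (points G - (\<Union>i. param G (from_nat_into (edges G) i) ` {0..len G (from_nat_into (edges G) i)})) = 0"
    using finite_subset[OF sub fin_verts] by (rule hausdorff1_finite)
  moreover have "\<exists>C. C-lipschitz_on {0..len G (from_nat_into (edges G) i)} (param G (from_nat_into (edges G) i))" for i
    using param_lipschitz[OF from_nat_into[OF assms(2)]] by blast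
  ultimately show ?thesis
    unfolding countably_H1_rectifiable_def
    by (intro exI[of _ "\<lambda>i. {0..len G (from_nat_into (edges G) i)}"] exI[of _ "\<lambda>i. param G (from_nat_into (edges G) i)"]) auto
qed

context fin_metric_graph
begin

text \<open>The inverse of a half edge is an isometry and carries Hausdorff null sets to null sets
  of parameters.\<close>

lemma half_preimage_negligible:
  assumes h: "h \<in> halves G" and N: "hausdorff1 N = 0"
  shows "negligible {t\<in>half_dom G h. param G (fst h) t \<in> N}"
proof -
  let ?g = "param G (fst h)" and ?I = "half_dom G h"
  have "negligible (inv_into ?I ?g ` (N \<inter> half_set G h))"
  proof (rule hausdorff1_null_lipschitz_image[where L=1])
    show "hausdorff1 (N \<inter> half_set G h) = 0" using hausdorff1_null_subset[OF _ N] by blast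
    fix x y assume "x \<in> N \<inter> half_set G h" "y \<in> N \<inter> half_set G h"
    then obtain s t where "s \<in> ?I" "t \<in> ?I" "x = ?g s" "y = ?g t" by blast
    then show "\<bar>inv_into ?I ?g x - inv_into ?I ?g y\<bar> \<le> 1 * dist x y"
      using half_isometry[OF h, of s t] half_inj[OF h] by simp
  qed simp
  moreover have "{t\<in>?I. ?g t \<in> N} \<subseteq> inv_into ?I ?g ` (N \<inter> half_set G h)"
  proof
    fix t assume t: "t \<in> {t\<in>?I. ?g t \<in> N}"
    then have "inv_into ?I ?g (?g t) = t" using half_inj[OF h] by simp
    moreover have "?g t \<in> N \<inter> half_set G h" using t by auto
    ultimately show "t \<in> inv_into ?I ?g ` (N \<inter> half_set G h)" by (metis imageI)
  qed
  ultimately show ?thesis by (rule negligible_subset)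
qed

lemma edge_measure_null:
  assumes N: "N \<in> sets (restrict_space borel (points G))" "hausdorff1 N = 0"
  shows "emeasure (edge_measure G w) N = 0"
proof -
  have "(LINT t:half_dom G h|lebesgue. indicat_real N (param G (fst h) t)) = 0" if h: "h \<in> halves G" for h
  proof -
    have "AE t in lebesgue. t \<notin> {t\<in>half_dom G h. param G (fst h) t \<in> N}"
      using half_preimage_negligible[OF h N(2)] by (intro AE_not_in) (simp add: negligible_iff_null_sets)
    then have "AE t in lebesgue. indicator (half_dom G h) t *\<^sub>R indicat_real N (param G (fst h) t) = 0"
      by eventually_elim (auto simp: indicator_def)
    then show ?thesis unfolding set_lebesgue_integral_def by (rule integral_eq_zero_AE)
  qed
  then have "measure (edge_measure G w) N = 0" using measure_edge_measure[OF N(1)] by simp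
  then show ?thesis using finite_edge_measure[of w] by (simp add: finite_measure.emeasure_eq_measure)
qed

text \<open>The description asks for a limit common to all approximating sequences. The bound by the
  edge measure shows that the integral formula gives such a limit, and the sequence
  \<open>F0\<close> makes it the only one.\<close>

lemma borel_extension_edge_current:
  assumes g: "g \<in> borel_measurable (restrict_space borel (points G))" "\<And>x. x \<in> points G \<Longrightarrow> \<bar>g x\<bar> \<le> B"
    and p: "C-lipschitz_on (points G) p"
    and F0: "\<And>n::nat. F0 n \<in> Lip_bdd (points G)" "(\<lambda>n. \<integral>x. \<bar>F0 n x - g x\<bar> \<partial>edge_measure G w) \<longlonglongrightarrow> 0"
  shows "borel_extension 1 (points G) (edge_current G w) g [p] = edge_current G w g [p]"
proof -
  have conv: "(\<lambda>n. edge_current G w (F n) [p]) \<longlonglongrightarrow> edge_current G w g [p]"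
    if F: "\<And>n::nat. F n \<in> Lip_bdd (points G)" "(\<lambda>n. \<integral>x. \<bar>F n x - g x\<bar> \<partial>edge_measure G w) \<longlonglongrightarrow> 0" for F
  proof (rule LIM_zero_cancel, rule Lim_null_comparison, rule always_eventually, rule allI)
    fix n
    obtain M where M: "0 \<le> M" "\<And>x. x \<in> points G \<Longrightarrow> \<bar>F n x\<bar> \<le> M" using Lip_bddE[OF F(1)] by metis
    have Fm: "F n \<in> borel_measurable (restrict_space borel (points G))"
      using Lip_borel_measurable[OF Lip_bdd_imp_Lip[OF F(1)] refl] .
    have b: "\<bar>F n x - g x\<bar> \<le> M + B" if "x \<in> points G" for x using M(2)[OF that] g(2)[OF that] by linarith
    have "edge_current G w (F n) [p] - edge_current G w g [p] = edge_current G w (\<lambda>x. 1 * F n x + (-1) * g x) [p]"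
      by (subst edge_current_lincomb[OF Fm M(2) g p]) simp_all
    also have "\<dots> = edge_current G w (\<lambda>x. F n x - g x) [p]" by simp
    finally show "norm (edge_current G w (F n) [p] - edge_current G w g [p]) \<le> C * (\<integral>x. \<bar>F n x - g x\<bar> \<partial>edge_measure G w)"
      using edge_current_bound[OF borel_measurable_diff[OF Fm g(1)] b p, of w] by simp
  next
    show "(\<lambda>n. C * (\<integral>x. \<bar>F n x - g x\<bar> \<partial>edge_measure G w)) \<longlonglongrightarrow> 0"
      using tendsto_mult_left[OF F(2), of C] by simp
  qed
  show ?thesis
    unfolding borel_extension_def mass_measure_edge_current
  proof (rule the_equality)
    show "\<forall>F. (\<forall>n. F n \<in> Lip_bdd (points G)) \<longrightarrow> (\<lambda>n. \<integral>x. \<bar>F n x - g x\<bar> \<partial>edge_measure G w) \<longlonglongrightarrow> 0 \<longrightarrow>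
      (\<lambda>n. edge_current G w (F n) [p]) \<longlonglongrightarrow> edge_current G w g [p]"
      using conv by blast
    fix c assume "\<forall>F. (\<forall>n. F n \<in> Lip_bdd (points G)) \<longrightarrow> (\<lambda>n. \<integral>x. \<bar>F n x - g x\<bar> \<partial>edge_measure G w) \<longlonglongrightarrow> 0 \<longrightarrow>
      (\<lambda>n. edge_current G w (F n) [p]) \<longlonglongrightarrow> c"
    then have "(\<lambda>n. edge_current G w (F0 n) [p]) \<longlonglongrightarrow> c" using F0 by blast
    then show "c = edge_current G w g [p]" using LIMSEQ_unique conv[OF F0] by blast
  qed
qed

text \<open>Since k is bounded, Lipschitz approximations of the indicator of U stay approximations
  after multiplication by k.\<close>

lemma restriction_edge_current:
  assumes U: "open U" and k: "k \<in> Lip_bdd (points G)" and p: "C-lipschitz_on (points G) p"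
  shows "restriction 1 (points G) (edge_current G w) U k [p] = edge_current G w (\<lambda>x. indicator U x * k x) [p]"
proof -
  let ?X = "points G"
  obtain B where B: "0 \<le> B" "\<And>x. x \<in> ?X \<Longrightarrow> \<bar>k x\<bar> \<le> B" using Lip_bddE[OF k] by metis
  have km: "k \<in> borel_measurable (restrict_space borel ?X)" using Lip_borel_measurable[OF Lip_bdd_imp_Lip[OF k] refl] .
  have Um: "indicat_real U \<in> borel_measurable (restrict_space borel ?X)"
    using U by (intro measurable_restrict_space1) auto
  obtain F where F: "\<And>n::nat. F n \<in> Lip_bdd ?X" "(\<lambda>n. \<integral>x. \<bar>F n x - indicator U x\<bar> \<partial>edge_measure G w) \<longlonglongrightarrow> 0"
    using Lip_bdd_approx_indicator_borel[OF sets_edge_measure finite_edge_measure borel_open[OF U]] by blast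
  have toM: "f \<in> borel_measurable (edge_measure G w)" if "f \<in> borel_measurable (restrict_space borel ?X)" for f :: "'a \<Rightarrow> real"
    using that measurable_cong_sets[OF sets_edge_measure refl] by blast
  have sp: "space (edge_measure G w) = ?X" by (rule space_restrict_borel[OF sets_edge_measure])
  interpret finite_measure "edge_measure G w" by (rule finite_edge_measure)
  have ki: "integrable (edge_measure G w) k" using Lip_bdd_integrable[OF k sets_edge_measure finite_edge_measure] .
  have Ui: "integrable (edge_measure G w) (indicat_real U)"
    by (rule integrable_const_bound[where B=1]) (use toM[OF Um] in \<open>auto simp: indicator_def\<close>)
  have Uki: "integrable (edge_measure G w) (\<lambda>x. indicator U x * k x)"
    by (rule integrable_const_bound[where B=B])
      (use B sp toM[OF borel_measurable_times[OF Um km]] in \<open>auto simp: indicator_def\<close>)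
  have Fi: "integrable (edge_measure G w) (F n)" for n
    using Lip_bdd_integrable[OF F(1) sets_edge_measure finite_edge_measure] .
  have Fki: "integrable (edge_measure G w) (\<lambda>x. F n x * k x)" for n
    using Lip_bdd_integrable[OF Lip_bdd_mult[OF F(1) k] sets_edge_measure finite_edge_measure] .
  have "(\<lambda>n. \<integral>x. \<bar>F n x * k x - indicator U x * k x\<bar> \<partial>edge_measure G w) \<longlonglongrightarrow> 0"
  proof (rule tendsto_sandwich[OF _ _ tendsto_const])
    show "\<forall>\<^sub>F n in sequentially. 0 \<le> (\<integral>x. \<bar>F n x * k x - indicator U x * k x\<bar> \<partial>edge_measure G w)" by simp
    show "\<forall>\<^sub>F n in sequentially. (\<integral>x. \<bar>F n x * k x - indicator U x * k x\<bar> \<partial>edge_measure G w) \<le> B * (\<integral>x. \<bar>F n x - indicator U x\<bar> \<partial>edge_measure G w)"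
    proof (rule always_eventually, rule allI)
      fix n
      have "(\<integral>x. \<bar>F n x * k x - indicator U x * k x\<bar> \<partial>edge_measure G w) \<le> (\<integral>x. B * \<bar>F n x - indicator U x\<bar> \<partial>edge_measure G w)"
      proof (rule integral_mono)
        show "integrable (edge_measure G w) (\<lambda>x. \<bar>F n x * k x - indicator U x * k x\<bar>)"
          by (intro integrable_abs Bochner_Integration.integrable_diff Fki Uki)
        show "integrable (edge_measure G w) (\<lambda>x. B * \<bar>F n x - indicator U x\<bar>)"
          by (intro integrable_mult_right integrable_abs Bochner_Integration.integrable_diff Fi Ui)
        fix x assume "x \<in> space (edge_measure G w)"
        then have "\<bar>k x\<bar> \<le> B" using B sp by simp
        then show "\<bar>F n x * k x - indicator U x * k x\<bar> \<le> B * \<bar>F n x - indicator U x\<bar>"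
          by (simp add: abs_mult mult_right_mono mult.commute[of _ "k x"] flip: right_diff_distrib)
      qed
      then show "(\<integral>x. \<bar>F n x * k x - indicator U x * k x\<bar> \<partial>edge_measure G w) \<le> B * (\<integral>x. \<bar>F n x - indicator U x\<bar> \<partial>edge_measure G w)"
        by simp
    qed
    show "(\<lambda>n. B * (\<integral>x. \<bar>F n x - indicator U x\<bar> \<partial>edge_measure G w)) \<longlonglongrightarrow> 0"
      using tendsto_mult_left[OF F(2), of B] by simp
  qed
  from borel_extension_edge_current[OF borel_measurable_times[OF Um km] _ p Lip_bdd_mult[OF F(1) k] this, of B]
  show ?thesis
    unfolding restriction_def using B by (auto simp: indicator_def)
qed

text \<open>The part of an edge inside U is an open set of parameters and has an integer density of
  its own; these finitely many densities are added with the integer weights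
  \<open>\<sigma> e\<close>.\<close>

lemma edge_current_pushforward:
  fixes \<sigma> :: "'e \<Rightarrow> int"
  assumes \<phi>: "\<phi> \<in> Lip (points G)" and U: "open U"
  shows "\<exists>\<theta> :: real \<Rightarrow> int. integrable lebesgue (\<lambda>t. real_of_int (\<theta> t)) \<and>
    (\<forall>(f, ps)\<in>forms 1 (UNIV :: real set).
       push_forward \<phi> (restriction 1 (points G) (edge_current G (\<lambda>h. real_of_int (\<sigma> (fst h)))) U) f ps = line_current UNIV id \<theta> f ps)"
proof -
  let ?X = "points G" and ?T = "edge_current G (\<lambda>h. real_of_int (\<sigma> (fst h)))"
  obtain L where L: "L-lipschitz_on ?X \<phi>" using \<phi> by (auto simp: Lip_def)
  define V where "V e = {0<..<len G e} \<inter> param G e -` U" for e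
  have "\<exists>\<theta>. pushes_forward_to (\<lambda>t. \<phi> (param G e t)) (V e) \<theta>" if e: "e \<in> edges G" for e
  proof (rule ex_pushes_forward_to[OF edge_lipschitz[OF L e]])
    have "continuous_on {0<..<len G e} (param G e)"
      by (rule continuous_on_subset[OF lipschitz_on_continuous_on[OF param_lipschitz[OF e]]]) auto
    then show "open (V e)" unfolding V_def using U by (intro continuous_open_preimage) auto
  qed (auto simp: V_def)
  then obtain \<theta> where \<theta>: "\<And>e. e \<in> edges G \<Longrightarrow> pushes_forward_to (\<lambda>t. \<phi> (param G e t)) (V e) (\<theta> e)"
    by metis
  define \<Theta> where "\<Theta> y = (\<Sum>e\<in>edges G. \<sigma> e * \<theta> e y)" for y
  have "push_forward \<phi> (restriction 1 ?X ?T U) f ps = line_current UNIV id \<Theta> f ps"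
    if "(f, ps) \<in> forms 1 (UNIV :: real set)" for f ps
  proof -
    obtain p M K B where p: "ps = [p]" "M-lipschitz_on UNIV p" and f: "K-lipschitz_on UNIV f" "\<And>x. \<bar>f x\<bar> \<le> B"
    proof -
      obtain p M A where *: "ps = [p]" "f \<in> Lip_bdd UNIV" "M-lipschitz_on UNIV p" using forms_1E[OF \<open>(f, ps) \<in> _\<close>] by metis
      obtain K B where "K-lipschitz_on UNIV f" "\<And>x. x \<in> UNIV \<Longrightarrow> \<bar>f x\<bar> \<le> B" using Lip_bddE[OF *(2)] by metis
      with * that show ?thesis by blast
    qed
    have p\<phi>: "(M * L)-lipschitz_on ?X (\<lambda>x. p (\<phi> x))"
      using lipschitz_on_compose2[OF L lipschitz_on_subset[OF p(2)]] by simp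
    have f\<phi>: "(\<lambda>x. f (\<phi> x)) \<in> Lip_bdd ?X"
      using lipschitz_on_compose2[OF L lipschitz_on_subset[OF f(1)]] f(2) by (intro Lip_bddI) auto
    have m: "(\<lambda>x. indicator U x * f (\<phi> x)) \<in> borel_measurable (restrict_space borel ?X)"
    proof (rule borel_measurable_times)
      show "indicat_real U \<in> borel_measurable (restrict_space borel ?X)"
        using U by (intro measurable_restrict_space1) auto
      show "(\<lambda>x. f (\<phi> x)) \<in> borel_measurable (restrict_space borel ?X)"
        by (rule Lip_borel_measurable[OF Lip_bdd_imp_Lip[OF f\<phi>] refl])
    qed
    have mb: "\<bar>indicator U x * f (\<phi> x)\<bar> \<le> B" for x
      using f(2)[of "\<phi> x"] by (auto simp: indicator_def)
    have "push_forward \<phi> (restriction 1 ?X ?T U) f ps = restriction 1 ?X ?T U (\<lambda>x. f (\<phi> x)) [\<lambda>x. p (\<phi> x)]"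
      by (simp add: push_forward_def p(1) o_def)
    also have "\<dots> = ?T (\<lambda>x. indicator U x * f (\<phi> x)) [\<lambda>x. p (\<phi> x)]"
      by (rule restriction_edge_current[OF U f\<phi> p\<phi>])
    also have "\<dots> = (\<Sum>e\<in>edges G. \<sigma> e * (LINT t:{0<..<len G e}|lebesgue. indicator U (param G e t) * f (\<phi> (param G e t)) * vector_derivative (\<lambda>s. p (\<phi> (param G e s))) (at t)))"
      by (rule edge_current_full[OF m mb p\<phi>])
    also have "\<dots> = (\<Sum>e\<in>edges G. \<sigma> e * (LINT t:V e|lebesgue. f (\<phi> (param G e t)) * vector_derivative (\<lambda>s. p (\<phi> (param G e s))) (at t)))"
      unfolding set_lebesgue_integral_def
      by (intro sum.cong refl arg_cong2[where f="(*)"] Bochner_Integration.integral_cong) (auto simp: V_def indicator_def)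
    also have "\<dots> = (\<Sum>e\<in>edges G. \<sigma> e * (LINT y|lebesgue. real_of_int (\<theta> e y) * (f y * vector_derivative p (at y))))"
      using pushes_forward_toD(3)[OF \<theta> f(1) p(2) f(2)] by (intro sum.cong refl) simp
    also have "\<dots> = (LINT y|lebesgue. (\<Sum>e\<in>edges G. \<sigma> e * (real_of_int (\<theta> e y) * (f y * vector_derivative p (at y)))))"
      using pushes_forward_toD(2)[OF \<theta> f(1) p(2) f(2)] by (subst Bochner_Integration.integral_sum) auto
    also have "\<dots> = line_current UNIV id \<Theta> f ps"
      by (simp add: line_current_def \<Theta>_def p(1) set_lebesgue_integral_def sum_distrib_right mult.assoc)
    finally show ?thesis .
  qed
  moreover have "integrable lebesgue (\<lambda>y. real_of_int (\<Theta> y))"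
    unfolding \<Theta>_def using pushes_forward_toD(1)[OF \<theta>] by simp
  ultimately show ?thesis by blast
qed

lemma edge_current_integral:
  fixes \<sigma> :: "'e \<Rightarrow> int"
  assumes "edges G \<noteq> {}"
  shows "edge_current G (\<lambda>h. real_of_int (\<sigma> (fst h))) \<in> integral_currents_1 (points G)"
proof -
  let ?T = "edge_current G (\<lambda>h. real_of_int (\<sigma> (fst h)))"
  have 1: "?T \<in> metric_currents 1 (points G)"
    using edge_current_metric_current[of "\<lambda>e. real_of_int (\<sigma> e)"] by simp
  have 2: "\<exists>S\<in>sets (restrict_space borel (points G)). countably_H1_rectifiable S \<and>
    emeasure (mass_measure 1 (points G) ?T) (points G - S) = 0"
  proof (intro bexI[OF _ points_sets] conjI)
    show "countably_H1_rectifiable (points G)"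
      by (rule countably_H1_rectifiable_param[OF fin_metric_graph_axioms assms])
  qed simp
  have 3: "\<forall>N\<in>sets (restrict_space borel (points G)). hausdorff1 N = 0 \<longrightarrow> emeasure (mass_measure 1 (points G) ?T) N = 0"
    unfolding mass_measure_edge_current using edge_measure_null by blast
  have "?T \<in> integer_rectifiable_1 (points G)"
    unfolding integer_rectifiable_1_def mem_Collect_eq
    by (intro conjI 1 2 3 ballI allI impI edge_current_pushforward)
  then show ?thesis
    unfolding integral_currents_1_def using point_mass_sum_integer_rectifiable_0[OF boundary_edge_current] by simp
qed

section \<open>Multiplicity one\<close>

text \<open>The half edges serve as charts: they are isometric with disjoint images, and the masses
  of the pieces add up because mass is additive over the weights of half edges.\<close>

lemma edge_current_unit:
  fixes \<sigma> :: "'e \<Rightarrow> int"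
  assumes ne: "edges G \<noteq> {}" and \<sigma>: "\<And>e. e \<in> edges G \<Longrightarrow> \<bar>\<sigma> e\<bar> = 1"
  shows "edge_current G (\<lambda>h. real_of_int (\<sigma> (fst h))) \<in> unit_currents G"
proof -
  let ?X = "points G" and ?T = "edge_current G (\<lambda>h. real_of_int (\<sigma> (fst h)))"
  obtain hh where hh: "bij_betw hh {0..<card (halves G)} (halves G)"
    using ex_bij_betw_nat_finite[OF fin_halves] by blast
  define n where "n = card (halves G)"
  have hin: "hh i \<in> halves G" if "i < n" for i
    using bij_betwE[OF hh] that by (auto simp: n_def)
  have hinj: "hh i \<noteq> hh j" if "i < n" "j < n" "i \<noteq> j" for i j
    using bij_betw_imp_inj_on[OF hh] that by (auto simp: n_def inj_on_def)
  \<comment> \<open>A representation is an infinite series of charts; from index n on the domains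
    are empty and contribute 0.\<close>
  define C where "C i = (if i < n then half_dom G (hh i) else {})" for i
  define \<phi> where "\<phi> i = param G (fst (hh i))" for i
  define \<theta> where "\<theta> i = (\<lambda>t::real. \<sigma> (fst (hh i)))" for i
  \<comment> \<open>On an open domain the derivative within the domain is the ordinary one, so the
    current of a chart is an edge current with a single weight, whose mass is already known.\<close>
  have line: "line_current (C i) (\<phi> i) (\<theta> i) f ps = edge_current G (\<lambda>h. if i < n \<and> h = hh i then real_of_int (\<sigma> (fst h)) else 0) f ps"
    if fps: "(f, ps) \<in> forms 1 ?X" for i f ps
  proof (cases "i < n")
    case True
    obtain p where p: "ps = [p]" using forms_1E[OF fps] by metis
    have "line_current (C i) (\<phi> i) (\<theta> i) f ps = real_of_int (\<sigma> (fst (hh i))) * (LINT t:half_dom G (hh i)|lebesgue. f (param G (fst (hh i)) t) * vector_derivative (\<lambda>s. p (param G (fst (hh i)) s)) (at t))"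
    proof -
      have "line_current (C i) (\<phi> i) (\<theta> i) f ps = (LINT t:half_dom G (hh i)|lebesgue. real_of_int (\<sigma> (fst (hh i))) * (f (param G (fst (hh i)) t) * vector_derivative (\<lambda>s. p (param G (fst (hh i)) s)) (at t)))"
        unfolding line_current_def p list.sel set_lebesgue_integral_def
        using True by (intro Bochner_Integration.integral_cong refl)
          (auto simp: C_def \<phi>_def \<theta>_def indicator_def at_within_open[OF _ open_greaterThanLessThan])
      then show ?thesis by simp
    qed
    also have "\<dots> = (\<Sum>h\<in>halves G. if h = hh i then real_of_int (\<sigma> (fst h)) * (LINT t:half_dom G h|lebesgue. f (param G (fst h) t) * vector_derivative (\<lambda>s. p (param G (fst h) s)) (at t)) else 0)"
      using hin[OF True] fin_halves by simp
    also have "\<dots> = edge_current G (\<lambda>h. if i < n \<and> h = hh i then real_of_int (\<sigma> (fst h)) else 0) f ps"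
      unfolding edge_current_def p list.sel using True by (intro sum.cong refl) auto
    finally show ?thesis .
  qed (simp add: line_current_def C_def edge_current_def set_lebesgue_integral_def)
  have "rectifiable_representation ?X ?T C \<phi> \<theta>"
    unfolding rectifiable_representation_def
  proof (intro conjI allI impI ballI)
    fix i
    show "C i \<in> sets borel" by (simp add: C_def)
    show "\<phi> i ` C i \<subseteq> ?X" using half_set_subset[OF hin] by (simp add: C_def \<phi>_def)
    show "bilipschitz_on (C i) (\<phi> i)"
      unfolding bilipschitz_on_def
    proof (intro exI[of _ 1] conjI ballI)
      fix s t assume st: "s \<in> C i" "t \<in> C i"
      then have i: "i < n" by (auto simp: C_def split: if_splits)
      have "dist (\<phi> i s) (\<phi> i t) = \<bar>s - t\<bar>"
        unfolding \<phi>_def using st i by (intro half_isometry[OF hin[OF i]]) (auto simp: C_def)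
      then show "dist s t / 1 \<le> dist (\<phi> i s) (\<phi> i t)" "dist (\<phi> i s) (\<phi> i t) \<le> 1 * dist s t"
        by (simp_all add: dist_real_def)
    qed simp
    show "set_integrable lebesgue (C i) (\<lambda>t. real_of_int (\<theta> i t))"
    proof (cases "i < n")
      case True
      then show ?thesis using half_lo_less_hi[OF hin[OF True]]
        unfolding set_integrable_def \<theta>_def C_def
        by (auto intro!: integrable_scaleR_left integrable_real_indicator)
    qed (simp add: C_def set_integrable_def)
  next
    fix i j :: nat assume "i \<noteq> j"
    then show "\<phi> i ` C i \<inter> \<phi> j ` C j = {}"
      using half_sets_disjoint[OF hin hin hinj, of i j] by (cases "i < n \<and> j < n") (auto simp: C_def \<phi>_def)
  next
    have "(\<lambda>i. line_current (C i) (\<phi> i) (\<theta> i) f ps) sums ?T f ps" if f: "(f, ps) \<in> forms 1 ?X" for f ps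
    proof -
      have "(\<lambda>i. line_current (C i) (\<phi> i) (\<theta> i) f ps) sums (\<Sum>i<n. line_current (C i) (\<phi> i) (\<theta> i) f ps)"
        by (rule sums_finite) (auto simp: C_def line_current_def set_lebesgue_integral_def)
      also have "(\<Sum>i<n. line_current (C i) (\<phi> i) (\<theta> i) f ps) =
        (\<Sum>i\<in>{0..<n}. real_of_int (\<sigma> (fst (hh i))) * (LINT t:half_dom G (hh i)|lebesgue. f (param G (fst (hh i)) t) * vector_derivative (\<lambda>s. hd ps (param G (fst (hh i)) s)) (at t)))"
      proof (rule sum.cong)
        fix i assume "i \<in> {0..<n}"
        then have i: "i < n" by simp
        have "line_current (C i) (\<phi> i) (\<theta> i) f ps = (\<Sum>h\<in>halves G. if h = hh i then real_of_int (\<sigma> (fst h)) * (LINT t:half_dom G h|lebesgue. f (param G (fst h) t) * vector_derivative (\<lambda>s. hd ps (param G (fst h) s)) (at t)) else 0)"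
          unfolding line[OF f] edge_current_def using i by (intro sum.cong refl) auto
        then show "line_current (C i) (\<phi> i) (\<theta> i) f ps = real_of_int (\<sigma> (fst (hh i))) * (LINT t:half_dom G (hh i)|lebesgue. f (param G (fst (hh i)) t) * vector_derivative (\<lambda>s. hd ps (param G (fst (hh i)) s)) (at t))"
          using hin[OF i] fin_halves by simp
      qed auto
      also have "\<dots> = ?T f ps"
        unfolding edge_current_def n_def by (rule sum.reindex_bij_betw[OF hh])
      finally show ?thesis .
    qed
    then show "case x of (f, ps) \<Rightarrow> (\<lambda>i. line_current (C i) (\<phi> i) (\<theta> i) f ps) sums ?T f ps" if "x \<in> forms 1 ?X" for x
      using that by auto
  next
    have ms: "mass 1 ?X (line_current (C i) (\<phi> i) (\<theta> i)) = (if i < n then \<bar>real_of_int (\<sigma> (fst (hh i)))\<bar> * (half_hi G (hh i) - half_lo G (hh i)) else 0)" for i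
    proof -
      have "mass 1 ?X (line_current (C i) (\<phi> i) (\<theta> i)) = mass 1 ?X (edge_current G (\<lambda>h. if i < n \<and> h = hh i then real_of_int (\<sigma> (fst h)) else 0))"
        by (rule mass_cong) (rule line)
      also have "\<dots> = (\<Sum>h\<in>halves G. if i < n \<and> h = hh i then \<bar>real_of_int (\<sigma> (fst h))\<bar> * (half_hi G h - half_lo G h) else 0)"
        unfolding mass_edge_current by (intro sum.cong refl) auto
      also have "\<dots> = (if i < n then \<bar>real_of_int (\<sigma> (fst (hh i)))\<bar> * (half_hi G (hh i) - half_lo G (hh i)) else 0)"
        using hin[of i] fin_halves by (cases "i < n") simp_all
      finally show ?thesis .
    qed
    have "(\<lambda>i. mass 1 ?X (line_current (C i) (\<phi> i) (\<theta> i))) sums (\<Sum>i\<in>{0..<n}. mass 1 ?X (line_current (C i) (\<phi> i) (\<theta> i)))"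
      unfolding ms by (rule sums_finite) auto
    also have "(\<Sum>i\<in>{0..<n}. mass 1 ?X (line_current (C i) (\<phi> i) (\<theta> i))) = (\<Sum>i\<in>{0..<n}. \<bar>real_of_int (\<sigma> (fst (hh i)))\<bar> * (half_hi G (hh i) - half_lo G (hh i)))"
      unfolding ms by (intro sum.cong) auto
    also have "\<dots> = mass 1 ?X ?T"
      unfolding mass_edge_current n_def by (rule sum.reindex_bij_betw[OF hh])
    finally show "(\<lambda>i. mass 1 ?X (line_current (C i) (\<phi> i) (\<theta> i))) sums mass 1 ?X ?T" .
  qed
  moreover have images: "(\<Union>i. \<phi> i ` C i) = (\<Union>h\<in>halves G. half_set G h)"
  proof -
    have "(\<Union>i. if i < n then A i else {}) = (\<Union>i\<in>{0..<n}. A i)" for A :: "nat \<Rightarrow> 'a set"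
      by (auto split: if_splits)
    moreover have "\<phi> i ` C i = (if i < n then half_set G (hh i) else {})" for i by (simp add: C_def \<phi>_def)
    ultimately have "(\<Union>i. \<phi> i ` C i) = (\<Union>i\<in>{0..<n}. half_set G (hh i))" by simp
    also have "\<dots> = (\<Union>h\<in>halves G. half_set G h)"
      using bij_betw_imp_surj_on[OF hh] by (metis (no_types, lifting) SUP_cong image_image n_def)
    finally show ?thesis .
  qed
  \<comment> \<open>A multiplicity has to vanish off the chart images; inside the edges this
    concerns finitely many points.\<close>
  define m where "m x = (if x \<in> (\<Union>i. \<phi> i ` C i) then 1 else 0 :: nat)" for x
  have "\<forall>i. \<forall>t\<in>C i. m (\<phi> i t) = nat \<bar>\<theta> i t\<bar>"
  proof (intro allI ballI)
    fix i t assume t: "t \<in> C i"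
    then have "i < n" by (auto simp: C_def split: if_splits)
    then have "\<bar>\<sigma> (fst (hh i))\<bar> = 1" using \<sigma> half_fst[OF hin] by blast
    moreover have "\<phi> i t \<in> (\<Union>i. \<phi> i ` C i)" using t by blast
    ultimately show "m (\<phi> i t) = nat \<bar>\<theta> i t\<bar>" by (simp add: m_def \<theta>_def)
  qed
  moreover have "\<forall>x. x \<notin> (\<Union>i. \<phi> i ` C i) \<longrightarrow> m x = 0" by (simp add: m_def)
  ultimately have mult: "is_multiplicity ?X ?T m" unfolding is_multiplicity_def by blast
  have "hausdorff1 {x \<in> edge_set G e. m x \<noteq> 1} = 0" if e: "e \<in> edges G" for e
  proof (rule hausdorff1_finite, rule finite_subset[OF _ finite_points_minus_halves])
    show "{x \<in> edge_set G e. m x \<noteq> 1} \<subseteq> points G - (\<Union>h\<in>halves G. half_set G h)"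
      using e images by (auto simp: m_def points_def split: if_splits)
  qed
  then show ?thesis
    unfolding unit_currents_def using edge_current_integral[OF ne] mult by blast
qed

end

section \<open>Balanced orientations\<close>

text \<open>Splicing preserves balances: when e and f are run through as one edge, their
  contributions at the common vertex v cancel. A spliced edge may become a loop, which contributes
  nothing and is dropped. Once no two edges share a vertex and no loops remain, every vertex meets
  at most one edge end, so any orientation will do.\<close>

lemma balanced_orientation:
  fixes s t :: "'e \<Rightarrow> 'v"
  assumes "finite E"
  shows "\<exists>\<sigma> :: 'e \<Rightarrow> int. (\<forall>e\<in>E. \<bar>\<sigma> e\<bar> = 1) \<and>
    (\<forall>v. \<bar>\<Sum>e\<in>E. \<sigma> e * (of_bool (t e = v) - of_bool (s e = v))\<bar> \<le> 1)"
  using assms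
proof (induction "card E" arbitrary: E s t rule: less_induct)
  case less
  note fin = \<open>finite E\<close>
  consider (loop) e where "e \<in> E" "s e = t e"
    | (pair) e f v where "e \<in> E" "f \<in> E" "e \<noteq> f" "v \<in> {s e, t e}" "v \<in> {s f, t f}"
    | (matching) "\<And>e. e \<in> E \<Longrightarrow> s e \<noteq> t e"
        "\<And>e f v. e \<in> E \<Longrightarrow> f \<in> E \<Longrightarrow> v \<in> {s e, t e} \<Longrightarrow> v \<in> {s f, t f} \<Longrightarrow> e = f"
    by blast
  then show ?case
  proof cases
    case loop
    have "card (E - {e}) < card E" using fin loop by (meson card_Diff1_less)
    from less.hyps[OF this, of t s] fin obtain \<sigma> :: "'e \<Rightarrow> int" where \<sigma>: "\<forall>e\<in>E - {e}. \<bar>\<sigma> e\<bar> = 1"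
      "\<forall>v. \<bar>\<Sum>e\<in>E - {e}. \<sigma> e * (of_bool (t e = v) - of_bool (s e = v))\<bar> \<le> 1" by auto
    have eq: "(\<Sum>a\<in>E. (\<sigma>(e := 1)) a * (of_bool (t a = v) - of_bool (s a = v))) =
      (\<Sum>a\<in>E - {e}. \<sigma> a * (of_bool (t a = v) - of_bool (s a = v)))" for v
    proof -
      have "(\<Sum>a\<in>E. (\<sigma>(e := 1)) a * (of_bool (t a = v) - of_bool (s a = v))) =
        (\<Sum>a\<in>E - {e}. (\<sigma>(e := 1)) a * (of_bool (t a = v) - of_bool (s a = v)))"
        using fin loop by (simp add: sum.remove)
      also have "\<dots> = (\<Sum>a\<in>E - {e}. \<sigma> a * (of_bool (t a = v) - of_bool (s a = v)))"
        by (intro sum.cong) auto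
      finally show ?thesis .
    qed
    show ?thesis
    proof (intro exI conjI)
      show "\<forall>a\<in>E. \<bar>(\<sigma>(e := 1)) a\<bar> = 1" using \<sigma>(1) by auto
      show "\<forall>v. \<bar>\<Sum>a\<in>E. (\<sigma>(e := 1)) a * (of_bool (t a = v) - of_bool (s a = v))\<bar> \<le> 1"
        unfolding eq using \<sigma>(2) .
    qed
  next
    case pair
    \<comment> \<open>The far ends of e and f as seen from v. In the smaller graph e runs from a to
      b and stands for both edges.\<close>
    define a where "a = (if t e = v then s e else t e)"
    define b where "b = (if s f = v then t f else s f)"
    have "card (E - {f}) < card E" using fin pair by (meson card_Diff1_less)
    from less.hyps[OF this, of "t(e := b)" "s(e := a)"] fin obtain \<tau> :: "'e \<Rightarrow> int" where \<tau>: "\<forall>x\<in>E - {f}. \<bar>\<tau> x\<bar> = 1"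
      "\<forall>v. \<bar>\<Sum>x\<in>E - {f}. \<tau> x * (of_bool ((t(e := b)) x = v) - of_bool ((s(e := a)) x = v))\<bar> \<le> 1" by auto
    \<comment> \<open>The route goes from a through v to b; an edge whose given direction opposes it
      receives the opposite sign.\<close>
    define \<sigma> where "\<sigma> = \<tau>(e := (if t e = v then \<tau> e else - \<tau> e), f := (if s f = v then \<tau> e else - \<tau> e))"
    have eq: "(\<Sum>x\<in>E. \<sigma> x * (of_bool (t x = w) - of_bool (s x = w))) =
      (\<Sum>x\<in>E - {f}. \<tau> x * (of_bool ((t(e := b)) x = w) - of_bool ((s(e := a)) x = w)))" for w
    proof -
      have "(\<Sum>x\<in>E. \<sigma> x * (of_bool (t x = w) - of_bool (s x = w))) =
        \<sigma> f * (of_bool (t f = w) - of_bool (s f = w)) + (\<sigma> e * (of_bool (t e = w) - of_bool (s e = w)) +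
          (\<Sum>x\<in>E - {f} - {e}. \<sigma> x * (of_bool (t x = w) - of_bool (s x = w))))"
        using fin pair by (simp add: sum.remove[of E f] sum.remove[of "E - {f}" e])
      also have "(\<Sum>x\<in>E - {f} - {e}. \<sigma> x * (of_bool (t x = w) - of_bool (s x = w))) =
        (\<Sum>x\<in>E - {f} - {e}. \<tau> x * (of_bool ((t(e := b)) x = w) - of_bool ((s(e := a)) x = w)))"
        by (intro sum.cong) (auto simp: \<sigma>_def)
      also have "\<sigma> e * (of_bool (t e = w) - of_bool (s e = w)) = \<tau> e * (of_bool (v = w) - of_bool (a = w))"
        using pair by (auto simp: \<sigma>_def a_def)
      also have "\<sigma> f * (of_bool (t f = w) - of_bool (s f = w)) = \<tau> e * (of_bool (b = w) - of_bool (v = w))"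
        using pair by (auto simp: \<sigma>_def b_def)
      finally have "(\<Sum>x\<in>E. \<sigma> x * (of_bool (t x = w) - of_bool (s x = w))) = \<tau> e * (of_bool (b = w) - of_bool (a = w)) +
        (\<Sum>x\<in>E - {f} - {e}. \<tau> x * (of_bool ((t(e := b)) x = w) - of_bool ((s(e := a)) x = w)))"
        by (simp add: algebra_simps)
      then show ?thesis using fin pair by (simp add: sum.remove[of "E - {f}" e])
    qed
    show ?thesis
    proof (intro exI conjI)
      show "\<forall>x\<in>E. \<bar>\<sigma> x\<bar> = 1" using \<tau>(1) pair by (auto simp: \<sigma>_def)
      show "\<forall>w. \<bar>\<Sum>x\<in>E. \<sigma> x * (of_bool (t x = w) - of_bool (s x = w))\<bar> \<le> 1"
        unfolding eq using \<tau>(2) .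
    qed
  next
    case matching
    have "\<bar>\<Sum>x\<in>E. 1 * (of_bool (t x = v) - of_bool (s x = v)) :: int\<bar> \<le> 1" for v
    proof (cases "\<exists>e\<in>E. v \<in> {s e, t e}")
      case True
      then obtain e where e: "e \<in> E" "v \<in> {s e, t e}" by blast
      have "of_bool (t x = v) - of_bool (s x = v) = (0::int)" if "x \<in> E - {e}" for x
        using matching(2)[of x e v] that e by auto
      then have "(\<Sum>x\<in>E. 1 * (of_bool (t x = v) - of_bool (s x = v)) :: int) = of_bool (t e = v) - of_bool (s e = v)"
        using fin e by (simp add: sum.remove[of E e])
      then show ?thesis by simp
    next
      case False
      then have "(\<Sum>x\<in>E. 1 * (of_bool (t x = v) - of_bool (s x = v)) :: int) = 0"
        by (intro sum.neutral) auto
      then show ?thesis by simp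
    qed
    then show ?thesis by (intro exI[of _ "\<lambda>_. 1"]) auto
  qed
qed

text \<open>The degree is the same sum with every coefficient 1, and an odd number differs from 1 by
  an even one. A loop enters through both summands, just as in the degree.\<close>

lemma (in fin_metric_graph) degree_parity:
  fixes x y :: "'e \<Rightarrow> int"
  assumes "\<And>e. e \<in> edges G \<Longrightarrow> param G e 0 = v \<Longrightarrow> odd (x e)"
    and "\<And>e. e \<in> edges G \<Longrightarrow> param G e (len G e) = v \<Longrightarrow> odd (y e)"
  shows "even (\<Sum>e\<in>edges G. of_bool (param G e 0 = v) * x e + of_bool (param G e (len G e) = v) * y e) \<longleftrightarrow> even (degree G v)"
proof -
  have c: "int (card {e\<in>edges G. P e}) = (\<Sum>e\<in>edges G. of_bool (P e))" for P
    using fin_edges by (simp add: of_bool_def sum.If_cases Int_def)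
  have "int (degree G v) = (\<Sum>e\<in>edges G. of_bool (param G e 0 = v) + of_bool (param G e (len G e) = v))"
    unfolding degree_def by (simp add: c sum.distrib)
  then have "(\<Sum>e\<in>edges G. of_bool (param G e 0 = v) * x e + of_bool (param G e (len G e) = v) * y e) - int (degree G v) =
    (\<Sum>e\<in>edges G. of_bool (param G e 0 = v) * (x e - 1) + of_bool (param G e (len G e) = v) * (y e - 1))"
    by (simp add: sum_subtractf[symmetric] algebra_simps)
  also have "even \<dots>"
    using assms by (intro dvd_sum dvd_add) (auto simp: of_bool_def)
  finally have "even ((\<Sum>e\<in>edges G. of_bool (param G e 0 = v) * x e + of_bool (param G e (len G e) = v) * y e) - int (degree G v))" .
  then show ?thesis by simp
qed

lemma (in fin_metric_graph) ex_balanced_unit_current: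
  assumes "edges G \<noteq> {}"
  shows "\<exists>S\<in>unit_currents G. mass 0 (points G) (boundary S) = real (card (Odd G)) \<and>
       (\<forall>v\<in>verts G.
          (even (degree G v) \<longrightarrow> point_coeff (points G) (boundary S) v = 0) \<and>
          (odd (degree G v) \<longrightarrow> \<bar>point_coeff (points G) (boundary S) v\<bar> = 1))"
proof -
  obtain \<sigma> :: "'e \<Rightarrow> int" where \<sigma>: "\<forall>e\<in>edges G. \<bar>\<sigma> e\<bar> = 1"
    "\<forall>v. \<bar>\<Sum>e\<in>edges G. \<sigma> e * (of_bool (param G e (len G e) = v) - of_bool (param G e 0 = v))\<bar> \<le> 1"
    using balanced_orientation[OF fin_edges, where t="\<lambda>e. param G e (len G e)" and s="\<lambda>e. param G e 0"] by blast
  let ?S = "edge_current G (\<lambda>h. real_of_int (\<sigma> (fst h)))"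
  have odd\<sigma>: "odd (\<sigma> e)" if "e \<in> edges G" for e
    using \<sigma>(1) that by (metis dvd_abs_iff odd_one)
  \<comment> \<open>A balance of absolute value at most 1 is determined up to sign by its parity,
    which is that of the degree.\<close>
  have bal: "\<bar>vertex_balance \<sigma> v\<bar> = of_bool (odd (degree G v))" for v
  proof -
    have "vertex_balance \<sigma> v = (\<Sum>e\<in>edges G. of_bool (param G e 0 = v) * (- \<sigma> e) + of_bool (param G e (len G e) = v) * \<sigma> e)"
      unfolding vertex_balance_def by (simp add: algebra_simps)
    then have "even (vertex_balance \<sigma> v) \<longleftrightarrow> even (degree G v)"
      using degree_parity[of v "\<lambda>e. - \<sigma> e" \<sigma>] odd\<sigma> by simp
    moreover have "\<bar>vertex_balance \<sigma> v\<bar> \<le> 1" using \<sigma>(2) unfolding vertex_balance_def by blast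
    ultimately show ?thesis by (cases "vertex_balance \<sigma> v = 0") (auto simp: abs_le_iff)
  qed
  note bd = boundary_edge_current[of \<sigma>]
  have "mass 0 (points G) (boundary ?S) = (\<Sum>v | vertex_balance \<sigma> v \<noteq> 0. \<bar>real_of_int (vertex_balance \<sigma> v)\<bar>)"
    by (rule mass_point_mass_sum[OF bd])
  also have "\<dots> = (\<Sum>v\<in>verts G. \<bar>real_of_int (vertex_balance \<sigma> v)\<bar>)"
    using vertex_balance_support[of \<sigma>] fin_verts by (intro sum.mono_neutral_left) auto
  also have "\<dots> = (\<Sum>v\<in>verts G. of_bool (odd (degree G v)))"
    by (intro sum.cong refl) (metis bal of_int_abs of_int_of_bool)
  also have "\<dots> = real (card (Odd G))"
    using fin_verts by (simp add: Odd_def of_bool_def sum.If_cases Int_def)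
  finally have mass: "mass 0 (points G) (boundary ?S) = real (card (Odd G))" .
  have "point_coeff (points G) (boundary ?S) = vertex_balance \<sigma>" by (rule point_coeff_eq[OF bd])
  then have "\<forall>v\<in>verts G. (even (degree G v) \<longrightarrow> point_coeff (points G) (boundary ?S) v = 0) \<and>
      (odd (degree G v) \<longrightarrow> \<bar>point_coeff (points G) (boundary ?S) v\<bar> = 1)"
    using bal by (metis abs_eq_0 of_bool_eq(1) of_bool_eq(2))
  moreover have "?S \<in> unit_currents G" using \<sigma>(1) by (intro edge_current_unit[OF assms]) blast
  ultimately show ?thesis using mass by blast
qed

section \<open>The orientation of a unit current\<close>

text \<open>Dominated convergence, with the integrand on the union as majorant. The form with
  \<open>sums\<close> is the one to be compared with the series of charts in a
  representation.\<close>

lemma set_integral_disjoint_sums: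
  fixes f :: "'a \<Rightarrow> real"
  assumes A: "\<And>i::nat. A i \<in> sets M" and dj: "disjoint_family A" and f: "set_integrable M (\<Union>i. A i) f"
  shows "(\<lambda>i. LINT x:A i|M. f x) sums (LINT x:(\<Union>i. A i)|M. f x)"
proof -
  have i: "integrable M (\<lambda>x. indicator (A i) x *\<^sub>R f x)" for i
    using set_integrable_subset[OF f A] by (auto simp: set_integrable_def)
  have "(\<lambda>n. \<integral>x. (\<Sum>i<n. indicator (A i) x *\<^sub>R f x) \<partial>M) \<longlonglongrightarrow> (\<integral>x. indicator (\<Union>i. A i) x *\<^sub>R f x \<partial>M)"
  proof (rule integral_dominated_convergence)
    show "integrable M (\<lambda>x. norm (indicator (\<Union>i. A i) x *\<^sub>R f x))"
      using f unfolding set_integrable_def by (rule integrable_norm)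
    show "(\<lambda>x. indicator (\<Union>i. A i) x *\<^sub>R f x) \<in> borel_measurable M"
      using f unfolding set_integrable_def by (rule borel_measurable_integrable)
    show "(\<lambda>x. \<Sum>i<n. indicator (A i) x *\<^sub>R f x) \<in> borel_measurable M" for n
      using i by (intro borel_measurable_sum borel_measurable_integrable)
    show "AE x in M. (\<lambda>n. \<Sum>i<n. indicator (A i) x *\<^sub>R f x) \<longlonglongrightarrow> indicator (\<Union>i. A i) x *\<^sub>R f x"
    proof (rule AE_I2)
      fix x
      have "(\<lambda>i. indicat_real (A i) x * f x) sums (indicator (\<Union>i. A i) x * f x)"
        using dj by (intro sums_mult2 indicator_sums) (auto simp: disjoint_family_on_def)
      then show "(\<lambda>n. \<Sum>i<n. indicator (A i) x *\<^sub>R f x) \<longlonglongrightarrow> indicator (\<Union>i. A i) x *\<^sub>R f x"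
        by (simp add: sums_def)
    qed
    show "AE x in M. norm (\<Sum>i<n. indicator (A i) x *\<^sub>R f x) \<le> norm (indicator (\<Union>i. A i) x *\<^sub>R f x)" for n
    proof (rule AE_I2)
      fix x
      have "disjoint_family_on A {..<n}" using dj by (auto simp: disjoint_family_on_def)
      then have "(\<Sum>i<n. indicator (A i) x *\<^sub>R f x) = indicator (\<Union>i<n. A i) x * f x"
        by (simp add: indicator_UN_disjoint sum_distrib_right)
      then show "norm (\<Sum>i<n. indicator (A i) x *\<^sub>R f x) \<le> norm (indicator (\<Union>i. A i) x *\<^sub>R f x)"
        by (auto simp: indicator_def)
    qed
  qed
  moreover have "(\<integral>x. (\<Sum>i<n. indicator (A i) x *\<^sub>R f x) \<partial>M) = (\<Sum>i<n. LINT x:A i|M. f x)" for n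
    unfolding set_lebesgue_integral_def using i by (rule Bochner_Integration.integral_sum)
  ultimately show ?thesis by (simp add: sums_def set_lebesgue_integral_def)
qed

lemma lmeasure_Un_disjoint:
  assumes "A \<in> lmeasurable" "B \<in> lmeasurable" "A \<inter> B = {}"
  shows "measure lebesgue (A \<union> B) = measure lebesgue A + measure lebesgue B"
  using assms by (intro measure_Union) (auto simp: fmeasurable_def)

lemma lmeasurable_subset_interval: "P \<in> sets lebesgue \<Longrightarrow> P \<subseteq> {a<..<b} \<Longrightarrow> P \<in> lmeasurable" for a b :: real
  by (rule fmeasurableI2[of "{a<..<b}"]) auto

text \<open>A set whose trace on every initial interval has the same relative measure is null or conull:
  otherwise compare it with an open set of almost the same measure.\<close>

lemma proportional_set_null_or_full:
  fixes P :: "real set"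
  assumes P: "P \<in> sets lebesgue" "P \<subseteq> {a<..<b}" and "a < b"
    and \<kappa>: "\<And>x. a \<le> x \<Longrightarrow> x \<le> b \<Longrightarrow> measure lebesgue (P \<inter> {a<..<x}) = \<kappa> * (x - a)"
  shows "\<kappa> = 0 \<or> \<kappa> = 1"
proof -
  have Pm: "P \<in> lmeasurable" by (rule lmeasurable_subset_interval[OF P])
  have \<kappa>0: "0 \<le> \<kappa>"
  proof -
    have "0 \<le> \<kappa> * (b - a)" using \<kappa>[of b] \<open>a < b\<close> measure_nonneg[of lebesgue "P \<inter> {a<..<b}"] by simp
    then show ?thesis using \<open>a < b\<close> by (simp add: zero_le_mult_iff)
  qed
  \<comment> \<open>Subtracting two initial intervals, up to the dividing point x, shows that every
    subinterval contains the same proportion of P.\<close>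
  have ival: "measure lebesgue (P \<inter> {x<..<y}) = \<kappa> * (y - x)" if xy: "a \<le> x" "x \<le> y" "y \<le> b" for x y
  proof (cases "x = y")
    case False
    have m: "P \<inter> {c<..<d} \<in> lmeasurable" for c d using Pm by (intro fmeasurable_Int_fmeasurable) auto
    have "measure lebesgue (P \<inter> {a<..<y}) = measure lebesgue ((P \<inter> {a<..<x}) \<union> (P \<inter> {x<..<y}))"
    proof (rule measure_negligible_symdiff[symmetric])
      show "P \<inter> {a<..<y} \<in> lmeasurable" by (rule m)
      show "negligible (sym_diff (P \<inter> {a<..<y}) ((P \<inter> {a<..<x}) \<union> (P \<inter> {x<..<y})))"
        by (rule negligible_subset[of "{x}"]) (use xy in auto)
    qed
    also have "\<dots> = measure lebesgue (P \<inter> {a<..<x}) + measure lebesgue (P \<inter> {x<..<y})"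
      using m by (intro lmeasure_Un_disjoint) auto
    finally show ?thesis using \<kappa>[of x] \<kappa>[of y] xy by (simp add: algebra_simps)
  qed simp
  have tot: "measure lebesgue P = \<kappa> * (b - a)"
    using \<kappa>[of b] \<open>a < b\<close> P(2) by (simp add: Int_absorb2)
  \<comment> \<open>Countable additivity over the component intervals extends the proportion to open
    sets.\<close>
  have op: "measure lebesgue (P \<inter> V) = \<kappa> * measure lebesgue V" if V: "open V" "V \<subseteq> {a<..<b}" for V
  proof -
    obtain l r :: "nat \<Rightarrow> real" where lr: "\<forall>n. l n \<le> r n" "\<forall>n. l n < r n \<longrightarrow> {l n..r n} \<subseteq> {a..b}"
      and dj: "disjoint_family (\<lambda>n. {l n<..<r n})" and Veq: "V = (\<Union>n. {l n<..<r n})"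
      by (rule open_bounded_disjoint_intervals[OF V]) blast
    have Vm: "V \<in> lmeasurable" using V by (intro lmeasurable_subset_interval[of V a b]) auto
    have 1: "(\<lambda>n. measure lebesgue {l n<..<r n}) sums measure lebesgue V"
      unfolding Veq
    proof (rule measure_UNION[OF _ dj])
      show "emeasure lebesgue (\<Union>n. {l n<..<r n}) \<noteq> \<infinity>" using Vm unfolding Veq by (simp add: fmeasurable_def less_top)
    qed auto
    have 2: "(\<lambda>n. measure lebesgue (P \<inter> {l n<..<r n})) sums measure lebesgue (P \<inter> V)"
    proof -
      have PV: "P \<inter> V = (\<Union>n. P \<inter> {l n<..<r n})" unfolding Veq by auto
      have "P \<inter> V \<in> lmeasurable" using Pm Vm by (intro fmeasurable_Int_fmeasurable) (auto simp: fmeasurableD)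
      then have "emeasure lebesgue (\<Union>n. P \<inter> {l n<..<r n}) \<noteq> \<infinity>" unfolding PV infinity_ennreal_def by (rule fmeasurableD2)
      moreover have "disjoint_family (\<lambda>n. P \<inter> {l n<..<r n})" using dj unfolding disjoint_family_on_def by blast
      ultimately show ?thesis unfolding PV using P(1) by (intro measure_UNION) auto
    qed
    have "measure lebesgue (P \<inter> {l n<..<r n}) = \<kappa> * measure lebesgue {l n<..<r n}" for n
    proof (cases "l n < r n")
      case True
      then have "{l n..r n} \<subseteq> {a..b}" using lr(2) by blast
      then show ?thesis using ival[of "l n" "r n"] True by auto
    qed simp
    with 2 have "(\<lambda>n. \<kappa> * measure lebesgue {l n<..<r n}) sums measure lebesgue (P \<inter> V)" by simp
    moreover have "(\<lambda>n. \<kappa> * measure lebesgue {l n<..<r n}) sums (\<kappa> * measure lebesgue V)" using 1 by (rule sums_mult)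
    ultimately show ?thesis by (rule sums_unique2)
  qed
  \<comment> \<open>An open V containing P with almost the same measure meets P in all of P, so the
    measure of P is \<kappa> times itself. As this measure is also \<kappa> (b - a), it follows that
    \<kappa> = \<kappa>^2.\<close>
  have "measure lebesgue P = \<kappa> * measure lebesgue P"
  proof (rule antisym)
    show "\<kappa> * measure lebesgue P \<le> measure lebesgue P"
    proof -
      have "measure lebesgue P \<le> measure lebesgue {a<..<b}" using P Pm by (intro measure_mono_fmeasurable) auto
      then have "\<kappa> * measure lebesgue P \<le> \<kappa> * (b - a)" using \<kappa>0 \<open>a < b\<close> by (intro mult_left_mono) auto
      then show ?thesis using tot by simp
    qed
    show "measure lebesgue P \<le> \<kappa> * measure lebesgue P"
    proof (rule field_le_epsilon)
      fix e :: real assume "e > 0"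
      \<comment> \<open>Chosen so that the excess \<kappa> d stays below e, also for \<kappa> =
        0.\<close>
      define d where "d = e / (\<kappa> + 1)"
      have "d > 0" using \<open>e > 0\<close> \<kappa>0 by (simp add: d_def)
      obtain T where T: "open T" "P \<subseteq> T" "(T - P) \<in> lmeasurable" "emeasure lebesgue (T - P) < ennreal d"
        using sets_lebesgue_outer_open[OF P(1) \<open>d > 0\<close>] by metis
      define V where "V = T \<inter> {a<..<b}"
      have V: "open V" "V \<subseteq> {a<..<b}" "P \<subseteq> V" using T P by (auto simp: V_def)
      have Vm: "V \<in> lmeasurable" using V by (intro lmeasurable_subset_interval[of V a b]) auto
      have "measure lebesgue (V - P) \<le> measure lebesgue (T - P)"
        using T(3) Vm Pm by (intro measure_mono_fmeasurable) (auto simp: V_def fmeasurableD)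
      also have "\<dots> \<le> d"
        using T(4) \<open>d > 0\<close> unfolding measure_def by (intro enn2real_leI) auto
      finally have "measure lebesgue V \<le> measure lebesgue P + d"
        using measurable_measure_Diff[OF Vm fmeasurableD[OF Pm] V(3)] by simp
      then have "\<kappa> * measure lebesgue V \<le> \<kappa> * (measure lebesgue P + d)" using \<kappa>0 by (rule mult_left_mono)
      also have "\<dots> \<le> \<kappa> * measure lebesgue P + e"
        using \<open>e > 0\<close> \<kappa>0 by (simp add: d_def field_simps)
      finally show "measure lebesgue P \<le> \<kappa> * measure lebesgue P + e"
        using op[OF V(1,2)] V(3) by (simp add: Int_absorb2)
    qed
  qed
  then have "\<kappa> * (b - a) = \<kappa> * (\<kappa> * (b - a))" using tot by simp
  then show ?thesis using \<open>a < b\<close> by auto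
qed

text \<open>The mean sign to the left of x equals the mean sign to its right for every x, so the
  signed measure of (a, x) is a constant c times its length. As P and N fill the interval up to a
  null set, P has the proportion (1 + c) / 2 in every initial interval; this is 0 or 1, and c =
  \<plusminus>1.\<close>

lemma constant_sign:
  fixes P N :: "real set" and a b :: real
  assumes P: "P \<in> sets lebesgue" and N: "N \<in> sets lebesgue" and "P \<inter> N = {}" and neg: "negligible ({a<..<b} - (P \<union> N))" and "a < b"
    and tri: "\<And>x. x \<in> {a<..<b} \<Longrightarrow>
      (measure lebesgue (P \<inter> {a<..<x}) - measure lebesgue (N \<inter> {a<..<x})) / (x - a) =
      (measure lebesgue (P \<inter> {x<..<b}) - measure lebesgue (N \<inter> {x<..<b})) / (b - x)"
  obtains \<epsilon> :: int where "\<bar>\<epsilon>\<bar> = 1" "measure lebesgue (P \<inter> {a<..<b}) - measure lebesgue (N \<inter> {a<..<b}) = \<epsilon> * (b - a)"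
proof -
  have m: "Q \<inter> {c<..<d} \<in> lmeasurable" if "Q \<in> sets lebesgue" for Q and c d :: real
    using that by (intro lmeasurable_subset_interval[of _ c d]) auto
  have split: "measure lebesgue (Q \<inter> {a<..<b}) = measure lebesgue (Q \<inter> {a<..<x}) + measure lebesgue (Q \<inter> {x<..<b})"
    if Q: "Q \<in> sets lebesgue" and x: "x \<in> {a<..<b}" for Q x
  proof -
    have "measure lebesgue (Q \<inter> {a<..<b}) = measure lebesgue ((Q \<inter> {a<..<x}) \<union> (Q \<inter> {x<..<b}))"
    proof (rule measure_negligible_symdiff[symmetric])
      show "Q \<inter> {a<..<b} \<in> lmeasurable" using Q by (rule m)
      show "negligible (sym_diff (Q \<inter> {a<..<b}) ((Q \<inter> {a<..<x}) \<union> (Q \<inter> {x<..<b})))"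
        by (rule negligible_subset[of "{x}"]) (use x in auto)
    qed
    also have "\<dots> = measure lebesgue (Q \<inter> {a<..<x}) + measure lebesgue (Q \<inter> {x<..<b})"
      using m Q by (intro lmeasure_Un_disjoint) auto
    finally show ?thesis .
  qed
  define D where "D x = measure lebesgue (P \<inter> {a<..<x}) - measure lebesgue (N \<inter> {a<..<x})" for x
  define c where "c = D b / (b - a)"
  have Dc: "D x = c * (x - a)" if x: "a \<le> x" "x \<le> b" for x
  proof -
    consider "x = a" | "x = b" | "x \<in> {a<..<b}" using x by fastforce
    then show ?thesis
    proof cases
      case 3
      have "D x / (x - a) = (D b - D x) / (b - x)"
        using tri[OF 3] split[OF P 3] split[OF N 3] by (simp add: D_def)
      then have "D x * (b - x) = (D b - D x) * (x - a)" using 3 by (simp add: divide_simps mult_ac)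
      then have "D x * (b - a) = D b * (x - a)" by (simp add: algebra_simps)
      then show ?thesis using \<open>a < b\<close> by (simp add: c_def field_simps)
    qed (use \<open>a < b\<close> in \<open>simp_all add: D_def c_def\<close>)
  qed
  have S: "measure lebesgue (P \<inter> {a<..<x}) + measure lebesgue (N \<inter> {a<..<x}) = x - a" if x: "a \<le> x" "x \<le> b" for x
  proof -
    have "measure lebesgue (P \<inter> {a<..<x}) + measure lebesgue (N \<inter> {a<..<x}) = measure lebesgue ((P \<inter> {a<..<x}) \<union> (N \<inter> {a<..<x}))"
      using m P N \<open>P \<inter> N = {}\<close> by (intro lmeasure_Un_disjoint[symmetric]) auto
    also have "\<dots> = measure lebesgue {a<..<x}"
    proof (rule measure_negligible_symdiff[symmetric])
      show "P \<inter> {a<..<x} \<union> N \<inter> {a<..<x} \<in> lmeasurable" using m P N by (intro fmeasurable.Un) auto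
      show "negligible (sym_diff (P \<inter> {a<..<x} \<union> N \<inter> {a<..<x}) {a<..<x})"
        by (rule negligible_subset[OF neg]) (use x in auto)
    qed
    finally show ?thesis using x by simp
  qed
  have "measure lebesgue ((P \<inter> {a<..<b}) \<inter> {a<..<x}) = (1 + c) / 2 * (x - a)" if x: "a \<le> x" "x \<le> b" for x
  proof -
    have "(P \<inter> {a<..<b}) \<inter> {a<..<x} = P \<inter> {a<..<x}" using x by auto
    then show ?thesis using S[OF x] Dc[OF x] by (simp add: D_def field_simps)
  qed
  then have "(1 + c) / 2 = 0 \<or> (1 + c) / 2 = 1"
    using P \<open>a < b\<close> by (intro proportional_set_null_or_full[of "P \<inter> {a<..<b}" a b]) auto
  then have "c = -1 \<or> c = 1" by auto
  then obtain \<epsilon> :: int where "\<bar>\<epsilon>\<bar> = 1" "c = real_of_int \<epsilon>"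
    by (metis abs_minus_cancel abs_one of_int_1 of_int_minus)
  with that[of \<epsilon>] Dc[of b] \<open>a < b\<close> show ?thesis by (simp add: D_def)
qed

lemma step_function_integral:
  fixes w :: "real \<Rightarrow> real"
  assumes P: "P \<in> sets lebesgue" "P \<subseteq> {\<alpha><..<\<beta>}" and F: "finite F"
    and w: "\<And>s. s \<in> {\<alpha><..<\<beta>} - F \<Longrightarrow> w s = c1 * indicator {a<..<x} s + c2 * indicator {x'<..<b} s"
  shows "(LINT s:P|lebesgue. w s) = c1 * measure lebesgue (P \<inter> {a<..<x}) + c2 * measure lebesgue (P \<inter> {x'<..<b})"
proof -
  have m: "P \<inter> {c<..<d} \<in> lmeasurable" for c d :: real
    using P(1) by (intro lmeasurable_subset_interval[of _ c d]) auto
  have i: "integrable lebesgue (\<lambda>s. c * indicator (P \<inter> {y<..<z}) s)" for c y z :: real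
    using m[of y z] by (intro integrable_mult_right integrable_real_indicator) (auto simp: fmeasurable_def)
  have "AE s in lebesgue. s \<notin> F"
    using F by (intro AE_not_in) (simp flip: negligible_iff_null_sets add: negligible_finite)
  then have "AE s in lebesgue. indicator P s *\<^sub>R w s = c1 * indicator (P \<inter> {a<..<x}) s + c2 * indicator (P \<inter> {x'<..<b}) s"
  proof eventually_elim
    case (elim s)
    then show ?case using w[of s] P(2) by (cases "s \<in> P") (auto simp: indicator_def)
  qed
  then have "(LINT s:P|lebesgue. w s) = (LINT s|lebesgue. c1 * indicator (P \<inter> {a<..<x}) s + c2 * indicator (P \<inter> {x'<..<b}) s)"
    unfolding set_lebesgue_integral_def
    by (intro lebesgue_integral_eq_AE borel_measurable_integrable Bochner_Integration.integrable_add i)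
  also have "\<dots> = c1 * measure lebesgue (P \<inter> {a<..<x}) + c2 * measure lebesgue (P \<inter> {x'<..<b})"
    using i by (subst Bochner_Integration.integral_add) simp_all
  finally show ?thesis .
qed

text \<open>A is relatively open in C, so near t both derivatives are taken along the same
  points.\<close>

lemma vector_derivative_within_cong:
  fixes f g :: "real \<Rightarrow> real"
  assumes "\<And>s. s \<in> A \<Longrightarrow> f s = g s" "t \<in> A" "open W" "A = C \<inter> W"
  shows "vector_derivative f (at t within A) = vector_derivative g (at t within C)"
proof -
  have "at t within C = at t within A"
    using assms(2-4) by (intro at_within_nhd[of t W]) auto
  moreover have "(f has_vector_derivative d) (at t within A) \<longleftrightarrow> (g has_vector_derivative d) (at t within A)" for d
    using assms(1,2) by (intro has_vector_derivative_cong_ev) (auto simp: eventually_at_filter)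
  ultimately show ?thesis unfolding vector_derivative_def by simp
qed

section \<open>From charts to orientations of half edges\<close>

context fin_metric_graph
begin

text \<open>On the edges, a current of multiplicity one is a measurable choice of orientation:
  \<open>P h\<close> and \<open>N h\<close> collect the parameters of the half edge \<open>h\<close> at which it agrees, respectively
  disagrees, with the parametrization.\<close>

definition orientation :: "'a functional \<Rightarrow> ('e \<times> bool \<Rightarrow> real set) \<Rightarrow> ('e \<times> bool \<Rightarrow> real set) \<Rightarrow> bool" where
  "orientation S P N \<longleftrightarrow>
    (\<forall>h\<in>halves G. P h \<in> sets lebesgue \<and> N h \<in> sets lebesgue \<and> P h \<inter> N h = {} \<and> P h \<union> N h \<subseteq> half_dom G h \<and>
       negligible (half_dom G h - (P h \<union> N h))) \<and>
    (\<forall>p C. C-lipschitz_on (points G) p \<longrightarrow> S (\<lambda>_. 1) [p] =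
       (\<Sum>h\<in>halves G. (LINT t:P h|lebesgue. vector_derivative (\<lambda>s. p (param G (fst h) s)) (at t)) -
         (LINT t:N h|lebesgue. vector_derivative (\<lambda>s. p (param G (fst h) s)) (at t))))"

text \<open>On the part A of its domain that lands in the half edge, the chart followed by the
  inverse of the half edge is a bi-Lipschitz real function, to which the area formula applies. An
  open set cuts A out of C, so A is measurable and derivatives within A and within C agree.\<close>

lemma chart_half_orientation:
  assumes h: "h \<in> halves G" and C: "C \<in> sets borel" and \<phi>: "\<phi> ` C \<subseteq> points G" and bil: "bilipschitz_on C \<phi>"
    and \<theta>: "set_integrable lebesgue C (\<lambda>t. real_of_int (\<theta> t))"
    and mult: "\<And>t. t \<in> C \<Longrightarrow> m (\<phi> t) = nat \<bar>\<theta> t\<bar>" and m1: "hausdorff1 {x\<in>edge_set G (fst h). m x \<noteq> 1} = 0"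
  defines "A \<equiv> {t\<in>C. \<phi> t \<in> half_set G h}"
  shows "A \<in> sets lebesgue"
    and "\<exists>P N. P \<in> sets lebesgue \<and> N \<in> sets lebesgue \<and> P \<inter> N = {} \<and> P \<union> N \<subseteq> half_dom G h \<and>
      param G (fst h) ` (P \<union> N) \<subseteq> \<phi> ` C \<and>
      negligible ({s\<in>half_dom G h. param G (fst h) s \<in> \<phi> ` C} - (P \<union> N)) \<and>
      (\<forall>p K. K-lipschitz_on (points G) p \<longrightarrow>
        set_integrable lebesgue A (\<lambda>t. real_of_int (\<theta> t) * vector_derivative (\<lambda>s. p (\<phi> s)) (at t within C)) \<and>
        (LINT t:A|lebesgue. real_of_int (\<theta> t) * vector_derivative (\<lambda>s. p (\<phi> s)) (at t within C)) =
        (LINT s:P|lebesgue. vector_derivative (\<lambda>s. p (param G (fst h) s)) (at s)) -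
        (LINT s:N|lebesgue. vector_derivative (\<lambda>s. p (param G (fst h) s)) (at s)))"
proof -
  let ?\<gamma> = "param G (fst h)" and ?I = "half_dom G h"
  obtain L where L: "L > 0" "\<And>s t. s \<in> C \<Longrightarrow> t \<in> C \<Longrightarrow> dist s t / L \<le> dist (\<phi> s) (\<phi> t)"
    "\<And>s t. s \<in> C \<Longrightarrow> t \<in> C \<Longrightarrow> dist (\<phi> s) (\<phi> t) \<le> L * dist s t"
    using bil unfolding bilipschitz_on_def by blast
  have "continuous_on C \<phi>"
    by (rule lipschitz_on_continuous_on[of L]) (use L in \<open>auto intro!: lipschitz_onI\<close>)
  obtain U where U: "open U" "half_set G h = points G \<inter> U" using half_set_openin[OF h] by blast
  have AU: "A = C \<inter> \<phi> -` U" unfolding A_def U(2) using \<phi> by auto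
  obtain W where W: "open W" "A = C \<inter> W"
    using continuous_openin_preimage_gen[OF \<open>continuous_on C \<phi>\<close> U(1)] unfolding AU[symmetric] by (auto simp: openin_open)
  have "A \<in> sets borel" unfolding W(2) using C W(1) by auto
  then show Am: "A \<in> sets lebesgue" by (simp add: sets_completionI_sets)
  define g where "g t = inv_into ?I ?\<gamma> (\<phi> t)" for t
  have g: "g t \<in> ?I" "?\<gamma> (g t) = \<phi> t" if "t \<in> A" for t
  proof -
    have "\<phi> t \<in> ?\<gamma> ` ?I" using that by (simp add: A_def)
    then show "g t \<in> ?I" "?\<gamma> (g t) = \<phi> t" unfolding g_def by (rule inv_into_into, rule f_inv_into_f)
  qed
  have AC: "t \<in> C" if "t \<in> A" for t using that by (simp add: A_def)
  have gd: "\<bar>g s - g t\<bar> = dist (\<phi> s) (\<phi> t)" if "s \<in> A" "t \<in> A" for s t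
    using half_isometry[OF h, of "g s" "g t"] g(1)[OF that(1)] g(1)[OF that(2)] g(2)[OF that(1)] g(2)[OF that(2)] by simp
  have gA: "s \<in> g ` A" if s: "s \<in> ?I" "?\<gamma> s \<in> \<phi> ` C" for s
  proof -
    obtain t where t: "t \<in> C" "?\<gamma> s = \<phi> t" using s(2) by auto
    have "\<phi> t \<in> half_set G h" using s(1) t(2) by (metis imageI)
    then have "t \<in> A" using t(1) by (simp add: A_def)
    moreover have "g t = s" unfolding g_def t(2)[symmetric] using half_inj[OF h] s(1) by simp
    ultimately show ?thesis by blast
  qed
  have injC: "inj_on \<phi> C"
  proof (rule inj_onI)
    fix s t assume "s \<in> C" "t \<in> C" "\<phi> s = \<phi> t"
    then have "dist s t / L \<le> 0" using L(2)[of s t] by simp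
    then show "s = t" using L(1) by (simp add: divide_le_0_iff)
  qed
  \<comment> \<open>Parameters of wrong multiplicity lie over a Hausdorff null part of the edge, and
    the inverse of the chart is Lipschitz.\<close>
  have \<theta>1: "negligible {t\<in>A. \<bar>\<theta> t\<bar> \<noteq> 1}"
  proof -
    let ?B = "{t\<in>A. \<bar>\<theta> t\<bar> \<noteq> 1}"
    have "negligible (inv_into C \<phi> ` (\<phi> ` ?B))"
    proof (rule hausdorff1_null_lipschitz_image[where L=L])
      have "\<phi> ` ?B \<subseteq> {x\<in>edge_set G (fst h). m x \<noteq> 1}"
      proof
        fix x assume "x \<in> \<phi> ` ?B"
        then obtain t where t: "t \<in> A" "\<bar>\<theta> t\<bar> \<noteq> 1" "x = \<phi> t" by auto
        have "g t \<in> {0..len G (fst h)}" using g(1)[OF t(1)] half_open_subset[OF h] by auto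
        then have "?\<gamma> (g t) \<in> edge_set G (fst h)" unfolding edge_set_def by (rule imageI)
        then have "x \<in> edge_set G (fst h)" using g(2)[OF t(1)] t(3) by simp
        moreover have "m x \<noteq> 1" using mult[OF AC[OF t(1)]] t(2,3) by (simp add: nat_eq_iff)
        ultimately show "x \<in> {x\<in>edge_set G (fst h). m x \<noteq> 1}" by simp
      qed
      then show "hausdorff1 (\<phi> ` ?B) = 0" using m1 by (rule hausdorff1_null_subset)
      fix x y assume "x \<in> \<phi> ` ?B" "y \<in> \<phi> ` ?B"
      then obtain s t where st: "s \<in> C" "t \<in> C" "x = \<phi> s" "y = \<phi> t" using AC by blast
      then show "\<bar>inv_into C \<phi> x - inv_into C \<phi> y\<bar> \<le> L * dist x y"
        using L(2)[of s t] L(1) injC by (simp add: dist_real_def divide_le_eq mult.commute)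
    qed (use L in simp)
    moreover have "inv_into C \<phi> ` (\<phi> ` ?B) = ?B"
      using injC AC by (intro inv_into_image_cancel) auto
    ultimately show ?thesis by simp
  qed
  obtain P N where PN: "P \<in> sets lebesgue" "N \<in> sets lebesgue" "P \<inter> N = {}" "P \<union> N \<subseteq> g ` A"
    "negligible (g ` A - (P \<union> N))"
    and eq: "\<forall>(u :: real \<Rightarrow> real) K. K-lipschitz_on {half_lo G h..half_hi G h} u \<longrightarrow>
      set_integrable lebesgue A (\<lambda>t. real_of_int (\<theta> t) * vector_derivative (\<lambda>s. u (g s)) (at t within A)) \<and>
      (LINT t:A|lebesgue. real_of_int (\<theta> t) * vector_derivative (\<lambda>s. u (g s)) (at t within A)) =
      (LINT s:P|lebesgue. vector_derivative u (at s)) - (LINT s:N|lebesgue. vector_derivative u (at s))"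
  proof (rule bilipschitz_chart_signed_area[OF Am L(1), of g "half_lo G h" "half_hi G h" \<theta>])
    show "\<bar>g s - g t\<bar> \<le> L * \<bar>s - t\<bar>" if "s \<in> A" "t \<in> A" for s t
      using gd[OF that] L(3)[OF AC AC, of s t] that by (simp add: dist_real_def)
    show "\<bar>s - t\<bar> \<le> L * \<bar>g s - g t\<bar>" if "s \<in> A" "t \<in> A" for s t
      using gd[OF that] L(2)[OF AC AC, of s t] L(1) that by (simp add: dist_real_def divide_le_eq mult.commute)
    show "g ` A \<subseteq> ?I" using g(1) by auto
    show "set_borel_measurable lebesgue A (\<lambda>t. real_of_int (\<theta> t))"
      using set_integrable_subset[OF \<theta> Am] AC unfolding set_integrable_def set_borel_measurable_def
      by (auto intro: borel_measurable_integrable)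
    show "negligible {t\<in>A. \<bar>\<theta> t\<bar> \<noteq> 1}" by (rule \<theta>1)
  qed blast
  have sub: "P \<union> N \<subseteq> ?I" using PN(4) g(1) by auto
  have im: "?\<gamma> ` (P \<union> N) \<subseteq> \<phi> ` C"
  proof
    fix x assume "x \<in> ?\<gamma> ` (P \<union> N)"
    then obtain t where "t \<in> A" "x = ?\<gamma> (g t)" using PN(4) by blast
    then show "x \<in> \<phi> ` C" using g(2) AC by auto
  qed
  have neg: "negligible ({s\<in>?I. ?\<gamma> s \<in> \<phi> ` C} - (P \<union> N))"
    by (rule negligible_subset[OF PN(5)]) (use gA in auto)
  have val: "set_integrable lebesgue A (\<lambda>t. real_of_int (\<theta> t) * vector_derivative (\<lambda>s. p (\<phi> s)) (at t within C)) \<and>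
        (LINT t:A|lebesgue. real_of_int (\<theta> t) * vector_derivative (\<lambda>s. p (\<phi> s)) (at t within C)) =
        (LINT s:P|lebesgue. vector_derivative (\<lambda>s. p (?\<gamma> s)) (at s)) -
        (LINT s:N|lebesgue. vector_derivative (\<lambda>s. p (?\<gamma> s)) (at s))" if p: "K-lipschitz_on (points G) p" for p K
  proof -
    have vd: "vector_derivative (\<lambda>s. p (?\<gamma> (g s))) (at t within A) = vector_derivative (\<lambda>s. p (\<phi> s)) (at t within C)" if "t \<in> A" for t
      by (rule vector_derivative_within_cong[OF _ that W]) (simp add: g(2))
    have fe: "(\<lambda>t. indicator A t *\<^sub>R (real_of_int (\<theta> t) * vector_derivative (\<lambda>s. p (?\<gamma> (g s))) (at t within A))) =
      (\<lambda>t. indicator A t *\<^sub>R (real_of_int (\<theta> t) * vector_derivative (\<lambda>s. p (\<phi> s)) (at t within C)))"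
      by (rule ext) (simp add: vd indicator_def)
    show ?thesis
      using eq[rule_format, OF half_lipschitz[OF p h]]
      unfolding set_integrable_def set_lebesgue_integral_def fe .
  qed
  show "\<exists>P N. P \<in> sets lebesgue \<and> N \<in> sets lebesgue \<and> P \<inter> N = {} \<and> P \<union> N \<subseteq> half_dom G h \<and>
      param G (fst h) ` (P \<union> N) \<subseteq> \<phi> ` C \<and>
      negligible ({s\<in>half_dom G h. param G (fst h) s \<in> \<phi> ` C} - (P \<union> N)) \<and>
      (\<forall>p K. K-lipschitz_on (points G) p \<longrightarrow>
        set_integrable lebesgue A (\<lambda>t. real_of_int (\<theta> t) * vector_derivative (\<lambda>s. p (\<phi> s)) (at t within C)) \<and>
        (LINT t:A|lebesgue. real_of_int (\<theta> t) * vector_derivative (\<lambda>s. p (\<phi> s)) (at t within C)) =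
        (LINT s:P|lebesgue. vector_derivative (\<lambda>s. p (param G (fst h) s)) (at s)) -
        (LINT s:N|lebesgue. vector_derivative (\<lambda>s. p (param G (fst h) s)) (at s)))"
  proof -
    have "\<forall>p K. K-lipschitz_on (points G) p \<longrightarrow>
        set_integrable lebesgue A (\<lambda>t. real_of_int (\<theta> t) * vector_derivative (\<lambda>s. p (\<phi> s)) (at t within C)) \<and>
        (LINT t:A|lebesgue. real_of_int (\<theta> t) * vector_derivative (\<lambda>s. p (\<phi> s)) (at t within C)) =
        (LINT s:P|lebesgue. vector_derivative (\<lambda>s. p (?\<gamma> s)) (at s)) -
        (LINT s:N|lebesgue. vector_derivative (\<lambda>s. p (?\<gamma> s)) (at s))"
      using val by simp
    then show ?thesis by (intro exI[of _ P] exI[of _ N] conjI PN(1-3) sub im neg)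
  qed
qed

text \<open>Chart images are disjoint, so the pieces from different charts are disjoint and their
  unions are again a choice of sign. They fill each half up to a null set: outside all charts the
  multiplicity is 0, but on an edge it is 1 almost everywhere.\<close>

lemma ex_orientation:
  assumes S: "S \<in> unit_currents G"
  shows "\<exists>P N. orientation S P N"
proof -
  from S obtain m where m: "is_multiplicity (points G) S m" and m1: "\<And>e. e \<in> edges G \<Longrightarrow> hausdorff1 {x\<in>edge_set G e. m x \<noteq> 1} = 0"
    unfolding unit_currents_def by blast
  from m obtain C \<phi> \<theta> where rep: "rectifiable_representation (points G) S C \<phi> \<theta>"
    and mult: "\<And>i t. t \<in> C i \<Longrightarrow> m (\<phi> i t) = nat \<bar>\<theta> i t\<bar>" and m0: "\<And>x. x \<notin> (\<Union>i. \<phi> i ` C i) \<Longrightarrow> m x = 0"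
    unfolding is_multiplicity_def by blast
  have Cb: "C i \<in> sets borel" and Cp: "\<phi> i ` C i \<subseteq> points G" and Cbil: "bilipschitz_on (C i) (\<phi> i)"
    and Cint: "set_integrable lebesgue (C i) (\<lambda>t. real_of_int (\<theta> i t))" for i
  proof -
    have "C i \<in> sets borel \<and> \<phi> i ` C i \<subseteq> points G \<and> bilipschitz_on (C i) (\<phi> i) \<and> set_integrable lebesgue (C i) (\<lambda>t. real_of_int (\<theta> i t))"
      using rep unfolding rectifiable_representation_def by blast
    then show "C i \<in> sets borel" "\<phi> i ` C i \<subseteq> points G" "bilipschitz_on (C i) (\<phi> i)" "set_integrable lebesgue (C i) (\<lambda>t. real_of_int (\<theta> i t))"
      by simp_all
  qed
  have Cdj: "\<phi> i ` C i \<inter> \<phi> j ` C j = {}" if "i \<noteq> j" for i j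
    using rep that unfolding rectifiable_representation_def by blast
  have Csum: "(\<lambda>i. line_current (C i) (\<phi> i) (\<theta> i) f ps) sums S f ps" if "(f, ps) \<in> forms 1 (points G)" for f ps
    using rep that unfolding rectifiable_representation_def by blast
  define A where "A i h = {t\<in>C i. \<phi> i t \<in> half_set G h}" for i h
  define F where "F i p t = real_of_int (\<theta> i t) * vector_derivative (\<lambda>s. p (\<phi> i s)) (at t within C i)"
    for i and p :: "'a \<Rightarrow> real" and t
  define D where "D h p s = vector_derivative (\<lambda>s. p (param G (fst h) s)) (at s)"
    for h :: "'e \<times> bool" and p :: "'a \<Rightarrow> real" and s
  define good where "good i h P N \<longleftrightarrow> P \<in> sets lebesgue \<and> N \<in> sets lebesgue \<and> P \<inter> N = {} \<and> P \<union> N \<subseteq> half_dom G h \<and>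
      param G (fst h) ` (P \<union> N) \<subseteq> \<phi> i ` C i \<and>
      negligible ({s\<in>half_dom G h. param G (fst h) s \<in> \<phi> i ` C i} - (P \<union> N)) \<and>
      (\<forall>p K. K-lipschitz_on (points G) p \<longrightarrow> set_integrable lebesgue (A i h) (F i p) \<and>
        (LINT t:A i h|lebesgue. F i p t) = (LINT s:P|lebesgue. D h p s) - (LINT s:N|lebesgue. D h p s))" for i h P N
  have ex: "\<exists>P N. good i h P N" if h: "h \<in> halves G" for i h
    unfolding good_def A_def F_def D_def
    using chart_half_orientation(2)[OF h Cb Cp Cbil Cint mult m1[OF half_fst[OF h]], of i] by blast
  \<comment> \<open>Pairing lets one application of choice select both sets for all charts and
    halves.\<close>
  have "\<forall>x. \<exists>y. snd x \<in> halves G \<longrightarrow> good (fst x) (snd x) (fst y) (snd y)"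
    using ex by (metis fst_conv snd_conv)
  then obtain Q where Q: "\<forall>x. snd x \<in> halves G \<longrightarrow> good (fst x) (snd x) (fst (Q x)) (snd (Q x))"
    by (rule choice[THEN exE])
  define P' where "P' i h = fst (Q (i, h))" for i h
  define N' where "N' i h = snd (Q (i, h))" for i h
  have PN: "good i h (P' i h) (N' i h)" if "h \<in> halves G" for i h
    using Q[rule_format, of "(i, h)"] that by (simp add: P'_def N'_def)
  define P where "P h = (\<Union>i. P' i h)" for h
  define N where "N h = (\<Union>i. N' i h)" for h
  have dj: "(P' i h \<union> N' i h) \<inter> (P' j h \<union> N' j h) = {}" if h: "h \<in> halves G" and "i \<noteq> j" for h i j
  proof (rule ccontr)
    assume "(P' i h \<union> N' i h) \<inter> (P' j h \<union> N' j h) \<noteq> {}"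
    then obtain s where "s \<in> P' i h \<union> N' i h" "s \<in> P' j h \<union> N' j h" by blast
    then have "param G (fst h) s \<in> \<phi> i ` C i" "param G (fst h) s \<in> \<phi> j ` C j"
      using PN[OF h, of i] PN[OF h, of j] unfolding good_def by (auto simp del: Un_iff)
    then show False using Cdj[OF \<open>i \<noteq> j\<close>] by blast
  qed
  have line: "line_current (C i) (\<phi> i) (\<theta> i) (\<lambda>_. 1) [p] = (\<Sum>h\<in>halves G. (LINT s:P' i h|lebesgue. D h p s) - (LINT s:N' i h|lebesgue. D h p s))"
    if p: "K-lipschitz_on (points G) p" for i p K
  proof -
    have int: "set_integrable lebesgue (A i h) (F i p)" and
      val: "(LINT t:A i h|lebesgue. F i p t) = (LINT s:P' i h|lebesgue. D h p s) - (LINT s:N' i h|lebesgue. D h p s)" if h: "h \<in> halves G" for h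
    proof -
      have "set_integrable lebesgue (A i h) (F i p) \<and>
        (LINT t:A i h|lebesgue. F i p t) = (LINT s:P' i h|lebesgue. D h p s) - (LINT s:N' i h|lebesgue. D h p s)"
        using PN[OF h, of i] p unfolding good_def by blast
      then show "set_integrable lebesgue (A i h) (F i p)"
        "(LINT t:A i h|lebesgue. F i p t) = (LINT s:P' i h|lebesgue. D h p s) - (LINT s:N' i h|lebesgue. D h p s)" by simp_all
    qed
    \<comment> \<open>What the chart sends to vertices and midpoints; this is finite, as the chart
      is injective.\<close>
    define R where "R = C i - (\<Union>h\<in>halves G. A i h)"
    have inj: "inj_on (\<phi> i) (C i)"
    proof (rule inj_onI)
      fix s t assume st: "s \<in> C i" "t \<in> C i" "\<phi> i s = \<phi> i t"
      obtain L where "L > 0" "dist s t / L \<le> dist (\<phi> i s) (\<phi> i t)" using Cbil[of i] st(1,2) unfolding bilipschitz_on_def by blast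
      then have "dist s t \<le> 0" using st(3) by (simp add: divide_le_0_iff)
      then show "s = t" by simp
    qed
    have "finite R"
    proof (rule finite_imageD)
      show "finite (\<phi> i ` R)"
      proof (rule finite_subset[OF _ finite_points_minus_halves])
        show "\<phi> i ` R \<subseteq> points G - (\<Union>h\<in>halves G. half_set G h)"
        proof
          fix x assume "x \<in> \<phi> i ` R"
          then obtain t where t: "t \<in> C i" "\<And>h. h \<in> halves G \<Longrightarrow> t \<notin> A i h" "x = \<phi> i t" by (auto simp: R_def)
          then have "x \<notin> half_set G h" if "h \<in> halves G" for h using that by (simp add: A_def)
          moreover have "x \<in> points G" using t(1,3) Cp[of i] by blast
          ultimately show "x \<in> points G - (\<Union>h\<in>halves G. half_set G h)" by blast
        qed
      qed
      show "inj_on (\<phi> i) R" by (rule inj_on_subset[OF inj]) (auto simp: R_def)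
    qed
    then have "AE t in lebesgue. t \<notin> R"
      by (intro AE_not_in) (simp flip: negligible_iff_null_sets add: negligible_finite)
    then have ae: "AE t in lebesgue. indicator (C i) t *\<^sub>R F i p t = (\<Sum>h\<in>halves G. indicator (A i h) t *\<^sub>R F i p t)"
    proof eventually_elim
      case (elim t)
      show ?case
      proof (cases "t \<in> C i")
        case True
        then obtain h where h: "h \<in> halves G" "t \<in> A i h" using elim by (auto simp: R_def)
        have "t \<notin> A i h'" if "h' \<in> halves G" "h' \<noteq> h" for h'
          using half_sets_disjoint[OF h(1) that(1)] that(2) h(2) unfolding A_def by blast
        then have "(\<Sum>h'\<in>halves G. indicator (A i h') t *\<^sub>R F i p t) = (\<Sum>h'\<in>halves G. if h' = h then F i p t else 0)"
          using h by (intro sum.cong refl) auto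
        then show ?thesis using True h(1) fin_halves by simp
      next
        case False
        then have "t \<notin> A i h" for h by (simp add: A_def)
        then show ?thesis using False by simp
      qed
    qed
    have "line_current (C i) (\<phi> i) (\<theta> i) (\<lambda>_. 1) [p] = (LINT t|lebesgue. indicator (C i) t *\<^sub>R F i p t)"
      unfolding line_current_def set_lebesgue_integral_def F_def by simp
    also have "\<dots> = (LINT t|lebesgue. (\<Sum>h\<in>halves G. indicator (A i h) t *\<^sub>R F i p t))"
      using int by (intro lebesgue_integral_eq_AE[OF _ ae] borel_measurable_sum borel_measurable_integrable) (simp add: set_integrable_def)
    also have "\<dots> = (\<Sum>h\<in>halves G. LINT t:A i h|lebesgue. F i p t)"
      unfolding set_lebesgue_integral_def using int by (intro Bochner_Integration.integral_sum) (simp add: set_integrable_def)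
    also have "\<dots> = (\<Sum>h\<in>halves G. (LINT s:P' i h|lebesgue. D h p s) - (LINT s:N' i h|lebesgue. D h p s))"
      using val by (intro sum.cong refl)
    finally show ?thesis .
  qed
  have Dint: "set_integrable lebesgue (half_dom G h) (D h p)" if "h \<in> halves G" "K-lipschitz_on (points G) p" for h p K
    unfolding D_def[abs_def] using lipschitz_interval_derivative_integrable[OF half_lipschitz[OF that(2,1)]] .
  have Pm: "P' i h \<in> sets lebesgue" "N' i h \<in> sets lebesgue" "P' i h \<inter> N' i h = {}" "P' i h \<subseteq> half_dom G h" "N' i h \<subseteq> half_dom G h" if "h \<in> halves G" for i h
    using PN[OF that, of i] unfolding good_def by auto
  have "S (\<lambda>_. 1) [p] = (\<Sum>h\<in>halves G. (LINT s:P h|lebesgue. D h p s) - (LINT s:N h|lebesgue. D h p s))"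
    if p: "K-lipschitz_on (points G) p" for p K
  proof -
    have "(\<lambda>i. \<Sum>h\<in>halves G. (LINT s:P' i h|lebesgue. D h p s) - (LINT s:N' i h|lebesgue. D h p s)) sums
      (\<Sum>h\<in>halves G. (LINT s:P h|lebesgue. D h p s) - (LINT s:N h|lebesgue. D h p s))"
    proof (intro sums_sum sums_diff)
      fix h assume h: "h \<in> halves G"
      show "(\<lambda>i. LINT s:P' i h|lebesgue. D h p s) sums (LINT s:P h|lebesgue. D h p s)"
        unfolding P_def
      proof (rule set_integral_disjoint_sums)
        show "disjoint_family (\<lambda>i. P' i h)" using dj[OF h] unfolding disjoint_family_on_def by blast
        have "(\<Union>i. P' i h) \<in> sets lebesgue" using Pm(1)[OF h] by auto
        moreover have "(\<Union>i. P' i h) \<subseteq> half_dom G h" using Pm(4)[OF h] by blast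
        ultimately show "set_integrable lebesgue (\<Union>i. P' i h) (D h p)"
          by (rule set_integrable_subset[OF Dint[OF h p]])
      qed (rule Pm[OF h])
      show "(\<lambda>i. LINT s:N' i h|lebesgue. D h p s) sums (LINT s:N h|lebesgue. D h p s)"
        unfolding N_def
      proof (rule set_integral_disjoint_sums)
        show "disjoint_family (\<lambda>i. N' i h)" using dj[OF h] unfolding disjoint_family_on_def by blast
        have "(\<Union>i. N' i h) \<in> sets lebesgue" using Pm(2)[OF h] by auto
        moreover have "(\<Union>i. N' i h) \<subseteq> half_dom G h" using Pm(5)[OF h] by blast
        ultimately show "set_integrable lebesgue (\<Union>i. N' i h) (D h p)"
          by (rule set_integrable_subset[OF Dint[OF h p]])
      qed (rule Pm[OF h])
    qed
    moreover have "(\<lambda>_. 1, [p]) \<in> forms 1 (points G)"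
      using p Lip_bdd_const[of 1 "points G"] by (auto simp: forms_def Lip_def)
    from Csum[OF this] have "(\<lambda>i. \<Sum>h\<in>halves G. (LINT s:P' i h|lebesgue. D h p s) - (LINT s:N' i h|lebesgue. D h p s)) sums S (\<lambda>_. 1) [p]"
      unfolding line[OF p] .
    ultimately show ?thesis using sums_unique2 by blast
  qed
  moreover have "P h \<in> sets lebesgue \<and> N h \<in> sets lebesgue \<and> P h \<inter> N h = {} \<and> P h \<union> N h \<subseteq> half_dom G h \<and>
       negligible (half_dom G h - (P h \<union> N h))" if h: "h \<in> halves G" for h
  proof (intro conjI)
    show "P h \<in> sets lebesgue" "N h \<in> sets lebesgue" unfolding P_def N_def using Pm[OF h] by auto
    show "P h \<inter> N h = {}"
    proof -
      have "P' i h \<inter> N' j h = {}" for i j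
        using dj[OF h, of i j] Pm(3)[OF h, of i] by (cases "i = j") auto
      then show ?thesis unfolding P_def N_def by blast
    qed
    show "P h \<union> N h \<subseteq> half_dom G h" unfolding P_def N_def using Pm[OF h] by blast
    show "negligible (half_dom G h - (P h \<union> N h))"
    proof (rule negligible_subset)
      show "negligible ((\<Union>i. {s\<in>half_dom G h. param G (fst h) s \<in> \<phi> i ` C i} - (P' i h \<union> N' i h)) \<union>
        {s\<in>half_dom G h. param G (fst h) s \<in> {x\<in>edge_set G (fst h). m x \<noteq> 1}})"
        using PN[OF h] unfolding good_def
        by (intro negligible_Un half_preimage_negligible[OF h m1[OF half_fst[OF h]]] negligible_Union_nat) auto
      show "half_dom G h - (P h \<union> N h) \<subseteq> (\<Union>i. {s\<in>half_dom G h. param G (fst h) s \<in> \<phi> i ` C i} - (P' i h \<union> N' i h)) \<union>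
        {s\<in>half_dom G h. param G (fst h) s \<in> {x\<in>edge_set G (fst h). m x \<noteq> 1}}"
      proof
        fix s assume s: "s \<in> half_dom G h - (P h \<union> N h)"
        show "s \<in> (\<Union>i. {s\<in>half_dom G h. param G (fst h) s \<in> \<phi> i ` C i} - (P' i h \<union> N' i h)) \<union>
          {s\<in>half_dom G h. param G (fst h) s \<in> {x\<in>edge_set G (fst h). m x \<noteq> 1}}"
        proof (cases "param G (fst h) s \<in> (\<Union>i. \<phi> i ` C i)")
          case True
          then obtain i where "param G (fst h) s \<in> \<phi> i ` C i" by blast
          then show ?thesis using s unfolding P_def N_def by blast
        next
          case False
          then have "m (param G (fst h) s) = 0" by (rule m0)
          moreover have "s \<in> {0..len G (fst h)}" using s half_open_subset[OF h] by auto
          then have "param G (fst h) s \<in> edge_set G (fst h)" unfolding edge_set_def by (rule imageI)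
          ultimately show ?thesis using s by simp
        qed
      qed
    qed
  qed
  ultimately have "orientation S P N" unfolding orientation_def D_def by blast
  then show ?thesis by blast
qed

lemma orientationD:
  assumes "orientation S P N"
  shows "h \<in> halves G \<Longrightarrow> P h \<in> sets lebesgue" "h \<in> halves G \<Longrightarrow> N h \<in> sets lebesgue"
    "h \<in> halves G \<Longrightarrow> P h \<inter> N h = {}" "h \<in> halves G \<Longrightarrow> P h \<subseteq> half_dom G h" "h \<in> halves G \<Longrightarrow> N h \<subseteq> half_dom G h"
    "h \<in> halves G \<Longrightarrow> negligible (half_dom G h - (P h \<union> N h))"
    "C-lipschitz_on (points G) p \<Longrightarrow> S (\<lambda>_. 1) [p] =
       (\<Sum>h\<in>halves G. (LINT t:P h|lebesgue. vector_derivative (\<lambda>s. p (param G (fst h) s)) (at t)) -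
         (LINT t:N h|lebesgue. vector_derivative (\<lambda>s. p (param G (fst h) s)) (at t)))"
  using assms by (simp_all add: orientation_def) blast

section \<open>Piecewise linear test functions\<close>

text \<open>For piecewise constant slopes the integrals reduce to measures of P and N in intervals.
  Two slopes are what a hat takes; c2 = 0 serves the tent at a vertex, and c1 = c2 = 0 the halves
  where the test function vanishes.\<close>

lemma orientation_step:
  assumes o: "orientation S P N" and h: "h \<in> halves G" and F: "finite F"
    and w: "\<And>s. s \<in> half_dom G h - F \<Longrightarrow> ((\<lambda>s. p (param G (fst h) s)) has_vector_derivative (c1 * indicator {a<..<x} s + c2 * indicator {x'<..<b} s)) (at s)"
  shows "(LINT t:P h|lebesgue. vector_derivative (\<lambda>s. p (param G (fst h) s)) (at t)) -
      (LINT t:N h|lebesgue. vector_derivative (\<lambda>s. p (param G (fst h) s)) (at t)) =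
    c1 * (measure lebesgue (P h \<inter> {a<..<x}) - measure lebesgue (N h \<inter> {a<..<x})) +
    c2 * (measure lebesgue (P h \<inter> {x'<..<b}) - measure lebesgue (N h \<inter> {x'<..<b}))"
  using step_function_integral[OF orientationD(1)[OF o h] orientationD(4)[OF o h] F, of "\<lambda>t. vector_derivative (\<lambda>s. p (param G (fst h) s)) (at t)" c1 a x c2 x' b]
    step_function_integral[OF orientationD(2)[OF o h] orientationD(5)[OF o h] F, of "\<lambda>t. vector_derivative (\<lambda>s. p (param G (fst h) s)) (at t)" c1 a x c2 x' b]
    vector_derivative_at[OF w]
  by (simp add: algebra_simps)

lemma half_derivative_transfer:
  fixes q :: "real \<Rightarrow> real"
  assumes h: "h \<in> halves G" and p: "\<And>s. s \<in> half_dom G h \<Longrightarrow> p (param G (fst h) s) = q s"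
    and s: "s \<in> half_dom G h" and d: "(q has_vector_derivative d) (at s)"
  shows "((\<lambda>s. p (param G (fst h) s)) has_vector_derivative d) (at s)"
  using d by (rule has_vector_derivative_transform_within_open[OF _ open_greaterThanLessThan s]) (simp add: p)

lemma has_vector_derivative_near:
  fixes q r :: "real \<Rightarrow> real"
  assumes "open W" "s \<in> W" "\<And>t. t \<in> W \<Longrightarrow> r t = q t" "(r has_real_derivative d) (at s)"
  shows "(q has_vector_derivative d) (at s)"
  using assms has_vector_derivative_transform_within_open[of r d s W q]
  by (simp add: has_real_derivative_iff_has_vector_derivative)

text \<open>The peak at x has height 1, so the slopes are reciprocal to the lengths of the two
  sides, and testing against the hat compares the mean sign on (a, x) with that on (x, b).\<close>

definition hat :: "real \<Rightarrow> real \<Rightarrow> real \<Rightarrow> real \<Rightarrow> real" where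
  "hat a x b s = max 0 (min ((s - a) / (x - a)) ((b - s) / (b - x)))"

lemma hat_derivative:
  assumes "a < x" "x < b" "s \<notin> {a, x, b}"
  shows "(hat a x b has_vector_derivative (1 / (x - a) * indicator {a<..<x} s + (- 1 / (b - x)) * indicator {x<..<b} s)) (at s)"
proof -
  have d1: "x - a > 0" and d2: "b - x > 0" using assms by auto
  have lo: "(t - a) / (x - a) \<le> (b - t) / (b - x)" if "t \<le> x" for t
  proof -
    have "(t - a) / (x - a) \<le> 1" "1 \<le> (b - t) / (b - x)" using that d1 d2 by (simp_all add: divide_le_eq le_divide_eq)
    then show ?thesis by linarith
  qed
  have hi: "(b - t) / (b - x) \<le> (t - a) / (x - a)" if "x \<le> t" for t
  proof -
    have "(b - t) / (b - x) \<le> 1" "1 \<le> (t - a) / (x - a)" using that d1 d2 by (simp_all add: divide_le_eq le_divide_eq)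
    then show ?thesis by linarith
  qed
  consider "s < a" | "a < s" "s < x" | "x < s" "s < b" | "b < s" using assms(3) by force
  then show ?thesis
  proof cases
    case 1
    have "hat a x b t = 0" if "t \<in> {..<a}" for t
      using that lo[of t] assms(1) d1 by (simp add: hat_def min_absorb1 divide_le_0_iff)
    then have "(hat a x b has_vector_derivative 0) (at s)"
      using 1 by (intro has_vector_derivative_near[of "{..<a}" s "\<lambda>_. 0"]) auto
    then show ?thesis using 1 assms by simp
  next
    case 2
    have "(t - a) / (x - a) = hat a x b t" if "t \<in> {a<..<x}" for t
      using that lo[of t] d1 by (simp add: hat_def min_absorb1)
    then have "(hat a x b has_vector_derivative (1 / (x - a))) (at s)"
      using 2 d1 by (intro has_vector_derivative_near[of "{a<..<x}" s "\<lambda>t. (t - a) / (x - a)"]) (auto intro!: derivative_eq_intros)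
    then show ?thesis using 2 by simp
  next
    case 3
    have "(b - t) / (b - x) = hat a x b t" if "t \<in> {x<..<b}" for t
      using that hi[of t] d2 by (simp add: hat_def min_absorb2)
    then have "(hat a x b has_vector_derivative (- 1 / (b - x))) (at s)"
    proof (intro has_vector_derivative_near[of "{x<..<b}" s "\<lambda>t. (b - t) / (b - x)"])
      have "((\<lambda>t. (b - t) / (b - x)) has_real_derivative ((0 - 1) / (b - x))) (at s)"
        by (intro DERIV_cdivide DERIV_diff DERIV_const DERIV_ident)
      then show "((\<lambda>t. (b - t) / (b - x)) has_real_derivative (- 1 / (b - x))) (at s)" by simp
    qed (use 3 in auto)
    then show ?thesis using 3 by simp
  next
    case 4
    have "hat a x b t = 0" if "t \<in> {b<..}" for t
      using that hi[of t] assms(2) d2 by (simp add: hat_def min_absorb2 divide_le_0_iff)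
    then have "(hat a x b has_vector_derivative 0) (at s)"
      using 4 by (intro has_vector_derivative_near[of "{b<..}" s "\<lambda>_. 0"]) auto
    then show ?thesis using 4 assms by simp
  qed
qed

lemma hat_outside:
  assumes "a < x" "x < b" "s \<notin> {a<..<b}"
  shows "hat a x b s = 0"
proof -
  have "(s - a) / (x - a) \<le> 0 \<or> (b - s) / (b - x) \<le> 0"
    using assms by (auto simp: divide_le_0_iff not_less)
  then show ?thesis by (auto simp: hat_def)
qed

lemma hat_lipschitz:
  assumes "a < x" "x < b"
  shows "(1 / (x - a) + 1 / (b - x))-lipschitz_on S (hat a x b)"
proof (rule lipschitz_onI)
  have d1: "x - a > 0" and d2: "b - x > 0" using assms by auto
  show "0 \<le> 1 / (x - a) + 1 / (b - x)" using d1 d2 by simp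
  fix s t
  have "\<bar>hat a x b s - hat a x b t\<bar> \<le> \<bar>(s - a) / (x - a) - (t - a) / (x - a)\<bar> + \<bar>(b - s) / (b - x) - (b - t) / (b - x)\<bar>"
    unfolding hat_def by (auto simp: max_def min_def)
  also have "\<dots> = \<bar>s - t\<bar> / (x - a) + \<bar>s - t\<bar> / (b - x)"
    using d1 d2 by (simp add: abs_minus_commute flip: diff_divide_distrib)
  finally show "dist (hat a x b s) (hat a x b t) \<le> (1 / (x - a) + 1 / (b - x)) * dist s t"
    by (simp add: dist_real_def distrib_right)
qed

text \<open>Testing against hat functions: away from the atoms of its boundary, the orientation of a
  current is constant along an edge.\<close>

lemma orientation_constant:
  fixes a b :: real
  assumes o: "orientation S P N" and bd: "point_mass_sum (points G) (boundary S) M"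
    and h: "h \<in> halves G" and ab: "a < b" "{a<..<b} \<subseteq> half_dom G h"
    and noatom: "\<And>t. t \<in> {a<..<b} \<Longrightarrow> M (param G (fst h) t) = 0"
  obtains \<epsilon> :: int where "\<bar>\<epsilon>\<bar> = 1"
    "measure lebesgue (P h \<inter> {a<..<b}) - measure lebesgue (N h \<inter> {a<..<b}) = \<epsilon> * (b - a)"
proof (rule constant_sign[OF orientationD(1)[OF o h] orientationD(2)[OF o h] orientationD(3)[OF o h] _ ab(1)])
  show "negligible ({a<..<b} - (P h \<union> N h))"
    by (rule negligible_subset[OF orientationD(6)[OF o h]]) (use ab in auto)
  fix x assume x: "x \<in> {a<..<b}"
  then have ax: "a < x" "x < b" by auto
  have e: "fst h \<in> edges G" by (rule half_fst[OF h])
  have bounds: "0 \<le> a" "b \<le> len G (fst h)"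
  proof -
    have "{a<..<b} \<subseteq> {0<..<len G (fst h)}" using ab(2) half_open_subset[OF h] by blast
    then show "0 \<le> a" "b \<le> len G (fst h)" using ab(1) by (auto simp: greaterThanLessThan_subseteq_greaterThanLessThan)
  qed
  \<comment> \<open>The hat vanishes at both ends of its edge, so together with 0 on all other edges
    it glues to a Lipschitz function that is 0 at every vertex.\<close>
  define k where "k e' = (if e' = fst h then hat a x b else (\<lambda>_. 0))" for e'
  define p where "p = glue G (\<lambda>_. 0) k"
  have k0: "k e' 0 = 0" "k e' (len G e') = 0" for e'
    using bounds ax by (auto simp: k_def intro!: hat_outside)
  have plip: "(1 / (x - a) + 1 / (b - x))-lipschitz_on (points G) p"
    unfolding p_def
  proof (rule glue_lipschitz)
    fix e' show "(1 / (x - a) + 1 / (b - x))-lipschitz_on {0..len G e'} (k e')"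
      using hat_lipschitz[OF ax, of "{0..len G e'}"] ax by (auto simp: k_def intro!: lipschitz_onI)
  qed (use k0 ax in auto)
  have pval: "p (param G e' t) = k e' t" if "e' \<in> edges G" "t \<in> {0..len G e'}" for e' t
    unfolding p_def using that k0 by (intro glue_param) auto
  \<comment> \<open>The hat is 0 outside (a, b), and inside there is no atom, so the boundary takes
    the value 0 on it.\<close>
  have pM: "real_of_int (M y) * p y = 0" if y: "y \<in> points G" for y
  proof (cases "y \<in> verts G")
    case True
    then show ?thesis by (simp add: p_def glue_def)
  next
    case False
    then obtain e' t where et: "e' \<in> edges G" "t \<in> {0..len G e'}" "y = param G e' t"
      using y by (auto simp: points_def edge_set_def)
    show ?thesis
    proof (cases "e' = fst h \<and> t \<in> {a<..<b}")
      case True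
      then show ?thesis using noatom[of t] et(3) by simp
    next
      case False
      then have "k e' t = 0" using hat_outside[OF ax, of t] by (auto simp: k_def)
      then show ?thesis using pval[OF et(1,2)] et(3) by simp
    qed
  qed
  have pb: "\<bar>p y\<bar> \<le> 1" if y: "y \<in> points G" for y
  proof (cases "y \<in> verts G")
    case False
    then obtain e' t where et: "e' \<in> edges G" "t \<in> {0..len G e'}" "y = param G e' t"
      using y by (auto simp: points_def edge_set_def)
    have "(t - a) / (x - a) \<le> 1 \<or> (b - t) / (b - x) \<le> 1"
      using ax by (cases "t \<le> x") (auto simp: divide_le_eq)
    then have "\<bar>hat a x b t\<bar> \<le> 1" by (auto simp: hat_def)
    then show ?thesis using pval[OF et(1,2)] et(3) by (simp add: k_def)
  qed (simp add: p_def glue_def)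
  have "S (\<lambda>_. 1) [p] = boundary S p []" by (simp add: boundary_def)
  also have "\<dots> = (\<Sum>y | M y \<noteq> 0. real_of_int (M y) * p y)"
    using bd Lip_bddI[OF plip pb] unfolding point_mass_sum_def by blast
  also have "\<dots> = 0"
    using bd pM unfolding point_mass_sum_def by (intro sum.neutral) blast
  finally have zero: "S (\<lambda>_. 1) [p] = 0" .
  have other: "(LINT t:P h'|lebesgue. vector_derivative (\<lambda>s. p (param G (fst h') s)) (at t)) -
      (LINT t:N h'|lebesgue. vector_derivative (\<lambda>s. p (param G (fst h') s)) (at t)) = 0" if h': "h' \<in> halves G" "h' \<noteq> h" for h'
  proof -
    have pz: "p (param G (fst h') s) = 0" if s: "s \<in> half_dom G h'" for s
    proof -
      have "s \<in> {0..len G (fst h')}" using s half_open_subset[OF h'(1)] by auto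
      moreover have "k (fst h') s = 0"
      proof (cases "fst h' = fst h")
        case True
        then have "half_dom G h' \<inter> half_dom G h = {}"
          using h'(2) by (cases h; cases h') (auto simp: half_lo_def half_hi_def)
        then have "s \<notin> {a<..<b}" using s ab(2) by blast
        then show ?thesis using hat_outside[OF ax] by (simp add: k_def)
      qed (simp add: k_def)
      ultimately show ?thesis using pval[OF half_fst[OF h'(1)]] by simp
    qed
    have "((\<lambda>s. p (param G (fst h') s)) has_vector_derivative (0 * indicator {0<..<0} s + 0 * indicator {0<..<0} s)) (at s)"
      if "s \<in> half_dom G h' - {}" for s :: real
      by (rule half_derivative_transfer[OF h'(1), of p "\<lambda>_. 0"]) (use that pz in auto)
    from orientation_step[OF o h'(1) finite.emptyI this] show ?thesis by simp
  qed
  have "((\<lambda>s. p (param G (fst h) s)) has_vector_derivative (1 / (x - a) * indicator {a<..<x} s + (- 1 / (b - x)) * indicator {x<..<b} s)) (at s)"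
    if s: "s \<in> half_dom G h - {a, x, b}" for s
  proof (rule half_derivative_transfer[OF h, of p "hat a x b"])
    show "p (param G (fst h) t) = hat a x b t" if "t \<in> half_dom G h" for t
      using pval[OF e, of t] that half_open_subset[OF h] by (auto simp: k_def)
  qed (use s hat_derivative[OF ax, of s] in auto)
  then have main: "(LINT t:P h|lebesgue. vector_derivative (\<lambda>s. p (param G (fst h) s)) (at t)) -
      (LINT t:N h|lebesgue. vector_derivative (\<lambda>s. p (param G (fst h) s)) (at t)) =
    1 / (x - a) * (measure lebesgue (P h \<inter> {a<..<x}) - measure lebesgue (N h \<inter> {a<..<x})) +
    (- 1 / (b - x)) * (measure lebesgue (P h \<inter> {x<..<b}) - measure lebesgue (N h \<inter> {x<..<b}))"
    by (intro orientation_step[OF o h, of "{a, x, b}"]) auto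
  \<comment> \<open>Only the half h contributes, and the vanishing of the value says that the two
    mean signs are equal.\<close>
  have "S (\<lambda>_. 1) [p] = (\<Sum>h'\<in>halves G. if h' = h then
      1 / (x - a) * (measure lebesgue (P h \<inter> {a<..<x}) - measure lebesgue (N h \<inter> {a<..<x})) +
      (- 1 / (b - x)) * (measure lebesgue (P h \<inter> {x<..<b}) - measure lebesgue (N h \<inter> {x<..<b})) else 0)"
    unfolding orientationD(7)[OF o plip] using other main by (intro sum.cong refl) auto
  then show "(measure lebesgue (P h \<inter> {a<..<x}) - measure lebesgue (N h \<inter> {a<..<x})) / (x - a) =
      (measure lebesgue (P h \<inter> {x<..<b}) - measure lebesgue (N h \<inter> {x<..<b})) / (b - x)"
    using zero h fin_halves by simp
qed (rule that)

section \<open>Boundary coefficients at vertices\<close>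

text \<open>The radius r is at most half of every edge length and at most the distance of any atom
  inside an edge to the ends of that edge. Hence the tent at v sees no atom but v, and the sign is
  constant on each edge end over which the tent slopes. The coefficient is a sum of one sign per
  edge end at v, two for a loop.\<close>

lemma boundary_coeff_parity:
  assumes o: "orientation S P N" and bd: "point_mass_sum (points G) (boundary S) M" and v: "v \<in> verts G"
  shows "even (M v) \<longleftrightarrow> even (degree G v)"
proof -
  let ?X = "points G"
  have finM: "finite {y. M y \<noteq> 0}" and subM: "{y. M y \<noteq> 0} \<subseteq> ?X" using bd by (auto simp: point_mass_sum_def)
  have tent_pos: "0 < tent G y" if y: "y \<in> ?X" "y \<notin> verts G" for y
  proof -
    obtain e t where et: "e \<in> edges G" "t \<in> {0..len G e}" "y = param G e t"
      using y by (auto simp: points_def edge_set_def)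
    then have "t \<noteq> 0" "t \<noteq> len G e" using y(2) param_0 param_len by auto
    then show ?thesis using et tent_param[OF et(1,2)] by auto
  qed
  \<comment> \<open>The element 1 keeps the set nonempty, so that its minimum is meaningful.\<close>
  define B where "B = insert 1 ((\<lambda>e. len G e / 2) ` edges G \<union> tent G ` ({y. M y \<noteq> 0} - verts G))"
  define r where "r = Min B"
  have B: "finite B" "B \<noteq> {}" using finM fin_edges by (auto simp: B_def)
  have "0 < y" if "y \<in> B" for y using that len_pos tent_pos subM by (auto simp: B_def)
  then have r0: "0 < r" using Min_in[OF B] by (simp add: r_def)
  have rl: "r \<le> len G e / 2" if "e \<in> edges G" for e
    unfolding r_def using B that by (intro Min_le) (auto simp: B_def)
  have rt: "r \<le> tent G y" if "M y \<noteq> 0" "y \<notin> verts G" for y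
    unfolding r_def using B that by (intro Min_le) (auto simp: B_def)
  have noatom: "M (param G e t) = 0" if e: "e \<in> edges G" and t: "t \<in> {0<..<r} \<union> {len G e - r<..<len G e}" for e t
  proof (rule ccontr)
    assume M: "M (param G e t) \<noteq> 0"
    have t': "t \<in> {0<..<len G e}" using t rl[OF e] r0 by auto
    have "r \<le> tent G (param G e t)" using rt[OF M] interior_not_vertex[OF e t'] by blast
    also have "tent G (param G e t) = min t (len G e - t)" using t' by (intro tent_param[OF e]) auto
    finally show False using t by auto
  qed
  have hv: "(e, b) \<in> halves G" if "e \<in> edges G" for e b using that by (simp add: halves_def)
  have "\<exists>\<epsilon>. \<bar>\<epsilon>\<bar> = (1::int) \<and> measure lebesgue (P (e, True) \<inter> {0<..<r}) - measure lebesgue (N (e, True) \<inter> {0<..<r}) = real_of_int \<epsilon> * r"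
    if e: "e \<in> edges G" for e
  proof (rule orientation_constant[OF o bd hv[OF e, of True], of "0" "r"])
    show "{0<..<r} \<subseteq> half_dom G (e, True)" using rl[OF e] r0 by (auto simp: half_lo_def half_hi_def)
    show "M (param G (fst (e, True)) t) = 0" if "t \<in> {0<..<r}" for t using noatom[OF e, of t] that by simp
  qed (use r0 in auto)
  then obtain \<epsilon>1 where \<epsilon>1: "\<And>e. e \<in> edges G \<Longrightarrow> \<bar>\<epsilon>1 e\<bar> = (1::int) \<and> measure lebesgue (P (e, True) \<inter> {0<..<r}) - measure lebesgue (N (e, True) \<inter> {0<..<r}) = real_of_int (\<epsilon>1 e) * r"
    by metis
  have "\<exists>\<epsilon>. \<bar>\<epsilon>\<bar> = (1::int) \<and> measure lebesgue (P (e, False) \<inter> {len G e - r<..<len G e}) - measure lebesgue (N (e, False) \<inter> {len G e - r<..<len G e}) = real_of_int \<epsilon> * r"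
    if e: "e \<in> edges G" for e
  proof (rule orientation_constant[OF o bd hv[OF e, of False], of "len G e - r" "len G e"])
    show "{len G e - r<..<len G e} \<subseteq> half_dom G (e, False)" using rl[OF e] r0 by (auto simp: half_lo_def half_hi_def)
    show "M (param G (fst (e, False)) t) = 0" if "t \<in> {len G e - r<..<len G e}" for t using noatom[OF e, of t] that by simp
  qed (use r0 in auto)
  then obtain \<epsilon>2 where \<epsilon>2: "\<And>e. e \<in> edges G \<Longrightarrow> \<bar>\<epsilon>2 e\<bar> = (1::int) \<and> measure lebesgue (P (e, False) \<inter> {len G e - r<..<len G e}) - measure lebesgue (N (e, False) \<inter> {len G e - r<..<len G e}) = real_of_int (\<epsilon>2 e) * r"
    by metis
  \<comment> \<open>One summand for each end of e, so that a loop at v carries both; by r \<le>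
    \<open>len G e / 2\<close> they are never positive at the same parameter.\<close>
  define k where "k e t = of_bool (param G e 0 = v) * max 0 (1 - t / r) + of_bool (param G e (len G e) = v) * max 0 (1 - (len G e - t) / r)" for e t
  define f where "f = glue G (\<lambda>y. of_bool (y = v)) k"
  have k0: "k e 0 = of_bool (param G e 0 = v)" "k e (len G e) = of_bool (param G e (len G e) = v)" if e: "e \<in> edges G" for e
  proof -
    have "1 - len G e / r \<le> 0" using rl[OF e] r0 by (simp add: le_divide_eq)
    then show "k e 0 = of_bool (param G e 0 = v)" "k e (len G e) = of_bool (param G e (len G e) = v)"
      by (auto simp: k_def max_def)
  qed
  have flip: "(2 / r)-lipschitz_on ?X f"
    unfolding f_def
  proof (rule glue_lipschitz)
    fix e assume e: "e \<in> edges G"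
    show "(2 / r)-lipschitz_on {0..len G e} (k e)"
    proof (rule lipschitz_onI)
      fix s t
      have 1: "\<bar>max 0 (1 - s / r) - max 0 (1 - t / r)\<bar> \<le> \<bar>s - t\<bar> / r"
      proof -
        have "\<bar>max 0 (1 - s / r) - max 0 (1 - t / r)\<bar> \<le> \<bar>s / r - t / r\<bar>" by (auto simp: max_def)
        then show ?thesis using r0 by (simp flip: diff_divide_distrib)
      qed
      have 2: "\<bar>max 0 (1 - (len G e - s) / r) - max 0 (1 - (len G e - t) / r)\<bar> \<le> \<bar>s - t\<bar> / r"
      proof -
        have "\<bar>max 0 (1 - (len G e - s) / r) - max 0 (1 - (len G e - t) / r)\<bar> \<le> \<bar>(len G e - s) / r - (len G e - t) / r\<bar>" by (auto simp: max_def)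
        then show ?thesis using r0 by (simp add: abs_minus_commute flip: diff_divide_distrib)
      qed
      have "\<bar>c1 * a1 + c2 * a2 - (c1 * b1 + c2 * b2)\<bar> \<le> \<bar>a1 - b1\<bar> + \<bar>a2 - b2\<bar>"
        if "c1 = 0 \<or> c1 = 1" "c2 = 0 \<or> c2 = 1" for a1 a2 b1 b2 c1 c2 :: real
        using that by auto
      then have "\<bar>k e s - k e t\<bar> \<le> \<bar>max 0 (1 - s / r) - max 0 (1 - t / r)\<bar> +
          \<bar>max 0 (1 - (len G e - s) / r) - max 0 (1 - (len G e - t) / r)\<bar>"
        unfolding k_def of_bool_def by presburger
      also have "\<dots> \<le> \<bar>s - t\<bar> / r + \<bar>s - t\<bar> / r" by (rule add_mono[OF 1 2])
      finally have "\<bar>k e s - k e t\<bar> \<le> \<bar>s - t\<bar> / r + \<bar>s - t\<bar> / r" .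
      then show "dist (k e s) (k e t) \<le> 2 / r * dist s t" by (simp add: dist_real_def)
    qed (use r0 in simp)
  qed (use k0 r0 in auto)
  have fval: "f (param G e t) = k e t" if "e \<in> edges G" "t \<in> {0..len G e}" for e t
    unfolding f_def using that k0[OF that(1)] by (intro glue_param) auto
  have fM: "real_of_int (M y) * f y = of_bool (y = v) * real_of_int (M v)" if y: "y \<in> ?X" for y
  proof (cases "y \<in> verts G")
    case True
    then show ?thesis by (auto simp: f_def glue_def of_bool_def)
  next
    case False
    then have "y \<noteq> v" using v by auto
    obtain e t where et: "e \<in> edges G" "t \<in> {0..len G e}" "y = param G e t"
      using y False by (auto simp: points_def edge_set_def)
    show ?thesis
    proof (cases "M y = 0")
      case False
      \<comment> \<open>An atom inside an edge lies at or beyond the radius, where the tent is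
        0.\<close>
      then have "r \<le> min t (len G e - t)" using rt[OF False \<open>y \<notin> verts G\<close>] tent_param[OF et(1,2)] et(3) by simp
      then have "1 - t / r \<le> 0" "1 - (len G e - t) / r \<le> 0" using r0 by (simp_all add: le_divide_eq)
      then have "k e t = 0" by (simp add: k_def)
      then show ?thesis using fval[OF et(1,2)] et(3) \<open>y \<noteq> v\<close> by simp
    qed (use \<open>y \<noteq> v\<close> in simp)
  qed
  have fb: "\<bar>f y\<bar> \<le> 2" if y: "y \<in> ?X" for y
  proof (cases "y \<in> verts G")
    case False
    then obtain e t where et: "e \<in> edges G" "t \<in> {0..len G e}" "y = param G e t"
      using y by (auto simp: points_def edge_set_def)
    have "0 \<le> t / r" "0 \<le> (len G e - t) / r" using et(2) r0 by simp_all
    then have "\<bar>k e t\<bar> \<le> 2" by (auto simp: k_def of_bool_def max_def)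
    then show ?thesis using fval[OF et(1,2)] et(3) by simp
  qed (simp add: f_def glue_def)
  have "S (\<lambda>_. 1) [f] = boundary S f []" by (simp add: boundary_def)
  also have "\<dots> = (\<Sum>y | M y \<noteq> 0. real_of_int (M y) * f y)"
    using bd Lip_bddI[OF flip fb] unfolding point_mass_sum_def by blast
  also have "\<dots> = (\<Sum>y | M y \<noteq> 0. if y = v then real_of_int (M v) else 0)"
  proof (rule sum.cong[OF refl])
    fix y assume "y \<in> {y. M y \<noteq> 0}"
    then have "y \<in> ?X" using subM by blast
    show "real_of_int (M y) * f y = (if y = v then real_of_int (M v) else 0)" unfolding fM[OF \<open>y \<in> ?X\<close>] by simp
  qed
  also have "\<dots> = real_of_int (M v)" using finM by simp
  finally have SM: "S (\<lambda>_. 1) [f] = real_of_int (M v)" .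
  \<comment> \<open>Leaving v, the tent has slope -1 / r over a length r on which the sign is
    constant; the result is minus that sign.\<close>
  have hT: "(LINT t:P (e, True)|lebesgue. vector_derivative (\<lambda>s. f (param G e s)) (at t)) -
      (LINT t:N (e, True)|lebesgue. vector_derivative (\<lambda>s. f (param G e s)) (at t)) = - (of_bool (param G e 0 = v) * \<epsilon>1 e)"
    if e: "e \<in> edges G" for e
  proof -
    let ?c = "of_bool (param G e 0 = v) :: real"
    have fk: "f (param G (fst (e, True)) s) = ?c * max 0 (1 - s / r)" if s: "s \<in> half_dom G (e, True)" for s
    proof -
      have s': "0 < s" "s < len G e / 2" using s by (simp_all add: half_lo_def half_hi_def)
      then have "r \<le> len G e - s" using rl[OF e] by simp
      then have "1 - (len G e - s) / r \<le> 0" using r0 by (simp add: le_divide_eq)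
      then show ?thesis using fval[OF e, of s] s' by (simp add: k_def)
    qed
    have "((\<lambda>s. f (param G (fst (e, True)) s)) has_vector_derivative ((- ?c / r) * indicator {0<..<r} s + 0 * indicator {0<..<0} s)) (at s)"
      if s: "s \<in> half_dom G (e, True) - {r}" for s
    proof (rule half_derivative_transfer[where h="(e, True)" and q="\<lambda>s. ?c * max 0 (1 - s / r)", OF hv[OF e] fk])
      show "s \<in> half_dom G (e, True)" using s by simp
      have s0: "0 < s" "s \<noteq> r" using s by (simp_all add: half_lo_def)
      show "((\<lambda>s. ?c * max 0 (1 - s / r)) has_vector_derivative ((- ?c / r) * indicator {0<..<r} s + 0 * indicator {0<..<0} s)) (at s)"
      proof (cases "s < r")
        case True
        have "((\<lambda>s. ?c * max 0 (1 - s / r)) has_vector_derivative (- ?c / r)) (at s)"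
        proof (rule has_vector_derivative_near[of "{..<r}" s "\<lambda>s. ?c * (1 - s / r)"])
          show "((\<lambda>s. ?c * (1 - s / r)) has_real_derivative (- ?c / r)) (at s)"
            using r0 by (auto intro!: derivative_eq_intros)
        qed (use True r0 in \<open>auto simp: max_def divide_simps\<close>)
        then show ?thesis using True s0 by simp
      next
        case False
        have "((\<lambda>s. ?c * max 0 (1 - s / r)) has_vector_derivative 0) (at s)"
          by (rule has_vector_derivative_near[of "{r<..}" s "\<lambda>_. 0"]) (use False s0 r0 in \<open>auto simp: max_def divide_simps\<close>)
        then show ?thesis using False by simp
      qed
    qed
    from orientation_step[OF o hv[OF e, of True] _ this, of "{r}"] show ?thesis
      using \<epsilon>1[OF e] r0 by (simp add: of_bool_def)
  qed
  \<comment> \<open>Towards v the slope is 1 / r, so the sign itself appears.\<close>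
  have hF: "(LINT t:P (e, False)|lebesgue. vector_derivative (\<lambda>s. f (param G e s)) (at t)) -
      (LINT t:N (e, False)|lebesgue. vector_derivative (\<lambda>s. f (param G e s)) (at t)) = of_bool (param G e (len G e) = v) * \<epsilon>2 e"
    if e: "e \<in> edges G" for e
  proof -
    let ?c = "of_bool (param G e (len G e) = v) :: real" and ?l = "len G e"
    have fk: "f (param G (fst (e, False)) s) = ?c * max 0 (1 - (?l - s) / r)" if s: "s \<in> half_dom G (e, False)" for s
    proof -
      have s': "?l / 2 < s" "s < ?l" using s by (simp_all add: half_lo_def half_hi_def)
      then have "r \<le> s" "0 < s" using rl[OF e] len_pos[OF e] by simp_all
      then have "1 - s / r \<le> 0" using r0 by (simp add: le_divide_eq)
      then show ?thesis using fval[OF e, of s] s' \<open>0 < s\<close> by (simp add: k_def)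
    qed
    have "((\<lambda>s. f (param G (fst (e, False)) s)) has_vector_derivative ((?c / r) * indicator {?l - r<..<?l} s + 0 * indicator {0<..<0} s)) (at s)"
      if s: "s \<in> half_dom G (e, False) - {?l - r}" for s
    proof (rule half_derivative_transfer[where h="(e, False)" and q="\<lambda>s. ?c * max 0 (1 - (?l - s) / r)", OF hv[OF e] fk])
      show "s \<in> half_dom G (e, False)" using s by simp
      have s0: "s < ?l" "s \<noteq> ?l - r" using s by (simp_all add: half_hi_def)
      show "((\<lambda>s. ?c * max 0 (1 - (?l - s) / r)) has_vector_derivative ((?c / r) * indicator {?l - r<..<?l} s + 0 * indicator {0<..<0} s)) (at s)"
      proof (cases "?l - r < s")
        case True
        have "((\<lambda>s. ?c * max 0 (1 - (?l - s) / r)) has_vector_derivative (?c / r)) (at s)"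
        proof (rule has_vector_derivative_near[of "{?l - r<..}" s "\<lambda>s. ?c * (1 - (?l - s) / r)"])
          show "((\<lambda>s. ?c * (1 - (?l - s) / r)) has_real_derivative (?c / r)) (at s)"
            using r0 by (auto intro!: derivative_eq_intros)
        qed (use True r0 in \<open>auto simp: max_def divide_simps\<close>)
        then show ?thesis using True s0 by simp
      next
        case False
        have "((\<lambda>s. ?c * max 0 (1 - (?l - s) / r)) has_vector_derivative 0) (at s)"
          by (rule has_vector_derivative_near[of "{..<?l - r}" s "\<lambda>_. 0"]) (use False s0 r0 in \<open>auto simp: max_def divide_simps\<close>)
        then show ?thesis using False by simp
      qed
    qed
    from orientation_step[OF o hv[OF e, of False] _ this, of "{?l - r}"] show ?thesis
      using \<epsilon>2[OF e] r0 by (simp add: of_bool_def)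
  qed
  have "S (\<lambda>_. 1) [f] = (\<Sum>e\<in>edges G. \<Sum>b\<in>UNIV. (LINT t:P (e, b)|lebesgue. vector_derivative (\<lambda>s. f (param G e s)) (at t)) -
         (LINT t:N (e, b)|lebesgue. vector_derivative (\<lambda>s. f (param G e s)) (at t)))"
    unfolding orientationD(7)[OF o flip] halves_def by (simp add: sum.cartesian_product case_prod_beta)
  also have "\<dots> = (\<Sum>e\<in>edges G. real_of_int (of_bool (param G e 0 = v) * (- \<epsilon>1 e) + of_bool (param G e (len G e) = v) * \<epsilon>2 e))"
    using hT hF by (intro sum.cong refl) (simp add: UNIV_bool)
  also have "\<dots> = real_of_int (\<Sum>e\<in>edges G. of_bool (param G e 0 = v) * (- \<epsilon>1 e) + of_bool (param G e (len G e) = v) * \<epsilon>2 e)"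
    by simp
  finally have "real_of_int (M v) = real_of_int (\<Sum>e\<in>edges G. of_bool (param G e 0 = v) * (- \<epsilon>1 e) + of_bool (param G e (len G e) = v) * \<epsilon>2 e)" unfolding SM .
  then have "M v = (\<Sum>e\<in>edges G. of_bool (param G e 0 = v) * (- \<epsilon>1 e) + of_bool (param G e (len G e) = v) * \<epsilon>2 e)" by (simp only: of_int_eq_iff)
  moreover have "odd (- \<epsilon>1 e)" "odd (\<epsilon>2 e)" if "e \<in> edges G" for e
  proof -
    have "\<epsilon>1 e = 1 \<or> \<epsilon>1 e = -1" using \<epsilon>1[OF that, THEN conjunct1] by linarith
    moreover have "\<epsilon>2 e = 1 \<or> \<epsilon>2 e = -1" using \<epsilon>2[OF that, THEN conjunct1] by linarith
    ultimately show "odd (- \<epsilon>1 e)" "odd (\<epsilon>2 e)" by auto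
  qed
  ultimately show ?thesis using degree_parity[of v "\<lambda>e. - \<epsilon>1 e" \<epsilon>2] by simp
qed

lemma card_Odd_le_mass_boundary:
  assumes S: "S \<in> unit_currents G"
  shows "real (card (Odd G)) \<le> mass 0 (points G) (boundary S)"
proof -
  obtain P N where o: "orientation S P N" using ex_orientation[OF S] by blast
  have "boundary S \<in> integer_rectifiable_0 (points G)"
    using S by (auto simp: unit_currents_def integral_currents_1_def)
  then obtain M where bd: "point_mass_sum (points G) (boundary S) M" by (auto simp: integer_rectifiable_0_def)
  have finM: "finite {y. M y \<noteq> 0}" using bd by (auto simp: point_mass_sum_def)
  have ne: "M v \<noteq> 0" if "v \<in> Odd G" for v
    using boundary_coeff_parity[OF o bd, of v] that by (auto simp: Odd_def)
  have "real (card (Odd G)) = (\<Sum>v\<in>Odd G. 1)" by simp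
  also have "\<dots> \<le> (\<Sum>v\<in>Odd G. \<bar>real_of_int (M v)\<bar>)"
  proof (rule sum_mono)
    fix v assume "v \<in> Odd G"
    then have "1 \<le> \<bar>M v\<bar>" using ne by fastforce
    then show "1 \<le> \<bar>real_of_int (M v)\<bar>" by linarith
  qed
  also have "\<dots> \<le> (\<Sum>v | M v \<noteq> 0. \<bar>real_of_int (M v)\<bar>)"
    using finM ne by (intro sum_mono2) auto
  also have "\<dots> = mass 0 (points G) (boundary S)" by (rule mass_point_mass_sum[OF bd, symmetric])
  finally show ?thesis .
qed

end

theorem theorem4p1:
  fixes G :: "('a::metric_space, 'e) metric_graph"
  assumes "finite_connected_metric_graph G"
    and "edges G \<noteq> {}"
  shows "(INF S\<in>unit_currents G. mass 0 (points G) (boundary S)) = real (card (Odd G)) \<and>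
    (\<exists>S\<in>unit_currents G.
       mass 0 (points G) (boundary S) = real (card (Odd G)) \<and>
       (\<forall>v\<in>verts G.
          (even (degree G v) \<longrightarrow> point_coeff (points G) (boundary S) v = 0) \<and>
          (odd (degree G v) \<longrightarrow> \<bar>point_coeff (points G) (boundary S) v\<bar> = 1)))"
proof -
  interpret fin_metric_graph G by unfold_locales (rule assms(1))
  note ex = ex_balanced_unit_current[OF assms(2)]
  then obtain S where S: "S \<in> unit_currents G" "mass 0 (points G) (boundary S) = real (card (Odd G))" by blast
  have "(INF S\<in>unit_currents G. mass 0 (points G) (boundary S)) = real (card (Odd G))"
  \<comment> \<open>A real infimum is meaningful for a nonempty set that is bounded below;
    attainment and the lower bound provide both.\<close>
  proof (rule cInf_eq_minimum)
    show "real (card (Odd G)) \<in> (\<lambda>S. mass 0 (points G) (boundary S)) ` unit_currents G"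
      using S by (metis imageI)
    fix x assume "x \<in> (\<lambda>S. mass 0 (points G) (boundary S)) ` unit_currents G"
    then show "real (card (Odd G)) \<le> x" using card_Odd_le_mass_boundary by blast
  qed
  with ex show ?thesis by blast
qed

end
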